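(* There exist a Hilbert space $H$ and a Hankel operator $\Gamma:H^2(H)\to H^2(H)^*$ such that the operator $$T_\Gamma=\begin{pmatrix}{}^tS&\Gamma\\ 0&S\end{pmatrix}:\ H^2(H)^*\oplus H^2(H)\longrightarrow H^2(H)^*\oplus H^2(H)$$ is polynomially bounded but is not similar to a contraction.
   Context: $H^2(H)$ is the Hardy space of $H$-valued functions in $L^2(\mathbb{T},m;H)$ with vanishing negative Fourier coefficients ($\mathbb{T}$ the unit circle, $m$ normalized Lebesgue measure), and $H^2(H)^*$ is its Banach space dual (itself a Hilbert space). For $f$ in the disc algebra $A$, $M_f$ is the operator of multiplication by $f$ on $H^2(H)$. $S=M_z$ is the shift (multiplication by $z$) on $H^2(H)$, and ${}^tS$ is its (Banach space) adjoint on $H^2(H)^*$. A bounded operator $\Gamma:H^2(H)\to H^2(H)^*$, identified with the bilinear form $\Gamma(g,h)=\Gamma[g](h)$, is called a Hankel operator if $\Gamma(fg,h)=\Gamma(g,fh)$ for all $f\in A$ and $g,h\in H^2(H)$. An operator $T$ on a Hilbert space is polynomially bounded if there is a constant $C$ such that $\|P(T)\|\le C\sup_{|z|=1}|P(z)|$ for every polynomial $P$. $T$ is similar to a contraction if there is an invertible bounded operator $R$ on the space such that $\|R^{-1}TR\|\le1$. *)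

theory Defs
  imports
    "HOL-Analysis.Analysis"
    "HOL-Computational_Algebra.Polynomial"
    "HOL-Algebra.Module"
begin

subsection \<open>Normed and Hilbert spaces with explicit carriers\<close>

text \<open>
  Spaces are carrier-based, so that one can quantify over Hilbert spaces inside a formula.
  The fields \<open>mult\<close> and \<open>one\<close> inherited from the module record of HOL-Algebra are not used
  (and left \<open>undefined\<close>), except in \<open>complex_space\<close>, which is also the ring of scalars.
\<close>

record 'a complex_normed = "(complex, 'a) module" +
  vnorm :: "'a \<Rightarrow> real" (\<open>\<parallel>_\<parallel>\<index>\<close>)

definition complex_space :: "complex complex_normed" where
  "complex_space =
    \<lparr> carrier = UNIV, mult = (*), one = 1, zero = 0, add = (+), smult = (*), vnorm = cmod \<rparr>"

definition inner_product_on :: "'a complex_normed \<Rightarrow> ('a \<Rightarrow> 'a \<Rightarrow> complex) \<Rightarrow> bool" where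
  "inner_product_on V ip \<longleftrightarrow>
    (\<forall>x\<in>carrier V. \<forall>y\<in>carrier V. \<forall>z\<in>carrier V. ip (x \<oplus>\<^bsub>V\<^esub> y) z = ip x z + ip y z) \<and>
    (\<forall>a. \<forall>x\<in>carrier V. \<forall>y\<in>carrier V. ip (a \<odot>\<^bsub>V\<^esub> x) y = a * ip x y) \<and>
    (\<forall>x\<in>carrier V. \<forall>y\<in>carrier V. ip y x = cnj (ip x y)) \<and>
    (\<forall>x\<in>carrier V. x \<noteq> \<zero>\<^bsub>V\<^esub> \<longrightarrow> Re (ip x x) > 0)"

definition norm_complete :: "'a complex_normed \<Rightarrow> bool" where
  "norm_complete V \<longleftrightarrow>
    (\<forall>X. range X \<subseteq> carrier V \<and>
         (\<forall>e>0. \<exists>N::nat. \<forall>m\<ge>N. \<forall>n\<ge>N. \<parallel>X m \<ominus>\<^bsub>V\<^esub> X n\<parallel>\<^bsub>V\<^esub> < e) \<longrightarrow>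
         (\<exists>x\<in>carrier V. (\<lambda>n. \<parallel>X n \<ominus>\<^bsub>V\<^esub> x\<parallel>\<^bsub>V\<^esub>) \<longlonglongrightarrow> 0))"

definition hilbert_space :: "'a complex_normed \<Rightarrow> bool" where
  "hilbert_space V \<longleftrightarrow>
    Module.module complex_space V \<and>
    (\<exists>ip. inner_product_on V ip \<and> (\<forall>x\<in>carrier V. \<parallel>x\<parallel>\<^bsub>V\<^esub> = sqrt (Re (ip x x)))) \<and>
    norm_complete V"


subsection \<open>Bounded operators, dual space, adjoint, direct sum\<close>

definition bounded_op :: "'a complex_normed \<Rightarrow> 'b complex_normed \<Rightarrow> ('a \<Rightarrow> 'b) \<Rightarrow> bool" where
  "bounded_op V W T \<longleftrightarrow>
    T \<in> carrier V \<rightarrow> carrier W \<and>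
    (\<forall>x\<in>carrier V. \<forall>y\<in>carrier V. T (x \<oplus>\<^bsub>V\<^esub> y) = T x \<oplus>\<^bsub>W\<^esub> T y) \<and>
    (\<forall>a. \<forall>x\<in>carrier V. T (a \<odot>\<^bsub>V\<^esub> x) = a \<odot>\<^bsub>W\<^esub> T x) \<and>
    (\<exists>K. \<forall>x\<in>carrier V. \<parallel>T x\<parallel>\<^bsub>W\<^esub> \<le> K * \<parallel>x\<parallel>\<^bsub>V\<^esub>)"

text \<open>Only meaningful for bounded operators, since \<open>Sup\<close> on the reals is arbitrary on unbounded sets.\<close>

definition op_norm :: "'a complex_normed \<Rightarrow> 'b complex_normed \<Rightarrow> ('a \<Rightarrow> 'b) \<Rightarrow> real" where
  "op_norm V W T = (SUP x\<in>{x \<in> carrier V. \<parallel>x\<parallel>\<^bsub>V\<^esub> \<le> 1}. \<parallel>T x\<parallel>\<^bsub>W\<^esub>)"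

text \<open>
  The Banach space dual is complex-linear in the usual sense, \<open>(a \<phi>)(x) = a \<phi>(x)\<close>.
  Functionals are extensional, so that equality in the dual is equality of functions.
\<close>

definition dual_space :: "'a complex_normed \<Rightarrow> ('a \<Rightarrow> complex) complex_normed" where
  "dual_space V =
    \<lparr> carrier = {\<phi> \<in> extensional (carrier V). bounded_op V complex_space \<phi>},
      mult = undefined, one = undefined,
      zero = (\<lambda>x\<in>carrier V. 0),
      add = (\<lambda>\<phi> \<psi>. \<lambda>x\<in>carrier V. \<phi> x + \<psi> x),
      smult = (\<lambda>a \<phi>. \<lambda>x\<in>carrier V. a * \<phi> x),
      vnorm = op_norm V complex_space \<rparr>"

definition banach_adjoint ::
    "'a complex_normed \<Rightarrow> ('a \<Rightarrow> 'a) \<Rightarrow> ('a \<Rightarrow> complex) \<Rightarrow> ('a \<Rightarrow> complex)" where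
  "banach_adjoint V T \<phi> = (\<lambda>x\<in>carrier V. \<phi> (T x))"

definition direct_sum ::
    "'a complex_normed \<Rightarrow> 'b complex_normed \<Rightarrow> ('a \<times> 'b) complex_normed" where
  "direct_sum V W =
    \<lparr> carrier = carrier V \<times> carrier W,
      mult = undefined, one = undefined,
      zero = (\<zero>\<^bsub>V\<^esub>, \<zero>\<^bsub>W\<^esub>),
      add = (\<lambda>p q. (fst p \<oplus>\<^bsub>V\<^esub> fst q, snd p \<oplus>\<^bsub>W\<^esub> snd q)),
      smult = (\<lambda>a p. (a \<odot>\<^bsub>V\<^esub> fst p, a \<odot>\<^bsub>W\<^esub> snd p)),
      vnorm = (\<lambda>p. sqrt (\<parallel>fst p\<parallel>\<^bsub>V\<^esub>\<^sup>2 + \<parallel>snd p\<parallel>\<^bsub>W\<^esub>\<^sup>2)) \<rparr>"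

definition poly_op :: "'a complex_normed \<Rightarrow> complex poly \<Rightarrow> ('a \<Rightarrow> 'a) \<Rightarrow> 'a \<Rightarrow> 'a" where
  "poly_op V P T x = (\<Oplus>\<^bsub>V\<^esub>k\<in>{..degree P}. coeff P k \<odot>\<^bsub>V\<^esub> (T ^^ k) x)"

definition polynomially_bounded :: "'a complex_normed \<Rightarrow> ('a \<Rightarrow> 'a) \<Rightarrow> bool" where
  "polynomially_bounded V T \<longleftrightarrow>
    bounded_op V V T \<and>
    (\<exists>C. \<forall>P. op_norm V V (poly_op V P T) \<le> C * (SUP z\<in>sphere 0 1. cmod (poly P z)))"

definition similar_to_contraction :: "'a complex_normed \<Rightarrow> ('a \<Rightarrow> 'a) \<Rightarrow> bool" where
  "similar_to_contraction V T \<longleftrightarrow>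
    (\<exists>R R'. bounded_op V V R \<and> bounded_op V V R' \<and>
      (\<forall>x\<in>carrier V. R (R' x) = x \<and> R' (R x) = x) \<and>
      op_norm V V (\<lambda>x. R' (T (R x))) \<le> 1)"


subsection \<open>The Hardy space of vector-valued functions\<close>

definition circle_measure :: "complex measure" where
  "circle_measure =
    distr (uniform_measure lborel {0..<2 * pi}) (restrict_space borel (sphere 0 1)) cis"

text \<open>Bochner measurability; the space of \<open>circle_measure\<close> is the unit circle.\<close>

definition strongly_measurable :: "'a complex_normed \<Rightarrow> (complex \<Rightarrow> 'a) \<Rightarrow> bool" where
  "strongly_measurable H f \<longleftrightarrow>
    f \<in> sphere 0 1 \<rightarrow> carrier H \<and>
    (\<exists>s :: nat \<Rightarrow> complex \<Rightarrow> 'a.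
      (\<forall>i. simple_function circle_measure (s i) \<and> s i \<in> sphere 0 1 \<rightarrow> carrier H) \<and>
      (\<forall>z\<in>sphere 0 1. (\<lambda>i. \<parallel>s i z \<ominus>\<^bsub>H\<^esub> f z\<parallel>\<^bsub>H\<^esub>) \<longlonglongrightarrow> 0))"

definition L2_functions :: "'a complex_normed \<Rightarrow> (complex \<Rightarrow> 'a) set" where
  "L2_functions H =
    {f. strongly_measurable H f \<and> integrable circle_measure (\<lambda>z. \<parallel>f z\<parallel>\<^bsub>H\<^esub>\<^sup>2)}"

text \<open>
  \<open>c\<close> is the vector-valued integral of \<open>z\<^sup>-\<^sup>n f(z)\<close> over the circle. The integral is taken
  weakly; for \<open>f\<close> in \<open>L2_functions H\<close> it coincides with the Bochner integral.
\<close>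

definition has_fourier_coeff :: "'a complex_normed \<Rightarrow> (complex \<Rightarrow> 'a) \<Rightarrow> int \<Rightarrow> 'a \<Rightarrow> bool" where
  "has_fourier_coeff H f n c \<longleftrightarrow>
    c \<in> carrier H \<and>
    (\<forall>\<phi>\<in>carrier (dual_space H). \<phi> c = (\<integral>z. z powi (- n) * \<phi> (f z) \<partial>circle_measure))"

definition H2_functions :: "'a complex_normed \<Rightarrow> (complex \<Rightarrow> 'a) set" where
  "H2_functions H = {f \<in> L2_functions H. \<forall>n<0. has_fourier_coeff H f n \<zero>\<^bsub>H\<^esub>}"

text \<open>
  The elements of the Hardy space are classes of functions modulo equality almost everywhere;
  \<open>rep\<close> picks a representative. The values of a representative off the circle are irrelevant.
\<close>

definition ae_class :: "'a complex_normed \<Rightarrow> (complex \<Rightarrow> 'a) \<Rightarrow> (complex \<Rightarrow> 'a) set" where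
  "ae_class H f = {g \<in> L2_functions H. AE z in circle_measure. g z = f z}"

definition rep :: "(complex \<Rightarrow> 'a) set \<Rightarrow> complex \<Rightarrow> 'a" where
  "rep u = (SOME f. f \<in> u)"

definition hardy_space :: "'a complex_normed \<Rightarrow> (complex \<Rightarrow> 'a) set complex_normed" where
  "hardy_space H =
    \<lparr> carrier = ae_class H ` H2_functions H,
      mult = undefined, one = undefined,
      zero = ae_class H (\<lambda>z. \<zero>\<^bsub>H\<^esub>),
      add = (\<lambda>u v. ae_class H (\<lambda>z. rep u z \<oplus>\<^bsub>H\<^esub> rep v z)),
      smult = (\<lambda>a u. ae_class H (\<lambda>z. a \<odot>\<^bsub>H\<^esub> rep u z)),
      vnorm = (\<lambda>u. sqrt (\<integral>z. \<parallel>rep u z\<parallel>\<^bsub>H\<^esub>\<^sup>2 \<partial>circle_measure)) \<rparr>"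


subsection \<open>Hankel operators\<close>

definition disc_algebra :: "(complex \<Rightarrow> complex) set" where
  "disc_algebra = {f. continuous_on (cball 0 1) f \<and> f holomorphic_on ball 0 1}"

definition mult_op ::
    "'a complex_normed \<Rightarrow> (complex \<Rightarrow> complex) \<Rightarrow> (complex \<Rightarrow> 'a) set \<Rightarrow> (complex \<Rightarrow> 'a) set" where
  "mult_op H f u = ae_class H (\<lambda>z. f z \<odot>\<^bsub>H\<^esub> rep u z)"

definition shift :: "'a complex_normed \<Rightarrow> (complex \<Rightarrow> 'a) set \<Rightarrow> (complex \<Rightarrow> 'a) set" where
  "shift H = mult_op H (\<lambda>z. z)"

definition hankel_operator ::
    "'a complex_normed \<Rightarrow> ((complex \<Rightarrow> 'a) set \<Rightarrow> (complex \<Rightarrow> 'a) set \<Rightarrow> complex) \<Rightarrow> bool" where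
  "hankel_operator H \<Gamma> \<longleftrightarrow>
    bounded_op (hardy_space H) (dual_space (hardy_space H)) \<Gamma> \<and>
    (\<forall>f\<in>disc_algebra. \<forall>g\<in>carrier (hardy_space H). \<forall>h\<in>carrier (hardy_space H).
      \<Gamma> (mult_op H f g) h = \<Gamma> g (mult_op H f h))"

definition T_space ::
    "'a complex_normed \<Rightarrow>
      (((complex \<Rightarrow> 'a) set \<Rightarrow> complex) \<times> (complex \<Rightarrow> 'a) set) complex_normed" where
  "T_space H = direct_sum (dual_space (hardy_space H)) (hardy_space H)"

definition T_op ::
    "'a complex_normed \<Rightarrow> ((complex \<Rightarrow> 'a) set \<Rightarrow> (complex \<Rightarrow> 'a) set \<Rightarrow> complex) \<Rightarrow>
      ((complex \<Rightarrow> 'a) set \<Rightarrow> complex) \<times> (complex \<Rightarrow> 'a) set \<Rightarrow>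
      ((complex \<Rightarrow> 'a) set \<Rightarrow> complex) \<times> (complex \<Rightarrow> 'a) set" where
  "T_op H \<Gamma> = (\<lambda>(\<phi>, g).
    (banach_adjoint (hardy_space H) (shift H) \<phi> \<oplus>\<^bsub>dual_space (hardy_space H)\<^esub> \<Gamma> g, shift H g))"

end

theory Submission
  imports Defs "HOL-Complex_Analysis.Complex_Analysis" "HOL-Library.Nat_Bijection"
begin

text \<open>
  The example is Pisier's. Let the orthonormal basis of the Hilbert space be indexed by the finite sets of
  naturals, let \<open>c\<^sub>l\<close> be the fermionic annihilation operators on it, which satisfy the canonical
  anticommutation relations, and let \<open>\<Gamma>(g, h) = \<Sum>\<^sub>i\<^sub>j w\<^sub>i\<^sub>+\<^sub>j c\<^sub>i\<^sub>+\<^sub>j(g\<^sub>i, h\<^sub>j)\<close> in terms of Fourier coefficients, where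
  \<open>w\<^sub>l\<close> decays like \<open>l\<close> to the power \<open>-3/2\<close>.

  Since \<open>P(T\<^sub>\<Gamma>)(\<phi>, g) = (\<phi> \<circ> P(S) + \<Gamma>(P' g), P g)\<close>, polynomial boundedness means
  \<open>\<bar>\<Gamma>(P' g, h)\<bar> \<le> C sup\<bar>P\<bar> \<parallel>g\<parallel> \<parallel>h\<parallel>\<close>. The anticommutation relations give
  \<open>\<Sum>\<^sub>l \<bar>c\<^sub>l(x, y)\<bar>\<^sup>2 \<le> \<parallel>x\<parallel>\<^sup>2 \<parallel>y\<parallel>\<^sup>2\<close>, and after writing the form as an area integral over the disc with weight
  \<open>1 - \<bar>z\<bar>\<^sup>2\<close> this reduces the bound to a scalar inequality for the Bergman kernel.

  For a contraction \<open>T\<close> the Gram kernel of its orbits is dominated by a positive Toeplitz kernel, and for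
  such kernels the anticommutation relations give
  \<open>\<Sum>\<^sub>A \<parallel>\<Sum>\<^sub>k\<^sub>,\<^sub>B b\<^sub>k c\<^sub>k(A, B) T\<^sup>k x\<^sub>B\<parallel>\<^sup>2 \<le> (\<Sum>\<^sub>k b\<^sub>k\<^sup>2) (\<Sum>\<^sub>A \<parallel>x\<^sub>A\<parallel>\<^sup>2)\<close>. If \<open>T\<^sub>\<Gamma>\<close> were similar to a contraction, this
  inequality, used with \<open>b\<^sub>k = (k + 1) w\<^sub>k\<close> and the vectors \<open>(0, e\<^sub>B)\<close>, would bound the sums of
  \<open>(k + 1)\<^sup>2 w\<^sub>k\<^sup>2\<close>, which grow like the harmonic series.
\<close>

subsection \<open>The canonical anticommutation relations\<close>

text \<open>What the fermions provide is a gap between scalar and matrix coefficients. A scalar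
  combination of the \<open>c_l\<close> has norm at most the Euclidean norm of its coefficients,
  which keeps scalar polynomials in \<open>T_op\<close> harmless. With the matrices
  \<open>c_l\<close> themselves as coefficients, each signed entry of the form meets its own sign
  and becomes a square, and for every \<open>l\<close> these squares add up to half of the
  dimension.

  The weight sits at the threshold between the two demands. Its square is the moment
  \<open>2 / ((l + 1) (l + 2) (l + 3))\<close> of \<open>(1 - |w|^2)^2\<close> on the disc, so the
  passage from sums over \<open>l\<close> to area integrals loses nothing, while
  \<open>(l + 1)^2\<close> times it still has size \<open>1 / l\<close>. At this threshold the
  estimates are critical: the integrals of the squared Bergman kernel against
  \<open>|h(z)|^2\<close> and \<open>|h(w)|^2\<close> separately grow like logarithms, and only the
  difference \<open>h(z) - h(w)\<close> is controlled.

  All estimates are made for polynomials and finitely many modes, with constants free of the degree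
  and of \<open>L\<close>; the form on the whole Hardy space is their limit.\<close>

text \<open>
  Entry of the \<open>l\<close>-th fermionic annihilation operator in row \<open>A\<close> and column \<open>B\<close>, with the Jordan-Wigner sign.
\<close>

definition car :: "nat \<Rightarrow> nat set \<Rightarrow> nat set \<Rightarrow> 'a::comm_ring_1" where
  "car l A B = (if l \<notin> A \<and> B = insert l A then (- 1) ^ card {j\<in>A. l < j} else 0)"

text \<open>Exactly one of \<open>k < l\<close> and \<open>l < k\<close> holds, so exactly one of
  the two counts grows by one when the other element is inserted. This single extra sign is what the
  Jordan-Wigner factor is for.\<close>

lemma car_anticommute_sign:
  fixes k l :: nat
  assumes "finite B" "k \<notin> B" "l \<notin> B" "k \<noteq> l"
  shows "(- 1) ^ card {j\<in>insert l B. k < j} * (- 1) ^ card {j\<in>insert k B. l < j}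
       = - ((- 1) ^ card {j\<in>B. l < j} * (- 1) ^ card {j\<in>B. k < j} :: 'a::comm_ring_1)"
proof -
  have ins: "{j\<in>insert l B. k < j} = (if k < l then insert l {j\<in>B. k < j} else {j\<in>B. k < j})" for k l
    by auto
  show ?thesis
    using assms unfolding ins by (cases rule: linorder_cases[of k l]) auto
qed

text \<open>In operator form, \<open>c_k\<close> times the adjoint of \<open>c_l\<close> plus the
  adjoint of \<open>c_l\<close> times \<open>c_k\<close> is the identity or zero. The truncation to
  subsets of \<open>{..<L}\<close> is exact, since inserting or removing an element below
  \<open>L\<close> does not leave it. The ring is left open because the relation is used over the
  complex and over the real numbers.\<close>

lemma car_relation:
  assumes kl: "k < L" "l < L" and A: "A \<in> Pow {..<L}" "A' \<in> Pow {..<L}"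
  shows "(\<Sum>B\<in>Pow {..<L}. car k A B * car l A' B) + (\<Sum>B\<in>Pow {..<L}. car l B A * car k B A')
       = (if k = l \<and> A = A' then 1 else (0::'a::comm_ring_1))"
proof -
  have fA: "finite A" "finite A'"
    using A finite_subset by auto
  let ?s = "\<lambda>l A. (- 1) ^ card {j\<in>A. l < j} :: 'a"
  have "(\<Sum>B\<in>Pow {..<L}. car k A B * car l A' B) = (\<Sum>B\<in>Pow {..<L}. if B = insert k A then
      (if k \<notin> A \<and> l \<notin> A' \<and> insert k A = insert l A' then ?s k A * ?s l A' else 0) else 0)"
    by (rule sum.cong) (auto simp: car_def)
  also have "\<dots> = (if k \<notin> A \<and> l \<notin> A' \<and> insert k A = insert l A' then ?s k A * ?s l A' else 0)"
    using kl A by (subst sum.delta) auto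
  finally have 1: "(\<Sum>B\<in>Pow {..<L}. car k A B * car l A' B) = \<dots>" .
  \<comment> \<open>Solved for the row instead of the column, so that the sum over rows also
    collapses to one term.\<close>
  have car': "car l B A = (if l \<in> A \<and> B = A - {l} then ?s l B else 0)" for l B A
  proof -
    have "l \<notin> B \<and> A = insert l B \<longleftrightarrow> l \<in> A \<and> B = A - {l}"
      by auto
    then show ?thesis
      by (simp only: car_def)
  qed
  have "(\<Sum>B\<in>Pow {..<L}. car l B A * car k B A') = (\<Sum>B\<in>Pow {..<L}. if B = A - {l} then
      (if l \<in> A \<and> k \<in> A' \<and> A - {l} = A' - {k} then ?s l (A - {l}) * ?s k (A - {l}) else 0) else 0)"
    by (rule sum.cong[OF refl]) (auto simp: car')
  also have "\<dots> = (if l \<in> A \<and> k \<in> A' \<and> A - {l} = A' - {k} then ?s l (A - {l}) * ?s k (A - {l}) else 0)"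
    using kl A by (subst sum.delta) auto
  finally have 2: "(\<Sum>B\<in>Pow {..<L}. car l B A * car k B A') = \<dots>" .
  have sq: "?s k B * ?s k B = 1" for k B
    by (simp flip: power_mult_distrib)
  show ?thesis
  proof (cases "k = l")
    case True
    show ?thesis
    proof (cases "A = A'")
      case True
      then show ?thesis
        using \<open>k = l\<close> unfolding 1 2 by (simp add: sq)
    next
      case False
      have "\<not> (k \<notin> A \<and> l \<notin> A' \<and> insert k A = insert l A')"
        using False \<open>k = l\<close> by (metis Diff_insert_absorb)
      moreover have "\<not> (l \<in> A \<and> k \<in> A' \<and> A - {l} = A' - {k})"
        using False \<open>k = l\<close> by (metis insert_Diff)
      ultimately show ?thesis
        using False unfolding 1 2 by auto
    qed
  next
    case False
    show ?thesis
    \<comment> \<open>For \<open>k \<noteq> l\<close> the two products are nonzero under the same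
      condition, and then they differ by a sign.\<close>
    proof (cases "l \<in> A \<and> k \<in> A' \<and> A - {l} = A' - {k}")
      case True
      define B where "B = A - {l}"
      have B: "A = insert l B" "A' = insert k B" "l \<notin> B" "k \<notin> B" "finite B"
        using True False fA unfolding B_def by auto
      have "k \<notin> A \<and> l \<notin> A' \<and> insert k A = insert l A'"
        using B False by auto
      moreover have "?s k A * ?s l A' = - (?s l (A - {l}) * ?s k (A - {l}))"
        using car_anticommute_sign[of B k l, where 'a='a] B False by (simp add: B_def[symmetric])
      ultimately show ?thesis
        using True False unfolding 1 2 by auto
    next
      case c: False
      have "\<not> (k \<notin> A \<and> l \<notin> A' \<and> insert k A = insert l A')"
      proof
        assume *: "k \<notin> A \<and> l \<notin> A' \<and> insert k A = insert l A'"
        then have "l \<in> A" "k \<in> A'" using False by auto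
        moreover have "A - {l} = A' - {k}" using * by auto
        ultimately show False using c by auto
      qed
      then show ?thesis
        using c False unfolding 1 2 by auto
    qed
  qed
qed

text \<open>The relation, summed against an arbitrary kernel, leaves only the diagonal of the
  kernel. It is used for scalar combinations of the \<open>c_l\<close> and again for Toeplitz
  kernels.\<close>

lemma car_kernel_sum:
  fixes W :: "nat \<Rightarrow> nat \<Rightarrow> nat set \<Rightarrow> nat set \<Rightarrow> 'a::comm_ring_1"
  shows "(\<Sum>k<L. \<Sum>l<L. \<Sum>A\<in>Pow {..<L}. \<Sum>A'\<in>Pow {..<L}. (\<Sum>B\<in>Pow {..<L}. car k A B * car l A' B) * W k l A A')
       + (\<Sum>k<L. \<Sum>l<L. \<Sum>A\<in>Pow {..<L}. \<Sum>A'\<in>Pow {..<L}. (\<Sum>B\<in>Pow {..<L}. car l B A * car k B A') * W k l A A')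
       = (\<Sum>k<L. \<Sum>A\<in>Pow {..<L}. W k k A A)"
proof -
  have "(\<Sum>k<L. \<Sum>l<L. \<Sum>A\<in>Pow {..<L}. \<Sum>A'\<in>Pow {..<L}. (\<Sum>B\<in>Pow {..<L}. car k A B * car l A' B) * W k l A A')
       + (\<Sum>k<L. \<Sum>l<L. \<Sum>A\<in>Pow {..<L}. \<Sum>A'\<in>Pow {..<L}. (\<Sum>B\<in>Pow {..<L}. car l B A * car k B A') * W k l A A')
      = (\<Sum>k<L. \<Sum>l<L. \<Sum>A\<in>Pow {..<L}. \<Sum>A'\<in>Pow {..<L}. (if k = l \<and> A = A' then 1 else 0) * W k l A A')"
    unfolding sum.distrib[symmetric] distrib_right[symmetric]
    by (intro sum.cong refl) (simp only: sum.distrib car_relation lessThan_iff)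
  also have "\<dots> = (\<Sum>k<L. \<Sum>l<L. if k = l then \<Sum>A\<in>Pow {..<L}. W k k A A else 0)"
  proof (intro sum.cong refl)
    fix k l
    have "(\<Sum>A'\<in>Pow {..<L}. (if k = l \<and> A = A' then 1 else 0) * W k l A A') = (if k = l then W k k A A else 0)"
      if "A \<in> Pow {..<L}" for A
    proof -
      have "(\<Sum>A'\<in>Pow {..<L}. (if k = l \<and> A = A' then 1 else 0) * W k l A A')
          = (\<Sum>A'\<in>Pow {..<L}. if A = A' then (if k = l then W k k A A else 0) else 0)"
        by (rule sum.cong) auto
      also have "\<dots> = (if k = l then W k k A A else 0)"
        using that by (subst sum.delta') auto
      finally show ?thesis .
    qed
    then show "(\<Sum>A\<in>Pow {..<L}. \<Sum>A'\<in>Pow {..<L}. (if k = l \<and> A = A' then 1 else 0) * W k l A A')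
        = (if k = l then \<Sum>A\<in>Pow {..<L}. W k k A A else 0)"
      by simp
  qed
  also have "\<dots> = (\<Sum>k<L. \<Sum>A\<in>Pow {..<L}. W k k A A)"
    by simp
  finally show ?thesis .
qed

lemma cmod_double_sum_squared:
  "complex_of_real ((cmod (\<Sum>l\<in>X. \<Sum>b\<in>Y. f l b))\<^sup>2)
    = (\<Sum>l\<in>X. \<Sum>b\<in>Y. \<Sum>k\<in>X. \<Sum>b'\<in>Y. f l b * cnj (f k b'))"
  by (simp only: complex_norm_square cnj_sum sum_distrib_right, simp only: sum_distrib_left)

text \<open>Let \<open>c\<close> combine the \<open>c_l\<close> with coefficients
  \<open>a l\<close>, and let \<open>c'\<close> be its adjoint. By the relations
  \<open>c' c + c c'\<close> is the scalar \<open>|a|^2\<close>, and this is its quadratic form at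
  \<open>x\<close>. In particular \<open>c\<close> has norm at most \<open>|a|\<close>.\<close>

lemma car_combination_norm:
  fixes L :: nat and a :: "nat \<Rightarrow> complex" and x :: "nat set \<Rightarrow> complex"
  defines "U \<equiv> Pow {..<L}"
  shows "(\<Sum>A\<in>U. (cmod (\<Sum>l<L. \<Sum>B\<in>U. a l * car l A B * x B))\<^sup>2)
      + (\<Sum>B\<in>U. (cmod (\<Sum>l<L. \<Sum>A\<in>U. cnj (a l) * car l A B * x A))\<^sup>2)
      = (\<Sum>l<L. (cmod (a l))\<^sup>2) * (\<Sum>A\<in>U. (cmod (x A))\<^sup>2)"
proof -
  have cc: "cnj (car l A B) = car l A B" for l A B
    by (simp add: car_def)
  let ?W = "\<lambda>k l A A'. cnj (a k) * a l * x A * cnj (x A')"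
  have sw: "(\<Sum>A\<in>U. \<Sum>l<L. \<Sum>B\<in>U. \<Sum>k<L. \<Sum>B'\<in>U. F A l B k B')
      = (\<Sum>k<L. \<Sum>l<L. \<Sum>B\<in>U. \<Sum>B'\<in>U. \<Sum>A\<in>U. F A l B k B')" for F :: "_ \<Rightarrow> _ \<Rightarrow> _ \<Rightarrow> _ \<Rightarrow> _ \<Rightarrow> complex"
  proof -
    have "(\<Sum>A\<in>U. \<Sum>l<L. \<Sum>B\<in>U. \<Sum>k<L. \<Sum>B'\<in>U. F A l B k B')
        = (\<Sum>l<L. \<Sum>A\<in>U. \<Sum>B\<in>U. \<Sum>k<L. \<Sum>B'\<in>U. F A l B k B')"
      by (rule sum.swap)
    also have "\<dots> = (\<Sum>l<L. \<Sum>B\<in>U. \<Sum>A\<in>U. \<Sum>k<L. \<Sum>B'\<in>U. F A l B k B')"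
      by (rule sum.cong[OF refl], rule sum.swap)
    also have "\<dots> = (\<Sum>l<L. \<Sum>B\<in>U. \<Sum>k<L. \<Sum>A\<in>U. \<Sum>B'\<in>U. F A l B k B')"
      by (rule sum.cong[OF refl], rule sum.cong[OF refl], rule sum.swap)
    also have "\<dots> = (\<Sum>l<L. \<Sum>B\<in>U. \<Sum>k<L. \<Sum>B'\<in>U. \<Sum>A\<in>U. F A l B k B')"
      by (rule sum.cong[OF refl], rule sum.cong[OF refl], rule sum.cong[OF refl], rule sum.swap)
    also have "\<dots> = (\<Sum>l<L. \<Sum>k<L. \<Sum>B\<in>U. \<Sum>B'\<in>U. \<Sum>A\<in>U. F A l B k B')"
      by (rule sum.cong[OF refl], rule sum.swap)
    also have "\<dots> = (\<Sum>k<L. \<Sum>l<L. \<Sum>B\<in>U. \<Sum>B'\<in>U. \<Sum>A\<in>U. F A l B k B')"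
      by (rule sum.swap)
    finally show ?thesis .
  qed
  have "of_real (\<Sum>A\<in>U. (cmod (\<Sum>l<L. \<Sum>B\<in>U. a l * car l A B * x B))\<^sup>2)
     = (\<Sum>A\<in>U. \<Sum>l<L. \<Sum>B\<in>U. \<Sum>k<L. \<Sum>B'\<in>U. (a l * car l A B * x B) * cnj (a k * car k A B' * x B'))"
    by (simp only: of_real_sum cmod_double_sum_squared)
  also have "\<dots> = (\<Sum>k<L. \<Sum>l<L. \<Sum>B\<in>U. \<Sum>B'\<in>U. \<Sum>A\<in>U. (a l * car l A B * x B) * cnj (a k * car k A B' * x B'))"
    by (rule sw)
  also have "\<dots> = (\<Sum>k<L. \<Sum>l<L. \<Sum>A\<in>U. \<Sum>A'\<in>U. (\<Sum>B\<in>U. car l B A * car k B A') * ?W k l A A')"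
    by (intro sum.cong refl) (simp add: cc sum_distrib_left mult_ac)
  finally have 1: "of_real (\<Sum>A\<in>U. (cmod (\<Sum>l<L. \<Sum>B\<in>U. a l * car l A B * x B))\<^sup>2) = \<dots>" .
  have "of_real (\<Sum>B\<in>U. (cmod (\<Sum>l<L. \<Sum>A\<in>U. cnj (a l) * car l A B * x A))\<^sup>2)
     = (\<Sum>B\<in>U. \<Sum>k<L. \<Sum>A\<in>U. \<Sum>l<L. \<Sum>A'\<in>U. (cnj (a k) * car k A B * x A) * cnj (cnj (a l) * car l A' B * x A'))"
    by (simp only: of_real_sum cmod_double_sum_squared)
  also have "\<dots> = (\<Sum>l<L. \<Sum>k<L. \<Sum>A\<in>U. \<Sum>A'\<in>U. \<Sum>B\<in>U. (cnj (a k) * car k A B * x A) * cnj (cnj (a l) * car l A' B * x A'))"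
    by (rule sw)
  also have "\<dots> = (\<Sum>k<L. \<Sum>l<L. \<Sum>A\<in>U. \<Sum>A'\<in>U. \<Sum>B\<in>U. (cnj (a k) * car k A B * x A) * cnj (cnj (a l) * car l A' B * x A'))"
    by (rule sum.swap)
  also have "\<dots> = (\<Sum>k<L. \<Sum>l<L. \<Sum>A\<in>U. \<Sum>A'\<in>U. (\<Sum>B\<in>U. car k A B * car l A' B) * ?W k l A A')"
    by (intro sum.cong refl) (simp add: cc sum_distrib_left mult_ac)
  finally have 2: "of_real (\<Sum>B\<in>U. (cmod (\<Sum>l<L. \<Sum>A\<in>U. cnj (a l) * car l A B * x A))\<^sup>2) = \<dots>" .
  have "complex_of_real ((\<Sum>A\<in>U. (cmod (\<Sum>l<L. \<Sum>B\<in>U. a l * car l A B * x B))\<^sup>2)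
      + (\<Sum>B\<in>U. (cmod (\<Sum>l<L. \<Sum>A\<in>U. cnj (a l) * car l A B * x A))\<^sup>2)) = (\<Sum>k<L. \<Sum>A\<in>U. ?W k k A A)"
    unfolding of_real_add 1 2 unfolding U_def by (subst add.commute) (rule car_kernel_sum)
  also have "\<dots> = of_real ((\<Sum>l<L. (cmod (a l))\<^sup>2) * (\<Sum>A\<in>U. (cmod (x A))\<^sup>2))"
    unfolding of_real_mult of_real_sum complex_norm_square sum_product by (intro sum.cong refl) (simp add: mult_ac)
  finally show ?thesis
    by (simp only: of_real_eq_iff)
qed

text \<open>Duality: with the conjugated values as coefficients \<open>a\<close>, the left side
  \<open>S\<close> is the pairing of \<open>v = c(a) x\<close> with \<open>y\<close>, hence at most
  \<open>sqrt S |x| |y|\<close> by \<open>car_combination_norm\<close>. Cancelling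
  \<open>sqrt S\<close> gives the bound, with a constant free of \<open>L\<close>.\<close>

lemma car_bilinear_bound:
  fixes L :: nat and x y :: "nat set \<Rightarrow> complex"
  defines "U \<equiv> Pow {..<L}"
  shows "(\<Sum>l<L. (cmod (\<Sum>A\<in>U. \<Sum>B\<in>U. car l A B * x B * y A))\<^sup>2)
      \<le> (\<Sum>A\<in>U. (cmod (x A))\<^sup>2) * (\<Sum>A\<in>U. (cmod (y A))\<^sup>2)"
proof -
  define a where "a l = cnj (\<Sum>A\<in>U. \<Sum>B\<in>U. car l A B * x B * y A)" for l
  define S where "S = (\<Sum>l<L. (cmod (a l))\<^sup>2)"
  define v where "v A = (\<Sum>l<L. \<Sum>B\<in>U. a l * car l A B * x B)" for A
  have S0: "S \<ge> 0"
    unfolding S_def by (intro sum_nonneg) auto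
  have v: "(\<Sum>A\<in>U. (cmod (v A))\<^sup>2) \<le> S * (\<Sum>A\<in>U. (cmod (x A))\<^sup>2)"
  proof -
    have "0 \<le> (\<Sum>B\<in>U. (cmod (\<Sum>l<L. \<Sum>A\<in>U. cnj (a l) * car l A B * x A))\<^sup>2)"
      by (intro sum_nonneg) auto
    then show ?thesis
      using car_combination_norm[where L=L and a=a and x=x, folded U_def S_def] unfolding v_def by linarith
  qed
  have "complex_of_real S = (\<Sum>l<L. a l * (\<Sum>A\<in>U. \<Sum>B\<in>U. car l A B * x B * y A))"
    unfolding S_def a_def by (simp only: of_real_sum complex_norm_square complex_cnj_cnj mult.commute)
  also have "\<dots> = (\<Sum>l<L. \<Sum>A\<in>U. \<Sum>B\<in>U. a l * car l A B * x B * y A)"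
    by (simp add: sum_distrib_left mult_ac)
  also have "\<dots> = (\<Sum>A\<in>U. v A * y A)"
    by (subst sum.swap) (simp add: v_def sum_distrib_right)
  finally have "S = cmod (\<Sum>A\<in>U. v A * y A)"
    using S0 by (metis norm_of_real abs_of_nonneg)
  also have "\<dots> \<le> (\<Sum>A\<in>U. cmod (v A) * cmod (y A))"
    by (rule order_trans[OF norm_sum]) (simp add: norm_mult)
  finally have "S\<^sup>2 \<le> (\<Sum>A\<in>U. cmod (v A) * cmod (y A))\<^sup>2"
    using S0 by (simp add: power_mono)
  also have "\<dots> \<le> (\<Sum>A\<in>U. (cmod (v A))\<^sup>2) * (\<Sum>A\<in>U. (cmod (y A))\<^sup>2)"
    by (rule Cauchy_Schwarz_ineq_sum)
  also have "\<dots> \<le> S * (\<Sum>A\<in>U. (cmod (x A))\<^sup>2) * (\<Sum>A\<in>U. (cmod (y A))\<^sup>2)"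
    by (intro mult_right_mono v sum_nonneg) auto
  finally have "S * S \<le> S * ((\<Sum>A\<in>U. (cmod (x A))\<^sup>2) * (\<Sum>A\<in>U. (cmod (y A))\<^sup>2))"
    by (simp add: power2_eq_square mult_ac)
  then have "S \<le> (\<Sum>A\<in>U. (cmod (x A))\<^sup>2) * (\<Sum>A\<in>U. (cmod (y A))\<^sup>2)"
    using S0 by (cases "S = 0") (auto intro!: mult_nonneg_nonneg sum_nonneg)
  then show ?thesis
    by (simp only: S_def a_def complex_mod_cnj)
qed

text \<open>The trace of the relation for \<open>k = l\<close>: both products have the same trace,
  and the identity has trace \<open>2 ^ L\<close>.\<close>

lemma car_frobenius_norm:
  assumes "l < L"
  shows "2 * (\<Sum>A\<in>Pow {..<L}. \<Sum>B\<in>Pow {..<L}. (car l A B)\<^sup>2) = (2 ^ L :: 'a::comm_ring_1)"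
proof -
  have "2 * (\<Sum>A\<in>Pow {..<L}. \<Sum>B\<in>Pow {..<L}. (car l A B)\<^sup>2)
     = (\<Sum>A\<in>Pow {..<L}. (\<Sum>B\<in>Pow {..<L}. car l A B * car l A B) + (\<Sum>B\<in>Pow {..<L}. car l B A * car l B A :: 'a))"
    unfolding sum.distrib mult_2 power2_eq_square
    by (subst sum.swap[of "\<lambda>B A. car l A B * car l A B"]) simp
  also have "\<dots> = (\<Sum>A\<in>Pow {..<L}. 1)"
    by (intro sum.cong refl) (simp add: car_relation assms)
  finally show ?thesis
    by (simp add: card_Pow)
qed

subsection \<open>Integrals over the circle and the disc\<close>

lemma space_circle_measure [simp]: "space circle_measure = sphere 0 1"
  by (simp add: circle_measure_def)

lemma sets_circle_measure [measurable_cong]: "sets circle_measure = sets (restrict_space borel (sphere 0 1))"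
  by (simp add: circle_measure_def)

lemma cis_measurable [measurable]: "cis \<in> M \<rightarrow>\<^sub>M restrict_space borel (sphere 0 1)" if "sets M = sets borel"
proof (rule measurable_restrict_space2)
  have "cis \<in> borel \<rightarrow>\<^sub>M borel"
    by (intro borel_measurable_continuous_onI continuous_intros)
  then show "cis \<in> M \<rightarrow>\<^sub>M borel"
    using that measurable_cong_sets by blast
qed simp

lemma circle_uniform_density:
  "uniform_measure lborel {0..<2 * pi} = density lborel (\<lambda>x. ennreal (indicator {0..<2 * pi} x / (2 * pi)))"
  unfolding uniform_measure_def
  by (rule density_cong) (simp_all add: ennreal_indicator[symmetric] divide_ennreal)

lemma finite_measure_circle: "finite_measure circle_measure"
proof -
  have "emeasure lborel {0..<2 * pi} \<noteq> 0" "emeasure lborel {0..<2 * pi} \<noteq> \<infinity>"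
    by simp_all
  then have "emeasure (uniform_measure lborel {0..<2 * pi}) UNIV \<noteq> \<infinity>"
    by (subst emeasure_uniform_measure) (simp_all add: divide_ennreal)
  then have "finite_measure (uniform_measure lborel {0..<2 * pi})"
    by (intro finite_measureI) simp
  then show ?thesis
    unfolding circle_measure_def by (rule finite_measure.finite_measure_distr) (simp add: cis_measurable)
qed

interpretation circle: finite_measure circle_measure
  by (rule finite_measure_circle)

lemma circle_continuous_measurable:
  "continuous_on (sphere 0 1) f \<Longrightarrow> f \<in> borel_measurable circle_measure"
  using borel_measurable_continuous_on_restrict[of "sphere 0 1" f]
  by (subst measurable_cong_sets[OF sets_circle_measure refl])

lemma circle_continuous_integrable:
  fixes f :: "complex \<Rightarrow> 'b::{banach, second_countable_topology}"
  assumes "continuous_on (sphere 0 1) f"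
  shows "integrable circle_measure f"
proof -
  have "compact (f ` sphere 0 1)"
    by (rule compact_continuous_image[OF assms]) simp
  then obtain B where "\<And>x. x \<in> f ` sphere 0 1 \<Longrightarrow> norm x \<le> B"
    using bounded_iff compact_imp_bounded by metis
  then show ?thesis
    by (intro circle.integrable_const_bound[where B=B] AE_I2 circle_continuous_measurable assms) auto
qed

lemma circle_moment:
  "(\<integral>z. z ^ i * cnj z ^ j \<partial>circle_measure) = (if i = j then 1 else 0)"
proof -
  define n where "n = int i - int j"
  define f where "f \<theta> = cis (of_int n * \<theta>)" for \<theta>
  have c: "continuous_on (sphere 0 1) (\<lambda>z. z ^ i * cnj z ^ j)"
    by (intro continuous_intros)
  have cm: "cis \<in> uniform_measure lborel {0..<2 * pi} \<rightarrow>\<^sub>M restrict_space borel (sphere 0 1)"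
    by (rule cis_measurable) simp
  have fe: "cis \<theta> ^ i * cnj (cis \<theta>) ^ j = f \<theta>" for \<theta>
  proof -
    have "cis \<theta> ^ i * cnj (cis \<theta>) ^ j = cis (real i * \<theta>) * cis (real j * (- \<theta>))"
      by (simp only: cis_cnj Complex.DeMoivre)
    also have "\<dots> = f \<theta>"
      unfolding cis_mult f_def n_def by (rule arg_cong[of _ _ cis]) (simp add: algebra_simps)
    finally show ?thesis .
  qed
  have fc: "continuous_on A f" for A
    unfolding f_def by (intro continuous_intros)
  have fm: "f \<in> borel_measurable lborel"
    using borel_measurable_continuous_onI[OF fc] by simp
  have "(\<integral>z. z ^ i * cnj z ^ j \<partial>circle_measure) = (\<integral>\<theta>. f \<theta> \<partial>uniform_measure lborel {0..<2 * pi})"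
    unfolding circle_measure_def
    by (subst integral_distr[OF cm])
       (use circle_continuous_measurable[OF c] in \<open>auto simp: fe measurable_cong_sets[OF sets_circle_measure refl]\<close>)
  also have "\<dots> = (\<integral>\<theta>. (indicator {0..<2 * pi} \<theta> / (2 * pi)) *\<^sub>R f \<theta> \<partial>lborel)"
    unfolding circle_uniform_density using fm by (subst integral_density) auto
  also have "\<dots> = (\<integral>\<theta>. (1 / (2 * pi)) *\<^sub>R (indicator {0..2 * pi} \<theta> *\<^sub>R f \<theta>) \<partial>lborel)"
  \<comment> \<open>The half-open interval is closed at the null point \<open>2 * pi\<close> so that
    the fundamental theorem applies.\<close>
  proof (rule integral_cong_AE)
    have "AE x in lborel. x \<noteq> 2 * pi"
      by (rule AE_lborel_singleton)
    then show "AE x in lborel. (indicator {0..<2 * pi} x / (2 * pi)) *\<^sub>R f x = (1 / (2 * pi)) *\<^sub>R (indicator {0..2 * pi} x *\<^sub>R f x)"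
      by eventually_elim (auto split: split_indicator)
  qed (use fm in measurable)
  also have "\<dots> = (1 / (2 * pi)) *\<^sub>R (\<integral>\<theta>. indicator {0..2 * pi} \<theta> *\<^sub>R f \<theta> \<partial>lborel)"
    by (rule integral_scaleR_right)
  also have "\<dots> = (if i = j then 1 else 0)"
  proof (cases "n = 0")
    case True
    then have "f = (\<lambda>_. 1)" by (simp add: f_def fun_eq_iff)
    moreover have "(\<integral>\<theta>. indicator {0..2 * pi} \<theta> *\<^sub>R (1::complex) \<partial>lborel) = of_real (2 * pi)"
      using integral_FTC_atLeastAtMost[of 0 "2*pi" of_real "\<lambda>_. 1::complex"]
      by (auto intro!: derivative_eq_intros simp: has_vector_derivative_def scaleR_conv_of_real intro: has_derivative_of_real)
    ultimately show ?thesis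
      using True by (simp add: n_def scaleR_conv_of_real)
  next
    case False
    define F where "F \<theta> = cis (of_int n * \<theta>) / (\<i> * of_int n)" for \<theta>
    have "((\<lambda>w. exp (\<i> * of_int n * w) / (\<i> * of_int n)) has_field_derivative exp (\<i> * of_int n * w)) (at w)" for w
      using False by (auto intro!: derivative_eq_intros)
    from has_vector_derivative_real_field[OF this]
    have "(F has_vector_derivative f x) (at x within {0..2*pi})" for x
      by (simp add: F_def[abs_def] f_def cis_conv_exp mult_ac)
    then have "(\<integral>\<theta>. indicator {0..2 * pi} \<theta> *\<^sub>R f \<theta> \<partial>lborel) = F (2 * pi) - F 0"
      by (intro integral_FTC_atLeastAtMost fc) auto
    also have "\<dots> = 0"
      using cis_multiple_2pi[of "of_int n"] by (simp add: F_def mult_ac)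
    finally show ?thesis
      using False by (simp add: n_def)
  qed
  finally show ?thesis .
qed

text \<open>With \<open>t = r^2\<close> the measure \<open>dt\<close> is \<open>2 r dr\<close>, so
  this is normalized area measure in polar coordinates. The choice of \<open>t\<close> makes the
  radial moments integrals of plain powers.\<close>

definition disc_measure :: "complex measure" where
  "disc_measure = distr (restrict_space lborel {0..1::real} \<Otimes>\<^sub>M circle_measure)
     (restrict_space borel (cball 0 1)) (\<lambda>(t, u). of_real (sqrt t) * u)"

lemma space_disc_measure [simp]: "space disc_measure = cball 0 1"
  by (simp add: disc_measure_def)

lemma sets_disc_measure [measurable_cong]: "sets disc_measure = sets (restrict_space borel (cball 0 1))"
  by (simp add: disc_measure_def)

lemma disc_polar_measurable:
  "(\<lambda>(t, u). of_real (sqrt t) * u) \<in> restrict_space lborel {0..1::real} \<Otimes>\<^sub>M circle_measure \<rightarrow>\<^sub>M restrict_space borel (cball 0 (1::real) :: complex set)"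
proof (rule measurable_restrict_space2)
  have [measurable]: "fst \<in> borel_measurable (restrict_space lborel {0..1::real} \<Otimes>\<^sub>M circle_measure)"
    by (rule measurable_compose[OF measurable_fst]) (simp add: measurable_restrict_space1)
  have "(\<lambda>x. x) \<in> borel_measurable circle_measure"
    by (rule circle_continuous_measurable) auto
  then have [measurable]: "snd \<in> borel_measurable (restrict_space lborel {0..1::real} \<Otimes>\<^sub>M circle_measure)"
    by (rule measurable_compose[OF measurable_snd])
  show "(\<lambda>(t, u). complex_of_real (sqrt t) * u) \<in> borel_measurable (restrict_space lborel {0..1::real} \<Otimes>\<^sub>M circle_measure)"
    unfolding case_prod_unfold by measurable
qed (auto simp: space_pair_measure space_restrict_space norm_mult mult_le_one)

lemma finite_measure_unit_interval: "finite_measure (restrict_space lborel {0..1::real})"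
  by (rule finite_measureI) (simp add: space_restrict_space emeasure_restrict_space)

interpretation polar: pair_sigma_finite "restrict_space lborel {0..1::real}" circle_measure
  using finite_measure_unit_interval finite_measure_circle
  by (simp add: pair_sigma_finite_def finite_measure_def)

lemma finite_measure_disc: "finite_measure disc_measure"
  unfolding disc_measure_def
  by (intro finite_measure.finite_measure_distr disc_polar_measurable finite_measure_pair_measure
      finite_measure_unit_interval finite_measure_circle)

interpretation disc: finite_measure disc_measure
  by (rule finite_measure_disc)

interpretation disc2: pair_sigma_finite disc_measure disc_measure
  using finite_measure_disc by (simp add: pair_sigma_finite_def finite_measure_def)

lemma disc_continuous_measurable:
  "continuous_on (cball 0 1) f \<Longrightarrow> f \<in> borel_measurable disc_measure"
  using borel_measurable_continuous_on_restrict[of "cball 0 1" f]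
  by (subst measurable_cong_sets[OF sets_disc_measure refl])

lemma disc_continuous_integrable:
  fixes f :: "complex \<Rightarrow> 'b::{banach, second_countable_topology}"
  assumes "continuous_on (cball 0 1) f"
  shows "integrable disc_measure f"
proof -
  have "compact (f ` cball 0 1)"
    by (rule compact_continuous_image[OF assms]) simp
  then obtain B where "\<And>x. x \<in> f ` cball 0 1 \<Longrightarrow> norm x \<le> B"
    using bounded_iff compact_imp_bounded by metis
  then show ?thesis
    by (intro disc.integrable_const_bound[where B=B] AE_I2 disc_continuous_measurable assms) auto
qed

lemma disc2_continuous_integrable:
  fixes f :: "complex \<times> complex \<Rightarrow> 'b::{banach, second_countable_topology}"
  assumes f: "continuous_on UNIV f"
  shows "integrable (disc_measure \<Otimes>\<^sub>M disc_measure) f"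
proof -
  have "compact (f ` (cball 0 1 \<times> cball 0 1))"
    by (intro compact_continuous_image compact_Times continuous_on_subset[OF assms]) auto
  then obtain B where B: "\<And>x. x \<in> f ` (cball 0 1 \<times> cball 0 1) \<Longrightarrow> norm x \<le> B"
    using bounded_iff compact_imp_bounded by metis
  interpret D: finite_measure "disc_measure \<Otimes>\<^sub>M disc_measure"
    by (intro finite_measure_pair_measure finite_measure_disc)
  have [measurable]: "(\<lambda>x. x) \<in> borel_measurable disc_measure"
    by (rule disc_continuous_measurable) auto
  have "(\<lambda>p. (fst p, snd p)) \<in> borel_measurable (disc_measure \<Otimes>\<^sub>M disc_measure)"
    by (intro borel_measurable_Pair measurable_compose[OF measurable_fst] measurable_compose[OF measurable_snd]) measurable
  then have "f \<in> borel_measurable (disc_measure \<Otimes>\<^sub>M disc_measure)"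
    using borel_measurable_continuous_on[OF f] by simp
  then show ?thesis
    by (intro D.integrable_const_bound[where B=B] AE_I2) (auto intro!: B simp: space_pair_measure)
qed

text \<open>The angular integral gives orthogonality; for \<open>i = j\<close> the radial one is
  that of \<open>t^i\<close> over \<open>{0..1}\<close>.\<close>

lemma disc_moment:
  "(\<integral>z. z ^ i * cnj z ^ j \<partial>disc_measure) = (if i = j then 1 / (of_nat i + 1) else 0)"
proof -
  let ?L = "restrict_space lborel {0..1::real}"
  have c: "continuous_on (cball 0 1) (\<lambda>z. z ^ i * cnj z ^ j)"
    by (intro continuous_intros)
  have int: "integrable (?L \<Otimes>\<^sub>M circle_measure) (\<lambda>(t, u). (of_real (sqrt t) * u) ^ i * cnj (of_real (sqrt t) * u) ^ j)"
    using disc_continuous_integrable[OF c] unfolding disc_measure_def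
    by (subst (asm) integrable_distr_eq[OF disc_polar_measurable])
       (use disc_continuous_measurable[OF c] in \<open>auto simp: case_prod_unfold measurable_cong_sets[OF sets_disc_measure refl]\<close>)
  have "(\<integral>z. z ^ i * cnj z ^ j \<partial>disc_measure)
      = (\<integral>p. (\<lambda>(t, u). (of_real (sqrt t) * u) ^ i * cnj (of_real (sqrt t) * u) ^ j) p \<partial>(?L \<Otimes>\<^sub>M circle_measure))"
    unfolding disc_measure_def
    by (subst integral_distr[OF disc_polar_measurable])
       (use disc_continuous_measurable[OF c] in \<open>auto simp: case_prod_unfold measurable_cong_sets[OF sets_disc_measure refl]\<close>)
  also have "\<dots> = (\<integral>t. (\<integral>u. (of_real (sqrt t) * u) ^ i * cnj (of_real (sqrt t) * u) ^ j \<partial>circle_measure) \<partial>?L)"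
    using polar.integral_fst'[OF int] by simp
  also have "\<dots> = (\<integral>t. of_real (sqrt t) ^ (i + j) * (if i = j then 1 else 0) \<partial>?L)"
  proof (rule Bochner_Integration.integral_cong[OF refl])
    fix t
    have "(\<integral>u. (of_real (sqrt t) * u) ^ i * cnj (of_real (sqrt t) * u) ^ j \<partial>circle_measure)
        = (\<integral>u. of_real (sqrt t) ^ (i + j) * (u ^ i * cnj u ^ j) \<partial>circle_measure)"
      by (simp add: power_mult_distrib power_add mult_ac)
    also have "\<dots> = of_real (sqrt t) ^ (i + j) * (if i = j then 1 else 0)"
      by (simp only: integral_mult_right_zero circle_moment)
    finally show "(\<integral>u. (of_real (sqrt t) * u) ^ i * cnj (of_real (sqrt t) * u) ^ j \<partial>circle_measure)
        = of_real (sqrt t) ^ (i + j) * (if i = j then 1 else 0)" .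
  qed
  also have "\<dots> = (if i = j then 1 / (of_nat i + 1) else 0)"
  proof (cases "i = j")
    case True
    have "(\<integral>t. of_real (sqrt t) ^ (i + j) \<partial>?L) = (\<integral>t. complex_of_real (t ^ i) \<partial>?L)"
      by (rule Bochner_Integration.integral_cong[OF refl])
         (use True in \<open>auto simp: space_restrict_space simp flip: of_real_power mult_2 simp: power_mult\<close>)
    also have "\<dots> = complex_of_real (\<integral>t. t ^ i \<partial>?L)"
      by (rule integral_complex_of_real)
    also have "(\<integral>t. t ^ i \<partial>?L) = (\<integral>t. indicator {0..1} t *\<^sub>R t ^ i \<partial>lborel)"
      by (subst integral_restrict_space) auto
    also have "(\<integral>t. indicator {0..1} t *\<^sub>R t ^ i \<partial>lborel) = (1::real) ^ Suc i / Suc i - 0 ^ Suc i / Suc i"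
      by (rule integral_FTC_atLeastAtMost)
         (auto intro!: derivative_eq_intros continuous_intros simp: has_real_derivative_iff_has_vector_derivative[symmetric] simp del: power_Suc)
    finally show ?thesis
      using True by simp
  qed simp
  finally show ?thesis .
qed

lemma poly_sum_le:
  fixes f :: "complex poly"
  shows "degree f \<le> n \<Longrightarrow> poly f z = (\<Sum>i\<le>n. coeff f i * z ^ i)"
  unfolding poly_altdef by (rule sum.mono_neutral_left) (auto simp: coeff_eq_0)

text \<open>The factor \<open>|z|^(2 s)\<close> shifts both exponents by \<open>s\<close>.
  Differences in \<open>s\<close> produce the weights \<open>1 - |z|^2\<close> and its square, and
  expanding the Bergman kernel produces such powers as well.\<close>

lemma disc_poly_inner:
  assumes "degree f \<le> n" "degree g \<le> n"
  shows "(\<integral>z. of_real ((cmod z) ^ (2 * s)) * (poly f z * cnj (poly g z)) \<partial>disc_measure)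
       = (\<Sum>i\<le>n. coeff f i * cnj (coeff g i) / of_nat (i + s + 1))"
proof -
  have int: "integrable disc_measure (\<lambda>z. z ^ (i + s) * cnj z ^ (j + s))" for i j
    by (intro disc_continuous_integrable continuous_intros)
  have "of_real ((cmod z) ^ (2 * s)) * (poly f z * cnj (poly g z))
     = (\<Sum>i\<le>n. \<Sum>j\<le>n. (coeff f i * cnj (coeff g j)) * (z ^ (i + s) * cnj z ^ (j + s)))" for z
  proof -
    have z: "of_real ((cmod z) ^ (2 * s)) = z ^ s * cnj z ^ s"
      by (simp only: power_mult of_real_power[of "(cmod z)\<^sup>2" s] complex_norm_square power_mult_distrib)
    show ?thesis
      unfolding z poly_sum_le[OF assms(1)] poly_sum_le[OF assms(2)] cnj_sum sum_product
      unfolding sum_distrib_left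
      by (intro sum.cong refl) (simp add: power_add mult_ac)
  qed
  then have "(\<integral>z. of_real ((cmod z) ^ (2 * s)) * (poly f z * cnj (poly g z)) \<partial>disc_measure)
     = (\<Sum>i\<le>n. \<Sum>j\<le>n. (coeff f i * cnj (coeff g j)) * (\<integral>z. z ^ (i + s) * cnj z ^ (j + s) \<partial>disc_measure))"
    by (simp add: int)
  also have "\<dots> = (\<Sum>i\<le>n. \<Sum>j\<le>n. if i = j then coeff f i * cnj (coeff g i) / of_nat (i + s + 1) else 0)"
    by (intro sum.cong refl) (simp add: disc_moment)
  also have "\<dots> = (\<Sum>i\<le>n. coeff f i * cnj (coeff g i) / of_nat (i + s + 1))"
    by simp
  finally show ?thesis .
qed

lemma disc_poly_norm:
  assumes "degree f \<le> n"
  shows "(\<integral>z. (cmod z) ^ (2 * s) * (cmod (poly f z))\<^sup>2 \<partial>disc_measure)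
       = (\<Sum>i\<le>n. (cmod (coeff f i))\<^sup>2 / (real i + real s + 1))"
proof -
  have "complex_of_real (\<integral>z. (cmod z) ^ (2 * s) * (cmod (poly f z))\<^sup>2 \<partial>disc_measure)
      = (\<integral>z. of_real ((cmod z) ^ (2 * s)) * (poly f z * cnj (poly f z)) \<partial>disc_measure)"
    by (simp only: integral_complex_of_real[symmetric] of_real_mult complex_norm_square[symmetric])
  also have "\<dots> = complex_of_real (\<Sum>i\<le>n. (cmod (coeff f i))\<^sup>2 / (real i + real s + 1))"
    unfolding disc_poly_inner[OF assms assms] of_real_sum of_real_divide complex_norm_square
    by (simp add: add_ac)
  finally show ?thesis
    by (simp only: of_real_eq_iff)
qed

lemma disc_poly_inner_weight1:
  assumes "degree f \<le> n" "degree g \<le> n"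
  shows "(\<integral>z. of_real (1 - (cmod z)\<^sup>2) * (poly f z * cnj (poly g z)) \<partial>disc_measure)
       = (\<Sum>i\<le>n. coeff f i * cnj (coeff g i) / of_nat ((i + 1) * (i + 2)))"
proof -
  have "(\<integral>z. of_real (1 - (cmod z)\<^sup>2) * (poly f z * cnj (poly g z)) \<partial>disc_measure)
    = (\<integral>z. of_real ((cmod z) ^ (2 * 0)) * (poly f z * cnj (poly g z))
          - of_real ((cmod z) ^ (2 * 1)) * (poly f z * cnj (poly g z)) \<partial>disc_measure)"
    by (simp add: algebra_simps power2_eq_square)
  also have "\<dots> = (\<Sum>i\<le>n. coeff f i * cnj (coeff g i) / of_nat (i + 0 + 1)) - (\<Sum>i\<le>n. coeff f i * cnj (coeff g i) / of_nat (i + 1 + 1))"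
    by (subst Bochner_Integration.integral_diff)
       (auto intro!: disc_continuous_integrable continuous_intros simp only: disc_poly_inner[OF assms])
  also have "\<dots> = (\<Sum>i\<le>n. coeff f i * cnj (coeff g i) / of_nat ((i + 1) * (i + 2)))"
    unfolding sum_subtractf[symmetric]
  proof (intro sum.cong refl)
    fix i
    have "complex_of_nat i + 1 \<noteq> 0" "complex_of_nat i + 2 \<noteq> 0"
      by (metis of_nat_Suc of_nat_eq_0_iff nat.simps(3) add.commute, metis of_nat_add of_nat_numeral of_nat_eq_0_iff add_eq_0_iff_both_eq_0 zero_neq_numeral)
    then show "coeff f i * cnj (coeff g i) / of_nat (i + 0 + 1) - coeff f i * cnj (coeff g i) / of_nat (i + 1 + 1)
        = coeff f i * cnj (coeff g i) / of_nat ((i + 1) * (i + 2))"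
      by (simp add: field_simps)
  qed
  finally show ?thesis .
qed

text \<open>The difference of the moments for \<open>s\<close> and \<open>s + 1\<close>.\<close>

lemma disc_poly_norm_weight1:
  assumes "degree f \<le> n"
  shows "(\<integral>z. (1 - (cmod z)\<^sup>2) * ((cmod z) ^ (2 * s) * (cmod (poly f z))\<^sup>2) \<partial>disc_measure)
       = (\<Sum>i\<le>n. (cmod (coeff f i))\<^sup>2 / ((real i + real s + 1) * (real i + real s + 2)))"
proof -
  have "(\<integral>z. (1 - (cmod z)\<^sup>2) * ((cmod z) ^ (2 * s) * (cmod (poly f z))\<^sup>2) \<partial>disc_measure)
     = (\<integral>z. (cmod z) ^ (2 * s) * (cmod (poly f z))\<^sup>2 - (cmod z) ^ (2 * (s + 1)) * (cmod (poly f z))\<^sup>2 \<partial>disc_measure)"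
    by (simp add: algebra_simps power2_eq_square)
  also have "\<dots> = (\<Sum>i\<le>n. (cmod (coeff f i))\<^sup>2 / (real i + real s + 1)) - (\<Sum>i\<le>n. (cmod (coeff f i))\<^sup>2 / (real i + real (s + 1) + 1))"
    by (subst Bochner_Integration.integral_diff)
       (auto intro!: disc_continuous_integrable continuous_intros simp only: disc_poly_norm[OF assms])
  also have "\<dots> = (\<Sum>i\<le>n. (cmod (coeff f i))\<^sup>2 / ((real i + real s + 1) * (real i + real s + 2)))"
    unfolding sum_subtractf[symmetric]
    by (intro sum.cong refl) (simp add: divide_simps add_eq_0_iff, (simp add: algebra_simps)?)
  finally show ?thesis .
qed

text \<open>The second difference of the moments. These numbers are later the squares of the Hankel
  weights.\<close>

lemma disc_poly_norm_weight2:
  assumes "degree f \<le> n"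
  shows "(\<integral>z. (1 - (cmod z)\<^sup>2)\<^sup>2 * (cmod (poly f z))\<^sup>2 \<partial>disc_measure)
       = (\<Sum>i\<le>n. (cmod (coeff f i))\<^sup>2 * (2 / ((real i + 1) * (real i + 2) * (real i + 3))))"
proof -
  have "(\<integral>z. (1 - (cmod z)\<^sup>2)\<^sup>2 * (cmod (poly f z))\<^sup>2 \<partial>disc_measure)
     = (\<integral>z. (1 - (cmod z)\<^sup>2) * ((cmod z) ^ (2 * 0) * (cmod (poly f z))\<^sup>2) - (1 - (cmod z)\<^sup>2) * ((cmod z) ^ (2 * 1) * (cmod (poly f z))\<^sup>2) \<partial>disc_measure)"
    by (simp add: algebra_simps power2_eq_square)
  also have "\<dots> = (\<Sum>i\<le>n. (cmod (coeff f i))\<^sup>2 / ((real i + real 0 + 1) * (real i + real 0 + 2))) - (\<Sum>i\<le>n. (cmod (coeff f i))\<^sup>2 / ((real i + real 1 + 1) * (real i + real 1 + 2)))"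
    by (subst Bochner_Integration.integral_diff)
       (auto intro!: disc_continuous_integrable continuous_intros simp only: disc_poly_norm_weight1[OF assms])
  also have "\<dots> = (\<Sum>i\<le>n. (cmod (coeff f i))\<^sup>2 * (2 / ((real i + 1) * (real i + 2) * (real i + 3))))"
    unfolding sum_subtractf[symmetric]
    by (intro sum.cong refl) (simp add: divide_simps add_eq_0_iff, (simp add: algebra_simps)?)
  finally show ?thesis .
qed

lemma circle_poly_norm:
  assumes "degree f \<le> n"
  shows "(\<integral>z. (cmod (poly f z))\<^sup>2 \<partial>circle_measure) = (\<Sum>i\<le>n. (cmod (coeff f i))\<^sup>2)"
proof -
  have int: "integrable circle_measure (\<lambda>z. z ^ i * cnj z ^ j)" for i j
    by (intro circle_continuous_integrable continuous_intros)
  have "complex_of_real (\<integral>z. (cmod (poly f z))\<^sup>2 \<partial>circle_measure)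
      = (\<integral>z. (\<Sum>i\<le>n. \<Sum>j\<le>n. (coeff f i * cnj (coeff f j)) * (z ^ i * cnj z ^ j)) \<partial>circle_measure)"
    unfolding integral_complex_of_real[symmetric] complex_norm_square poly_sum_le[OF assms] cnj_sum sum_product
    by (intro Bochner_Integration.integral_cong refl sum.cong) (simp add: mult_ac)
  also have "\<dots> = (\<Sum>i\<le>n. \<Sum>j\<le>n. (coeff f i * cnj (coeff f j)) * (\<integral>z. z ^ i * cnj z ^ j \<partial>circle_measure))"
    by (simp add: int)
  also have "\<dots> = (\<Sum>i\<le>n. \<Sum>j\<le>n. if i = j then coeff f i * cnj (coeff f i) else 0)"
    by (intro sum.cong refl) (simp add: circle_moment)
  also have "\<dots> = complex_of_real (\<Sum>i\<le>n. (cmod (coeff f i))\<^sup>2)"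
    unfolding of_real_sum complex_norm_square by simp
  finally show ?thesis
    by (simp only: of_real_eq_iff)
qed

section \<open>Pointwise and square-mean estimates for polynomials on the disc\<close>

lemma poly_bound_disc:
  assumes M: "\<And>z. cmod z = 1 \<Longrightarrow> cmod (poly P z) \<le> M" and w: "cmod w \<le> 1"
  shows "cmod (poly P w) \<le> M"
  by (rule maximum_modulus_frontier[of "poly P" "cball 0 1"])
     (use M w in \<open>auto intro!: holomorphic_intros continuous_intros simp: frontier_cball\<close>)

text \<open>Cauchy's estimate on the disc of radius \<open>1 - |w|\<close> around \<open>w\<close>;
  the factor \<open>2\<close> absorbs \<open>1 + |w|\<close>.\<close>

lemma poly_deriv_bound_disc:
  assumes M: "\<And>z. cmod z = 1 \<Longrightarrow> cmod (poly P z) \<le> M" and w: "cmod w \<le> 1"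
  shows "(1 - (cmod w)\<^sup>2) * cmod (poly (pderiv P) w) \<le> 2 * M"
proof (cases "cmod w = 1")
  case True
  then show ?thesis
    using order_trans[OF norm_ge_zero M[of 1]] by simp
next
  case False
  then have w1: "cmod w < 1" using w by simp
  have hol: "poly P holomorphic_on S" for S
    unfolding holomorphic_on_def field_differentiable_def
    by (blast intro: poly_DERIV has_field_derivative_at_within)
  have "cmod ((deriv ^^ 1) (poly P) w) \<le> fact 1 * M / (1 - cmod w) ^ 1"
  proof (rule Cauchy_inequality[OF hol])
    show "continuous_on (cball w (1 - cmod w)) (poly P)"
      by (rule holomorphic_on_imp_continuous_on[OF hol])
    show "0 < 1 - cmod w" using w1 by simp
    fix x assume x: "cmod (w - x) = 1 - cmod w"
    have "x = w - (w - x)" by simp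
    then have "cmod x \<le> cmod w + cmod (w - x)"
      by (metis norm_triangle_ineq4)
    then have "cmod x \<le> 1"
      using x by linarith
    then show "cmod (poly P x) \<le> M"
      by (rule poly_bound_disc[rotated]) (rule M)
  qed
  then have "cmod (deriv (poly P) w) \<le> M / (1 - cmod w)"
    by simp
  moreover have "deriv (poly P) w = poly (pderiv P) w"
    by (intro DERIV_imp_deriv poly_DERIV)
  ultimately have *: "(1 - cmod w) * cmod (poly (pderiv P) w) \<le> M"
    using w1 by (simp add: pos_le_divide_eq mult.commute)
  have "(1 - (cmod w)\<^sup>2) * cmod (poly (pderiv P) w) = (1 + cmod w) * ((1 - cmod w) * cmod (poly (pderiv P) w))"
    by (simp add: algebra_simps power2_eq_square)
  also have "\<dots> \<le> 2 * M"
    using w1 by (intro mult_mono *) auto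
  finally show ?thesis .
qed

lemma cmod_add_square_le: "(cmod (x + y))\<^sup>2 \<le> 2 * (cmod x)\<^sup>2 + 2 * (cmod y)\<^sup>2"
proof -
  have "(cmod (x + y))\<^sup>2 \<le> (cmod x + cmod y)\<^sup>2"
    by (intro power_mono norm_triangle_ineq) auto
  also have "\<dots> \<le> 2 * (cmod x)\<^sup>2 + 2 * (cmod y)\<^sup>2"
    using sum_squares_bound[of "cmod x" "cmod y"] by (simp add: power2_sum)
  finally show ?thesis .
qed

text \<open>By Parseval this is the squared Hardy space norm of a scalar polynomial.\<close>

definition sqnorm_coeffs :: "complex poly \<Rightarrow> real" where
  "sqnorm_coeffs f = (\<Sum>i\<le>degree f. (cmod (coeff f i))\<^sup>2)"

text \<open>On the coefficient side the product is a convolution; on the circle, where Parseval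
  moves the norm, it is pointwise and costs at most \<open>M\<close>.\<close>

lemma sqnorm_coeffs_mult_le:
  assumes M: "\<And>z. cmod z = 1 \<Longrightarrow> cmod (poly P z) \<le> M"
  shows "sqnorm_coeffs (P * h) \<le> M\<^sup>2 * sqnorm_coeffs h"
proof -
  have "sqnorm_coeffs (P * h) = (\<integral>z. (cmod (poly (P * h) z))\<^sup>2 \<partial>circle_measure)"
    unfolding sqnorm_coeffs_def by (subst circle_poly_norm) auto
  also have "\<dots> \<le> (\<integral>z. M\<^sup>2 * (cmod (poly h z))\<^sup>2 \<partial>circle_measure)"
  proof (rule integral_mono)
    fix z assume "z \<in> space circle_measure"
    then have "cmod (poly P z) * cmod (poly h z) \<le> M * cmod (poly h z)"
      by (intro mult_right_mono M) auto
    then show "(cmod (poly (P * h) z))\<^sup>2 \<le> M\<^sup>2 * (cmod (poly h z))\<^sup>2"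
      unfolding poly_mult norm_mult power_mult_distrib[symmetric] by (intro power_mono) auto
  qed (intro circle_continuous_integrable continuous_intros)+
  also have "\<dots> = M\<^sup>2 * sqnorm_coeffs h"
    unfolding sqnorm_coeffs_def by (subst circle_poly_norm[symmetric]) auto
  finally show ?thesis .
qed

text \<open>One half of the Littlewood-Paley formula: the factor \<open>(i + 1)^2\<close> from the
  derivative meets the moment \<open>1 / ((i + 1) (i + 2))\<close>, and the quotient is below
  \<open>1\<close>.\<close>

lemma disc_pderiv_norm_le:
  "(\<integral>z. (1 - (cmod z)\<^sup>2) * (cmod (poly (pderiv f) z))\<^sup>2 \<partial>disc_measure) \<le> sqnorm_coeffs f"
proof -
  have "(\<integral>z. (1 - (cmod z)\<^sup>2) * (cmod (poly (pderiv f) z))\<^sup>2 \<partial>disc_measure)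
      = (\<Sum>i\<le>degree f. (cmod (coeff (pderiv f) i))\<^sup>2 / ((real i + 1) * (real i + 2)))"
    using disc_poly_norm_weight1[of "pderiv f" "degree f" 0] by (simp add: degree_pderiv)
  also have "\<dots> \<le> (\<Sum>i\<le>degree f. (cmod (coeff f (Suc i)))\<^sup>2)"
  proof (rule sum_mono)
    fix i
    have "(cmod (coeff (pderiv f) i))\<^sup>2 / ((real i + 1) * (real i + 2)) = (cmod (coeff f (Suc i)))\<^sup>2 * ((real i + 1) / (real i + 2))"
      by (simp add: coeff_pderiv norm_mult power_mult_distrib divide_simps power2_eq_square del: of_nat_Suc) (simp add: algebra_simps)
    also have "\<dots> \<le> (cmod (coeff f (Suc i)))\<^sup>2 * 1"
      by (intro mult_left_mono) auto
    finally show "(cmod (coeff (pderiv f) i))\<^sup>2 / ((real i + 1) * (real i + 2)) \<le> (cmod (coeff f (Suc i)))\<^sup>2" by simp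
  qed
  also have "\<dots> = (\<Sum>i\<in>{Suc 0..Suc (degree f)}. (cmod (coeff f i))\<^sup>2)"
    by (simp only: sum.shift_bounds_cl_Suc_ivl atMost_atLeast0)
  also have "\<dots> = (\<Sum>i\<in>{Suc 0..degree f}. (cmod (coeff f i))\<^sup>2)"
    by (simp add: coeff_eq_0)
  also have "\<dots> \<le> sqnorm_coeffs f"
    unfolding sqnorm_coeffs_def by (intro sum_mono2) auto
  finally show ?thesis .
qed

text \<open>The idea is \<open>P' h = (P h)' - P h'\<close>.\<close>

lemma disc_carleson:
  assumes M: "\<And>z. cmod z = 1 \<Longrightarrow> cmod (poly P z) \<le> M"
  shows "(\<integral>w. (1 - (cmod w)\<^sup>2) * (cmod (poly (pderiv P) w * poly h w))\<^sup>2 \<partial>disc_measure) \<le> 4 * M\<^sup>2 * sqnorm_coeffs h"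
proof -
  have "(\<integral>w. (1 - (cmod w)\<^sup>2) * (cmod (poly (pderiv P) w * poly h w))\<^sup>2 \<partial>disc_measure)
     \<le> (\<integral>w. 2 * ((1 - (cmod w)\<^sup>2) * (cmod (poly (pderiv (P * h)) w))\<^sup>2) + 2 * M\<^sup>2 * ((1 - (cmod w)\<^sup>2) * (cmod (poly (pderiv h) w))\<^sup>2) \<partial>disc_measure)"
  proof (rule integral_mono)
    fix w assume "w \<in> space disc_measure"
    then have w: "cmod w \<le> 1" by simp
    have "(cmod (poly (pderiv P) w * poly h w))\<^sup>2 = (cmod (poly (pderiv (P * h)) w + - (poly P w * poly (pderiv h) w)))\<^sup>2"
      by (simp add: pderiv_mult algebra_simps)
    also have "\<dots> \<le> 2 * (cmod (poly (pderiv (P * h)) w))\<^sup>2 + 2 * (cmod (poly P w * poly (pderiv h) w))\<^sup>2"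
      using cmod_add_square_le[of "poly (pderiv (P * h)) w" "- (poly P w * poly (pderiv h) w)"] by simp
    also have "(cmod (poly P w * poly (pderiv h) w))\<^sup>2 \<le> M\<^sup>2 * (cmod (poly (pderiv h) w))\<^sup>2"
      unfolding norm_mult power_mult_distrib by (intro mult_right_mono power_mono poly_bound_disc[OF M w]) auto
    finally have "(1 - (cmod w)\<^sup>2) * (cmod (poly (pderiv P) w * poly h w))\<^sup>2
       \<le> (1 - (cmod w)\<^sup>2) * (2 * (cmod (poly (pderiv (P * h)) w))\<^sup>2 + 2 * (M\<^sup>2 * (cmod (poly (pderiv h) w))\<^sup>2))"
      using w by (intro mult_left_mono) (auto simp: power_le_one)
    then show "(1 - (cmod w)\<^sup>2) * (cmod (poly (pderiv P) w * poly h w))\<^sup>2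
       \<le> 2 * ((1 - (cmod w)\<^sup>2) * (cmod (poly (pderiv (P * h)) w))\<^sup>2) + 2 * M\<^sup>2 * ((1 - (cmod w)\<^sup>2) * (cmod (poly (pderiv h) w))\<^sup>2)"
      by (simp add: algebra_simps)
  qed (intro disc_continuous_integrable continuous_intros)+
  also have "\<dots> = 2 * (\<integral>w. (1 - (cmod w)\<^sup>2) * (cmod (poly (pderiv (P * h)) w))\<^sup>2 \<partial>disc_measure)
      + 2 * M\<^sup>2 * (\<integral>w. (1 - (cmod w)\<^sup>2) * (cmod (poly (pderiv h) w))\<^sup>2 \<partial>disc_measure)"
    by (subst Bochner_Integration.integral_add) (auto intro!: disc_continuous_integrable continuous_intros)
  also have "\<dots> \<le> 2 * sqnorm_coeffs (P * h) + 2 * M\<^sup>2 * sqnorm_coeffs h"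
    by (intro add_mono mult_left_mono disc_pderiv_norm_le) auto
  also have "\<dots> \<le> 4 * M\<^sup>2 * sqnorm_coeffs h"
    using sqnorm_coeffs_mult_le[of P M h, OF M] by (simp add: mult_ac)
  finally show ?thesis .
qed

text \<open>These are the coefficients of \<open>|h_n|^2\<close> when \<open>|h(z) - h(w)|^2\<close>
  is integrated against the squared kernel: \<open>A\<close> comes from \<open>|h(z)|^2\<close>,
  \<open>B\<close> from \<open>|h(w)|^2\<close>, \<open>C\<close> from the mixed term. Each sum
  grows logarithmically in \<open>N\<close>; the growth cancels in the combination.\<close>

lemma bergman_sum_bound:
  defines "A n \<equiv> \<lambda>k. (real k + 1) / ((real n + real k + 1) * (real n + real k + 2))"
    and "B n \<equiv> \<lambda>k. (real k + 1) / ((real k + 2) * (real n + real k + 1))"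
    and "C n \<equiv> \<lambda>k. if n \<le> k then (real k - real n + 1) / ((real k + 1) * (real k + 2)) else 0"
  shows "(\<Sum>k<N. A n k) + (\<Sum>k<N. B n k) - 2 * (\<Sum>k<N. C n k) \<le> 3"
proof -
  have A: "A n k \<le> 1 / (real n + real k + 1)" for k
    unfolding A_def by (simp add: divide_simps) (simp add: algebra_simps)?
  have B: "B n k \<le> 1 / (real n + real k + 1)" for k
    unfolding B_def by (simp add: divide_simps)
  show ?thesis
  proof (cases "N \<le> n")
    case True
    have le: "1 / (real n + real k + 1) \<le> 1 / (real n + 1)" for k
      by (simp add: divide_simps)
    have "(\<Sum>k<N. A n k) \<le> (\<Sum>k<N. 1 / (real n + 1))" "(\<Sum>k<N. B n k) \<le> (\<Sum>k<N. 1 / (real n + 1))"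
      by (intro sum_mono order_trans[OF A le] order_trans[OF B le])+
    moreover have "(\<Sum>k<N. 1 / (real n + 1)) \<le> 1"
      using True by (simp add: divide_simps)
    moreover have "0 \<le> (\<Sum>k<N. C n k)"
      by (intro sum_nonneg) (auto simp: C_def)
    ultimately show ?thesis by linarith
  next
    case False
    \<comment> \<open>Shifting the index by \<open>n\<close> turns \<open>C\<close> into the first
      \<open>K\<close> terms of \<open>A\<close>. What remains are the tails of \<open>A\<close> and
      \<open>B\<close>, with \<open>n\<close> terms of size at most \<open>1 / N\<close> each, and
      the sum of \<open>B - A\<close>, which telescopes. Each of the three is at most
      \<open>1\<close>.\<close>
    define K where "K = N - n"
    have N: "N = n + K" "N = K + n" and N0: "N > 0" using False by (auto simp: K_def)
    have tail: "(\<Sum>k\<in>{K..<N}. 1 / (real n + real k + 1)) \<le> 1"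
    proof -
      have "(\<Sum>k\<in>{K..<N}. 1 / (real n + real k + 1)) \<le> (\<Sum>k\<in>{K..<N}. 1 / real N)"
        using N0 N by (intro sum_mono divide_left_mono) auto
      also have "\<dots> \<le> 1"
        using N0 N by (simp add: divide_simps)
      finally show ?thesis .
    qed
    have split: "(\<Sum>k<N. f k) = (\<Sum>k<K. f k) + (\<Sum>k\<in>{K..<N}. f k)" for f :: "nat \<Rightarrow> real"
      unfolding lessThan_atLeast0 by (rule sum.atLeastLessThan_concat[symmetric]) (auto simp: K_def)
    have tA: "(\<Sum>k\<in>{K..<N}. A n k) \<le> 1" and tB: "(\<Sum>k\<in>{K..<N}. B n k) \<le> 1"
      by (rule order_trans[OF sum_mono tail], rule A, rule order_trans[OF sum_mono tail], rule B)
    have "(\<Sum>k<N. C n k) = (\<Sum>k\<in>{n..<N}. C n k)"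
      by (rule sum.mono_neutral_right) (auto simp: C_def)
    also have "\<dots> = (\<Sum>k\<in>{0+n..<K+n}. C n k)"
      by (simp add: N(2))
    also have "\<dots> = (\<Sum>k<K. A n k)"
      unfolding sum.shift_bounds_nat_ivl lessThan_atLeast0
      by (intro sum.cong refl) (simp add: A_def C_def algebra_simps)
    finally have C: "(\<Sum>k<N. C n k) = (\<Sum>k<K. A n k)" .
    have "B n k - A n k \<le> real n * (1 / (real n + real k + 1) - 1 / (real n + real (Suc k) + 1))" for k
    proof -
      have "B n k - A n k = ((real k + 1) / (real k + 2)) * (real n / ((real n + real k + 1) * (real n + real k + 2)))"
        unfolding A_def B_def by (simp add: divide_simps) (simp add: algebra_simps)?
      also have "\<dots> \<le> 1 * (real n / ((real n + real k + 1) * (real n + real k + 2)))"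
        by (intro mult_right_mono) auto
      also have "\<dots> = real n * (1 / (real n + real k + 1) - 1 / (real n + real (Suc k) + 1))"
        by (simp add: divide_simps) (simp add: algebra_simps)?
      finally show ?thesis .
    qed
    then have "(\<Sum>k<K. B n k - A n k) \<le> (\<Sum>k<K. real n * (1 / (real n + real k + 1) - 1 / (real n + real (Suc k) + 1)))"
      by (rule sum_mono)
    also have "\<dots> = real n * (1 / (real n + real 0 + 1) - 1 / (real n + real K + 1))"
      unfolding sum_distrib_left[symmetric] by (subst sum_lessThan_telescope') simp
    also have "\<dots> \<le> real n * (1 / (real n + 1))"
      by (intro mult_left_mono) auto
    also have "\<dots> \<le> 1" by (simp add: divide_simps)
    finally have "(\<Sum>k<K. B n k) - (\<Sum>k<K. A n k) \<le> 1"
      by (simp add: sum_subtractf)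
    then show ?thesis
      using tA tB unfolding C split[of "A n"] split[of "B n"] by linarith
  qed
qed

subsection \<open>Estimates with the Bergman kernel\<close>

text \<open>The Bergman kernel \<open>1 / (1 - x w)^2\<close> as a power series in \<open>w\<close>,
  cut at degree \<open>N\<close>; it is used with \<open>x = cnj z\<close>. The cut does not affect
  the coefficients below \<open>N\<close> of a product with another polynomial.\<close>

definition bergman_poly :: "nat \<Rightarrow> complex \<Rightarrow> complex poly" where
  "bergman_poly N x = (\<Sum>k<N. monom (of_nat (k + 1) * x ^ k) k)"

lemma coeff_bergman_poly: "coeff (bergman_poly N x) i = (if i < N then of_nat (i + 1) * x ^ i else 0)"
  unfolding bergman_poly_def coeff_sum coeff_monom by (simp add: sum.delta)

lemma poly_bergman_poly: "poly (bergman_poly N x) w = (\<Sum>k<N. of_nat (k + 1) * (x * w) ^ k)"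
  by (simp add: bergman_poly_def poly_sum poly_monom power_mult_distrib mult_ac)

lemma degree_bergman_poly: "degree (bergman_poly N x) \<le> N"
  by (rule degree_le) (simp add: coeff_bergman_poly)

text \<open>Hermitian symmetry of the kernel. It lets either variable play the role of the parameter
  when a double integral is evaluated.\<close>

lemma cmod_bergman_poly_swap: "cmod (poly (bergman_poly N (cnj z)) w) = cmod (poly (bergman_poly N (cnj w)) z)"
proof -
  have "poly (bergman_poly N (cnj w)) z = cnj (poly (bergman_poly N (cnj z)) w)"
    by (simp add: poly_bergman_poly mult_ac)
  then show ?thesis by simp
qed

lemma continuous_on_bergman_poly [continuous_intros]:
  assumes "continuous_on S f" "continuous_on S g"
  shows "continuous_on S (\<lambda>p. poly (bergman_poly N (f p)) (g p))"
  unfolding poly_bergman_poly by (intro continuous_intros assms)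

lemma cmod_coeff_bergman_poly:
  "(cmod (coeff (bergman_poly N (cnj z)) i))\<^sup>2 = (if i < N then (real i + 1)\<^sup>2 * (cmod z) ^ (2 * i) else 0)"
proof -
  have "(cmod (of_nat (i + 1) * cnj z ^ i))\<^sup>2 = (real (i + 1))\<^sup>2 * (cmod z ^ i)\<^sup>2"
    by (simp only: norm_mult norm_of_nat norm_power complex_mod_cnj power_mult_distrib)
  also have "(cmod z ^ i)\<^sup>2 = (cmod z) ^ (2 * i)"
    by (simp add: power_mult[symmetric] mult.commute)
  finally show ?thesis
    by (simp add: coeff_bergman_poly add.commute)
qed

lemma sum_if_lessThan:
  fixes N :: nat
  shows "(\<Sum>i\<le>N. if i < N then f i else 0) = (\<Sum>i<N. f i :: 'a::comm_monoid_add)"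
  by (rule sum.mono_neutral_cong_right) auto

lemma bergman_disc_norm:
  "(\<integral>w. (cmod (poly (bergman_poly N (cnj z)) w))\<^sup>2 \<partial>disc_measure) = (\<Sum>k<N. (real k + 1) * (cmod z) ^ (2 * k))"
proof -
  have "(\<integral>w. (cmod (poly (bergman_poly N (cnj z)) w))\<^sup>2 \<partial>disc_measure)
     = (\<Sum>i\<le>N. (cmod (coeff (bergman_poly N (cnj z)) i))\<^sup>2 / (real i + 1))"
    using disc_poly_norm[of "bergman_poly N (cnj z)" N 0] degree_bergman_poly by simp
  also have "\<dots> = (\<Sum>i\<le>N. if i < N then (real i + 1) * (cmod z) ^ (2 * i) else 0)"
    by (intro sum.cong refl) (simp only: cmod_coeff_bergman_poly, simp add: power2_eq_square)
  finally show ?thesis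
    by (simp only: sum_if_lessThan)
qed

lemma bergman_disc_norm_weight1:
  "(\<integral>w. (1 - (cmod w)\<^sup>2) * (cmod (poly (bergman_poly N (cnj z)) w))\<^sup>2 \<partial>disc_measure)
   = (\<Sum>k<N. (real k + 1) / (real k + 2) * (cmod z) ^ (2 * k))"
proof -
  have "(\<integral>w. (1 - (cmod w)\<^sup>2) * (cmod (poly (bergman_poly N (cnj z)) w))\<^sup>2 \<partial>disc_measure)
     = (\<Sum>i\<le>N. (cmod (coeff (bergman_poly N (cnj z)) i))\<^sup>2 / ((real i + 1) * (real i + 2)))"
    using disc_poly_norm_weight1[of "bergman_poly N (cnj z)" N 0] degree_bergman_poly by simp
  also have "\<dots> = (\<Sum>i\<le>N. if i < N then (real i + 1) / (real i + 2) * (cmod z) ^ (2 * i) else 0)"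
    by (intro sum.cong refl) (simp only: cmod_coeff_bergman_poly, simp add: power2_eq_square)
  finally show ?thesis
    by (simp only: sum_if_lessThan)
qed

text \<open>The coefficients \<open>(k + 1) / (k + 2)\<close> are below \<open>1\<close>, so the
  integral is dominated by a geometric series in \<open>|z|^2\<close>, which the factor
  \<open>1 - |z|^2\<close> sums.\<close>

lemma bergman_norm_bound:
  assumes "cmod z \<le> 1"
  shows "(1 - (cmod z)\<^sup>2) * (\<integral>w. (1 - (cmod w)\<^sup>2) * (cmod (poly (bergman_poly N (cnj z)) w))\<^sup>2 \<partial>disc_measure) \<le> 1"
proof -
  define x where "x = (cmod z)\<^sup>2"
  have x: "0 \<le> x" "x \<le> 1" using assms by (auto simp: x_def power_le_one)
  have "(\<Sum>k<N. (real k + 1) / (real k + 2) * (cmod z) ^ (2 * k)) \<le> (\<Sum>k<N. x ^ k)"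
  proof (rule sum_mono)
    fix k
    have "(real k + 1) / (real k + 2) * x ^ k \<le> 1 * x ^ k"
      using x by (intro mult_right_mono) auto
    then show "(real k + 1) / (real k + 2) * (cmod z) ^ (2 * k) \<le> x ^ k"
      by (simp add: x_def power_mult)
  qed
  then have "(1 - x) * (\<Sum>k<N. (real k + 1) / (real k + 2) * (cmod z) ^ (2 * k)) \<le> (1 - x) * (\<Sum>k<N. x ^ k)"
    using x by (intro mult_left_mono) auto
  also have "\<dots> = 1 - x ^ N"
    by (simp add: one_diff_power_eq)
  also have "\<dots> \<le> 1" using x by simp
  finally show ?thesis
    by (simp add: bergman_disc_norm_weight1 x_def)
qed

text \<open>Writing the squared modulus of the kernel as kernel times conjugate makes the inner
  integral a weighted inner product of \<open>h\<close> times the kernel with the kernel. The result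
  is a polynomial in \<open>w\<close> and \<open>cnj w\<close>, from which the outer integral picks
  single coefficients of \<open>h\<close>.\<close>

lemma bergman_cross_term:
  "(\<integral>w. cnj (poly h w) * (\<integral>z. of_real (1 - (cmod z)\<^sup>2) * (poly h z * of_real ((cmod (poly (bergman_poly N (cnj w)) z))\<^sup>2)) \<partial>disc_measure) \<partial>disc_measure)
   = of_real (\<Sum>n\<le>degree h. (cmod (coeff h n))\<^sup>2 * (\<Sum>k<N. if n \<le> k then (real k - real n + 1) / ((real k + 1) * (real k + 2)) else 0))"
proof -
  define d where "d = degree h"
  have inner: "(\<integral>z. of_real (1 - (cmod z)\<^sup>2) * (poly h z * of_real ((cmod (poly (bergman_poly N (cnj w)) z))\<^sup>2)) \<partial>disc_measure)
      = (\<Sum>k<N. \<Sum>n\<le>d. if n \<le> k then coeff h n * (of_nat (k - n + 1) / of_nat (k + 2)) * (w ^ k * cnj w ^ (k - n)) else 0)" for w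
  proof -
    let ?B = "bergman_poly N (cnj w)"
    have dB: "degree ?B \<le> d + N" "degree (h * ?B) \<le> d + N"
      using degree_bergman_poly[of N "cnj w"] degree_mult_le[of h ?B] by (auto simp: d_def)
    have "(\<integral>z. of_real (1 - (cmod z)\<^sup>2) * (poly h z * of_real ((cmod (poly ?B z))\<^sup>2)) \<partial>disc_measure)
       = (\<integral>z. of_real (1 - (cmod z)\<^sup>2) * (poly (h * ?B) z * cnj (poly ?B z)) \<partial>disc_measure)"
      by (simp only: complex_norm_square poly_mult mult.assoc)
    also have "\<dots> = (\<Sum>i\<le>d + N. coeff (h * ?B) i * cnj (coeff ?B i) / of_nat ((i + 1) * (i + 2)))"
      by (rule disc_poly_inner_weight1[OF dB(2) dB(1)])
    also have "\<dots> = (\<Sum>k<N. coeff (h * ?B) k * cnj (coeff ?B k) / of_nat ((k + 1) * (k + 2)))"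
      by (rule sum.mono_neutral_right) (auto simp: coeff_bergman_poly)
    also have "\<dots> = (\<Sum>k<N. \<Sum>n\<le>d. if n \<le> k then coeff h n * (of_nat (k - n + 1) / of_nat (k + 2)) * (w ^ k * cnj w ^ (k - n)) else 0)"
    proof (rule sum.cong[OF refl])
      fix k assume k: "k \<in> {..<N}"
      have nz: "complex_of_nat (k + 1) \<noteq> 0" by (simp only: of_nat_eq_0_iff)
      have "coeff (h * ?B) k * cnj (coeff ?B k) / of_nat ((k + 1) * (k + 2))
         = (\<Sum>n\<le>k. coeff h n * (of_nat (k - n + 1) * cnj w ^ (k - n))) * (of_nat (k + 1) * w ^ k) / of_nat ((k + 1) * (k + 2))"
      proof -
        have "coeff (h * ?B) k = (\<Sum>n\<le>k. coeff h n * (of_nat (k - n + 1) * cnj w ^ (k - n)))"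
          unfolding coeff_mult using k by (intro sum.cong refl) (simp add: coeff_bergman_poly)
        moreover have "cnj (coeff ?B k) = of_nat (k + 1) * w ^ k"
          using k by (simp add: coeff_bergman_poly)
        ultimately show ?thesis by (simp only:)
      qed
      also have "\<dots> = (\<Sum>n\<le>k. coeff h n * (of_nat (k - n + 1) * cnj w ^ (k - n))) * (w ^ k / of_nat (k + 2))"
      proof -
        have "S * (c * x) / (c * y) = S * (x / y)" if "c \<noteq> 0" for S x c y :: complex
          using that by simp
        from this[OF nz] show ?thesis unfolding of_nat_mult .
      qed
      also have "\<dots> = (\<Sum>n\<le>k. coeff h n * (of_nat (k - n + 1) / of_nat (k + 2)) * (w ^ k * cnj w ^ (k - n)))"
        unfolding sum_distrib_right by (intro sum.cong refl) simp
      also have "\<dots> = (\<Sum>n\<le>k + d. if n \<le> k then coeff h n * (of_nat (k - n + 1) / of_nat (k + 2)) * (w ^ k * cnj w ^ (k - n)) else 0)"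
        by (rule sum.mono_neutral_cong_left) auto
      also have "\<dots> = (\<Sum>n\<le>d. if n \<le> k then coeff h n * (of_nat (k - n + 1) / of_nat (k + 2)) * (w ^ k * cnj w ^ (k - n)) else 0)"
        by (rule sum.mono_neutral_right) (auto simp: d_def coeff_eq_0)
      finally show "coeff (h * ?B) k * cnj (coeff ?B k) / of_nat ((k + 1) * (k + 2))
         = (\<Sum>n\<le>d. if n \<le> k then coeff h n * (of_nat (k - n + 1) / of_nat (k + 2)) * (w ^ k * cnj w ^ (k - n)) else 0)" .
    qed
    finally show ?thesis .
  qed
  \<comment> \<open>The power \<open>w^k\<close> is paired with \<open>w^(k - n) h\<close>, so only
    the coefficient of \<open>h\<close> at \<open>n\<close> contributes.\<close>
  have outer: "(\<integral>w. cnj (poly h w) * (w ^ k * cnj w ^ (k - n)) \<partial>disc_measure) = cnj (coeff h n) / of_nat (k + 1)" if "n \<le> k" for n k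
  proof -
    have "(\<integral>w. cnj (poly h w) * (w ^ k * cnj w ^ (k - n)) \<partial>disc_measure)
       = (\<integral>w. of_real ((cmod w) ^ (2 * 0)) * (poly (monom 1 k) w * cnj (poly (monom 1 (k - n) * h) w)) \<partial>disc_measure)"
      by (simp add: poly_monom mult_ac)
    also have "\<dots> = (\<Sum>i\<le>k + d. coeff (monom 1 k) i * cnj (coeff (monom 1 (k - n) * h) i) / of_nat (i + 0 + 1))"
    proof (rule disc_poly_inner)
      show "degree (monom (1::complex) k) \<le> k + d"
        using degree_monom_le[of "1::complex" k] by simp
      show "degree (monom 1 (k - n) * h) \<le> k + d"
        using degree_mult_le[of "monom 1 (k - n)" h] degree_monom_le[of "1::complex" "k - n"] by (simp add: d_def)
    qed
    also have "\<dots> = (\<Sum>i\<le>k + d. if i = k then cnj (coeff (monom 1 (k - n) * h) k) / of_nat (k + 1) else 0)"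
      by (intro sum.cong refl) (simp add: coeff_monom)
    also have "\<dots> = cnj (coeff h n) / of_nat (k + 1)"
      using that by (simp add: coeff_monom_mult)
    finally show ?thesis .
  qed
  define c where "c k n = (if n \<le> k then coeff h n * (of_nat (k - n + 1) / of_nat (k + 2)) else 0)" for k n
  have int: "integrable disc_measure (\<lambda>w. c k n * (cnj (poly h w) * (w ^ k * cnj w ^ (k - n))))" for k n
    by (intro disc_continuous_integrable continuous_intros)
  have "(\<integral>w. cnj (poly h w) * (\<integral>z. of_real (1 - (cmod z)\<^sup>2) * (poly h z * of_real ((cmod (poly (bergman_poly N (cnj w)) z))\<^sup>2)) \<partial>disc_measure) \<partial>disc_measure)
     = (\<integral>w. (\<Sum>k<N. \<Sum>n\<le>d. c k n * (cnj (poly h w) * (w ^ k * cnj w ^ (k - n)))) \<partial>disc_measure)"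
    unfolding inner sum_distrib_left
    by (intro Bochner_Integration.integral_cong refl sum.cong) (simp add: c_def)
  also have "\<dots> = (\<Sum>k<N. \<Sum>n\<le>d. \<integral>w. c k n * (cnj (poly h w) * (w ^ k * cnj w ^ (k - n))) \<partial>disc_measure)"
    by (simp only: Bochner_Integration.integral_sum Bochner_Integration.integrable_sum int)
  also have "\<dots> = (\<Sum>k<N. \<Sum>n\<le>d. c k n * (cnj (coeff h n) / of_nat (k + 1)))"
  proof (intro sum.cong refl)
    fix k n
    show "(\<integral>w. c k n * (cnj (poly h w) * (w ^ k * cnj w ^ (k - n))) \<partial>disc_measure) = c k n * (cnj (coeff h n) / of_nat (k + 1))"
      unfolding integral_mult_right_zero by (cases "n \<le> k") (simp only: outer, simp add: c_def)
  qed
  also have "\<dots> = (\<Sum>k<N. \<Sum>n\<le>d. of_real ((cmod (coeff h n))\<^sup>2 * (if n \<le> k then (real k - real n + 1) / ((real k + 1) * (real k + 2)) else 0)))"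
  proof (intro sum.cong refl)
    fix k n
    show "c k n * (cnj (coeff h n) / of_nat (k + 1))
        = of_real ((cmod (coeff h n))\<^sup>2 * (if n \<le> k then (real k - real n + 1) / ((real k + 1) * (real k + 2)) else 0))"
    proof (cases "n \<le> k")
      case True
      have "c k n * (cnj (coeff h n) / of_nat (k + 1)) = (coeff h n * cnj (coeff h n)) * (of_nat (k - n + 1) / (of_nat (k + 1) * of_nat (k + 2)))"
      proof -
        have "a * (m / p) * (b / q) = (a * b) * (m / (q * p))" for a b m p q :: complex
          by (simp add: mult_ac)
        then show ?thesis using True unfolding c_def by (simp only: if_True)
      qed
      also have "\<dots> = of_real ((cmod (coeff h n))\<^sup>2 * (real (k - n + 1) / (real (k + 1) * real (k + 2))))"
        unfolding of_real_mult complex_norm_square by simp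
      finally show ?thesis
        using True by (simp add: of_nat_diff add_ac)
    qed (simp add: c_def)
  qed
  also have "\<dots> = of_real (\<Sum>n\<le>d. (cmod (coeff h n))\<^sup>2 * (\<Sum>k<N. if n \<le> k then (real k - real n + 1) / ((real k + 1) * (real k + 2)) else 0))"
    unfolding sum_distrib_left of_real_sum by (rule sum.swap)
  finally show ?thesis
    unfolding d_def .
qed

lemma continuous_on_coeff_bergman_poly [continuous_intros]:
  assumes "continuous_on S f"
  shows "continuous_on S (\<lambda>z. coeff (bergman_poly N (f z)) i)"
  by (cases "i < N") (auto simp: coeff_bergman_poly intro!: continuous_intros assms)

lemma disc2_continuous_integrable':
  fixes F :: "complex \<Rightarrow> complex \<Rightarrow> 'b::{banach, second_countable_topology}"
  assumes "continuous_on UNIV (\<lambda>p. F (fst p) (snd p))"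
  shows "integrable (disc_measure \<Otimes>\<^sub>M disc_measure) (case_prod F)"
  using disc2_continuous_integrable[OF assms] by (simp add: case_prod_unfold)

text \<open>The square of the difference is expanded and each of the three terms is integrated
  exactly. The bound, uniform in \<open>N\<close>, is due to their combination only and is the
  content of \<open>bergman_sum_bound\<close>.\<close>

lemma bergman_double_integral:
  "(\<integral>p. (\<lambda>(z, w). (1 - (cmod z)\<^sup>2) * ((cmod (poly (bergman_poly N (cnj z)) w))\<^sup>2 * (cmod (poly h z - poly h w))\<^sup>2)) p
     \<partial>(disc_measure \<Otimes>\<^sub>M disc_measure)) \<le> 3 * sqnorm_coeffs h"
proof -
  define k where "k z w = cmod (poly (bergman_poly N (cnj z)) w)" for z w
  define Fa where "Fa z w = (1 - (cmod z)\<^sup>2) * ((k z w)\<^sup>2 * (cmod (poly h z))\<^sup>2)" for z w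
  define Fb where "Fb z w = (1 - (cmod z)\<^sup>2) * ((k z w)\<^sup>2 * (cmod (poly h w))\<^sup>2)" for z w
  define Fc where "Fc z w = cnj (poly h w) * (of_real (1 - (cmod z)\<^sup>2) * (poly h z * of_real ((cmod (poly (bergman_poly N (cnj w)) z))\<^sup>2)))" for z w
  define d where "d = degree h"
  let ?D2 = "disc_measure \<Otimes>\<^sub>M disc_measure"
  have ksw: "k z w = cmod (poly (bergman_poly N (cnj w)) z)" for z w
    unfolding k_def by (rule cmod_bergman_poly_swap)
  have ia: "integrable ?D2 (case_prod Fa)"
    unfolding Fa_def k_def by (intro disc2_continuous_integrable' continuous_intros)
  have ib: "integrable ?D2 (case_prod Fb)"
    unfolding Fb_def k_def by (intro disc2_continuous_integrable' continuous_intros)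
  have ic: "integrable ?D2 (case_prod Fc)"
    unfolding Fc_def by (intro disc2_continuous_integrable' continuous_intros)
  have "integral\<^sup>L ?D2 (case_prod Fa) = (\<integral>z. (\<integral>w. Fa z w \<partial>disc_measure) \<partial>disc_measure)"
    by (rule disc2.integral_fst[OF ia, symmetric])
  also have "\<dots> = (\<integral>z. (\<Sum>j<N. (real j + 1) * ((1 - (cmod z)\<^sup>2) * ((cmod z) ^ (2 * j) * (cmod (poly h z))\<^sup>2))) \<partial>disc_measure)"
  proof (intro Bochner_Integration.integral_cong refl)
    fix z
    have "(\<integral>w. Fa z w \<partial>disc_measure) = (\<integral>w. ((1 - (cmod z)\<^sup>2) * (cmod (poly h z))\<^sup>2) * (k z w)\<^sup>2 \<partial>disc_measure)"
      unfolding Fa_def by (intro Bochner_Integration.integral_cong refl) simp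
    also have "\<dots> = ((1 - (cmod z)\<^sup>2) * (cmod (poly h z))\<^sup>2) * (\<Sum>j<N. (real j + 1) * (cmod z) ^ (2 * j))"
      unfolding integral_mult_right_zero k_def bergman_disc_norm ..
    finally show "(\<integral>w. Fa z w \<partial>disc_measure) = (\<Sum>j<N. (real j + 1) * ((1 - (cmod z)\<^sup>2) * ((cmod z) ^ (2 * j) * (cmod (poly h z))\<^sup>2)))"
      unfolding sum_distrib_left by (simp add: mult_ac)
  qed
  also have "\<dots> = (\<Sum>j<N. (real j + 1) * (\<integral>z. (1 - (cmod z)\<^sup>2) * ((cmod z) ^ (2 * j) * (cmod (poly h z))\<^sup>2) \<partial>disc_measure))"
    unfolding integral_mult_right_zero[symmetric]
    by (intro Bochner_Integration.integral_sum disc_continuous_integrable continuous_intros)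
  also have "\<dots> = (\<Sum>j<N. (real j + 1) * (\<Sum>n\<le>d. (cmod (coeff h n))\<^sup>2 / ((real n + real j + 1) * (real n + real j + 2))))"
    by (simp only: disc_poly_norm_weight1[OF order_refl] d_def)
  also have "\<dots> = (\<Sum>n\<le>d. (cmod (coeff h n))\<^sup>2 * (\<Sum>j<N. (real j + 1) / ((real n + real j + 1) * (real n + real j + 2))))"
    unfolding sum_distrib_left by (rule trans[OF sum.swap]) (simp add: mult_ac)
  finally have a: "integral\<^sup>L ?D2 (case_prod Fa) = \<dots>" .
  \<comment> \<open>For the terms containing \<open>h(w)\<close> the integration over
    \<open>z\<close> comes first, with the kernel rewritten so that \<open>w\<close> is its
    parameter.\<close>
  have "integral\<^sup>L ?D2 (case_prod Fb) = (\<integral>w. (\<integral>z. Fb z w \<partial>disc_measure) \<partial>disc_measure)"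
    by (rule disc2.integral_snd[OF ib, symmetric])
  also have "\<dots> = (\<integral>w. (\<Sum>j<N. (real j + 1) / (real j + 2) * ((cmod w) ^ (2 * j) * (cmod (poly h w))\<^sup>2)) \<partial>disc_measure)"
  proof (intro Bochner_Integration.integral_cong refl)
    fix w
    have "(\<integral>z. Fb z w \<partial>disc_measure) = (\<integral>z. (cmod (poly h w))\<^sup>2 * ((1 - (cmod z)\<^sup>2) * (cmod (poly (bergman_poly N (cnj w)) z))\<^sup>2) \<partial>disc_measure)"
      unfolding Fb_def ksw by (intro Bochner_Integration.integral_cong refl) simp
    also have "\<dots> = (cmod (poly h w))\<^sup>2 * (\<Sum>j<N. (real j + 1) / (real j + 2) * (cmod w) ^ (2 * j))"
      unfolding integral_mult_right_zero bergman_disc_norm_weight1 ..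
    finally show "(\<integral>z. Fb z w \<partial>disc_measure) = (\<Sum>j<N. (real j + 1) / (real j + 2) * ((cmod w) ^ (2 * j) * (cmod (poly h w))\<^sup>2))"
      unfolding sum_distrib_left by (simp add: mult_ac)
  qed
  also have "\<dots> = (\<Sum>j<N. (real j + 1) / (real j + 2) * (\<integral>w. (cmod w) ^ (2 * j) * (cmod (poly h w))\<^sup>2 \<partial>disc_measure))"
    unfolding integral_mult_right_zero[symmetric]
    by (intro Bochner_Integration.integral_sum disc_continuous_integrable continuous_intros) auto
  also have "\<dots> = (\<Sum>j<N. (real j + 1) / (real j + 2) * (\<Sum>n\<le>d. (cmod (coeff h n))\<^sup>2 / (real n + real j + 1)))"
    by (simp only: disc_poly_norm[OF order_refl] d_def)
  also have "\<dots> = (\<Sum>n\<le>d. (cmod (coeff h n))\<^sup>2 * (\<Sum>j<N. (real j + 1) / ((real j + 2) * (real n + real j + 1))))"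
    unfolding sum_distrib_left by (rule trans[OF sum.swap]) (simp add: mult_ac)
  finally have b: "integral\<^sup>L ?D2 (case_prod Fb) = \<dots>" .
  have "integral\<^sup>L ?D2 (case_prod Fc) = (\<integral>w. (\<integral>z. Fc z w \<partial>disc_measure) \<partial>disc_measure)"
    by (rule disc2.integral_snd[OF ic, symmetric])
  also have "\<dots> = of_real (\<Sum>n\<le>d. (cmod (coeff h n))\<^sup>2 * (\<Sum>j<N. if n \<le> j then (real j - real n + 1) / ((real j + 1) * (real j + 2)) else 0))"
    unfolding Fc_def integral_mult_right_zero d_def by (rule bergman_cross_term)
  finally have c: "integral\<^sup>L ?D2 (case_prod Fc) = \<dots>" .
  have F: "(\<lambda>(z, w). (1 - (cmod z)\<^sup>2) * ((cmod (poly (bergman_poly N (cnj z)) w))\<^sup>2 * (cmod (poly h z - poly h w))\<^sup>2))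
     = (\<lambda>p. case_prod Fa p + case_prod Fb p - 2 * Re (case_prod Fc p))"
  proof (rule ext)
    fix p :: "complex \<times> complex"
    obtain z w where p: "p = (z, w)" by (cases p)
    have e: "(cmod (poly h z - poly h w))\<^sup>2 = (cmod (poly h z))\<^sup>2 + (cmod (poly h w))\<^sup>2 - 2 * Re (poly h z * cnj (poly h w))"
      by (simp only: cmod_power2) (simp add: power2_eq_square algebra_simps)
    have "Fc z w = of_real ((1 - (cmod z)\<^sup>2) * (k z w)\<^sup>2) * (poly h z * cnj (poly h w))"
      unfolding Fc_def ksw of_real_mult by (simp only: mult_ac)
    then have "Re (Fc z w) = (1 - (cmod z)\<^sup>2) * (k z w)\<^sup>2 * Re (poly h z * cnj (poly h w))"
      by (simp only: Re_complex_of_real Im_complex_of_real times_complex.sel(1)[of "of_real _"])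
    then show "(case p of (z, w) \<Rightarrow> (1 - (cmod z)\<^sup>2) * ((cmod (poly (bergman_poly N (cnj z)) w))\<^sup>2 * (cmod (poly h z - poly h w))\<^sup>2))
       = case_prod Fa p + case_prod Fb p - 2 * Re (case_prod Fc p)"
      unfolding p prod.case e k_def[symmetric] Fa_def Fb_def by (simp add: algebra_simps)
  qed
  have "(\<integral>p. case_prod Fa p + case_prod Fb p - 2 * Re (case_prod Fc p) \<partial>?D2)
     = integral\<^sup>L ?D2 (case_prod Fa) + integral\<^sup>L ?D2 (case_prod Fb) - 2 * Re (integral\<^sup>L ?D2 (case_prod Fc))"
    using ia ib ic by simp
  also have "\<dots> = (\<Sum>n\<le>d. (cmod (coeff h n))\<^sup>2 * ((\<Sum>j<N. (real j + 1) / ((real n + real j + 1) * (real n + real j + 2)))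
      + (\<Sum>j<N. (real j + 1) / ((real j + 2) * (real n + real j + 1)))
      - 2 * (\<Sum>j<N. if n \<le> j then (real j - real n + 1) / ((real j + 1) * (real j + 2)) else 0)))"
    unfolding a b c Re_complex_of_real
    by (simp only: right_diff_distrib distrib_left sum.distrib sum_subtractf sum_distrib_left mult.left_commute[of "2::real"])
  also have "\<dots> \<le> (\<Sum>n\<le>d. (cmod (coeff h n))\<^sup>2 * 3)"
    by (intro sum_mono mult_left_mono bergman_sum_bound) auto
  also have "\<dots> = 3 * sqnorm_coeffs h"
    by (simp add: sqnorm_coeffs_def d_def sum_distrib_left mult.commute)
  finally show ?thesis
    unfolding F .
qed

text \<open>
  Parseval turns the sum over \<open>l\<close> into an area integral over \<open>w\<close> with weight \<open>(1 - \<bar>w\<bar>\<^sup>2)\<^sup>2\<close>. Splitting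
  \<open>h(z) = h(w) + (h(z) - h(w))\<close>, the first part is a Carleson estimate, and the second one uses
  \<open>(1 - \<bar>w\<bar>\<^sup>2) \<bar>P'(w)\<bar> \<le> 2 M\<close>.
\<close>

lemma disc_hankel_bound:
  assumes M: "\<And>z. cmod z = 1 \<Longrightarrow> cmod (poly P z) \<le> M"
  shows "(\<integral>z. (1 - (cmod z)\<^sup>2) * ((\<Sum>l<N. (cmod (coeff (pderiv P * bergman_poly N (cnj z)) l))\<^sup>2
       * (2 / ((real l + 1) * (real l + 2) * (real l + 3)))) * (cmod (poly h z))\<^sup>2) \<partial>disc_measure)
     \<le> 32 * M\<^sup>2 * sqnorm_coeffs h"
proof -
  define k where "k z w = cmod (poly (bergman_poly N (cnj z)) w)" for z w
  define Q where "Q = pderiv P"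
  define F where "F z w = (1 - (cmod z)\<^sup>2) * ((1 - (cmod w)\<^sup>2)\<^sup>2 * ((cmod (poly Q w))\<^sup>2 * ((k z w)\<^sup>2 * (cmod (poly h z))\<^sup>2)))" for z w
  define F1 where "F1 z w = (1 - (cmod z)\<^sup>2) * ((1 - (cmod w)\<^sup>2)\<^sup>2 * ((cmod (poly Q w))\<^sup>2 * ((k z w)\<^sup>2 * (cmod (poly h w))\<^sup>2)))" for z w
  define F3 where "F3 z w = (1 - (cmod z)\<^sup>2) * ((k z w)\<^sup>2 * (cmod (poly h z - poly h w))\<^sup>2)" for z w
  let ?D2 = "disc_measure \<Otimes>\<^sub>M disc_measure"
  have ksw: "k z w = cmod (poly (bergman_poly N (cnj w)) z)" for z w
    unfolding k_def by (rule cmod_bergman_poly_swap)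
  have i: "integrable ?D2 (case_prod F)"
    unfolding F_def k_def by (intro disc2_continuous_integrable' continuous_intros)
  have i1: "integrable ?D2 (case_prod F1)"
    unfolding F1_def k_def by (intro disc2_continuous_integrable' continuous_intros)
  have i3: "integrable ?D2 (case_prod F3)"
    unfolding F3_def k_def by (intro disc2_continuous_integrable' continuous_intros)
  have M0: "0 \<le> M"
    using order_trans[OF norm_ge_zero M[of 1]] by simp
  have "(\<integral>z. (1 - (cmod z)\<^sup>2) * ((\<Sum>l<N. (cmod (coeff (Q * bergman_poly N (cnj z)) l))\<^sup>2
       * (2 / ((real l + 1) * (real l + 2) * (real l + 3)))) * (cmod (poly h z))\<^sup>2) \<partial>disc_measure)
     \<le> (\<integral>z. (\<integral>w. F z w \<partial>disc_measure) \<partial>disc_measure)"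
  proof (rule integral_mono)
    show "integrable disc_measure (\<lambda>z. \<integral>w. F z w \<partial>disc_measure)"
      by (rule disc2.integrable_fst[OF i])
    show "integrable disc_measure (\<lambda>z. (1 - (cmod z)\<^sup>2) * ((\<Sum>l<N. (cmod (coeff (Q * bergman_poly N (cnj z)) l))\<^sup>2
       * (2 / ((real l + 1) * (real l + 2) * (real l + 3)))) * (cmod (poly h z))\<^sup>2))"
      unfolding coeff_mult by (intro disc_continuous_integrable continuous_intros) (auto simp: add_eq_0_iff)
    fix z assume "z \<in> space disc_measure"
    then have z: "cmod z \<le> 1" by simp
    let ?B = "bergman_poly N (cnj z)"
    let ?n = "degree Q + N"
    have deg: "degree (Q * ?B) \<le> ?n"
      using degree_mult_le[of Q ?B] degree_bergman_poly[of N "cnj z"] by linarith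
    \<comment> \<open>The degrees from \<open>N\<close> on, where the cut of the kernel shows, are
      added only to complete the Parseval sum.\<close>
    have "(\<Sum>l<N. (cmod (coeff (Q * ?B) l))\<^sup>2 * (2 / ((real l + 1) * (real l + 2) * (real l + 3))))
       \<le> (\<Sum>l\<le>?n. (cmod (coeff (Q * ?B) l))\<^sup>2 * (2 / ((real l + 1) * (real l + 2) * (real l + 3))))"
      by (rule sum_mono2) auto
    also have "\<dots> = (\<integral>w. (1 - (cmod w)\<^sup>2)\<^sup>2 * (cmod (poly (Q * ?B) w))\<^sup>2 \<partial>disc_measure)"
      by (rule disc_poly_norm_weight2[OF deg, symmetric])
    finally have "(1 - (cmod z)\<^sup>2) * ((\<Sum>l<N. (cmod (coeff (Q * ?B) l))\<^sup>2 * (2 / ((real l + 1) * (real l + 2) * (real l + 3)))) * (cmod (poly h z))\<^sup>2)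
       \<le> (1 - (cmod z)\<^sup>2) * ((\<integral>w. (1 - (cmod w)\<^sup>2)\<^sup>2 * (cmod (poly (Q * ?B) w))\<^sup>2 \<partial>disc_measure) * (cmod (poly h z))\<^sup>2)"
      using z by (intro mult_left_mono mult_right_mono) (auto simp: power_le_one)
    also have "\<dots> = (\<integral>w. F z w \<partial>disc_measure)"
      unfolding integral_mult_left_zero[symmetric] integral_mult_right_zero[symmetric]
      by (intro Bochner_Integration.integral_cong refl) (simp add: F_def k_def norm_mult power_mult_distrib mult_ac)
    finally show "(1 - (cmod z)\<^sup>2) * ((\<Sum>l<N. (cmod (coeff (Q * ?B) l))\<^sup>2 * (2 / ((real l + 1) * (real l + 2) * (real l + 3)))) * (cmod (poly h z))\<^sup>2)
       \<le> (\<integral>w. F z w \<partial>disc_measure)" .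
  qed
  also have "\<dots> = integral\<^sup>L ?D2 (case_prod F)"
    by (rule disc2.integral_fst[OF i])
  also have "\<dots> \<le> (\<integral>p. 2 * case_prod F1 p + 8 * M\<^sup>2 * case_prod F3 p \<partial>?D2)"
  proof (rule integral_mono)
    fix p assume "p \<in> space ?D2"
    then obtain z w where p: "p = (z, w)" and z: "cmod z \<le> 1" and w: "cmod w \<le> 1"
      by (auto simp: space_pair_measure)
    define c where "c = (1 - (cmod z)\<^sup>2) * (k z w)\<^sup>2"
    define q where "q = (1 - (cmod w)\<^sup>2)\<^sup>2 * (cmod (poly Q w))\<^sup>2"
    have c0: "0 \<le> c" using z by (simp add: c_def power_le_one)
    have q0: "0 \<le> q" by (simp add: q_def)
    have qM: "q \<le> 4 * M\<^sup>2"
    proof -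
      have "((1 - (cmod w)\<^sup>2) * cmod (poly Q w))\<^sup>2 \<le> (2 * M)\<^sup>2"
        unfolding Q_def using M w by (intro power_mono poly_deriv_bound_disc) (auto simp: power_le_one)
      then show ?thesis by (simp add: q_def power_mult_distrib)
    qed
    have "(cmod (poly h z))\<^sup>2 \<le> 2 * (cmod (poly h w))\<^sup>2 + 2 * (cmod (poly h z - poly h w))\<^sup>2"
      using cmod_add_square_le[of "poly h w" "poly h z - poly h w"] by simp
    then have "c * q * (cmod (poly h z))\<^sup>2 \<le> c * q * (2 * (cmod (poly h w))\<^sup>2 + 2 * (cmod (poly h z - poly h w))\<^sup>2)"
      using c0 q0 by (intro mult_left_mono) auto
    also have "\<dots> = 2 * (c * q * (cmod (poly h w))\<^sup>2) + c * (2 * (cmod (poly h z - poly h w))\<^sup>2) * q"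
      by (simp add: algebra_simps)
    also have "\<dots> \<le> 2 * (c * q * (cmod (poly h w))\<^sup>2) + c * (2 * (cmod (poly h z - poly h w))\<^sup>2) * (4 * M\<^sup>2)"
      using c0 by (intro add_left_mono mult_left_mono qM) auto
    finally show "case_prod F p \<le> 2 * case_prod F1 p + 8 * M\<^sup>2 * case_prod F3 p"
      by (simp add: p F_def F1_def F3_def c_def q_def mult_ac)
  qed (use i i1 i3 in auto)
  also have "\<dots> = 2 * integral\<^sup>L ?D2 (case_prod F1) + 8 * M\<^sup>2 * integral\<^sup>L ?D2 (case_prod F3)"
    using i1 i3 by simp
  finally have le: "(\<integral>z. (1 - (cmod z)\<^sup>2) * ((\<Sum>l<N. (cmod (coeff (Q * bergman_poly N (cnj z)) l))\<^sup>2
       * (2 / ((real l + 1) * (real l + 2) * (real l + 3)))) * (cmod (poly h z))\<^sup>2) \<partial>disc_measure)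
     \<le> 2 * integral\<^sup>L ?D2 (case_prod F1) + 8 * M\<^sup>2 * integral\<^sup>L ?D2 (case_prod F3)" .
  have I3: "integral\<^sup>L ?D2 (case_prod F3) \<le> 3 * sqnorm_coeffs h"
    unfolding F3_def k_def by (rule bergman_double_integral)
  have "integral\<^sup>L ?D2 (case_prod F1) = (\<integral>w. (\<integral>z. F1 z w \<partial>disc_measure) \<partial>disc_measure)"
    by (rule disc2.integral_snd[OF i1, symmetric])
  also have "\<dots> \<le> (\<integral>w. (1 - (cmod w)\<^sup>2) * (cmod (poly (pderiv P) w * poly h w))\<^sup>2 \<partial>disc_measure)"
  proof (rule integral_mono)
    show "integrable disc_measure (\<lambda>w. \<integral>z. F1 z w \<partial>disc_measure)"
      by (rule disc2.integrable_snd[OF i1])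
    show "integrable disc_measure (\<lambda>w. (1 - (cmod w)\<^sup>2) * (cmod (poly (pderiv P) w * poly h w))\<^sup>2)"
      by (intro disc_continuous_integrable continuous_intros)
    fix w assume "w \<in> space disc_measure"
    then have w: "cmod w \<le> 1" by simp
    define e where "e = (1 - (cmod w)\<^sup>2) * (cmod (poly Q w * poly h w))\<^sup>2"
    have e0: "0 \<le> e" using w by (simp add: e_def power_le_one)
    have "(\<integral>z. F1 z w \<partial>disc_measure)
       = (\<integral>z. e * ((1 - (cmod w)\<^sup>2) * ((1 - (cmod z)\<^sup>2) * (cmod (poly (bergman_poly N (cnj w)) z))\<^sup>2)) \<partial>disc_measure)"
      by (intro Bochner_Integration.integral_cong refl)
         (simp add: F1_def e_def ksw norm_mult power_mult_distrib power2_eq_square[of "1 - _"] mult_ac)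
    also have "\<dots> = e * ((1 - (cmod w)\<^sup>2) * (\<integral>z. (1 - (cmod z)\<^sup>2) * (cmod (poly (bergman_poly N (cnj w)) z))\<^sup>2 \<partial>disc_measure))"
      by (simp only: integral_mult_right_zero)
    also have "\<dots> \<le> e * 1"
      by (intro mult_left_mono bergman_norm_bound w e0)
    finally show "(\<integral>z. F1 z w \<partial>disc_measure) \<le> (1 - (cmod w)\<^sup>2) * (cmod (poly (pderiv P) w * poly h w))\<^sup>2"
      by (simp add: e_def Q_def)
  qed
  also have "\<dots> \<le> 4 * M\<^sup>2 * sqnorm_coeffs h"
    using M by (rule disc_carleson)
  finally have I1: "integral\<^sup>L ?D2 (case_prod F1) \<le> 4 * M\<^sup>2 * sqnorm_coeffs h" .
  \<comment> \<open>The constant is \<open>32 = 2 * 4 + 8 * 3\<close>, from the Carleson estimate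
    and the double integral.\<close>
  have "8 * M\<^sup>2 * integral\<^sup>L ?D2 (case_prod F3) \<le> 8 * M\<^sup>2 * (3 * sqnorm_coeffs h)"
    using I3 by (intro mult_left_mono) auto
  then show ?thesis
    using le I1 unfolding Q_def by linarith
qed

subsection \<open>The Hankel estimate\<close>

text \<open>The root of the moment of \<open>(1 - |w|^2)^2\<close>, so that
  \<open>disc_poly_norm_weight2\<close> applies without loss. The decay is that of
  \<open>l^(-3/2)\<close>.\<close>

definition hankel_weight :: "nat \<Rightarrow> real" where
  "hankel_weight l = sqrt (2 / ((real l + 1) * (real l + 2) * (real l + 3)))"

lemma hankel_weight_sq: "(hankel_weight l)\<^sup>2 = 2 / ((real l + 1) * (real l + 2) * (real l + 3))"
  by (simp add: hankel_weight_def)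

definition car_form :: "nat \<Rightarrow> nat \<Rightarrow> (nat set \<Rightarrow> complex) \<Rightarrow> (nat set \<Rightarrow> complex) \<Rightarrow> complex" where
  "car_form L l x y = (\<Sum>A\<in>Pow {..<L}. \<Sum>B\<in>Pow {..<L}. car l A B * x B * y A)"

lemma car_form_bound:
  "(\<Sum>l<L. (cmod (car_form L l x y))\<^sup>2) \<le> (\<Sum>A\<in>Pow {..<L}. (cmod (x A))\<^sup>2) * (\<Sum>A\<in>Pow {..<L}. (cmod (y A))\<^sup>2)"
  unfolding car_form_def by (rule car_bilinear_bound)

definition seq_poly :: "nat \<Rightarrow> (nat \<Rightarrow> complex) \<Rightarrow> complex poly" where
  "seq_poly d a = (\<Sum>i<d. monom (a i) i)"

lemma coeff_seq_poly: "coeff (seq_poly d a) i = (if i < d then a i else 0)"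
  unfolding seq_poly_def coeff_sum coeff_monom by (simp add: sum.delta)

lemma degree_seq_poly: "degree (seq_poly d a) \<le> d"
  by (rule degree_le) (simp add: coeff_seq_poly)

lemma sqnorm_coeffs_seq_poly: "sqnorm_coeffs (seq_poly d a) = (\<Sum>i<d. (cmod (a i))\<^sup>2)"
proof -
  have "sqnorm_coeffs (seq_poly d a) = (\<Sum>i\<le>d. (cmod (coeff (seq_poly d a) i))\<^sup>2)"
    unfolding sqnorm_coeffs_def using degree_seq_poly[of d a]
    by (intro sum.mono_neutral_left) (auto simp: coeff_eq_0)
  also have "\<dots> = (\<Sum>i\<le>d. if i < d then (cmod (a i))\<^sup>2 else 0)"
    by (intro sum.cong refl) (simp add: coeff_seq_poly)
  finally show ?thesis by (simp only: sum_if_lessThan)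
qed

text \<open>The factors \<open>i + 1\<close> make the polynomial the derivative of \<open>z\<close>
  times the one with coefficients \<open>a i\<close>, so this is the Littlewood-Paley estimate once
  more.\<close>

lemma disc_seq_poly_deriv_norm:
  "(\<integral>z. (1 - (cmod z)\<^sup>2) * (cmod (poly (seq_poly d (\<lambda>i. of_nat (i + 1) * a i)) z))\<^sup>2 \<partial>disc_measure) \<le> (\<Sum>i<d. (cmod (a i))\<^sup>2)"
proof -
  let ?f = "seq_poly d (\<lambda>i. of_nat (i + 1) * a i)"
  have "(\<integral>z. (1 - (cmod z)\<^sup>2) * (cmod (poly ?f z))\<^sup>2 \<partial>disc_measure)
     = (\<Sum>i\<le>d. (cmod (coeff ?f i))\<^sup>2 / ((real i + 1) * (real i + 2)))"
    using disc_poly_norm_weight1[OF degree_seq_poly, where s=0] by simp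
  also have "\<dots> \<le> (\<Sum>i\<le>d. if i < d then (cmod (a i))\<^sup>2 else 0)"
  proof (rule sum_mono)
    fix i
    have "(cmod (of_nat (i + 1) * a i))\<^sup>2 = (real (i + 1))\<^sup>2 * (cmod (a i))\<^sup>2"
      by (simp only: norm_mult norm_of_nat power_mult_distrib)
    then have "(cmod (of_nat (i + 1) * a i))\<^sup>2 / ((real i + 1) * (real i + 2)) = (cmod (a i))\<^sup>2 * ((real i + 1) / (real i + 2))"
      by (simp add: power2_eq_square add.commute)
    also have "\<dots> \<le> (cmod (a i))\<^sup>2 * 1"
      by (intro mult_left_mono) auto
    finally show "(cmod (coeff ?f i))\<^sup>2 / ((real i + 1) * (real i + 2)) \<le> (if i < d then (cmod (a i))\<^sup>2 else 0)"
      by (simp add: coeff_seq_poly)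
  qed
  finally show ?thesis by (simp only: sum_if_lessThan)
qed

text \<open>Young's inequality with a free parameter. It stands in for Cauchy-Schwarz under an
  integral: the bound is linear in \<open>a\<close> and \<open>b\<close>, and \<open>t\<close> is
  optimized after integration.\<close>

lemma amgm_square_bound:
  fixes u a b t :: real
  assumes "u\<^sup>2 \<le> a * b" "0 \<le> a" "0 \<le> b" "t > 0"
  shows "u \<le> (t * a + b / t) / 2"
proof -
  have "0 \<le> (t * a - b / t)\<^sup>2" by simp
  then have "4 * (a * b) \<le> (t * a + b / t)\<^sup>2"
    using assms(4) by (simp add: power2_sum power2_diff)
  then have "(2 * u)\<^sup>2 \<le> (t * a + b / t)\<^sup>2"
    using assms(1) by (simp add: power_mult_distrib)
  moreover have "0 \<le> t * a + b / t" using assms by simp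
  ultimately have "2 * u \<le> t * a + b / t"
    by (rule power2_le_imp_le)
  then show ?thesis by simp
qed

lemma sum_mult_square_le:
  fixes E X :: "nat \<Rightarrow> complex"
  shows "(cmod (\<Sum>l\<in>I. E l * X l))\<^sup>2 \<le> (\<Sum>l\<in>I. (cmod (E l))\<^sup>2) * (\<Sum>l\<in>I. (cmod (X l))\<^sup>2)"
proof -
  have "(cmod (\<Sum>l\<in>I. E l * X l))\<^sup>2 \<le> (\<Sum>l\<in>I. cmod (E l) * cmod (X l))\<^sup>2"
    by (intro power_mono order_trans[OF norm_sum]) (simp_all add: norm_mult)
  also have "\<dots> \<le> (\<Sum>l\<in>I. (cmod (E l))\<^sup>2) * (\<Sum>l\<in>I. (cmod (X l))\<^sup>2)"
    by (rule Cauchy_Schwarz_ineq_sum)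
  finally show ?thesis .
qed

text \<open>
  The moment \<open>1 / ((n + 1) (n + 2))\<close> of the weight \<open>1 - \<bar>z\<bar>\<^sup>2\<close> is compensated by the Bergman coefficient \<open>n + 1\<close>
  and by \<open>n + 2 = (i + 1) + (j + 1)\<close> for \<open>i + j = n\<close>, which is shared between the two arguments.
\<close>

lemma hankel_form_coefficient:
  assumes "l < L"
    and g: "\<And>i A. i \<ge> d \<Longrightarrow> g i A = 0" and h: "\<And>i A. i \<ge> d \<Longrightarrow> h i A = 0"
  defines "gp A \<equiv> seq_poly d (\<lambda>i. g i A)" and "hp A \<equiv> seq_poly d (\<lambda>i. h i A)"
    and "gq A \<equiv> seq_poly d (\<lambda>i. of_nat (i + 1) * g i A)" and "hq A \<equiv> seq_poly d (\<lambda>i. of_nat (i + 1) * h i A)"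
  shows "(\<integral>z. of_real (1 - (cmod z)\<^sup>2) * (coeff (Q * bergman_poly L (cnj z)) l
       * (car_form L l (\<lambda>A. poly (gq A) z) (\<lambda>A. poly (hp A) z) + car_form L l (\<lambda>A. poly (gp A) z) (\<lambda>A. poly (hq A) z))) \<partial>disc_measure)
     = (\<Sum>n\<le>l. \<Sum>i\<le>n. coeff Q (l - n) * car_form L l (g i) (h (n - i)))"
proof -
  define X where "X = (\<Sum>A\<in>Pow {..<L}. \<Sum>B\<in>Pow {..<L}. Polynomial.smult (car l A B) (gq B * hp A + gp B * hq A))"
  \<comment> \<open>As a function of \<open>z\<close> the coefficient is a polynomial in
    \<open>cnj z\<close>. Storing its conjugate as \<open>E\<close> turns the integral into an inner
    product with weight \<open>1 - |z|^2\<close>.\<close>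
  define E where "E = seq_poly (Suc l) (\<lambda>n. cnj (coeff Q (l - n) * of_nat (n + 1)))"
  have poly_X: "car_form L l (\<lambda>A. poly (gq A) z) (\<lambda>A. poly (hp A) z) + car_form L l (\<lambda>A. poly (gp A) z) (\<lambda>A. poly (hq A) z) = poly X z" for z
    unfolding car_form_def X_def sum.distrib[symmetric] poly_sum poly_smult poly_add poly_mult
    by (intro sum.cong refl) (simp add: algebra_simps)
  have poly_E: "coeff (Q * bergman_poly L (cnj z)) l = cnj (poly E z)" for z
  proof -
    have "coeff (Q * bergman_poly L (cnj z)) l = (\<Sum>n\<le>l. coeff (bergman_poly L (cnj z)) n * coeff Q (l - n))"
      by (subst mult.commute) (rule coeff_mult)
    also have "\<dots> = (\<Sum>n<Suc l. cnj (cnj (coeff Q (l - n) * of_nat (n + 1)) * z ^ n))"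
      unfolding lessThan_Suc_atMost using assms(1) by (intro sum.cong refl) (simp add: coeff_bergman_poly)
    also have "\<dots> = cnj (poly E z)"
      by (simp only: E_def seq_poly_def poly_sum poly_monom cnj_sum)
    finally show ?thesis .
  qed
  define n where "n = degree X + Suc l"
  have "(\<integral>z. of_real (1 - (cmod z)\<^sup>2) * (coeff (Q * bergman_poly L (cnj z)) l
       * (car_form L l (\<lambda>A. poly (gq A) z) (\<lambda>A. poly (hp A) z) + car_form L l (\<lambda>A. poly (gp A) z) (\<lambda>A. poly (hq A) z))) \<partial>disc_measure)
     = (\<integral>z. of_real (1 - (cmod z)\<^sup>2) * (poly X z * cnj (poly E z)) \<partial>disc_measure)"
    unfolding poly_X poly_E by (simp add: mult.commute)
  also have "\<dots> = (\<Sum>i\<le>n. coeff X i * cnj (coeff E i) / of_nat ((i + 1) * (i + 2)))"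
  proof (rule disc_poly_inner_weight1)
    show "degree E \<le> n"
      unfolding E_def n_def by (rule order_trans[OF degree_seq_poly]) simp
  qed (simp add: n_def)
  also have "\<dots> = (\<Sum>i\<le>l. coeff X i * cnj (coeff E i) / of_nat ((i + 1) * (i + 2)))"
    by (rule sum.mono_neutral_right) (auto simp: n_def E_def coeff_seq_poly)
  also have "\<dots> = (\<Sum>n\<le>l. \<Sum>i\<le>n. coeff Q (l - n) * car_form L l (g i) (h (n - i)))"
  proof (intro sum.cong refl)
    fix n assume n: "n \<in> {..l}"
    have cg: "coeff (gp A) i = g i A" "coeff (gq A) i = of_nat (i + 1) * g i A"
      and ch: "coeff (hp A) i = h i A" "coeff (hq A) i = of_nat (i + 1) * h i A" for A i
      using g[of i A] h[of i A] by (auto simp: gp_def gq_def hp_def hq_def coeff_seq_poly not_less)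
    have "coeff (gq B * hp A + gp B * hq A) n = of_nat (n + 2) * (\<Sum>i\<le>n. g i B * h (n - i) A)" for A B
      unfolding coeff_add coeff_mult cg ch sum.distrib[symmetric] sum_distrib_left
    proof (intro sum.cong refl)
      fix i assume "i \<in> {..n}"
      then have "complex_of_nat (n + 2) = of_nat (i + 1) + of_nat (n - i + 1)"
        by (simp flip: of_nat_add)
      then show "of_nat (i + 1) * g i B * h (n - i) A + g i B * (of_nat (n - i + 1) * h (n - i) A) = of_nat (n + 2) * (g i B * h (n - i) A)"
        by (simp only:) (simp add: algebra_simps)
    qed
    then have "coeff X n = of_nat (n + 2) * (\<Sum>A\<in>Pow {..<L}. \<Sum>B\<in>Pow {..<L}. \<Sum>i\<le>n. car l A B * g i B * h (n - i) A)"
      unfolding X_def coeff_sum coeff_smult by (simp only: sum_distrib_left mult_ac)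
    also have "(\<Sum>A\<in>Pow {..<L}. \<Sum>B\<in>Pow {..<L}. \<Sum>i\<le>n. car l A B * g i B * h (n - i) A) = (\<Sum>i\<le>n. car_form L l (g i) (h (n - i)))"
      unfolding car_form_def
      by (rule trans[OF sum.cong[OF refl sum.swap] sum.swap])
    finally have X: "coeff X n = of_nat (n + 2) * (\<Sum>i\<le>n. car_form L l (g i) (h (n - i)))" .
    have E: "cnj (coeff E n) = coeff Q (l - n) * of_nat (n + 1)"
      using n by (simp add: E_def coeff_seq_poly)
    have gen: "p * s * (q * r) / (r * p) = q * s" if "p \<noteq> 0" "r \<noteq> 0" for p q r s :: complex
      using that by simp
    have nz: "complex_of_nat (n + 2) \<noteq> 0" "complex_of_nat (n + 1) \<noteq> 0"
      by (simp_all only: of_nat_eq_0_iff)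
    show "coeff X n * cnj (coeff E n) / of_nat ((n + 1) * (n + 2)) = (\<Sum>i\<le>n. coeff Q (l - n) * car_form L l (g i) (h (n - i)))"
      unfolding X E of_nat_mult gen[OF nz] by (rule sum_distrib_left)
  qed
  finally show ?thesis .
qed

text \<open>For fixed \<open>z\<close>, Cauchy-Schwarz in \<open>l\<close> separates the scalars
  \<open>E l z\<close> from the values of the forms \<open>c_l\<close>, and
  \<open>car_form_bound\<close> controls the latter independently of \<open>L\<close>. After Young's
  inequality the integrals are of two types, covered by \<open>disc_hankel_bound\<close> and
  \<open>disc_seq_poly_deriv_norm\<close>. Positivity is assumed so that the parameters can be
  divided by.\<close>

lemma hankel_form_bound_aux:
  fixes g h :: "nat \<Rightarrow> nat set \<Rightarrow> complex" and L d :: nat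
  assumes M: "\<And>z. cmod z = 1 \<Longrightarrow> cmod (poly P z) \<le> M" and "M > 0"
    and g: "\<And>i A. i \<ge> d \<Longrightarrow> g i A = 0" and h: "\<And>i A. i \<ge> d \<Longrightarrow> h i A = 0"
  defines "G \<equiv> (\<Sum>i<d. \<Sum>A\<in>Pow {..<L}. (cmod (g i A))\<^sup>2)" and "H \<equiv> (\<Sum>i<d. \<Sum>A\<in>Pow {..<L}. (cmod (h i A))\<^sup>2)"
  assumes GH: "G > 0" "H > 0"
  shows "cmod (\<Sum>l<L. of_real (hankel_weight l) * (\<Sum>n\<le>l. \<Sum>i\<le>n. coeff (pderiv P) (l - n) * car_form L l (g i) (h (n - i))))
     \<le> 12 * M * sqrt G * sqrt H"
proof -
  let ?U = "Pow {..<L}"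
  define gp hp gq hq where "gp A = seq_poly d (\<lambda>i. g i A)" and "hp A = seq_poly d (\<lambda>i. h i A)"
    and "gq A = seq_poly d (\<lambda>i. of_nat (i + 1) * g i A)" and "hq A = seq_poly d (\<lambda>i. of_nat (i + 1) * h i A)" for A
  define E where "E l z = of_real (hankel_weight l) * coeff (pderiv P * bergman_poly L (cnj z)) l" for l z
  define X1 where "X1 l z = car_form L l (\<lambda>A. poly (gq A) z) (\<lambda>A. poly (hp A) z)" for l z
  define X2 where "X2 l z = car_form L l (\<lambda>A. poly (gp A) z) (\<lambda>A. poly (hq A) z)" for l z
  define e where "e z = (\<Sum>l<L. (cmod (E l z))\<^sup>2)" for z
  define N where "N f z = (\<Sum>A\<in>?U. (cmod (poly (f A) z))\<^sup>2)" for f :: "nat set \<Rightarrow> complex poly" and z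
  define w where "w z = 1 - (cmod z)\<^sup>2" for z :: complex
  \<comment> \<open>The minimizers of \<open>18 M^2 H s + G / (2 s)\<close> and of
    \<open>18 M^2 G t + H / (2 t)\<close>. Each of the four resulting terms is
    \<open>3 M sqrt G sqrt H\<close>, which gives the constant \<open>12\<close>.\<close>
  define s t where "s = sqrt G / (6 * M * sqrt H)" and "t = sqrt H / (6 * M * sqrt G)"
  have st: "s > 0" "t > 0" using GH \<open>M > 0\<close> by (auto simp: s_def t_def)
  have N0: "0 \<le> N f z" for f z by (simp add: N_def sum_nonneg)
  have e0: "0 \<le> e z" for z by (simp add: e_def sum_nonneg)
  have cE: "continuous_on S (E l)" for S l
    unfolding E_def[abs_def] coeff_mult by (intro continuous_intros)
  have cN: "continuous_on S (N f)" for S f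
    unfolding N_def[abs_def] by (intro continuous_intros)
  have ce: "continuous_on S e" for S
    unfolding e_def[abs_def] by (intro continuous_intros cE)
  have cw: "continuous_on S w" for S
    unfolding w_def[abs_def] by (intro continuous_intros)
  have cX: "continuous_on S (X1 l)" "continuous_on S (X2 l)" for S l
    unfolding X1_def[abs_def] X2_def[abs_def] car_form_def by (intro continuous_intros)+
  have intEX: "integrable disc_measure (\<lambda>z. of_real (w z) * (E l z * (X1 l z + X2 l z)))" for l
    by (intro disc_continuous_integrable continuous_intros cE cw cX)
  have "(\<Sum>l<L. of_real (hankel_weight l) * (\<Sum>n\<le>l. \<Sum>i\<le>n. coeff (pderiv P) (l - n) * car_form L l (g i) (h (n - i))))
     = (\<Sum>l<L. \<integral>z. of_real (w z) * (E l z * (X1 l z + X2 l z)) \<partial>disc_measure)"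
  proof (intro sum.cong refl)
    fix l assume "l \<in> {..<L}"
    then have l: "l < L" by simp
    show "of_real (hankel_weight l) * (\<Sum>n\<le>l. \<Sum>i\<le>n. coeff (pderiv P) (l - n) * car_form L l (g i) (h (n - i)))
       = (\<integral>z. of_real (w z) * (E l z * (X1 l z + X2 l z)) \<partial>disc_measure)"
    proof -
      have "(\<Sum>n\<le>l. \<Sum>i\<le>n. coeff (pderiv P) (l - n) * car_form L l (g i) (h (n - i)))
         = (\<integral>z. of_real (w z) * (coeff (pderiv P * bergman_poly L (cnj z)) l * (X1 l z + X2 l z)) \<partial>disc_measure)"
        unfolding w_def X1_def X2_def gp_def hp_def gq_def hq_def
        by (rule hankel_form_coefficient[OF l, symmetric]) (use g h in auto)
      then have "of_real (hankel_weight l) * (\<Sum>n\<le>l. \<Sum>i\<le>n. coeff (pderiv P) (l - n) * car_form L l (g i) (h (n - i)))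
         = (\<integral>z. of_real (hankel_weight l) * (of_real (w z) * (coeff (pderiv P * bergman_poly L (cnj z)) l * (X1 l z + X2 l z))) \<partial>disc_measure)"
        by (simp only: integral_mult_right_zero)
      also have "\<dots> = (\<integral>z. of_real (w z) * (E l z * (X1 l z + X2 l z)) \<partial>disc_measure)"
        unfolding E_def by (intro Bochner_Integration.integral_cong refl) (simp only: mult_ac)
      finally show ?thesis .
    qed
  qed
  also have "\<dots> = (\<integral>z. (\<Sum>l<L. of_real (w z) * (E l z * (X1 l z + X2 l z))) \<partial>disc_measure)"
    by (rule Bochner_Integration.integral_sum[symmetric]) (rule intEX)
  finally have "cmod (\<Sum>l<L. of_real (hankel_weight l) * (\<Sum>n\<le>l. \<Sum>i\<le>n. coeff (pderiv P) (l - n) * car_form L l (g i) (h (n - i))))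
     \<le> (\<integral>z. cmod (\<Sum>l<L. of_real (w z) * (E l z * (X1 l z + X2 l z))) \<partial>disc_measure)"
    by simp
  also have "\<dots> \<le> (\<integral>z. s / 2 * (w z * (e z * N hp z)) + 1 / (2 * s) * (w z * N gq z)
        + (t / 2 * (w z * (e z * N gp z)) + 1 / (2 * t) * (w z * N hq z)) \<partial>disc_measure)"
  proof (rule integral_mono)
    fix z assume "z \<in> space disc_measure"
    then have w0: "0 \<le> w z" by (simp add: w_def power_le_one)
    have 1: "cmod (\<Sum>l<L. E l z * X1 l z) \<le> (s * (e z * N hp z) + N gq z / s) / 2"
    proof (rule amgm_square_bound)
      have "(cmod (\<Sum>l<L. E l z * X1 l z))\<^sup>2 \<le> e z * (\<Sum>l<L. (cmod (X1 l z))\<^sup>2)"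
        unfolding e_def by (rule sum_mult_square_le)
      also have "\<dots> \<le> e z * (N gq z * N hp z)"
        unfolding X1_def N_def by (intro mult_left_mono car_form_bound e0)
      finally show "(cmod (\<Sum>l<L. E l z * X1 l z))\<^sup>2 \<le> (e z * N hp z) * N gq z"
        by (simp add: mult_ac)
    qed (use st N0 e0 in auto)
    have 2: "cmod (\<Sum>l<L. E l z * X2 l z) \<le> (t * (e z * N gp z) + N hq z / t) / 2"
    proof (rule amgm_square_bound)
      have "(cmod (\<Sum>l<L. E l z * X2 l z))\<^sup>2 \<le> e z * (\<Sum>l<L. (cmod (X2 l z))\<^sup>2)"
        unfolding e_def by (rule sum_mult_square_le)
      also have "\<dots> \<le> e z * (N gp z * N hq z)"
        unfolding X2_def N_def by (intro mult_left_mono car_form_bound e0)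
      finally show "(cmod (\<Sum>l<L. E l z * X2 l z))\<^sup>2 \<le> (e z * N gp z) * N hq z"
        by (simp add: mult_ac)
    qed (use st N0 e0 in auto)
    have "cmod (\<Sum>l<L. of_real (w z) * (E l z * (X1 l z + X2 l z)))
       = w z * cmod ((\<Sum>l<L. E l z * X1 l z) + (\<Sum>l<L. E l z * X2 l z))"
    proof -
      have "(\<Sum>l<L. of_real (w z) * (E l z * (X1 l z + X2 l z)))
         = of_real (w z) * ((\<Sum>l<L. E l z * X1 l z) + (\<Sum>l<L. E l z * X2 l z))"
        by (simp only: sum_distrib_left distrib_left sum.distrib)
      then show ?thesis using w0 by (simp add: norm_mult)
    qed
    also have "\<dots> \<le> w z * ((s * (e z * N hp z) + N gq z / s) / 2 + (t * (e z * N gp z) + N hq z / t) / 2)"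
      by (intro mult_left_mono w0 order_trans[OF norm_triangle_ineq] add_mono 1 2)
    finally show "cmod (\<Sum>l<L. of_real (w z) * (E l z * (X1 l z + X2 l z)))
       \<le> s / 2 * (w z * (e z * N hp z)) + 1 / (2 * s) * (w z * N gq z)
        + (t / 2 * (w z * (e z * N gp z)) + 1 / (2 * t) * (w z * N hq z))"
      by (simp add: algebra_simps add_divide_distrib)
  qed (use intEX st in \<open>auto intro!: disc_continuous_integrable continuous_intros cw ce cN\<close>)
  also have "\<dots> = s / 2 * (\<integral>z. w z * (e z * N hp z) \<partial>disc_measure) + 1 / (2 * s) * (\<integral>z. w z * N gq z \<partial>disc_measure)
        + (t / 2 * (\<integral>z. w z * (e z * N gp z) \<partial>disc_measure) + 1 / (2 * t) * (\<integral>z. w z * N hq z \<partial>disc_measure))"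
  proof -
    have i1: "integrable disc_measure (\<lambda>z. w z * (e z * N f z))" and i2: "integrable disc_measure (\<lambda>z. w z * N f z)" for f
      by (intro disc_continuous_integrable continuous_intros cw ce cN)+
    show ?thesis
      by (simp only: Bochner_Integration.integral_add Bochner_Integration.integrable_add integrable_mult_right i1 i2 integral_mult_right_zero)
  qed
  also have "\<dots> \<le> s / 2 * (36 * M\<^sup>2 * H) + 1 / (2 * s) * G + (t / 2 * (36 * M\<^sup>2 * G) + 1 / (2 * t) * H)"
  proof -
    have car: "(\<integral>z. w z * (e z * N (\<lambda>A. seq_poly d (\<lambda>i. f i A)) z) \<partial>disc_measure) \<le> 36 * M\<^sup>2 * (\<Sum>i<d. \<Sum>A\<in>?U. (cmod (f i A))\<^sup>2)" for f
    proof -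
      have "(\<integral>z. w z * (e z * N (\<lambda>A. seq_poly d (\<lambda>i. f i A)) z) \<partial>disc_measure)
         = (\<integral>z. (\<Sum>A\<in>?U. w z * (e z * (cmod (poly (seq_poly d (\<lambda>i. f i A)) z))\<^sup>2)) \<partial>disc_measure)"
        unfolding N_def sum_distrib_left ..
      also have "\<dots> = (\<Sum>A\<in>?U. \<integral>z. w z * (e z * (cmod (poly (seq_poly d (\<lambda>i. f i A)) z))\<^sup>2) \<partial>disc_measure)"
        by (intro Bochner_Integration.integral_sum disc_continuous_integrable continuous_intros cw ce)
      also have "\<dots> \<le> (\<Sum>A\<in>?U. 32 * M\<^sup>2 * sqnorm_coeffs (seq_poly d (\<lambda>i. f i A)))"
      proof (rule sum_mono)
        fix A
        have "e z = (\<Sum>l<L. (cmod (coeff (pderiv P * bergman_poly L (cnj z)) l))\<^sup>2 * (2 / ((real l + 1) * (real l + 2) * (real l + 3))))" for z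
          unfolding e_def E_def norm_mult power_mult_distrib hankel_weight_sq[symmetric] by (simp add: mult.commute)
        then show "(\<integral>z. w z * (e z * (cmod (poly (seq_poly d (\<lambda>i. f i A)) z))\<^sup>2) \<partial>disc_measure) \<le> 32 * M\<^sup>2 * sqnorm_coeffs (seq_poly d (\<lambda>i. f i A))"
          using disc_hankel_bound[OF M, where N=L and h="seq_poly d (\<lambda>i. f i A)"] by (simp only: w_def)
      qed
      also have "\<dots> = 32 * M\<^sup>2 * (\<Sum>i<d. \<Sum>A\<in>?U. (cmod (f i A))\<^sup>2)"
        unfolding sqnorm_coeffs_seq_poly sum_distrib_left[symmetric] by (subst sum.swap) (rule refl)
      \<comment> \<open>Rounding \<open>32\<close> up to a square keeps roots out of
        \<open>s\<close> and \<open>t\<close>.\<close>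
      also have "\<dots> \<le> 36 * M\<^sup>2 * (\<Sum>i<d. \<Sum>A\<in>?U. (cmod (f i A))\<^sup>2)"
        by (intro mult_right_mono sum_nonneg) auto
      finally show ?thesis .
    qed
    have der: "(\<integral>z. w z * N (\<lambda>A. seq_poly d (\<lambda>i. of_nat (i + 1) * f i A)) z \<partial>disc_measure) \<le> (\<Sum>i<d. \<Sum>A\<in>?U. (cmod (f i A))\<^sup>2)" for f
    proof -
      have "(\<integral>z. w z * N (\<lambda>A. seq_poly d (\<lambda>i. of_nat (i + 1) * f i A)) z \<partial>disc_measure)
         = (\<integral>z. (\<Sum>A\<in>?U. w z * (cmod (poly (seq_poly d (\<lambda>i. of_nat (i + 1) * f i A)) z))\<^sup>2) \<partial>disc_measure)"
        unfolding N_def sum_distrib_left ..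
      also have "\<dots> = (\<Sum>A\<in>?U. \<integral>z. w z * (cmod (poly (seq_poly d (\<lambda>i. of_nat (i + 1) * f i A)) z))\<^sup>2 \<partial>disc_measure)"
        by (intro Bochner_Integration.integral_sum disc_continuous_integrable continuous_intros cw)
      also have "\<dots> \<le> (\<Sum>A\<in>?U. \<Sum>i<d. (cmod (f i A))\<^sup>2)"
        unfolding w_def by (intro sum_mono disc_seq_poly_deriv_norm)
      also have "\<dots> = (\<Sum>i<d. \<Sum>A\<in>?U. (cmod (f i A))\<^sup>2)"
        by (rule sum.swap)
      finally show ?thesis .
    qed
    show ?thesis
      unfolding G_def H_def gp_def[abs_def] hp_def[abs_def] gq_def[abs_def] hq_def[abs_def]
      using st by (intro add_mono mult_left_mono car der) auto
  qed
  also have "\<dots> = 12 * M * sqrt G * sqrt H"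
  proof -
    define a b where "a = sqrt G" and "b = sqrt H"
    have ab: "a > 0" "b > 0" "G = a * a" "H = b * b" using GH by (auto simp: a_def b_def)
    show ?thesis
      unfolding s_def t_def a_def[symmetric] b_def[symmetric] ab(3,4)
      using ab(1,2) \<open>M > 0\<close> by (simp add: field_simps power2_eq_square)
  qed
  finally show ?thesis .
qed

text \<open>Removes the positivity assumptions: if \<open>G\<close> or \<open>H\<close> is zero, the
  family vanishes on all relevant sets and so does the form; otherwise \<open>M\<close> is enlarged
  by a small amount, chosen to cost exactly \<open>e\<close>.\<close>

lemma hankel_form_bound:
  fixes g h :: "nat \<Rightarrow> nat set \<Rightarrow> complex" and L d :: nat
  assumes M: "\<And>z. cmod z = 1 \<Longrightarrow> cmod (poly P z) \<le> M"
    and g: "\<And>i A. i \<ge> d \<Longrightarrow> g i A = 0" and h: "\<And>i A. i \<ge> d \<Longrightarrow> h i A = 0"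
  defines "G \<equiv> (\<Sum>i<d. \<Sum>A\<in>Pow {..<L}. (cmod (g i A))\<^sup>2)" and "H \<equiv> (\<Sum>i<d. \<Sum>A\<in>Pow {..<L}. (cmod (h i A))\<^sup>2)"
  shows "cmod (\<Sum>l<L. of_real (hankel_weight l) * (\<Sum>n\<le>l. \<Sum>i\<le>n. coeff (pderiv P) (l - n) * car_form L l (g i) (h (n - i))))
     \<le> 12 * M * sqrt G * sqrt H"
proof -
  have GH0: "0 \<le> G" "0 \<le> H" by (simp_all add: G_def H_def sum_nonneg)
  have zero: "f i A = 0" if f: "\<And>i A. i \<ge> d \<Longrightarrow> f i A = 0" and "(\<Sum>i<d. \<Sum>A\<in>Pow {..<L}. (cmod (f i A))\<^sup>2) = 0" "A \<in> Pow {..<L}"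
    for f :: "nat \<Rightarrow> nat set \<Rightarrow> complex" and i A
  proof (cases "i < d")
    case True
    have "\<forall>i\<in>{..<d}. (\<Sum>A\<in>Pow {..<L}. (cmod (f i A))\<^sup>2) = 0"
      using that(2) by (subst (asm) sum_nonneg_eq_0_iff) (auto intro: sum_nonneg)
    then have "(\<Sum>A\<in>Pow {..<L}. (cmod (f i A))\<^sup>2) = 0" using True by simp
    then have "\<forall>A\<in>Pow {..<L}. (cmod (f i A))\<^sup>2 = 0"
      by (subst (asm) sum_nonneg_eq_0_iff) auto
    then show ?thesis using that(3) by auto
  qed (use f in auto)
  have cz: "car_form L l (g i) (h j) = 0" if "G = 0 \<or> H = 0" for l i j
    using that
  proof
    assume "G = 0"
    then have "g i A = 0" if "A \<in> Pow {..<L}" for A using zero[of g A i] g that by (simp add: G_def)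
    then show ?thesis by (simp add: car_form_def)
  next
    assume "H = 0"
    then have "h j A = 0" if "A \<in> Pow {..<L}" for A using zero[of h A j] h that by (simp add: H_def)
    then show ?thesis by (simp add: car_form_def)
  qed
  have M0: "0 \<le> M" using order_trans[OF norm_ge_zero M[of 1]] by simp
  show ?thesis
  proof (cases "G = 0 \<or> H = 0")
    case True
    then show ?thesis using cz M0 GH0 by simp
  next
    case False
    then have GH: "G > 0" "H > 0" using GH0 by auto
    show ?thesis
    proof (rule field_le_epsilon)
      fix e :: real assume e: "e > 0"
      define \<epsilon> where "\<epsilon> = e / (12 * sqrt G * sqrt H)"
      have \<epsilon>: "\<epsilon> > 0" using e GH by (simp add: \<epsilon>_def)
      have "cmod (\<Sum>l<L. of_real (hankel_weight l) * (\<Sum>n\<le>l. \<Sum>i\<le>n. coeff (pderiv P) (l - n) * car_form L l (g i) (h (n - i))))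
         \<le> 12 * (M + \<epsilon>) * sqrt G * sqrt H"
        unfolding G_def H_def
      proof (rule hankel_form_bound_aux)
        show "cmod (poly P z) \<le> M + \<epsilon>" if "cmod z = 1" for z
          using M[OF that] \<epsilon> by simp
      qed (use \<epsilon> M0 g h GH in \<open>auto simp: G_def H_def\<close>)
      also have "\<dots> = 12 * M * sqrt G * sqrt H + e"
        using GH by (simp add: \<epsilon>_def field_simps)
      finally show "cmod (\<Sum>l<L. of_real (hankel_weight l) * (\<Sum>n\<le>l. \<Sum>i\<le>n. coeff (pderiv P) (l - n) * car_form L l (g i) (h (n - i))))
         \<le> 12 * M * sqrt G * sqrt H + e" .
    qed
  qed
qed

subsection \<open>Bounded bilinear forms on square-summable families\<close>

type_synonym dseq = "nat \<times> nat \<Rightarrow> complex"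

definition nat_box :: "nat \<Rightarrow> (nat \<times> nat) set" where
  "nat_box N = {..<N} \<times> {..<N}"

definition sqnorm_on :: "(nat \<times> nat) set \<Rightarrow> dseq \<Rightarrow> real" where
  "sqnorm_on F g = (\<Sum>p\<in>F. (cmod (g p))\<^sup>2)"

definition form_on :: "(nat \<times> nat \<Rightarrow> nat \<times> nat \<Rightarrow> complex) \<Rightarrow> (nat \<times> nat) set \<Rightarrow> (nat \<times> nat) set \<Rightarrow> dseq \<Rightarrow> dseq \<Rightarrow> complex" where
  "form_on b F F' g h = (\<Sum>p\<in>F. \<Sum>q\<in>F'. b p q * g p * h q)"

text \<open>The bound is demanded on finite rectangles, so that it can be established before any
  infinite sum is known to converge.\<close>

definition bounded_form :: "(nat \<times> nat \<Rightarrow> nat \<times> nat \<Rightarrow> complex) \<Rightarrow> real \<Rightarrow> bool" where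
  "bounded_form b K \<longleftrightarrow> (\<forall>F F' g h. finite F \<longrightarrow> finite F' \<longrightarrow>
     cmod (form_on b F F' g h) \<le> K * sqrt (sqnorm_on F g) * sqrt (sqnorm_on F' h))"

text \<open>Here \<open>G\<close> bounds the squared norm; hence the roots of \<open>G\<close> in
  the estimates below.\<close>

definition l2_bound :: "dseq \<Rightarrow> real \<Rightarrow> bool" where
  "l2_bound g G \<longleftrightarrow> (\<forall>N. sqnorm_on (nat_box N) g \<le> G)"

lemma finite_box [simp]: "finite (nat_box N)"
  by (simp add: nat_box_def)

lemma nat_box_mono: "M \<le> N \<Longrightarrow> nat_box M \<subseteq> nat_box N"
  by (auto simp: nat_box_def)

lemma finite_subset_box:
  assumes "finite F"
  obtains N where "F \<subseteq> nat_box N"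
proof -
  have "F \<subseteq> nat_box (Suc (Max (fst ` F \<union> snd ` F)))"
  proof
    fix p assume "p \<in> F"
    then have "fst p \<le> Max (fst ` F \<union> snd ` F)" "snd p \<le> Max (fst ` F \<union> snd ` F)"
      using assms by (auto intro!: Max_ge)
    then show "p \<in> nat_box (Suc (Max (fst ` F \<union> snd ` F)))"
      by (cases p) (auto simp: nat_box_def)
  qed
  then show ?thesis by (rule that)
qed

lemma sqnorm_on_nonneg: "0 \<le> sqnorm_on F g"
  by (simp add: sqnorm_on_def sum_nonneg)

lemma sqnorm_on_mono: "finite F' \<Longrightarrow> F \<subseteq> F' \<Longrightarrow> sqnorm_on F g \<le> sqnorm_on F' g"
  unfolding sqnorm_on_def by (rule sum_mono2) auto

lemma l2_bound_finite: "l2_bound g G \<Longrightarrow> finite F \<Longrightarrow> sqnorm_on F g \<le> G"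
  by (metis finite_subset_box sqnorm_on_mono finite_box l2_bound_def order_trans)

lemma l2_bound_nonneg: "l2_bound g G \<Longrightarrow> 0 \<le> G"
  by (meson l2_bound_def order_trans sqnorm_on_nonneg)

lemma bounded_form_nonneg:
  assumes "bounded_form b K" shows "0 \<le> K"
proof -
  have "cmod (form_on b {(0,0)} {(0,0)} (\<lambda>_. 1) (\<lambda>_. 1)) \<le> K * sqrt (sqnorm_on {(0,0)} (\<lambda>_. 1)) * sqrt (sqnorm_on {(0,0)} (\<lambda>_. 1))"
    using assms unfolding bounded_form_def by blast
  then have "cmod (form_on b {(0,0)} {(0,0)} (\<lambda>_. 1) (\<lambda>_. 1)) \<le> K"
    by (simp add: sqnorm_on_def)
  then show ?thesis
    using norm_ge_zero order_trans by blast
qed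

text \<open>A box whose partial sum is within \<open>e\<close> of the supremum leaves less than
  \<open>e\<close> for everything disjoint from it.\<close>

lemma l2_tail_small:
  assumes g: "l2_bound g G" and e: "0 < e"
  obtains N where "\<And>F. finite F \<Longrightarrow> F \<inter> nat_box N = {} \<Longrightarrow> sqnorm_on F g < e"
proof -
  define S where "S = (SUP N. sqnorm_on (nat_box N) g)"
  have bdd: "bdd_above (range (\<lambda>N. sqnorm_on (nat_box N) g))"
    using g by (auto simp: l2_bound_def intro: bdd_aboveI[of _ G])
  obtain N where N: "S - e < sqnorm_on (nat_box N) g"
    using less_cSUP_iff[OF _ bdd, of "S - e"] e unfolding S_def by auto
  show ?thesis
  proof
    fix F assume F: "finite F" "F \<inter> nat_box N = {}"
    obtain N' where N': "F \<union> nat_box N \<subseteq> nat_box N'"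
      using finite_subset_box[of "F \<union> nat_box N"] F(1) by auto
    have "sqnorm_on F g + sqnorm_on (nat_box N) g = sqnorm_on (F \<union> nat_box N) g"
      unfolding sqnorm_on_def using F by (subst sum.union_disjoint) auto
    also have "\<dots> \<le> sqnorm_on (nat_box N') g"
      by (rule sqnorm_on_mono) (use N' in auto)
    also have "\<dots> \<le> S"
      unfolding S_def by (rule cSUP_upper[OF _ bdd]) simp
    finally show "sqnorm_on F g < e" using N by simp
  qed
qed

text \<open>Enlarging the rectangle changes the form by two forms in which one argument lives off
  the box and is therefore small.\<close>

lemma form_near:
  assumes b: "bounded_form b K" and g: "l2_bound g G" and h: "l2_bound h H" and e: "0 < e"
  obtains N where "\<And>F F'. finite F \<Longrightarrow> finite F' \<Longrightarrow> nat_box N \<subseteq> F \<Longrightarrow> nat_box N \<subseteq> F'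
      \<Longrightarrow> cmod (form_on b F F' g h - form_on b (nat_box N) (nat_box N) g h) \<le> e"
proof -
  have K: "0 \<le> K" by (rule bounded_form_nonneg[OF b])
  \<comment> \<open>With both tails at most \<open>e / c\<close> the total error is
    \<open>e (c - 1) / c\<close>; the summand \<open>1\<close> keeps \<open>c\<close>
    positive.\<close>
  define c where "c = K * (sqrt G + sqrt H) + 1"
  have c: "c > 0" using K l2_bound_nonneg[OF g] l2_bound_nonneg[OF h] by (simp add: c_def add_nonneg_pos)
  have e': "(e / c)\<^sup>2 > 0" using e c by simp
  obtain N1 where N1: "\<And>F. finite F \<Longrightarrow> F \<inter> nat_box N1 = {} \<Longrightarrow> sqnorm_on F g < (e / c)\<^sup>2"
    using l2_tail_small[OF g e'] by blast
  obtain N2 where N2: "\<And>F. finite F \<Longrightarrow> F \<inter> nat_box N2 = {} \<Longrightarrow> sqnorm_on F h < (e / c)\<^sup>2"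
    using l2_tail_small[OF h e'] by blast
  define N where "N = max N1 N2"
  show ?thesis
  proof
    fix F F' assume F: "finite F" "finite F'" "nat_box N \<subseteq> F" "nat_box N \<subseteq> F'"
    have dg: "sqrt (sqnorm_on (F - nat_box N) g) \<le> e / c"
      using N1[of "F - nat_box N"] F nat_box_mono[of N1 N] e c by (intro real_le_lsqrt less_imp_le) (auto simp: N_def)
    have dh: "sqrt (sqnorm_on (F' - nat_box N) h) \<le> e / c"
      using N2[of "F' - nat_box N"] F nat_box_mono[of N2 N] e c by (intro real_le_lsqrt less_imp_le) (auto simp: N_def)
    have split: "form_on b F F' g h - form_on b (nat_box N) (nat_box N) g h = form_on b (F - nat_box N) F' g h + form_on b (nat_box N) (F' - nat_box N) g h"
    proof -
      have "form_on b F F' g h = form_on b (F - nat_box N) F' g h + form_on b (nat_box N) F' g h"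
        unfolding form_on_def by (rule sum.subset_diff[OF F(3) F(1)])
      moreover have "form_on b (nat_box N) F' g h = form_on b (nat_box N) (F' - nat_box N) g h + form_on b (nat_box N) (nat_box N) g h"
        unfolding form_on_def sum.distrib[symmetric] by (intro sum.cong refl sum.subset_diff[OF F(4) F(2)])
      ultimately show ?thesis by simp
    qed
    have "cmod (form_on b F F' g h - form_on b (nat_box N) (nat_box N) g h)
       \<le> K * sqrt (sqnorm_on (F - nat_box N) g) * sqrt (sqnorm_on F' h) + K * sqrt (sqnorm_on (nat_box N) g) * sqrt (sqnorm_on (F' - nat_box N) h)"
      unfolding split using b F by (intro order_trans[OF norm_triangle_ineq] add_mono) (auto simp: bounded_form_def)
    also have "\<dots> \<le> K * (e / c) * sqrt H + K * sqrt G * (e / c)"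
      using K e c F l2_bound_nonneg[OF g]
      by (intro add_mono mult_mono dg dh real_sqrt_le_mono l2_bound_finite[OF g] l2_bound_finite[OF h] order_refl)
         (auto simp: sqnorm_on_nonneg)
    also have "\<dots> = e * ((c - 1) / c)"
      by (simp add: c_def algebra_simps add_divide_distrib)
    also have "\<dots> \<le> e * 1"
      using e c by (intro mult_left_mono) auto
    finally show "cmod (form_on b F F' g h - form_on b (nat_box N) (nat_box N) g h) \<le> e" by simp
  qed
qed

definition exhausting :: "(nat \<Rightarrow> (nat \<times> nat) set) \<Rightarrow> bool" where
  "exhausting F \<longleftrightarrow> (\<forall>n. finite (F n)) \<and> (\<forall>N. \<forall>\<^sub>F n in sequentially. nat_box N \<subseteq> F n)"

definition form_lim :: "(nat \<times> nat \<Rightarrow> nat \<times> nat \<Rightarrow> complex) \<Rightarrow> dseq \<Rightarrow> dseq \<Rightarrow> complex" where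
  "form_lim b g h = lim (\<lambda>N. form_on b (nat_box N) (nat_box N) g h)"

lemma exhausting_box: "exhausting nat_box"
  unfolding exhausting_def by (auto intro!: eventually_sequentiallyI nat_box_mono)

text \<open>The two arguments may be exhausted along different sets, because shifting one of them
  turns its boxes into rectangles of another shape.\<close>

lemma form_lim_tendsto:
  assumes b: "bounded_form b K" and g: "l2_bound g G" and h: "l2_bound h H" and F: "exhausting F" "exhausting F'"
  shows "(\<lambda>n. form_on b (F n) (F' n) g h) \<longlonglongrightarrow> form_lim b g h"
proof -
  have near: "\<exists>N. \<forall>\<^sub>F n in sequentially. cmod (form_on b (F n) (F' n) g h - form_on b (nat_box N) (nat_box N) g h) \<le> e"
    if "exhausting F" "exhausting F'" "e > 0" for F F' e
  proof -
    obtain N where N: "\<And>F F'. finite F \<Longrightarrow> finite F' \<Longrightarrow> nat_box N \<subseteq> F \<Longrightarrow> nat_box N \<subseteq> F'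
      \<Longrightarrow> cmod (form_on b F F' g h - form_on b (nat_box N) (nat_box N) g h) \<le> e"
      using form_near[OF b g h \<open>e > 0\<close>] by metis
    have "\<forall>\<^sub>F n in sequentially. nat_box N \<subseteq> F n" "\<forall>\<^sub>F n in sequentially. nat_box N \<subseteq> F' n"
      using that by (auto simp: exhausting_def)
    then have "\<forall>\<^sub>F n in sequentially. cmod (form_on b (F n) (F' n) g h - form_on b (nat_box N) (nat_box N) g h) \<le> e"
      by eventually_elim (use N that in \<open>auto simp: exhausting_def\<close>)
    then show ?thesis ..
  qed
  have "Cauchy (\<lambda>N. form_on b (nat_box N) (nat_box N) g h)"
  proof (rule metric_CauchyI)
    fix e :: real assume e: "e > 0"
    obtain N where N: "\<And>F F'. finite F \<Longrightarrow> finite F' \<Longrightarrow> nat_box N \<subseteq> F \<Longrightarrow> nat_box N \<subseteq> F'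
      \<Longrightarrow> cmod (form_on b F F' g h - form_on b (nat_box N) (nat_box N) g h) \<le> e / 3"
      using form_near[OF b g h, of "e/3"] e by (metis divide_pos_pos zero_less_numeral)
    have "dist (form_on b (nat_box m) (nat_box m) g h) (form_on b (nat_box n) (nat_box n) g h) < e" if "m \<ge> N" "n \<ge> N" for m n
      using N[of "nat_box m" "nat_box m"] N[of "nat_box n" "nat_box n"] nat_box_mono[of N m] nat_box_mono[of N n] that e
        norm_triangle_ineq4[of "form_on b (nat_box m) (nat_box m) g h - form_on b (nat_box N) (nat_box N) g h" "form_on b (nat_box n) (nat_box n) g h - form_on b (nat_box N) (nat_box N) g h"]
      by (auto simp: dist_norm)
    then show "\<exists>M. \<forall>m\<ge>M. \<forall>n\<ge>M. dist (form_on b (nat_box m) (nat_box m) g h) (form_on b (nat_box n) (nat_box n) g h) < e" by blast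
  qed
  then have L: "(\<lambda>N. form_on b (nat_box N) (nat_box N) g h) \<longlonglongrightarrow> form_lim b g h"
    unfolding form_lim_def using Cauchy_convergent convergent_LIMSEQ_iff by blast
  have "(\<lambda>n. form_on b (F n) (F' n) g h - form_on b (nat_box n) (nat_box n) g h) \<longlonglongrightarrow> 0"
  proof (rule tendstoI)
    fix e :: real assume e: "e > 0"
    obtain N where N: "\<And>F F'. finite F \<Longrightarrow> finite F' \<Longrightarrow> nat_box N \<subseteq> F \<Longrightarrow> nat_box N \<subseteq> F'
      \<Longrightarrow> cmod (form_on b F F' g h - form_on b (nat_box N) (nat_box N) g h) \<le> e / 3"
      using form_near[OF b g h, of "e/3"] e by (metis divide_pos_pos zero_less_numeral)
    have "\<forall>\<^sub>F n in sequentially. nat_box N \<subseteq> F n" "\<forall>\<^sub>F n in sequentially. nat_box N \<subseteq> F' n" "\<forall>\<^sub>F n in sequentially. nat_box N \<subseteq> nat_box n"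
      using F exhausting_box by (auto simp: exhausting_def)
    then show "\<forall>\<^sub>F n in sequentially. dist (form_on b (F n) (F' n) g h - form_on b (nat_box n) (nat_box n) g h) 0 < e"
    proof eventually_elim
      case (elim n)
      then show ?case
        using N[of "F n" "F' n"] N[of "nat_box n" "nat_box n"] F e
          norm_triangle_ineq4[of "form_on b (F n) (F' n) g h - form_on b (nat_box N) (nat_box N) g h" "form_on b (nat_box n) (nat_box n) g h - form_on b (nat_box N) (nat_box N) g h"]
        by (auto simp: dist_norm exhausting_def)
    qed
  qed
  from tendsto_add[OF this L] show ?thesis by simp
qed

lemmas form_lim_box = form_lim_tendsto[OF _ _ _ exhausting_box exhausting_box]

lemma form_lim_bound:
  assumes b: "bounded_form b K" and g: "l2_bound g G" and h: "l2_bound h H"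
  shows "cmod (form_lim b g h) \<le> K * sqrt G * sqrt H"
proof (rule LIMSEQ_le_const2[OF tendsto_norm[OF form_lim_box[OF b g h]]])
  have K: "0 \<le> K" by (rule bounded_form_nonneg[OF b])
  have "cmod (form_on b (nat_box n) (nat_box n) g h) \<le> K * sqrt G * sqrt H" for n
  proof -
    have "cmod (form_on b (nat_box n) (nat_box n) g h) \<le> K * sqrt (sqnorm_on (nat_box n) g) * sqrt (sqnorm_on (nat_box n) h)"
      using b by (auto simp: bounded_form_def)
    also have "\<dots> \<le> K * sqrt G * sqrt H"
      using K l2_bound_nonneg[OF g]
      by (intro mult_mono real_sqrt_le_mono l2_bound_finite[OF g] l2_bound_finite[OF h]) (auto simp: sqnorm_on_nonneg)
    finally show ?thesis .
  qed
  then show "\<exists>N. \<forall>n\<ge>N. cmod (form_on b (nat_box n) (nat_box n) g h) \<le> K * sqrt G * sqrt H" by blast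
qed

lemma l2_bound_add:
  assumes "l2_bound g G" "l2_bound h H"
  shows "l2_bound (\<lambda>p. g p + h p) (2 * G + 2 * H)"
  unfolding l2_bound_def
proof
  fix N
  have "sqnorm_on (nat_box N) (\<lambda>p. g p + h p) \<le> 2 * sqnorm_on (nat_box N) g + 2 * sqnorm_on (nat_box N) h"
    unfolding sqnorm_on_def sum_distrib_left sum.distrib[symmetric] by (intro sum_mono cmod_add_square_le)
  also have "\<dots> \<le> 2 * G + 2 * H"
    using assms by (simp add: l2_bound_def add_mono)
  finally show "sqnorm_on (nat_box N) (\<lambda>p. g p + h p) \<le> 2 * G + 2 * H" .
qed

lemma l2_bound_scale:
  assumes "l2_bound g G"
  shows "l2_bound (\<lambda>p. a * g p) ((cmod a)\<^sup>2 * G)"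
  using assms unfolding l2_bound_def sqnorm_on_def norm_mult power_mult_distrib sum_distrib_left[symmetric]
  by (auto intro: mult_left_mono)

lemma form_lim_add_left:
  assumes "bounded_form b K" "l2_bound g G" "l2_bound g' G'" "l2_bound h H"
  shows "form_lim b (\<lambda>p. g p + g' p) h = form_lim b g h + form_lim b g' h"
proof (rule LIMSEQ_unique)
  show "(\<lambda>N. form_on b (nat_box N) (nat_box N) (\<lambda>p. g p + g' p) h) \<longlonglongrightarrow> form_lim b (\<lambda>p. g p + g' p) h"
    by (rule form_lim_box[OF assms(1) l2_bound_add[OF assms(2,3)] assms(4)])
  show "(\<lambda>N. form_on b (nat_box N) (nat_box N) (\<lambda>p. g p + g' p) h) \<longlonglongrightarrow> form_lim b g h + form_lim b g' h"
    using tendsto_add[OF form_lim_box[OF assms(1,2,4)] form_lim_box[OF assms(1,3,4)]]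
    by (simp add: form_on_def sum.distrib[symmetric] algebra_simps)
qed

lemma form_lim_add_right:
  assumes "bounded_form b K" "l2_bound g G" "l2_bound h H" "l2_bound h' H'"
  shows "form_lim b g (\<lambda>p. h p + h' p) = form_lim b g h + form_lim b g h'"
proof (rule LIMSEQ_unique)
  show "(\<lambda>N. form_on b (nat_box N) (nat_box N) g (\<lambda>p. h p + h' p)) \<longlonglongrightarrow> form_lim b g (\<lambda>p. h p + h' p)"
    by (rule form_lim_box[OF assms(1,2) l2_bound_add[OF assms(3,4)]])
  show "(\<lambda>N. form_on b (nat_box N) (nat_box N) g (\<lambda>p. h p + h' p)) \<longlonglongrightarrow> form_lim b g h + form_lim b g h'"
    using tendsto_add[OF form_lim_box[OF assms(1,2,3)] form_lim_box[OF assms(1,2,4)]]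
    by (simp add: form_on_def sum.distrib[symmetric] algebra_simps)
qed

lemma form_lim_scale_left:
  assumes "bounded_form b K" "l2_bound g G" "l2_bound h H"
  shows "form_lim b (\<lambda>p. a * g p) h = a * form_lim b g h"
proof (rule LIMSEQ_unique)
  show "(\<lambda>N. form_on b (nat_box N) (nat_box N) (\<lambda>p. a * g p) h) \<longlonglongrightarrow> form_lim b (\<lambda>p. a * g p) h"
    by (rule form_lim_box[OF assms(1) l2_bound_scale[OF assms(2)] assms(3)])
  show "(\<lambda>N. form_on b (nat_box N) (nat_box N) (\<lambda>p. a * g p) h) \<longlonglongrightarrow> a * form_lim b g h"
    using tendsto_mult_left[OF form_lim_box[OF assms], of a]
    by (simp add: form_on_def sum_distrib_left mult_ac)
qed

lemma form_lim_scale_right: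
  assumes "bounded_form b K" "l2_bound g G" "l2_bound h H"
  shows "form_lim b g (\<lambda>p. a * h p) = a * form_lim b g h"
proof (rule LIMSEQ_unique)
  show "(\<lambda>N. form_on b (nat_box N) (nat_box N) g (\<lambda>p. a * h p)) \<longlonglongrightarrow> form_lim b g (\<lambda>p. a * h p)"
    by (rule form_lim_box[OF assms(1,2) l2_bound_scale[OF assms(3)]])
  show "(\<lambda>N. form_on b (nat_box N) (nat_box N) g (\<lambda>p. a * h p)) \<longlonglongrightarrow> a * form_lim b g h"
    using tendsto_mult_left[OF form_lim_box[OF assms], of a]
    by (simp add: form_on_def sum_distrib_left mult_ac)
qed

text \<open>
  The index \<open>(i, n)\<close> stands for the \<open>i\<close>-th Fourier coefficient at the basis vector of the finite set coded by \<open>n\<close>.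
\<close>

definition hankel_matrix :: "nat \<Rightarrow> nat \<times> nat \<Rightarrow> nat \<times> nat \<Rightarrow> complex" where
  "hankel_matrix m p q = of_real (hankel_weight (m + fst p + fst q)) * car (m + fst p + fst q) (set_decode (snd q)) (set_decode (snd p))"

lemma set_decode_subset:
  assumes "n < 2 ^ L" shows "set_decode n \<subseteq> {..<L}"
proof
  fix x assume "x \<in> set_decode n"
  then have "odd (n div 2 ^ x)" by (simp add: set_decode_def)
  then have "n div 2 ^ x \<noteq> 0" by (metis even_zero)
  then have "2 ^ x \<le> n" by (metis div_less not_le)
  then have "(2::nat) ^ x < 2 ^ L" using assms by (rule le_less_trans)
  then have "x < L" by (rule power_less_imp_less_exp[rotated]) simp
  then show "x \<in> {..<L}" by simp
qed

lemma sum_Pow_set_encode: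
  fixes F :: "nat \<Rightarrow> 'a::comm_monoid_add"
  assumes "N \<le> 2 ^ L"
  shows "(\<Sum>A\<in>Pow {..<L}. if set_encode A < N then F (set_encode A) else 0) = (\<Sum>n<N. F n)"
proof -
  have "(\<Sum>A\<in>Pow {..<L}. if set_encode A < N then F (set_encode A) else 0)
      = (\<Sum>A\<in>{A \<in> Pow {..<L}. set_encode A < N}. F (set_encode A))"
    by (rule sum.inter_filter[symmetric]) simp
  also have "\<dots> = (\<Sum>n<N. F n)"
  proof (rule sum.reindex_bij_witness[where i=set_decode and j=set_encode])
    fix A assume "A \<in> {A \<in> Pow {..<L}. set_encode A < N}"
    then have "finite A" using finite_subset by auto
    then show "set_decode (set_encode A) = A" by simp
  qed (use assms set_decode_subset in \<open>auto intro: less_le_trans\<close>)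
  finally show ?thesis .
qed

text \<open>The substitution \<open>l = m + i + j\<close>, \<open>n = i + j\<close>; the bound on
  \<open>L\<close> ensures that no index triple of the support is lost.\<close>

lemma triple_sum_reindex:
  fixes t :: "nat \<Rightarrow> nat \<Rightarrow> nat \<Rightarrow> 'a::comm_monoid_add"
  assumes z: "\<And>m i j. \<not> (m \<le> e \<and> i < N \<and> j < N) \<Longrightarrow> t m i j = 0" and L: "e + 2 * N < L"
  shows "(\<Sum>l<L. \<Sum>n\<le>l. \<Sum>i\<le>n. t (l - n) i (n - i)) = (\<Sum>m\<le>e. \<Sum>i<N. \<Sum>j<N. t m i j)"
proof -
  have "(\<Sum>l<L. \<Sum>n\<le>l. \<Sum>i\<le>n. t (l - n) i (n - i))
     = (\<Sum>(l, n, i)\<in>(SIGMA l:{..<L}. SIGMA n:{..l}. {..n}). t (l - n) i (n - i))"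
    by (simp add: sum.Sigma)
  also have "\<dots> = (\<Sum>(m, i, j)\<in>{(m, i, j). m + i + j < L}. t m i j)"
    by (rule sum.reindex_bij_witness[where i="\<lambda>(m, i, j). (m + i + j, i + j, i)" and j="\<lambda>(l, n, i). (l - n, i, n - i)"]) auto
  also have "\<dots> = (\<Sum>(m, i, j)\<in>{..e} \<times> {..<N} \<times> {..<N}. t m i j)"
  proof (rule sum.mono_neutral_right)
    have "{(m, i, j). m + i + j < L} \<subseteq> {..<L} \<times> {..<L} \<times> {..<L}" by auto
    then show "finite {(m, i, j). m + i + j < L}" by (rule finite_subset) auto
    show "{..e} \<times> {..<N} \<times> {..<N} \<subseteq> {(m, i, j). m + i + j < L}" using L by auto
  qed (use z in auto)
  also have "\<dots> = (\<Sum>m\<le>e. \<Sum>i<N. \<Sum>j<N. t m i j)"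
    by (simp add: sum.cartesian_product)
  finally show ?thesis .
qed

text \<open>The estimate \<open>hankel_form_bound\<close>, transferred from families indexed by
  finite sets to families indexed by their codes. The families are extended by zero outside the
  box.\<close>

lemma hankel_matrix_box_bound:
  assumes M: "\<And>z. cmod z = 1 \<Longrightarrow> cmod (poly P z) \<le> M"
  shows "cmod (\<Sum>m\<le>degree (pderiv P). coeff (pderiv P) m * form_on (hankel_matrix m) (nat_box N) (nat_box N) g h)
     \<le> 12 * M * sqrt (sqnorm_on (nat_box N) g) * sqrt (sqnorm_on (nat_box N) h)"
proof -
  define e where "e = degree (pderiv P)"
  \<comment> \<open>\<open>L\<close> exceeds every \<open>m + i + j\<close> with
    \<open>m \<le> e\<close> and \<open>i, j < N\<close>, and \<open>2 ^ L\<close> is at least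
    \<open>N\<close>, so that all sets with codes below \<open>N\<close> are subsets of
    \<open>{..<L}\<close>.\<close>
  define L where "L = Suc (e + 2 * N)"
  have NL: "N \<le> 2 ^ L"
    by (rule order_trans[OF _ less_imp_le[OF less_exp]]) (simp add: L_def)
  define ext where "ext f i A = (if i < N then if set_encode A < N then f (i, set_encode A) else 0 else 0)" for f :: dseq and i A
  have ext0: "ext f i A = 0" if "i \<ge> N" for f i A using that by (simp add: ext_def)
  have norm: "(\<Sum>i<N. \<Sum>A\<in>Pow {..<L}. (cmod (ext f i A))\<^sup>2) = sqnorm_on (nat_box N) f" for f
  proof -
    have "(\<Sum>A\<in>Pow {..<L}. (cmod (ext f i A))\<^sup>2) = (\<Sum>n<N. (cmod (f (i, n)))\<^sup>2)" if "i < N" for i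
      unfolding sum_Pow_set_encode[OF NL, symmetric] using that by (intro sum.cong refl) (simp add: ext_def)
    then show ?thesis
      by (simp add: sqnorm_on_def nat_box_def sum.cartesian_product')
  qed
  have cf: "car_form L l (ext g i) (ext h j) = (\<Sum>b<N. \<Sum>a<N. car l (set_decode a) (set_decode b) * g (i, b) * h (j, a))"
    if "i < N" "j < N" for i j l
  proof -
    have dec: "set_decode (set_encode A) = A" if "A \<in> Pow {..<L}" for A
      using that finite_subset[of A "{..<L}"] by simp
    have "car_form L l (ext g i) (ext h j)
       = (\<Sum>B\<in>Pow {..<L}. \<Sum>A\<in>Pow {..<L}. car l A B * ext g i B * ext h j A)"
      unfolding car_form_def by (rule sum.swap)
    also have "\<dots> = (\<Sum>B\<in>Pow {..<L}. if set_encode B < N then (\<Sum>A\<in>Pow {..<L}. if set_encode A < N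
        then car l (set_decode (set_encode A)) (set_decode (set_encode B)) * g (i, set_encode B) * h (j, set_encode A) else 0) else 0)"
      using that by (intro sum.cong refl) (auto simp: ext_def dec intro!: sum.cong)
    also have "\<dots> = (\<Sum>b<N. \<Sum>a<N. car l (set_decode a) (set_decode b) * g (i, b) * h (j, a))"
      unfolding sum_Pow_set_encode[OF NL, where F="\<lambda>a. car l (set_decode a) (set_decode (set_encode B)) * g (i, set_encode B) * h (j, a)" for B]
        sum_Pow_set_encode[OF NL, where F="\<lambda>b. \<Sum>a<N. car l (set_decode a) (set_decode b) * g (i, b) * h (j, a)"] ..
    finally show ?thesis .
  qed
  define t where "t m i j = coeff (pderiv P) m * (of_real (hankel_weight (m + i + j)) * car_form L (m + i + j) (ext g i) (ext h j))" for m i j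
  have "(\<Sum>m\<le>e. coeff (pderiv P) m * form_on (hankel_matrix m) (nat_box N) (nat_box N) g h) = (\<Sum>m\<le>e. \<Sum>i<N. \<Sum>j<N. t m i j)"
  proof (intro sum.cong refl)
    fix m
    have "form_on (hankel_matrix m) (nat_box N) (nat_box N) g h
       = (\<Sum>i<N. \<Sum>b<N. \<Sum>j<N. \<Sum>a<N. hankel_matrix m (i, b) (j, a) * g (i, b) * h (j, a))"
      unfolding form_on_def nat_box_def by (simp add: sum.cartesian_product')
    also have "\<dots> = (\<Sum>i<N. \<Sum>j<N. \<Sum>b<N. \<Sum>a<N. hankel_matrix m (i, b) (j, a) * g (i, b) * h (j, a))"
      by (rule sum.cong[OF refl], rule sum.swap)
    also have "\<dots> = (\<Sum>i<N. \<Sum>j<N. of_real (hankel_weight (m + i + j)) * car_form L (m + i + j) (ext g i) (ext h j))"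
      by (intro sum.cong refl) (simp add: cf hankel_matrix_def sum_distrib_left mult_ac)
    finally show "coeff (pderiv P) m * form_on (hankel_matrix m) (nat_box N) (nat_box N) g h = (\<Sum>i<N. \<Sum>j<N. t m i j)"
      by (simp only: t_def sum_distrib_left)
  qed
  also have "\<dots> = (\<Sum>l<L. \<Sum>n\<le>l. \<Sum>i\<le>n. t (l - n) i (n - i))"
  proof (rule triple_sum_reindex[symmetric])
    fix m i j assume "\<not> (m \<le> e \<and> i < N \<and> j < N)"
    then consider "m > e" | "i \<ge> N" | "j \<ge> N" by linarith
    then show "t m i j = 0"
      by cases (simp_all add: t_def e_def coeff_eq_0 car_form_def ext0)
  qed (simp add: L_def)
  also have "\<dots> = (\<Sum>l<L. of_real (hankel_weight l) * (\<Sum>n\<le>l. \<Sum>i\<le>n. coeff (pderiv P) (l - n) * car_form L l (ext g i) (ext h (n - i))))"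
    unfolding sum_distrib_left by (intro sum.cong refl) (simp add: t_def mult_ac)
  finally have eq: "(\<Sum>m\<le>e. coeff (pderiv P) m * form_on (hankel_matrix m) (nat_box N) (nat_box N) g h) = \<dots>" .
  show ?thesis
    unfolding e_def[symmetric] eq unfolding norm[symmetric]
    by (rule hankel_form_bound) (use M ext0 in auto)
qed

text \<open>The case \<open>P = z^(m + 1) / (m + 1)\<close> of the polynomial estimate: its
  derivative is \<open>z^m\<close> and it is at most \<open>1\<close> on the circle. For
  \<open>m = 0\<close> this is the boundedness of the Hankel operator itself.\<close>

lemma bounded_form_hankel_matrix: "bounded_form (hankel_matrix m) 12"
  unfolding bounded_form_def
proof (intro allI impI)
  fix F F' :: "(nat \<times> nat) set" and g h :: dseq
  assume fin: "finite F" "finite F'"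
  obtain N where N: "F \<union> F' \<subseteq> nat_box N" using finite_subset_box[of "F \<union> F'"] fin by auto
  define P :: "complex poly" where "P = monom (1 / of_nat (Suc m)) (Suc m)"
  have dP: "pderiv P = monom 1 m"
    by (simp add: P_def pderiv_monom del: of_nat_Suc)
  have P1: "cmod (poly P z) \<le> 1" if "cmod z = 1" for z
    using that by (simp add: P_def poly_monom norm_mult norm_power norm_divide del: of_nat_Suc)
  \<comment> \<open>Extension by zero reduces arbitrary finite sets to one common box.\<close>
  define g' h' where "g' p = (if p \<in> F then g p else 0)" and "h' p = (if p \<in> F' then h p else 0)" for p
  have "(\<Sum>k\<le>degree (pderiv P). coeff (pderiv P) k * form_on (hankel_matrix k) (nat_box N) (nat_box N) g' h') = form_on (hankel_matrix m) (nat_box N) (nat_box N) g' h'"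
    by (simp add: dP degree_monom_eq coeff_monom if_distrib[of "\<lambda>x. x * _"] cong: if_cong)
  also have "\<dots> = form_on (hankel_matrix m) F F' g h"
  proof -
    have "form_on (hankel_matrix m) (nat_box N) (nat_box N) g' h' = (\<Sum>p\<in>F. \<Sum>q\<in>nat_box N. hankel_matrix m p q * g' p * h' q)"
      unfolding form_on_def using N by (intro sum.mono_neutral_right) (auto simp: g'_def)
    also have "\<dots> = (\<Sum>p\<in>F. \<Sum>q\<in>F'. hankel_matrix m p q * g' p * h' q)"
      using N by (intro sum.cong refl sum.mono_neutral_right) (auto simp: h'_def)
    also have "\<dots> = form_on (hankel_matrix m) F F' g h"
      unfolding form_on_def by (intro sum.cong refl) (simp add: g'_def h'_def)
    finally show ?thesis .
  qed
  finally have "cmod (form_on (hankel_matrix m) F F' g h) \<le> 12 * 1 * sqrt (sqnorm_on (nat_box N) g') * sqrt (sqnorm_on (nat_box N) h')"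
    using hankel_matrix_box_bound[of P 1 N g' h', OF P1] by simp
  moreover have "sqnorm_on (nat_box N) g' = sqnorm_on F g"
    unfolding sqnorm_on_def using N by (intro sum.mono_neutral_cong_right) (auto simp: g'_def)
  moreover have "sqnorm_on (nat_box N) h' = sqnorm_on F' h"
    unfolding sqnorm_on_def using N by (intro sum.mono_neutral_cong_right) (auto simp: h'_def)
  ultimately show "cmod (form_on (hankel_matrix m) F F' g h) \<le> 12 * sqrt (sqnorm_on F g) * sqrt (sqnorm_on F' h)"
    by simp
qed

text \<open>The effect of multiplication by \<open>z^m\<close> on Fourier coefficients.\<close>

definition shift_seq :: "nat \<Rightarrow> dseq \<Rightarrow> dseq" where
  "shift_seq m g p = (if fst p < m then 0 else g (fst p - m, snd p))"

lemma rect_exhausting: "exhausting (\<lambda>N. {..<N - m} \<times> {..<N})"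
proof -
  have "\<forall>\<^sub>F n in sequentially. nat_box N \<subseteq> {..<n - m} \<times> {..<n}" for N
    by (rule eventually_sequentiallyI[of "N + m"]) (auto simp: nat_box_def)
  then show ?thesis by (auto simp: exhausting_def)
qed

lemma sum_shift_rect:
  fixes f :: "nat \<times> nat \<Rightarrow> complex"
  shows "(\<Sum>p\<in>nat_box N. if fst p < m then 0 else f (fst p - m, snd p)) = (\<Sum>p\<in>{..<N - m} \<times> {..<N}. f p)"
proof -
  have "(\<Sum>p\<in>nat_box N. if fst p < m then 0 else f (fst p - m, snd p)) = (\<Sum>p\<in>{m..<N} \<times> {..<N}. f (fst p - m, snd p))"
    by (rule sum.mono_neutral_cong_right) (auto simp: nat_box_def)
  also have "\<dots> = (\<Sum>p\<in>{..<N - m} \<times> {..<N}. f p)"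
    by (rule sum.reindex_bij_witness[where i="\<lambda>p. (fst p + m, snd p)" and j="\<lambda>p. (fst p - m, snd p)"]) auto
  finally show ?thesis .
qed

text \<open>An entry depends on the Fourier indices only through \<open>m + i + j\<close>, so a
  shift of \<open>g\<close> is absorbed into \<open>m\<close>, at the price of a rectangle that is
  shorter by \<open>m\<close>. The same happens for \<open>h\<close>, and the agreement of both
  results is the Hankel identity.\<close>

lemma form_lim_shift_left:
  assumes "l2_bound g G" "l2_bound h H" "l2_bound (shift_seq m g) G'"
  shows "form_lim (hankel_matrix 0) (shift_seq m g) h = form_lim (hankel_matrix m) g h"
proof (rule LIMSEQ_unique)
  show "(\<lambda>N. form_on (hankel_matrix 0) (nat_box N) (nat_box N) (shift_seq m g) h) \<longlonglongrightarrow> form_lim (hankel_matrix 0) (shift_seq m g) h"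
    by (rule form_lim_box[OF bounded_form_hankel_matrix assms(3,2)])
  have "form_on (hankel_matrix 0) (nat_box N) (nat_box N) (shift_seq m g) h = form_on (hankel_matrix m) ({..<N - m} \<times> {..<N}) (nat_box N) g h" for N
    unfolding form_on_def sum_shift_rect[symmetric]
    by (intro sum.cong refl) (auto simp: shift_seq_def hankel_matrix_def intro!: sum.cong)
  then show "(\<lambda>N. form_on (hankel_matrix 0) (nat_box N) (nat_box N) (shift_seq m g) h) \<longlonglongrightarrow> form_lim (hankel_matrix m) g h"
    using form_lim_tendsto[OF bounded_form_hankel_matrix assms(1,2) rect_exhausting exhausting_box] by simp
qed

lemma form_lim_shift_right:
  assumes "l2_bound g G" "l2_bound h H" "l2_bound (shift_seq m h) H'"
  shows "form_lim (hankel_matrix 0) g (shift_seq m h) = form_lim (hankel_matrix m) g h"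
proof (rule LIMSEQ_unique)
  show "(\<lambda>N. form_on (hankel_matrix 0) (nat_box N) (nat_box N) g (shift_seq m h)) \<longlonglongrightarrow> form_lim (hankel_matrix 0) g (shift_seq m h)"
    by (rule form_lim_box[OF bounded_form_hankel_matrix assms(1,3)])
  have "form_on (hankel_matrix 0) (nat_box N) (nat_box N) g (shift_seq m h) = form_on (hankel_matrix m) (nat_box N) ({..<N - m} \<times> {..<N}) g h" for N
    unfolding form_on_def sum_shift_rect[symmetric]
    by (intro sum.cong refl) (auto simp: shift_seq_def hankel_matrix_def add_ac)
  then show "(\<lambda>N. form_on (hankel_matrix 0) (nat_box N) (nat_box N) g (shift_seq m h)) \<longlonglongrightarrow> form_lim (hankel_matrix m) g h"
    using form_lim_tendsto[OF bounded_form_hankel_matrix assms(1,2) exhausting_box rect_exhausting] by simp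
qed

text \<open>The box estimates in the limit; in terms of functions this is the bound for
  \<open>\<Gamma>(P' g, h)\<close>.\<close>

lemma hankel_polynomial_bound:
  assumes M: "\<And>z. cmod z = 1 \<Longrightarrow> cmod (poly P z) \<le> M" and g: "l2_bound g G" and h: "l2_bound h H"
  shows "cmod (\<Sum>m\<le>degree (pderiv P). coeff (pderiv P) m * form_lim (hankel_matrix m) g h) \<le> 12 * M * sqrt G * sqrt H"
proof (rule LIMSEQ_le_const2)
  show "(\<lambda>N. cmod (\<Sum>m\<le>degree (pderiv P). coeff (pderiv P) m * form_on (hankel_matrix m) (nat_box N) (nat_box N) g h))
     \<longlonglongrightarrow> cmod (\<Sum>m\<le>degree (pderiv P). coeff (pderiv P) m * form_lim (hankel_matrix m) g h)"
    by (intro tendsto_intros form_lim_box[OF bounded_form_hankel_matrix g h])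
  have M0: "0 \<le> M" using order_trans[OF norm_ge_zero M[of 1]] by simp
  have "cmod (\<Sum>m\<le>degree (pderiv P). coeff (pderiv P) m * form_on (hankel_matrix m) (nat_box N) (nat_box N) g h) \<le> 12 * M * sqrt G * sqrt H" for N
  proof -
    have "cmod (\<Sum>m\<le>degree (pderiv P). coeff (pderiv P) m * form_on (hankel_matrix m) (nat_box N) (nat_box N) g h)
       \<le> 12 * M * sqrt (sqnorm_on (nat_box N) g) * sqrt (sqnorm_on (nat_box N) h)"
      using M by (rule hankel_matrix_box_bound)
    also have "\<dots> \<le> 12 * M * sqrt G * sqrt H"
      using M0 l2_bound_nonneg[OF g]
      by (intro mult_mono real_sqrt_le_mono l2_bound_finite[OF g] l2_bound_finite[OF h]) (auto simp: sqnorm_on_nonneg)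
    finally show ?thesis .
  qed
  then show "\<exists>N. \<forall>n\<ge>N. cmod (\<Sum>m\<le>degree (pderiv P). coeff (pderiv P) m * form_on (hankel_matrix m) (nat_box n) (nat_box n) g h) \<le> 12 * M * sqrt G * sqrt H" by blast
qed

text \<open>Once a box contains both indices the partial forms are constant. This allows single
  matrix entries to be read off the operator.\<close>

lemma form_lim_unit:
  "form_lim b (\<lambda>p. if p = p0 then 1 else 0) (\<lambda>q. if q = q0 then 1 else 0) = b p0 q0"
proof -
  obtain N0 where N0: "{p0, q0} \<subseteq> nat_box N0" using finite_subset_box[of "{p0, q0}"] by auto
  have "form_on b (nat_box N) (nat_box N) (\<lambda>p. if p = p0 then 1 else 0) (\<lambda>q. if q = q0 then 1 else 0) = b p0 q0" if "N \<ge> N0" for N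
  proof -
    have "p0 \<in> nat_box N" "q0 \<in> nat_box N" using N0 nat_box_mono[OF that] by auto
    moreover have "(\<Sum>q\<in>nat_box N. b p q * (if p = p0 then 1 else 0) * (if q = q0 then 1 else 0)) = (if p = p0 then b p0 q0 else 0)"
      if "q0 \<in> nat_box N" for p
    proof -
      have "(\<Sum>q\<in>nat_box N. b p q * (if p = p0 then 1 else 0) * (if q = q0 then 1 else 0))
          = (\<Sum>q\<in>nat_box N. if q = q0 then (if p = p0 then b p0 q0 else 0) else 0)"
        by (intro sum.cong refl) auto
      then show ?thesis using that by simp
    qed
    ultimately show ?thesis
      unfolding form_on_def by simp
  qed
  then have "(\<lambda>N. form_on b (nat_box N) (nat_box N) (\<lambda>p. if p = p0 then 1 else 0) (\<lambda>q. if q = q0 then 1 else 0)) \<longlonglongrightarrow> b p0 q0"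
    by (intro tendsto_eventually eventually_sequentiallyI) auto
  then show ?thesis
    unfolding form_lim_def by (rule limI)
qed

subsection \<open>Square-summable sequences\<close>

lemma cring_complex_space: "cring complex_space"
proof (rule cringI)
  show "abelian_group complex_space"
    by (rule abelian_groupI) (auto simp: complex_space_def add_eq_0_iff2 intro: exI[of _ "- _"])
  show "comm_monoid complex_space"
    by (rule comm_monoidI) (auto simp: complex_space_def)
qed (simp add: complex_space_def algebra_simps)

text \<open>Additive inverses are supplied by \<open>(-1) \<odot> x\<close>, which leaves closure
  conditions and equations to verify.\<close>

lemma complex_moduleI:
  fixes V :: "'a complex_normed" (structure)
  assumes add: "\<And>x y. x \<in> carrier V \<Longrightarrow> y \<in> carrier V \<Longrightarrow> x \<oplus> y \<in> carrier V"
    and zero: "\<zero> \<in> carrier V"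
    and assoc: "\<And>x y z. x \<in> carrier V \<Longrightarrow> y \<in> carrier V \<Longrightarrow> z \<in> carrier V \<Longrightarrow> (x \<oplus> y) \<oplus> z = x \<oplus> (y \<oplus> z)"
    and comm: "\<And>x y. x \<in> carrier V \<Longrightarrow> y \<in> carrier V \<Longrightarrow> x \<oplus> y = y \<oplus> x"
    and lzero: "\<And>x. x \<in> carrier V \<Longrightarrow> \<zero> \<oplus> x = x"
    and smult: "\<And>a x. x \<in> carrier V \<Longrightarrow> a \<odot> x \<in> carrier V"
    and dist1: "\<And>a b x. x \<in> carrier V \<Longrightarrow> (a + b) \<odot> x = a \<odot> x \<oplus> b \<odot> x"
    and dist2: "\<And>a x y. x \<in> carrier V \<Longrightarrow> y \<in> carrier V \<Longrightarrow> a \<odot> (x \<oplus> y) = a \<odot> x \<oplus> a \<odot> y"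
    and mult: "\<And>a b x. x \<in> carrier V \<Longrightarrow> (a * b) \<odot> x = a \<odot> (b \<odot> x)"
    and one: "\<And>x. x \<in> carrier V \<Longrightarrow> 1 \<odot> x = x"
    and smult_zero: "\<And>x. x \<in> carrier V \<Longrightarrow> 0 \<odot> x = \<zero>"
  shows "Module.module complex_space V"
proof (rule Module.moduleI)
  show "abelian_group V"
  proof (rule abelian_groupI)
    fix x assume x: "x \<in> carrier V"
    have "(-1) \<odot> x \<oplus> x = (-1) \<odot> x \<oplus> 1 \<odot> x" using x by (simp add: one)
    also have "\<dots> = \<zero>" using x by (simp add: dist1[symmetric] smult_zero)
    finally show "\<exists>y\<in>carrier V. y \<oplus> x = \<zero>" using smult[OF x] by blast
  qed (use assms in auto)
qed (use assms in \<open>auto simp: cring_complex_space\<close>, simp_all add: complex_space_def assms)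

locale complex_module =
  fixes V :: "'a complex_normed" (structure)
  assumes module: "Module.module complex_space V"
begin

sublocale M: module complex_space V by (rule module)

lemma smult_closed [simp, intro]: "x \<in> carrier V \<Longrightarrow> a \<odot> x \<in> carrier V"
  using M.smult_closed[of a x] by (simp add: complex_space_def)

lemma dist1: "x \<in> carrier V \<Longrightarrow> (a + b) \<odot> x = a \<odot> x \<oplus> b \<odot> x"
  using M.smult_l_distr[of a b x] by (simp add: complex_space_def)

lemma dist2: "x \<in> carrier V \<Longrightarrow> y \<in> carrier V \<Longrightarrow> a \<odot> (x \<oplus> y) = a \<odot> x \<oplus> a \<odot> y"
  using M.smult_r_distr[of a x y] by (simp add: complex_space_def)

lemma smult_mult: "x \<in> carrier V \<Longrightarrow> a \<odot> (b \<odot> x) = (a * b) \<odot> x"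
  using M.smult_assoc1[of a b x] by (simp add: complex_space_def)

lemma smult_1 [simp]: "x \<in> carrier V \<Longrightarrow> 1 \<odot> x = x"
  using M.smult_one[of x] by (simp add: complex_space_def)

lemma smult_0 [simp]: "x \<in> carrier V \<Longrightarrow> 0 \<odot> x = \<zero>"
  using M.smult_l_null[of x] by (simp add: complex_space_def)

lemma smult_zero [simp]: "a \<odot> \<zero> = \<zero>"
  using M.smult_r_null[of a] by (simp add: complex_space_def)

lemma uminus_eq: "x \<in> carrier V \<Longrightarrow> \<ominus> x = (-1) \<odot> x"
proof (rule M.minus_equality)
  assume x: "x \<in> carrier V"
  have "(-1) \<odot> x \<oplus> 1 \<odot> x = \<zero>" using x by (simp only: dist1[symmetric]) simp
  then show "(-1) \<odot> x \<oplus> x = \<zero>" using x by simp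
qed auto

lemma minus_eq: "y \<in> carrier V \<Longrightarrow> x \<ominus> y = x \<oplus> (-1) \<odot> y"
  by (simp add: M.minus_eq uminus_eq)

end

text \<open>Coordinate \<open>n\<close> belongs to the basis vector of the finite set
  \<open>set_decode n\<close>.\<close>

definition ell2 :: "(nat \<Rightarrow> complex) complex_normed" where
  "ell2 = \<lparr> carrier = {x. summable (\<lambda>n. (cmod (x n))\<^sup>2)}, mult = undefined, one = undefined,
     zero = (\<lambda>n. 0), add = (\<lambda>x y n. x n + y n), smult = (\<lambda>a x n. a * x n),
     vnorm = (\<lambda>x. sqrt (\<Sum>n. (cmod (x n))\<^sup>2)) \<rparr>"

lemma ell2_simps [simp]:
  "x \<in> carrier ell2 \<longleftrightarrow> summable (\<lambda>n. (cmod (x n))\<^sup>2)"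
  "\<zero>\<^bsub>ell2\<^esub> = (\<lambda>n. 0)" "x \<oplus>\<^bsub>ell2\<^esub> y = (\<lambda>n. x n + y n)" "a \<odot>\<^bsub>ell2\<^esub> x = (\<lambda>n. a * x n)"
  by (simp_all add: ell2_def)

lemma ell2_norm: "\<parallel>x\<parallel>\<^bsub>ell2\<^esub> = sqrt (\<Sum>n. (cmod (x n))\<^sup>2)"
  by (simp add: ell2_def)

lemma summable_square_add:
  assumes "summable (\<lambda>n. (cmod (x n))\<^sup>2)" "summable (\<lambda>n. (cmod (y n))\<^sup>2)"
  shows "summable (\<lambda>n. (cmod (x n + y n))\<^sup>2)"
  by (rule summable_comparison_test'[where N=0, OF summable_add[OF summable_mult[OF assms(1), of 2] summable_mult[OF assms(2), of 2]]])
     (simp add: cmod_add_square_le)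

lemma summable_square_scale:
  assumes "summable (\<lambda>n. (cmod (x n))\<^sup>2)" shows "summable (\<lambda>n. (cmod (a * x n))\<^sup>2)"
  using summable_mult[OF assms, of "(cmod a)\<^sup>2"] by (simp add: norm_mult power_mult_distrib)

lemma summable_square_mult:
  fixes x y :: "nat \<Rightarrow> complex"
  assumes "summable (\<lambda>n. (cmod (x n))\<^sup>2)" "summable (\<lambda>n. (cmod (y n))\<^sup>2)"
  shows "summable (\<lambda>n. x n * cnj (y n))"
proof (rule summable_norm_cancel, rule summable_comparison_test'[where N=0, OF summable_add[OF assms]])
  fix n
  show "norm (norm (x n * cnj (y n))) \<le> (cmod (x n))\<^sup>2 + (cmod (y n))\<^sup>2"
  proof -
    have "0 \<le> cmod (x n) * cmod (y n)" by simp
    then have "cmod (x n) * cmod (y n) \<le> (cmod (x n))\<^sup>2 + (cmod (y n))\<^sup>2"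
      using sum_squares_bound[of "cmod (x n)" "cmod (y n)"] by linarith
    then show ?thesis by (simp add: norm_mult)
  qed
qed

lemma module_ell2: "Module.module complex_space ell2"
  by (rule complex_moduleI)
     (simp_all add: summable_square_add summable_square_scale del: norm_mult, simp_all add: fun_eq_iff algebra_simps)

interpretation ell2: complex_module ell2
  by (rule complex_module.intro[OF module_ell2])

lemma ell2_minus: "y \<in> carrier ell2 \<Longrightarrow> x \<ominus>\<^bsub>ell2\<^esub> y = (\<lambda>n. x n - y n)"
  by (subst ell2.minus_eq) auto

lemma ell2_component_le:
  assumes "x \<in> carrier ell2" shows "cmod (x n) \<le> \<parallel>x\<parallel>\<^bsub>ell2\<^esub>"
proof -
  have "(cmod (x n))\<^sup>2 \<le> (\<Sum>n. (cmod (x n))\<^sup>2)"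
    using sum_le_suminf[of "\<lambda>n. (cmod (x n))\<^sup>2" "{n}"] assms by simp
  then show ?thesis
    unfolding ell2_norm by (rule real_le_rsqrt)
qed

lemma inner_product_ell2: "inner_product_on ell2 (\<lambda>x y. \<Sum>n. x n * cnj (y n))"
  unfolding inner_product_on_def
proof (intro conjI ballI allI impI)
  fix x y z assume "x \<in> carrier ell2" "y \<in> carrier ell2" "z \<in> carrier ell2"
  then show "(\<Sum>n. (x \<oplus>\<^bsub>ell2\<^esub> y) n * cnj (z n)) = (\<Sum>n. x n * cnj (z n)) + (\<Sum>n. y n * cnj (z n))"
    by (subst suminf_add) (auto simp: summable_square_mult algebra_simps)
next
  fix a x y assume "x \<in> carrier ell2" "y \<in> carrier ell2"
  then show "(\<Sum>n. (a \<odot>\<^bsub>ell2\<^esub> x) n * cnj (y n)) = a * (\<Sum>n. x n * cnj (y n))"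
    by (subst suminf_mult[symmetric]) (auto simp: summable_square_mult mult_ac)
next
  fix x y assume "x \<in> carrier ell2" "y \<in> carrier ell2"
  then have "(\<lambda>n. x n * cnj (y n)) sums (\<Sum>n. x n * cnj (y n))"
    by (simp add: summable_square_mult summable_sums)
  then have "(\<lambda>n. cnj (x n * cnj (y n))) sums cnj (\<Sum>n. x n * cnj (y n))"
    by (simp only: sums_cnj)
  then show "(\<Sum>n. y n * cnj (x n)) = cnj (\<Sum>n. x n * cnj (y n))"
    by (simp add: sums_iff mult.commute)
next
  fix x assume x: "x \<in> carrier ell2" "x \<noteq> \<zero>\<^bsub>ell2\<^esub>"
  then obtain m where m: "x m \<noteq> 0" by (auto simp: fun_eq_iff)
  have "0 < (cmod (x m))\<^sup>2" using m by simp
  also have "\<dots> \<le> (\<Sum>n. (cmod (x n))\<^sup>2)"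
    using sum_le_suminf[of "\<lambda>n. (cmod (x n))\<^sup>2" "{m}"] x by simp
  also have "\<dots> = Re (\<Sum>n. x n * cnj (x n))"
    unfolding complex_norm_square[symmetric] using x by (subst suminf_of_real[symmetric]) simp_all
  finally show "0 < Re (\<Sum>n. x n * cnj (x n))" .
qed

lemma norm_complete_ell2: "norm_complete ell2"
  unfolding norm_complete_def
proof (intro allI impI, elim conjE)
  fix X :: "nat \<Rightarrow> nat \<Rightarrow> complex"
  assume R: "range X \<subseteq> carrier ell2" and cau: "\<forall>e>0. \<exists>N. \<forall>m\<ge>N. \<forall>n\<ge>N. \<parallel>X m \<ominus>\<^bsub>ell2\<^esub> X n\<parallel>\<^bsub>ell2\<^esub> < e"
  have X: "X m \<in> carrier ell2" for m using R by (rule range_subsetD)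
  have sd: "summable (\<lambda>n. (cmod (X m n - X k n))\<^sup>2)" for m k
    using summable_square_add[of "X m" "\<lambda>n. (-1) * X k n"] summable_square_scale[of "X k" "-1"] X by simp
  have le: "cmod (X m n - X k n) \<le> \<parallel>X m \<ominus>\<^bsub>ell2\<^esub> X k\<parallel>\<^bsub>ell2\<^esub>" for m k n
    using ell2_component_le[of "\<lambda>n. X m n - X k n" n] X sd by (simp add: ell2_minus)
  have "Cauchy (\<lambda>m. X m n)" for n
    using cau le[of _ n] unfolding Cauchy_def dist_norm by (meson le_less_trans)
  then have "\<exists>l. (\<lambda>m. X m n) \<longlonglongrightarrow> l" for n
    using Cauchy_convergent convergent_def by blast
  then obtain x where x: "\<And>n. (\<lambda>m. X m n) \<longlonglongrightarrow> x n" by metis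
  \<comment> \<open>On a finite partial sum the Cauchy bound survives the limit in the second index,
    and the resulting bound is uniform in \<open>B\<close>.\<close>
  have tail: "\<exists>N. \<forall>m\<ge>N. \<forall>B. (\<Sum>n<B. (cmod (X m n - x n))\<^sup>2) \<le> e\<^sup>2" if e: "e > 0" for e
  proof -
    obtain N where N: "\<And>m k. m \<ge> N \<Longrightarrow> k \<ge> N \<Longrightarrow> \<parallel>X m \<ominus>\<^bsub>ell2\<^esub> X k\<parallel>\<^bsub>ell2\<^esub> < e" using cau e by blast
    have "(\<Sum>n<B. (cmod (X m n - x n))\<^sup>2) \<le> e\<^sup>2" if m: "m \<ge> N" for m B
    proof (rule LIMSEQ_le_const2)
      show "(\<lambda>k. \<Sum>n<B. (cmod (X m n - X k n))\<^sup>2) \<longlonglongrightarrow> (\<Sum>n<B. (cmod (X m n - x n))\<^sup>2)"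
        by (intro tendsto_intros x)
      have "(\<Sum>n<B. (cmod (X m n - X k n))\<^sup>2) \<le> e\<^sup>2" if "k \<ge> N" for k
      proof -
        have "(\<Sum>n<B. (cmod (X m n - X k n))\<^sup>2) \<le> (\<Sum>n. (cmod (X m n - X k n))\<^sup>2)"
          by (rule sum_le_suminf) (auto simp: sd)
        also have "\<dots> = (\<parallel>X m \<ominus>\<^bsub>ell2\<^esub> X k\<parallel>\<^bsub>ell2\<^esub>)\<^sup>2"
          using X by (simp add: ell2_minus ell2_norm suminf_nonneg sd)
        also have "\<dots> \<le> e\<^sup>2"
          using N[OF m that] X by (intro power_mono) (auto simp: ell2_minus ell2_norm suminf_nonneg sd)
        finally show ?thesis .
      qed
      then show "\<exists>N. \<forall>k\<ge>N. (\<Sum>n<B. (cmod (X m n - X k n))\<^sup>2) \<le> e\<^sup>2" by blast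
    qed
    then show ?thesis by blast
  qed
  have sx: "summable (\<lambda>n. (cmod (X m n - x n))\<^sup>2)" if "\<forall>B. (\<Sum>n<B. (cmod (X m n - x n))\<^sup>2) \<le> e" for m e
    by (rule summableI_nonneg_bounded[where x=e]) (use that in auto)
  obtain N1 where "\<forall>m\<ge>N1. \<forall>B. (\<Sum>n<B. (cmod (X m n - x n))\<^sup>2) \<le> 1\<^sup>2" using tail[of 1] by auto
  then have s1: "summable (\<lambda>n. (cmod (X N1 n - x n))\<^sup>2)" using sx by blast
  have xc: "x \<in> carrier ell2"
    using summable_square_add[of "X N1" "\<lambda>n. (-1) * (X N1 n - x n)"] summable_square_scale[OF s1, of "-1"] X by simp
  have "(\<lambda>m. \<parallel>X m \<ominus>\<^bsub>ell2\<^esub> x\<parallel>\<^bsub>ell2\<^esub>) \<longlonglongrightarrow> 0"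
  proof (rule tendstoI)
    fix e :: real assume e: "e > 0"
    obtain N where N: "\<forall>m\<ge>N. \<forall>B. (\<Sum>n<B. (cmod (X m n - x n))\<^sup>2) \<le> (e / 2)\<^sup>2" using tail[of "e / 2"] e by auto
    have "\<bar>\<parallel>X m \<ominus>\<^bsub>ell2\<^esub> x\<parallel>\<^bsub>ell2\<^esub>\<bar> < e" if "m \<ge> N" for m
    proof -
      have s: "summable (\<lambda>n. (cmod (X m n - x n))\<^sup>2)" using sx N that by blast
      have "(\<Sum>n. (cmod (X m n - x n))\<^sup>2) \<le> (e / 2)\<^sup>2"
        by (rule suminf_le_const[OF s]) (use N that in auto)
      then have "\<parallel>X m \<ominus>\<^bsub>ell2\<^esub> x\<parallel>\<^bsub>ell2\<^esub> \<le> e / 2"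
        unfolding ell2_minus[OF xc] ell2_norm using e by (intro real_le_lsqrt) auto
      moreover have "0 \<le> \<parallel>X m \<ominus>\<^bsub>ell2\<^esub> x\<parallel>\<^bsub>ell2\<^esub>"
        unfolding ell2_minus[OF xc] ell2_norm by (intro real_sqrt_ge_zero suminf_nonneg s) simp
      ultimately show ?thesis using e by simp
    qed
    then show "\<forall>\<^sub>F m in sequentially. dist (\<parallel>X m \<ominus>\<^bsub>ell2\<^esub> x\<parallel>\<^bsub>ell2\<^esub>) 0 < e"
      by (intro eventually_sequentiallyI[of N]) (simp add: dist_norm)
  qed
  then show "\<exists>x\<in>carrier ell2. (\<lambda>n. \<parallel>X n \<ominus>\<^bsub>ell2\<^esub> x\<parallel>\<^bsub>ell2\<^esub>) \<longlonglongrightarrow> 0"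
    using xc by blast
qed

lemma hilbert_space_ell2: "hilbert_space ell2"
proof -
  have "\<parallel>x\<parallel>\<^bsub>ell2\<^esub> = sqrt (Re (\<Sum>n. x n * cnj (x n)))" if "x \<in> carrier ell2" for x
    unfolding complex_norm_square[symmetric] ell2_norm using that by (subst suminf_of_real[symmetric]) simp_all
  then show ?thesis
    unfolding hilbert_space_def using module_ell2 inner_product_ell2 norm_complete_ell2 by blast
qed

subsection \<open>The Hardy space\<close>

definition ell2_sq :: "(nat \<Rightarrow> complex) \<Rightarrow> real" where
  "ell2_sq x = (\<Sum>n. (cmod (x n))\<^sup>2)"

lemma ell2_sq_nonneg: "x \<in> carrier ell2 \<Longrightarrow> 0 \<le> ell2_sq x"
  by (simp add: ell2_sq_def suminf_nonneg)

lemma ell2_norm_sq: "x \<in> carrier ell2 \<Longrightarrow> (\<parallel>x\<parallel>\<^bsub>ell2\<^esub>)\<^sup>2 = ell2_sq x"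
  using ell2_sq_nonneg[of x] by (simp add: ell2_norm ell2_sq_def)

lemma ell2_sq_scale: "x \<in> carrier ell2 \<Longrightarrow> ell2_sq (\<lambda>n. a * x n) = (cmod a)\<^sup>2 * ell2_sq x"
  unfolding ell2_sq_def norm_mult power_mult_distrib by (rule suminf_mult) simp

text \<open>A substitute for the triangle inequality that is linear in the squared norms and can
  therefore be integrated; optimizing \<open>t\<close> afterwards recovers the triangle
  inequality.\<close>

lemma ell2_sq_add_le:
  assumes "x \<in> carrier ell2" "y \<in> carrier ell2" "t > 0"
  shows "ell2_sq (\<lambda>n. x n + y n) \<le> (1 + t) * ell2_sq x + (1 + 1 / t) * ell2_sq y"
proof -
  have pt: "(cmod (a + b))\<^sup>2 \<le> (1 + t) * (cmod a)\<^sup>2 + (1 + 1 / t) * (cmod b)\<^sup>2" for a b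
  proof -
    have "0 \<le> (t * cmod a - cmod b)\<^sup>2 / t" using assms(3) by simp
    then have "2 * (cmod a * cmod b) \<le> t * (cmod a)\<^sup>2 + (cmod b)\<^sup>2 / t"
      using assms(3) by (simp add: power2_diff field_simps power2_eq_square)
    moreover have "(cmod (a + b))\<^sup>2 \<le> (cmod a + cmod b)\<^sup>2"
      by (intro power_mono norm_triangle_ineq) auto
    ultimately show ?thesis by (simp add: power2_sum algebra_simps)
  qed
  have s: "summable (\<lambda>n. (cmod (x n))\<^sup>2)" "summable (\<lambda>n. (cmod (y n))\<^sup>2)" using assms by auto
  have "ell2_sq (\<lambda>n. x n + y n) \<le> (\<Sum>n. (1 + t) * (cmod (x n))\<^sup>2 + (1 + 1 / t) * (cmod (y n))\<^sup>2)"
    unfolding ell2_sq_def by (intro suminf_le pt summable_square_add s summable_add summable_mult)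
  also have "\<dots> = (1 + t) * ell2_sq x + (1 + 1 / t) * ell2_sq y"
    unfolding ell2_sq_def using s by (simp add: suminf_add[symmetric] suminf_mult summable_mult)
  finally show ?thesis .
qed

lemma ell2_sq_parallelogram:
  assumes "x \<in> carrier ell2" "y \<in> carrier ell2"
  shows "ell2_sq (\<lambda>n. x n + y n) + ell2_sq (\<lambda>n. x n + (-1) * y n) = 2 * ell2_sq x + 2 * ell2_sq y"
proof -
  have s: "summable (\<lambda>n. (cmod (x n))\<^sup>2)" "summable (\<lambda>n. (cmod (y n))\<^sup>2)" "summable (\<lambda>n. (cmod (-1 * y n))\<^sup>2)"
    using assms summable_square_scale[of y "-1"] by auto
  have pt: "(cmod (a + b))\<^sup>2 + (cmod (a + (-1) * b))\<^sup>2 = 2 * (cmod a)\<^sup>2 + 2 * (cmod b)\<^sup>2" for a b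
    unfolding cmod_power2 by (simp add: power2_eq_square algebra_simps)
  have "ell2_sq (\<lambda>n. x n + y n) + ell2_sq (\<lambda>n. x n + (-1) * y n) = (\<Sum>n. 2 * (cmod (x n))\<^sup>2 + 2 * (cmod (y n))\<^sup>2)"
    unfolding ell2_sq_def pt[symmetric] by (rule suminf_add[OF summable_square_add[OF s(1,2)] summable_square_add[OF s(1,3)]])
  also have "\<dots> = 2 * ell2_sq x + 2 * ell2_sq y"
    unfolding ell2_sq_def using s by (simp add: suminf_add[symmetric] suminf_mult summable_mult)
  finally show ?thesis .
qed

section \<open>Measurability and square integrability of functions with values in
  \<open>ell2\<close>\<close>

lemma simple_function_truncate:
  fixes s :: "nat \<Rightarrow> 'a \<Rightarrow> complex" and i :: nat
  assumes "\<And>n. simple_function M (s n)"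
  shows "simple_function M (\<lambda>z. (\<lambda>n. if n < i then s n z else (0::complex)))"
proof (induction i)
  case 0
  then show ?case by simp
next
  case (Suc i)
  have "(\<lambda>z. (\<lambda>n. if n < Suc i then s n z else 0)) = (\<lambda>z. (\<lambda>g c. g(i := c)) (\<lambda>n. if n < i then s n z else 0) (s i z))"
    by (auto simp: fun_eq_iff less_Suc_eq)
  then show ?case
    using simple_function_compose2[OF Suc assms[of i], of "\<lambda>g c. g(i := c)"] by simp
qed

text \<open>Reduces Bochner measurability to scalar measurability. For the converse, the first
  \<open>i\<close> coordinates are replaced by their \<open>i\<close>-th simple approximations and
  the others by zero.\<close>

lemma strongly_measurable_ell2_iff:
  "strongly_measurable ell2 f \<longleftrightarrow>
    (\<forall>z\<in>sphere 0 1. f z \<in> carrier ell2) \<and> (\<forall>n. (\<lambda>z. f z n) \<in> borel_measurable circle_measure)"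
proof
  assume "strongly_measurable ell2 f"
  then obtain s where f: "f \<in> sphere 0 1 \<rightarrow> carrier ell2"
    and s: "\<And>i. simple_function circle_measure (s i)" "\<And>i. s i \<in> sphere 0 1 \<rightarrow> carrier ell2"
    and lim: "\<And>z. z \<in> sphere 0 1 \<Longrightarrow> (\<lambda>i. \<parallel>s i z \<ominus>\<^bsub>ell2\<^esub> f z\<parallel>\<^bsub>ell2\<^esub>) \<longlonglongrightarrow> 0"
    unfolding strongly_measurable_def by blast
  have "(\<lambda>z. f z n) \<in> borel_measurable circle_measure" for n
  proof (rule borel_measurable_LIMSEQ_metric)
    fix i show "(\<lambda>z. s i z n) \<in> borel_measurable circle_measure"
      using simple_function_compose1[OF s(1)[of i], of "\<lambda>x. x n"] by (rule borel_measurable_simple_function)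
  next
    fix z assume "z \<in> space circle_measure"
    then have z: "z \<in> sphere 0 1" by simp
    have c: "f z \<in> carrier ell2" "s i z \<in> carrier ell2" for i using f s(2)[of i] z by auto
    have "cmod (s i z n - f z n) \<le> \<parallel>s i z \<ominus>\<^bsub>ell2\<^esub> f z\<parallel>\<^bsub>ell2\<^esub>" for i
      using ell2_component_le[of "s i z \<ominus>\<^bsub>ell2\<^esub> f z" n] ell2.M.minus_closed[OF c(2)[of i] c(1)] by (simp add: ell2_minus[OF c(1)])
    then have "(\<lambda>i. s i z n - f z n) \<longlonglongrightarrow> 0"
      by (intro Lim_null_comparison[OF _ lim[OF z]] always_eventually allI) simp
    then show "(\<lambda>i. s i z n) \<longlonglongrightarrow> f z n"
      by (rule LIM_zero_cancel)
  qed
  then show "(\<forall>z\<in>sphere 0 1. f z \<in> carrier ell2) \<and> (\<forall>n. (\<lambda>z. f z n) \<in> borel_measurable circle_measure)"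
    using f by auto
next
  assume *: "(\<forall>z\<in>sphere 0 1. f z \<in> carrier ell2) \<and> (\<forall>n. (\<lambda>z. f z n) \<in> borel_measurable circle_measure)"
  have "\<exists>F. (\<forall>i. simple_function circle_measure (F i)) \<and> (\<forall>z\<in>sphere 0 1. (\<lambda>i. F i z) \<longlonglongrightarrow> f z n) \<and>
      (\<forall>i. \<forall>z\<in>sphere 0 1. cmod (F i z) \<le> 2 * cmod (f z n))" for n
    using borel_measurable_implies_sequence_metric[of "\<lambda>z. f z n" circle_measure 0] * by simp
  then obtain s where s: "\<And>n i. simple_function circle_measure (s n i)"
    and lim: "\<And>n z. z \<in> sphere 0 1 \<Longrightarrow> (\<lambda>i. s n i z) \<longlonglongrightarrow> f z n"
    and bd: "\<And>n i z. z \<in> sphere 0 1 \<Longrightarrow> cmod (s n i z) \<le> 2 * cmod (f z n)" by metis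
  define t where "t i z = (\<lambda>n. if n < i then s n i z else 0)" for i z
  have tc: "t i z \<in> carrier ell2" for i z
    unfolding ell2_simps by (rule summable_finite[of "{..<i}"]) (auto simp: t_def)
  have "(\<lambda>i. \<parallel>t i z \<ominus>\<^bsub>ell2\<^esub> f z\<parallel>\<^bsub>ell2\<^esub>) \<longlonglongrightarrow> 0" if z: "z \<in> sphere 0 1" for z
  proof -
    have c: "f z \<in> carrier ell2" using * z by blast
    have "((\<lambda>i. \<Sum>n. (cmod (t i z n - f z n))\<^sup>2) \<longlonglongrightarrow> (\<Sum>n. 0))"
    proof (rule tannerys_theorem[THEN conjunct2, THEN conjunct2])
      fix n
      have "(\<lambda>i. (cmod (s n i z - f z n))\<^sup>2) \<longlonglongrightarrow> (cmod (f z n - f z n))\<^sup>2"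
        by (intro tendsto_intros lim z)
      then have "(\<lambda>i. (cmod (s n i z - f z n))\<^sup>2) \<longlonglongrightarrow> 0" by simp
      moreover have "\<forall>\<^sub>F i in sequentially. (cmod (s n i z - f z n))\<^sup>2 = (cmod (t i z n - f z n))\<^sup>2"
        by (rule eventually_sequentiallyI[of "Suc n"]) (simp add: t_def)
      ultimately show "(\<lambda>i. (cmod (t i z n - f z n))\<^sup>2) \<longlonglongrightarrow> 0"
        by (rule Lim_transform_eventually)
      \<comment> \<open>The simple approximations are at most twice the function in modulus, so the
        differences are at most three times it; the squares give a summable majorant for Tannery's
        theorem.\<close>
      have "cmod (t i z n - f z n) \<le> 3 * cmod (f z n)" for n i
        using norm_triangle_ineq4[of "t i z n" "f z n"] bd[OF z, of n i] by (auto simp: t_def)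
      then have "norm ((cmod (t i z n - f z n))\<^sup>2) \<le> 9 * (cmod (f z n))\<^sup>2" for n i
        using power_mono[of "cmod (t i z n - f z n)" "3 * cmod (f z n)" 2] by (simp add: power_mult_distrib)
      then show "\<forall>\<^sub>F (n, i) in sequentially \<times>\<^sub>F sequentially. norm ((cmod (t i z n - f z n))\<^sup>2) \<le> 9 * (cmod (f z n))\<^sup>2"
        by (intro always_eventually) auto
      show "summable (\<lambda>n. 9 * (cmod (f z n))\<^sup>2)" using c by (intro summable_mult) simp
    qed simp
    then have "(\<lambda>i. sqrt (\<Sum>n. (cmod (t i z n - f z n))\<^sup>2)) \<longlonglongrightarrow> sqrt 0"
      by (intro tendsto_intros) simp
    then show ?thesis unfolding ell2_minus[OF c] ell2_norm by simp
  qed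
  moreover have "simple_function circle_measure (t i)" for i
    using simple_function_truncate[of circle_measure "\<lambda>n. s n i" i, OF s] by (simp add: t_def[abs_def])
  ultimately show "strongly_measurable ell2 f"
    unfolding strongly_measurable_def using * tc by (intro conjI exI[of _ t]) auto
qed

lemma ell2_sq_measurable:
  assumes "\<And>n. (\<lambda>z. f z n) \<in> borel_measurable M"
  shows "(\<lambda>z. ell2_sq (f z)) \<in> borel_measurable M"
  unfolding ell2_sq_def using assms by measurable

lemma L2_ell2_iff:
  "f \<in> L2_functions ell2 \<longleftrightarrow> (\<forall>z\<in>sphere 0 1. f z \<in> carrier ell2)
     \<and> (\<forall>n. (\<lambda>z. f z n) \<in> borel_measurable circle_measure) \<and> integrable circle_measure (\<lambda>z. ell2_sq (f z))"
proof -
  have "integrable circle_measure (\<lambda>z. (\<parallel>f z\<parallel>\<^bsub>ell2\<^esub>)\<^sup>2) \<longleftrightarrow> integrable circle_measure (\<lambda>z. ell2_sq (f z))"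
    if "\<forall>z\<in>sphere 0 1. f z \<in> carrier ell2"
    by (rule Bochner_Integration.integrable_cong) (use that in \<open>auto simp: ell2_norm_sq simp del: ell2_simps\<close>)
  then show ?thesis
    unfolding L2_functions_def strongly_measurable_ell2_iff by auto
qed

lemma L2_ell2D:
  assumes "f \<in> L2_functions ell2"
  shows "z \<in> sphere 0 1 \<Longrightarrow> f z \<in> carrier ell2" "(\<lambda>z. f z n) \<in> borel_measurable circle_measure"
    "integrable circle_measure (\<lambda>z. ell2_sq (f z))"
  using assms unfolding L2_ell2_iff by blast+

lemma L2_add:
  assumes f: "f \<in> L2_functions ell2" and g: "g \<in> L2_functions ell2"
  shows "(\<lambda>z. (\<lambda>n. f z n + g z n)) \<in> L2_functions ell2"
  unfolding L2_ell2_iff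
proof (intro conjI ballI allI)
  fix z :: complex assume z: "z \<in> sphere 0 1"
  show "(\<lambda>n. f z n + g z n) \<in> carrier ell2"
    using ell2.M.a_closed[OF L2_ell2D(1)[OF f z] L2_ell2D(1)[OF g z]] by simp
next
  show m: "(\<lambda>z. f z n + g z n) \<in> borel_measurable circle_measure" for n
    by (intro borel_measurable_add L2_ell2D(2) f g)
  show "integrable circle_measure (\<lambda>z. ell2_sq (\<lambda>n. f z n + g z n))"
  proof (rule Bochner_Integration.integrable_bound)
    show "integrable circle_measure (\<lambda>z. 2 * ell2_sq (f z) + 2 * ell2_sq (g z))"
      by (intro Bochner_Integration.integrable_add integrable_mult_right L2_ell2D(3) f g)
    show "(\<lambda>z. ell2_sq (\<lambda>n. f z n + g z n)) \<in> borel_measurable circle_measure"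
      by (rule ell2_sq_measurable[OF m])
    show "AE z in circle_measure. norm (ell2_sq (\<lambda>n. f z n + g z n)) \<le> norm (2 * ell2_sq (f z) + 2 * ell2_sq (g z))"
    proof (rule AE_I2)
      fix z assume "z \<in> space circle_measure"
      then have c: "f z \<in> carrier ell2" "g z \<in> carrier ell2" using L2_ell2D(1) f g by auto
      have "(\<lambda>n. f z n + g z n) \<in> carrier ell2" using ell2.M.a_closed[OF c] by simp
      then show "norm (ell2_sq (\<lambda>n. f z n + g z n)) \<le> norm (2 * ell2_sq (f z) + 2 * ell2_sq (g z))"
        using ell2_sq_add_le[OF c, of 1] ell2_sq_nonneg[OF c(1)] ell2_sq_nonneg[OF c(2)] ell2_sq_nonneg[of "\<lambda>n. f z n + g z n"]
        by simp
    qed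
  qed
qed

lemma continuous_bounded_on_circle:
  fixes p :: "complex \<Rightarrow> complex"
  assumes "continuous_on (sphere 0 1) p"
  obtains B where "B \<ge> 0" "\<And>z. z \<in> sphere 0 1 \<Longrightarrow> cmod (p z) \<le> B"
proof -
  have "compact (p ` sphere 0 1)" by (rule compact_continuous_image[OF assms]) simp
  then obtain B where "\<forall>x\<in>p ` sphere 0 1. norm x \<le> B" using compact_imp_bounded bounded_iff by blast
  then show ?thesis by (intro that[of "max B 0"]) (auto intro: max.coboundedI1)
qed

lemma L2_mult:
  assumes f: "f \<in> L2_functions ell2" and p: "continuous_on (sphere 0 1) p"
  shows "(\<lambda>z. (\<lambda>n. p z * f z n)) \<in> L2_functions ell2"
  unfolding L2_ell2_iff
proof (intro conjI ballI allI)
  fix z :: complex assume z: "z \<in> sphere 0 1"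
  show "(\<lambda>n. p z * f z n) \<in> carrier ell2"
    using ell2.smult_closed[OF L2_ell2D(1)[OF f z], of "p z"] by simp
next
  show m: "(\<lambda>z. p z * f z n) \<in> borel_measurable circle_measure" for n
    by (intro borel_measurable_times L2_ell2D(2) f circle_continuous_measurable p)
  obtain B where B: "B \<ge> 0" "\<And>z. z \<in> sphere 0 1 \<Longrightarrow> cmod (p z) \<le> B" using continuous_bounded_on_circle[OF p] by blast
  show "integrable circle_measure (\<lambda>z. ell2_sq (\<lambda>n. p z * f z n))"
  proof (rule Bochner_Integration.integrable_bound)
    show "integrable circle_measure (\<lambda>z. B\<^sup>2 * ell2_sq (f z))"
      by (intro integrable_mult_right L2_ell2D(3) f)
    show "(\<lambda>z. ell2_sq (\<lambda>n. p z * f z n)) \<in> borel_measurable circle_measure"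
      by (rule ell2_sq_measurable[OF m])
    show "AE z in circle_measure. norm (ell2_sq (\<lambda>n. p z * f z n)) \<le> norm (B\<^sup>2 * ell2_sq (f z))"
    proof (rule AE_I2)
      fix z assume "z \<in> space circle_measure"
      then have z: "z \<in> sphere 0 1" by simp
      have c: "f z \<in> carrier ell2" using L2_ell2D(1)[OF f z] .
      have "(cmod (p z))\<^sup>2 * ell2_sq (f z) \<le> B\<^sup>2 * ell2_sq (f z)"
        using B z by (intro mult_right_mono power_mono ell2_sq_nonneg c) auto
      then show "norm (ell2_sq (\<lambda>n. p z * f z n)) \<le> norm (B\<^sup>2 * ell2_sq (f z))"
        using ell2_sq_nonneg[OF c] by (simp add: ell2_sq_scale[OF c] abs_mult)
    qed
  qed
qed

text \<open>The modulus around the norm is there because an arbitrary record \<open>V\<close> may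
  have a norm field with negative values.\<close>

lemma dual_linear:
  assumes "\<phi> \<in> carrier (dual_space V)"
  shows "x \<in> carrier V \<Longrightarrow> y \<in> carrier V \<Longrightarrow> \<phi> (x \<oplus>\<^bsub>V\<^esub> y) = \<phi> x + \<phi> y"
    and "x \<in> carrier V \<Longrightarrow> \<phi> (a \<odot>\<^bsub>V\<^esub> x) = a * \<phi> x"
    and "\<exists>K\<ge>0. \<forall>x\<in>carrier V. cmod (\<phi> x) \<le> K * \<bar>\<parallel>x\<parallel>\<^bsub>V\<^esub>\<bar>"
proof -
  have b: "bounded_op V complex_space \<phi>" using assms by (simp add: dual_space_def)
  then show "x \<in> carrier V \<Longrightarrow> y \<in> carrier V \<Longrightarrow> \<phi> (x \<oplus>\<^bsub>V\<^esub> y) = \<phi> x + \<phi> y"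
    "x \<in> carrier V \<Longrightarrow> \<phi> (a \<odot>\<^bsub>V\<^esub> x) = a * \<phi> x"
    unfolding bounded_op_def by (auto simp: complex_space_def)
  obtain K where K: "\<forall>x\<in>carrier V. cmod (\<phi> x) \<le> K * \<parallel>x\<parallel>\<^bsub>V\<^esub>"
    using b unfolding bounded_op_def by (auto simp: complex_space_def)
  have "cmod (\<phi> x) \<le> \<bar>K\<bar> * \<bar>\<parallel>x\<parallel>\<^bsub>V\<^esub>\<bar>" if "x \<in> carrier V" for x
    using K that by (metis abs_ge_self abs_mult order_trans)
  then show "\<exists>K\<ge>0. \<forall>x\<in>carrier V. cmod (\<phi> x) \<le> K * \<bar>\<parallel>x\<parallel>\<^bsub>V\<^esub>\<bar>"
    by (intro exI[of _ "\<bar>K\<bar>"]) auto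
qed

text \<open>Applying \<open>\<phi>\<close> to simple approximations of \<open>f\<close> gives
  measurability without a representation of \<open>\<phi>\<close>; integrability follows from
  \<open>r \<le> 1 + r^2\<close> on a finite measure space.\<close>

lemma dual_comp_integrable:
  assumes f: "f \<in> L2_functions ell2" and \<phi>: "\<phi> \<in> carrier (dual_space ell2)"
  shows "integrable circle_measure (\<lambda>z. \<phi> (f z))"
proof -
  obtain K where K: "K \<ge> 0" "\<forall>x\<in>carrier ell2. cmod (\<phi> x) \<le> K * \<bar>\<parallel>x\<parallel>\<^bsub>ell2\<^esub>\<bar>"
    using dual_linear(3)[OF \<phi>] by blast
  obtain s where s: "\<And>i. simple_function circle_measure (s i)" "\<And>i. s i \<in> sphere 0 1 \<rightarrow> carrier ell2"
    and lim: "\<And>z. z \<in> sphere 0 1 \<Longrightarrow> (\<lambda>i. \<parallel>s i z \<ominus>\<^bsub>ell2\<^esub> f z\<parallel>\<^bsub>ell2\<^esub>) \<longlonglongrightarrow> 0"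
    using f unfolding L2_functions_def strongly_measurable_def by blast
  have meas: "(\<lambda>z. \<phi> (f z)) \<in> borel_measurable circle_measure"
  proof (rule borel_measurable_LIMSEQ_metric)
    fix i show "(\<lambda>z. \<phi> (s i z)) \<in> borel_measurable circle_measure"
      using simple_function_compose1[OF s(1)[of i], of \<phi>] by (rule borel_measurable_simple_function)
  next
    fix z assume "z \<in> space circle_measure"
    then have z: "z \<in> sphere 0 1" by simp
    have c: "f z \<in> carrier ell2" "s i z \<in> carrier ell2" for i using L2_ell2D(1)[OF f z] s(2)[of i] z by auto
    have "cmod (\<phi> (s i z) - \<phi> (f z)) \<le> K * \<bar>\<parallel>s i z \<ominus>\<^bsub>ell2\<^esub> f z\<parallel>\<^bsub>ell2\<^esub>\<bar>" for i
    proof -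
      let ?d = "s i z \<ominus>\<^bsub>ell2\<^esub> f z"
      have d: "?d \<in> carrier ell2" by (rule ell2.M.minus_closed[OF c(2) c(1)])
      have "s i z = ?d \<oplus>\<^bsub>ell2\<^esub> f z"
        by (simp add: ell2_minus[OF c(1)])
      then have "\<phi> (s i z) = \<phi> ?d + \<phi> (f z)" using dual_linear(1)[OF \<phi> d c(1)] by simp
      then show ?thesis using K(2) d by simp
    qed
    then have "(\<lambda>i. \<phi> (s i z) - \<phi> (f z)) \<longlonglongrightarrow> 0"
      by (intro Lim_null_comparison[OF _ tendsto_mult_right_zero[OF tendsto_rabs_zero[OF lim[OF z]], of K]] always_eventually allI)
    then show "(\<lambda>i. \<phi> (s i z)) \<longlonglongrightarrow> \<phi> (f z)"
      by (rule LIM_zero_cancel)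
  qed
  show ?thesis
  proof (rule Bochner_Integration.integrable_bound)
    show "integrable circle_measure (\<lambda>z. K * (1 + ell2_sq (f z)))"
      by (intro Bochner_Integration.integrable_add integrable_mult_right L2_ell2D(3) f circle.integrable_const)
    show "AE z in circle_measure. norm (\<phi> (f z)) \<le> norm (K * (1 + ell2_sq (f z)))"
    proof (rule AE_I2)
      fix z assume "z \<in> space circle_measure"
      then have c: "f z \<in> carrier ell2" using L2_ell2D(1)[OF f] by simp
      define r where "r = \<parallel>f z\<parallel>\<^bsub>ell2\<^esub>"
      have "0 \<le> (\<bar>r\<bar> - 1)\<^sup>2" by simp
      then have "2 * \<bar>r\<bar> \<le> 1 + r\<^sup>2" by (simp add: power2_diff)
      then have "\<bar>r\<bar> \<le> 1 + r\<^sup>2" using abs_ge_zero[of r] by linarith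
      then have "K * \<bar>r\<bar> \<le> K * (1 + ell2_sq (f z))"
        using K(1) unfolding r_def ell2_norm_sq[OF c] by (rule mult_left_mono)
      then have "norm (\<phi> (f z)) \<le> K * (1 + ell2_sq (f z))"
        using K(2) c unfolding r_def by (meson order_trans)
      then show "norm (\<phi> (f z)) \<le> norm (K * (1 + ell2_sq (f z)))"
        unfolding real_norm_def by (rule order_trans[OF _ abs_ge_self])
    qed
  qed (rule meas)
qed

lemma dual_zero: "\<phi> \<in> carrier (dual_space ell2) \<Longrightarrow> \<phi> (\<lambda>n. 0) = 0"
  using dual_linear(2)[of \<phi> ell2 "\<lambda>n. 0" 0] by simp

section \<open>Vanishing negative Fourier coefficients and multiplication by the disc
  algebra\<close>

lemma H2_ell2_iff:
  "f \<in> H2_functions ell2 \<longleftrightarrow> f \<in> L2_functions ell2 \<and>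
     (\<forall>k>0. \<forall>\<phi>\<in>carrier (dual_space ell2). (\<integral>z. z ^ k * \<phi> (f z) \<partial>circle_measure) = 0)"
proof -
  have "(\<forall>n<0. has_fourier_coeff ell2 f n \<zero>\<^bsub>ell2\<^esub>) \<longleftrightarrow>
     (\<forall>k>0. \<forall>\<phi>\<in>carrier (dual_space ell2). (\<integral>z. z ^ k * \<phi> (f z) \<partial>circle_measure) = 0)"
  proof
    assume *: "\<forall>n<0. has_fourier_coeff ell2 f n \<zero>\<^bsub>ell2\<^esub>"
    show "\<forall>k>0. \<forall>\<phi>\<in>carrier (dual_space ell2). (\<integral>z. z ^ k * \<phi> (f z) \<partial>circle_measure) = 0"
    proof (intro allI impI ballI)
      fix k :: nat and \<phi> assume "k > 0" and \<phi>: "\<phi> \<in> carrier (dual_space ell2)"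
      then have "- int k < 0" by simp
      then have "has_fourier_coeff ell2 f (- int k) \<zero>\<^bsub>ell2\<^esub>" using * by blast
      then show "(\<integral>z. z ^ k * \<phi> (f z) \<partial>circle_measure) = 0"
        using \<phi> dual_zero[OF \<phi>] unfolding has_fourier_coeff_def by (simp add: power_int_of_nat)
    qed
  next
    assume *: "\<forall>k>0. \<forall>\<phi>\<in>carrier (dual_space ell2). (\<integral>z. z ^ k * \<phi> (f z) \<partial>circle_measure) = 0"
    show "\<forall>n<0. has_fourier_coeff ell2 f n \<zero>\<^bsub>ell2\<^esub>"
    proof (intro allI impI)
      fix n :: int assume "n < 0"
      then obtain k where k: "- n = int k" "k > 0" by (metis neg_0_less_iff_less pos_int_cases)
      show "has_fourier_coeff ell2 f n \<zero>\<^bsub>ell2\<^esub>"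
        unfolding has_fourier_coeff_def k(1) using * k(2) by (simp add: power_int_of_nat dual_zero)
    qed
  qed
  then show ?thesis unfolding H2_functions_def by auto
qed

text \<open>By uniform continuity the dilation \<open>p(r z)\<close> is close to \<open>p\<close>
  for \<open>r\<close> near \<open>1\<close>, and the Taylor series of the dilation converges
  uniformly on the closed disc.\<close>

lemma disc_algebra_poly_approx:
  assumes p: "p \<in> disc_algebra" and e: "e > 0"
  obtains P where "\<And>z. cmod z \<le> 1 \<Longrightarrow> cmod (p z - poly P z) \<le> e"
proof -
  have c: "continuous_on (cball 0 1) p" and hol: "p holomorphic_on ball 0 1"
    using p by (auto simp: disc_algebra_def)
  have "uniformly_continuous_on (cball 0 1) p"
    by (rule compact_uniformly_continuous[OF c]) simp
  then obtain d where d: "d > 0" and D: "\<And>x y. x \<in> cball 0 1 \<Longrightarrow> y \<in> cball 0 1 \<Longrightarrow> dist y x < d \<Longrightarrow> dist (p y) (p x) < e / 2"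
    using e unfolding uniformly_continuous_on_def by (metis half_gt_zero)
  define r where "r = max (1 / 2) (1 - d / 2)"
  have r: "0 < r" "r < 1" "1 - r < d" using d by (auto simp: r_def)
  define a where "a n = (deriv ^^ n) p 0 / fact n" for n
  have pw: "(\<lambda>n. a n * w ^ n) sums p w" if "cmod w < 1" for w
    using holomorphic_power_series[OF hol, of w] that by (simp add: a_def)
  \<comment> \<open>Convergence at a radius strictly between \<open>r\<close> and \<open>1\<close>
    gives absolute convergence at \<open>r\<close>.\<close>
  define s where "s = (1 + r) / 2"
  have s: "r < s" "s < 1" "0 < s" using r by (auto simp: s_def)
  have "summable (\<lambda>n. a n * of_real s ^ n)"
    using pw[of "of_real s"] s by (auto simp: sums_iff)
  then have "summable (\<lambda>n. norm (a n * of_real r ^ n))"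
    by (rule powser_insidea) (use r s in auto)
  then have sm: "summable (\<lambda>n. cmod (a n) * r ^ n)"
    using r by (simp add: norm_mult norm_power)
  obtain N where N: "norm (\<Sum>i. cmod (a (i + N)) * r ^ (i + N)) < e / 2"
    using suminf_exist_split[OF _ sm, of "e / 2"] e by auto
  define P where "P = (\<Sum>n<N. monom (a n * of_real r ^ n) n)"
  have "cmod (p z - poly P z) \<le> e" if z: "cmod z \<le> 1" for z
  proof -
    define w where "w = of_real r * z"
    have wr: "cmod w \<le> r" using z r by (simp add: w_def norm_mult mult_left_le)
    have w1: "cmod w < 1" using wr r by simp
    have "dist w z = cmod ((of_real r - 1) * z)" by (simp add: dist_norm w_def algebra_simps)
    also have "\<dots> = (1 - r) * cmod z"
      using r unfolding norm_mult by (metis norm_of_real of_real_1 of_real_diff abs_minus_commute abs_of_pos diff_gt_0_iff_gt)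
    also have "\<dots> \<le> 1 - r" using z r by (simp add: mult_left_le)
    finally have "dist w z < d" using r by simp
    then have 1: "cmod (p w - p z) < e / 2"
      using D[of z w] z w1 by (simp add: dist_norm)
    have Pw: "poly P z = (\<Sum>n<N. a n * w ^ n)"
      by (simp add: P_def poly_sum poly_monom w_def power_mult_distrib mult_ac)
    have "p w - poly P z = (\<Sum>i. a (i + N) * w ^ (i + N))"
      using suminf_minus_initial_segment[of "\<lambda>n. a n * w ^ n" N] pw[OF w1] by (simp add: Pw sums_iff)
    also have "cmod \<dots> \<le> (\<Sum>i. cmod (a (i + N)) * r ^ (i + N))"
    proof (rule norm_suminf_le)
      show "summable (\<lambda>i. cmod (a (i + N)) * r ^ (i + N))"
        using summable_iff_shift[of "\<lambda>n. cmod (a n) * r ^ n" N] sm by simp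
      show "norm (a (i + N) * w ^ (i + N)) \<le> cmod (a (i + N)) * r ^ (i + N)" for i
        unfolding norm_mult norm_power using wr by (intro mult_left_mono power_mono) auto
    qed
    finally have "cmod (p w - poly P z) < e / 2" using N by simp
    moreover have "p z - poly P z = (p w - poly P z) - (p w - p z)" by simp
    ultimately show ?thesis
      using 1 norm_triangle_ineq4[of "p w - poly P z" "p w - p z"] by simp
  qed
  then show ?thesis by (rule that)
qed

lemma disc_algebra_continuous: "p \<in> disc_algebra \<Longrightarrow> continuous_on (sphere 0 1) p"
  unfolding disc_algebra_def by (auto intro: continuous_on_subset)

lemma poly_disc_algebra: "poly P \<in> disc_algebra"
  by (auto simp: disc_algebra_def intro!: continuous_intros holomorphic_intros)

lemma circle_integrable_mult:
  fixes g :: "complex \<Rightarrow> complex"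
  assumes p: "continuous_on (sphere 0 1) p" and g: "integrable circle_measure g"
  shows "integrable circle_measure (\<lambda>z. p z * g z)"
proof -
  obtain B where B: "B \<ge> 0" "\<And>z. z \<in> sphere 0 1 \<Longrightarrow> cmod (p z) \<le> B" using continuous_bounded_on_circle[OF p] by blast
  show ?thesis
  proof (rule Bochner_Integration.integrable_bound)
    show "integrable circle_measure (\<lambda>z. B * norm (g z))"
      using g by (intro integrable_mult_right integrable_norm)
    show "(\<lambda>z. p z * g z) \<in> borel_measurable circle_measure"
      by (intro borel_measurable_times circle_continuous_measurable[OF p] borel_measurable_integrable g)
    show "AE z in circle_measure. norm (p z * g z) \<le> norm (B * norm (g z))"
      using B by (intro AE_I2) (auto simp: norm_mult abs_mult intro: mult_right_mono)
  qed
qed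

lemma H2_L2: "f \<in> H2_functions ell2 \<Longrightarrow> f \<in> L2_functions ell2"
  by (simp add: H2_functions_def)

lemma H2_vanish:
  "f \<in> H2_functions ell2 \<Longrightarrow> k > 0 \<Longrightarrow> \<phi> \<in> carrier (dual_space ell2) \<Longrightarrow> (\<integral>z. z ^ k * \<phi> (f z) \<partial>circle_measure) = 0"
  unfolding H2_ell2_iff by blast

lemma H2_add:
  assumes f: "f \<in> H2_functions ell2" and g: "g \<in> H2_functions ell2"
  shows "(\<lambda>z. (\<lambda>n. f z n + g z n)) \<in> H2_functions ell2"
  unfolding H2_ell2_iff
proof (intro conjI allI impI ballI)
  show "(\<lambda>z. (\<lambda>n. f z n + g z n)) \<in> L2_functions ell2"
    by (intro L2_add H2_L2 f g)
  fix k :: nat and \<phi> assume k: "k > 0" and \<phi>: "\<phi> \<in> carrier (dual_space ell2)"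
  have i: "integrable circle_measure (\<lambda>z. z ^ k * \<phi> (h z))" if "h \<in> H2_functions ell2" for h
    by (intro circle_integrable_mult continuous_intros dual_comp_integrable H2_L2 that \<phi>)
  have "(\<integral>z. z ^ k * \<phi> (\<lambda>n. f z n + g z n) \<partial>circle_measure) = (\<integral>z. z ^ k * \<phi> (f z) + z ^ k * \<phi> (g z) \<partial>circle_measure)"
  proof (rule Bochner_Integration.integral_cong[OF refl])
    fix z assume "z \<in> space circle_measure"
    then have "f z \<in> carrier ell2" "g z \<in> carrier ell2"
      using L2_ell2D(1)[OF H2_L2[OF f]] L2_ell2D(1)[OF H2_L2[OF g]] by auto
    from dual_linear(1)[OF \<phi> this]
    show "z ^ k * \<phi> (\<lambda>n. f z n + g z n) = z ^ k * \<phi> (f z) + z ^ k * \<phi> (g z)"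
      by (simp add: distrib_left)
  qed
  also have "\<dots> = 0"
    by (simp add: i f g H2_vanish k \<phi>)
  finally show "(\<integral>z. z ^ k * \<phi> (\<lambda>n. f z n + g z n) \<partial>circle_measure) = 0" .
qed

text \<open>For a polynomial in place of \<open>p\<close> the integral is a combination of the
  coefficients for the exponents \<open>k + j > 0\<close>, which all vanish; uniform approximation
  on the circle extends this to the disc algebra.\<close>

lemma H2_mult:
  assumes f: "f \<in> H2_functions ell2" and p: "p \<in> disc_algebra"
  shows "(\<lambda>z. (\<lambda>n. p z * f z n)) \<in> H2_functions ell2"
  unfolding H2_ell2_iff
proof (intro conjI allI impI ballI)
  have pc: "continuous_on (sphere 0 1) p" by (rule disc_algebra_continuous[OF p])
  show "(\<lambda>z. (\<lambda>n. p z * f z n)) \<in> L2_functions ell2"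
    by (intro L2_mult H2_L2 f pc)
  fix k :: nat and \<phi> assume k: "k > 0" and \<phi>: "\<phi> \<in> carrier (dual_space ell2)"
  have i\<phi>: "integrable circle_measure (\<lambda>z. \<phi> (f z))"
    by (intro dual_comp_integrable H2_L2 f \<phi>)
  define C where "C = (\<integral>z. cmod (\<phi> (f z)) \<partial>circle_measure)"
  have C: "0 \<le> C" unfolding C_def by simp
  have "cmod (\<integral>z. z ^ k * \<phi> (\<lambda>n. p z * f z n) \<partial>circle_measure) \<le> 0"
  proof (rule field_le_epsilon)
    fix e :: real assume e: "e > 0"
    have "e / (C + 1) > 0" using e C by simp
    then obtain P where P: "\<And>z. cmod z \<le> 1 \<Longrightarrow> cmod (p z - poly P z) \<le> e / (C + 1)"
      using disc_algebra_poly_approx[OF p] by blast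
    have i1: "integrable circle_measure (\<lambda>z. z ^ k * (p z - poly P z) * \<phi> (f z))"
      by (intro circle_integrable_mult i\<phi> continuous_intros pc)
    have i2: "integrable circle_measure (\<lambda>z. coeff P j * (z ^ (k + j) * \<phi> (f z)))" for j
      by (intro integrable_mult_right circle_integrable_mult i\<phi> continuous_intros)
    have "(\<integral>z. z ^ k * \<phi> (\<lambda>n. p z * f z n) \<partial>circle_measure)
       = (\<integral>z. z ^ k * (p z - poly P z) * \<phi> (f z) + (\<Sum>j\<le>degree P. coeff P j * (z ^ (k + j) * \<phi> (f z))) \<partial>circle_measure)"
    proof (rule Bochner_Integration.integral_cong[OF refl])
      fix z assume "z \<in> space circle_measure"
      then have "f z \<in> carrier ell2" using L2_ell2D(1)[OF H2_L2[OF f]] by auto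
      from dual_linear(2)[OF \<phi> this, of "p z"]
      have "\<phi> (\<lambda>n. p z * f z n) = p z * \<phi> (f z)" by simp
      moreover have "(\<Sum>j\<le>degree P. coeff P j * (z ^ (k + j) * \<phi> (f z))) = z ^ k * poly P z * \<phi> (f z)"
        by (simp add: poly_altdef sum_distrib_left sum_distrib_right power_add mult_ac)
      ultimately show "z ^ k * \<phi> (\<lambda>n. p z * f z n) = z ^ k * (p z - poly P z) * \<phi> (f z) + (\<Sum>j\<le>degree P. coeff P j * (z ^ (k + j) * \<phi> (f z)))"
        by (simp add: algebra_simps)
    qed
    also have "\<dots> = (\<integral>z. z ^ k * (p z - poly P z) * \<phi> (f z) \<partial>circle_measure) + (\<Sum>j\<le>degree P. coeff P j * (\<integral>z. z ^ (k + j) * \<phi> (f z) \<partial>circle_measure))"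
      by (subst Bochner_Integration.integral_add[OF i1 Bochner_Integration.integrable_sum[OF i2]])
         (simp only: Bochner_Integration.integral_sum[OF i2] integral_mult_right_zero)
    also have "\<dots> = (\<integral>z. z ^ k * (p z - poly P z) * \<phi> (f z) \<partial>circle_measure)"
      using k by (simp add: H2_vanish[OF f _ \<phi>])
    finally have "cmod (\<integral>z. z ^ k * \<phi> (\<lambda>n. p z * f z n) \<partial>circle_measure) \<le> (\<integral>z. cmod (z ^ k * (p z - poly P z) * \<phi> (f z)) \<partial>circle_measure)"
      by simp
    also have "\<dots> \<le> (\<integral>z. e / (C + 1) * cmod (\<phi> (f z)) \<partial>circle_measure)"
    proof (rule integral_mono)
      show "integrable circle_measure (\<lambda>z. e / (C + 1) * cmod (\<phi> (f z)))"
        by (intro integrable_mult_right integrable_norm i\<phi>)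
      show "integrable circle_measure (\<lambda>z. cmod (z ^ k * (p z - poly P z) * \<phi> (f z)))"
        by (rule integrable_norm[OF i1])
      fix z assume "z \<in> space circle_measure"
      then have "cmod z = 1" by simp
      then show "cmod (z ^ k * (p z - poly P z) * \<phi> (f z)) \<le> e / (C + 1) * cmod (\<phi> (f z))"
        using P[of z] by (simp add: norm_mult norm_power mult_right_mono del: times_divide_eq_left)
    qed
    also have "\<dots> = e * (C / (C + 1))" by (simp add: C_def)
    also have "\<dots> \<le> e * 1" using e C by (intro mult_left_mono) auto
    finally show "cmod (\<integral>z. z ^ k * \<phi> (\<lambda>n. p z * f z n) \<partial>circle_measure) \<le> 0 + e" by simp
  qed
  then show "(\<integral>z. z ^ k * \<phi> (\<lambda>n. p z * f z n) \<partial>circle_measure) = 0" by simp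
qed

lemma H2_AE:
  assumes f: "f \<in> H2_functions ell2" and g: "g \<in> L2_functions ell2" and ae: "AE z in circle_measure. g z = f z"
  shows "g \<in> H2_functions ell2"
  unfolding H2_ell2_iff
proof (intro conjI allI impI ballI g)
  fix k :: nat and \<phi> assume k: "k > 0" and \<phi>: "\<phi> \<in> carrier (dual_space ell2)"
  have i: "integrable circle_measure (\<lambda>z. z ^ k * \<phi> (h z))" if "h \<in> L2_functions ell2" for h
    by (intro circle_integrable_mult continuous_intros dual_comp_integrable that \<phi>)
  have "(\<integral>z. z ^ k * \<phi> (g z) \<partial>circle_measure) = (\<integral>z. z ^ k * \<phi> (f z) \<partial>circle_measure)"
    using ae i[OF g] i[OF H2_L2[OF f]] by (intro integral_cong_AE) auto
  then show "(\<integral>z. z ^ k * \<phi> (g z) \<partial>circle_measure) = 0"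
    using H2_vanish[OF f k \<phi>] by simp
qed

lemma H2_const_zero: "(\<lambda>z. \<zero>\<^bsub>ell2\<^esub>) \<in> H2_functions ell2"
  unfolding H2_ell2_iff by (auto simp: L2_ell2_iff ell2_sq_def dual_zero)

section \<open>The Hardy space as a space of classes modulo null sets\<close>

abbreviation HS :: "(complex \<Rightarrow> nat \<Rightarrow> complex) set complex_normed" where
  "HS \<equiv> hardy_space ell2"

lemma ae_class_eq:
  assumes "AE z in circle_measure. f z = g z"
  shows "ae_class ell2 f = ae_class ell2 g"
proof -
  have "(AE z in circle_measure. h z = f z) \<longleftrightarrow> (AE z in circle_measure. h z = g z)" for h
  proof
    assume "AE z in circle_measure. h z = f z"
    then show "AE z in circle_measure. h z = g z" using assms by eventually_elim simp
  next
    assume "AE z in circle_measure. h z = g z"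
    then show "AE z in circle_measure. h z = f z" using assms by eventually_elim simp
  qed
  then show ?thesis by (simp add: ae_class_def)
qed

lemma rep_ae_class:
  assumes "f \<in> L2_functions ell2"
  shows "rep (ae_class ell2 f) \<in> L2_functions ell2" "AE z in circle_measure. rep (ae_class ell2 f) z = f z"
proof -
  have "f \<in> ae_class ell2 f" using assms by (simp add: ae_class_def)
  then have "rep (ae_class ell2 f) \<in> ae_class ell2 f" unfolding rep_def by (rule someI[of "\<lambda>h. h \<in> ae_class ell2 f" f])
  then show "rep (ae_class ell2 f) \<in> L2_functions ell2" "AE z in circle_measure. rep (ae_class ell2 f) z = f z"
    by (auto simp: ae_class_def)
qed

lemma hardy_ae_class_closed: "f \<in> H2_functions ell2 \<Longrightarrow> ae_class ell2 f \<in> carrier HS"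
  by (simp add: hardy_space_def)

text \<open>The chosen representative differs from a Hardy function only on a null set, and
  \<open>H2_AE\<close> transfers the vanishing coefficients to it.\<close>

lemma hardy_rep:
  assumes "u \<in> carrier HS"
  shows "rep u \<in> H2_functions ell2" "ae_class ell2 (rep u) = u"
proof -
  obtain f where f: "f \<in> H2_functions ell2" "u = ae_class ell2 f" using assms by (auto simp: hardy_space_def)
  show "rep u \<in> H2_functions ell2"
    using H2_AE[OF f(1)] rep_ae_class[OF H2_L2[OF f(1)]] f(2) by simp
  show "ae_class ell2 (rep u) = u"
    using ae_class_eq[OF rep_ae_class(2)[OF H2_L2[OF f(1)]]] f(2) by simp
qed

lemma hardy_eqI:
  assumes "u \<in> carrier HS" "v \<in> carrier HS" "AE z in circle_measure. rep u z = rep v z"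
  shows "u = v"
  using ae_class_eq[OF assms(3)] hardy_rep(2)[OF assms(1)] hardy_rep(2)[OF assms(2)] by simp

lemma hardy_rep_carrier: "u \<in> carrier HS \<Longrightarrow> z \<in> sphere 0 1 \<Longrightarrow> rep u z \<in> carrier ell2"
  by (rule L2_ell2D(1)[OF H2_L2[OF hardy_rep(1)]])

lemma hardy_add:
  assumes u: "u \<in> carrier HS" and v: "v \<in> carrier HS"
  shows "u \<oplus>\<^bsub>HS\<^esub> v \<in> carrier HS" "AE z in circle_measure. rep (u \<oplus>\<^bsub>HS\<^esub> v) z = (\<lambda>n. rep u z n + rep v z n)"
proof -
  have h: "(\<lambda>z. (\<lambda>n. rep u z n + rep v z n)) \<in> H2_functions ell2" by (intro H2_add hardy_rep u v)
  have e: "u \<oplus>\<^bsub>HS\<^esub> v = ae_class ell2 (\<lambda>z. (\<lambda>n. rep u z n + rep v z n))" by (simp add: hardy_space_def)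
  show "u \<oplus>\<^bsub>HS\<^esub> v \<in> carrier HS" unfolding e by (rule hardy_ae_class_closed[OF h])
  show "AE z in circle_measure. rep (u \<oplus>\<^bsub>HS\<^esub> v) z = (\<lambda>n. rep u z n + rep v z n)"
    unfolding e by (rule rep_ae_class(2)[OF H2_L2[OF h]])
qed

lemma hardy_mult_op:
  assumes u: "u \<in> carrier HS" and p: "p \<in> disc_algebra"
  shows "mult_op ell2 p u \<in> carrier HS" "AE z in circle_measure. rep (mult_op ell2 p u) z = (\<lambda>n. p z * rep u z n)"
proof -
  have h: "(\<lambda>z. (\<lambda>n. p z * rep u z n)) \<in> H2_functions ell2" by (intro H2_mult hardy_rep u p)
  have e: "mult_op ell2 p u = ae_class ell2 (\<lambda>z. (\<lambda>n. p z * rep u z n))" by (simp add: mult_op_def)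
  show "mult_op ell2 p u \<in> carrier HS" unfolding e by (rule hardy_ae_class_closed[OF h])
  show "AE z in circle_measure. rep (mult_op ell2 p u) z = (\<lambda>n. p z * rep u z n)"
    unfolding e by (rule rep_ae_class(2)[OF H2_L2[OF h]])
qed

text \<open>Scalars act as constant multipliers, so that statements about \<open>mult_op\<close>
  cover them.\<close>

lemma hardy_smult_mult_op: "a \<odot>\<^bsub>HS\<^esub> u = mult_op ell2 (\<lambda>z. a) u"
  by (simp add: hardy_space_def mult_op_def)

lemma const_disc_algebra: "(\<lambda>z. a) \<in> disc_algebra"
  by (auto simp: disc_algebra_def)

lemma hardy_smult:
  assumes u: "u \<in> carrier HS"
  shows "a \<odot>\<^bsub>HS\<^esub> u \<in> carrier HS" "AE z in circle_measure. rep (a \<odot>\<^bsub>HS\<^esub> u) z = (\<lambda>n. a * rep u z n)"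
  unfolding hardy_smult_mult_op by (rule hardy_mult_op[OF u const_disc_algebra])+

lemma hardy_zero:
  "\<zero>\<^bsub>HS\<^esub> \<in> carrier HS" "AE z in circle_measure. rep \<zero>\<^bsub>HS\<^esub> z = (\<lambda>n. 0)"
proof -
  have e: "\<zero>\<^bsub>HS\<^esub> = ae_class ell2 (\<lambda>z. \<zero>\<^bsub>ell2\<^esub>)" by (simp add: hardy_space_def)
  show "\<zero>\<^bsub>HS\<^esub> \<in> carrier HS" unfolding e by (rule hardy_ae_class_closed[OF H2_const_zero])
  show "AE z in circle_measure. rep \<zero>\<^bsub>HS\<^esub> z = (\<lambda>n. 0)"
    unfolding e using rep_ae_class(2)[OF H2_L2[OF H2_const_zero]] by simp
qed

lemma module_hardy: "Module.module complex_space HS"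
proof (rule complex_moduleI)
  fix x y z assume xyz: "x \<in> carrier HS" "y \<in> carrier HS" "z \<in> carrier HS"
  show "x \<oplus>\<^bsub>HS\<^esub> y \<oplus>\<^bsub>HS\<^esub> z = x \<oplus>\<^bsub>HS\<^esub> (y \<oplus>\<^bsub>HS\<^esub> z)"
  proof (rule hardy_eqI)
    show "AE w in circle_measure. rep (x \<oplus>\<^bsub>HS\<^esub> y \<oplus>\<^bsub>HS\<^esub> z) w = rep (x \<oplus>\<^bsub>HS\<^esub> (y \<oplus>\<^bsub>HS\<^esub> z)) w"
      using hardy_add(2)[OF hardy_add(1)[OF xyz(1,2)] xyz(3)] hardy_add(2)[OF xyz(1) hardy_add(1)[OF xyz(2,3)]]
        hardy_add(2)[OF xyz(1,2)] hardy_add(2)[OF xyz(2,3)]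
      by eventually_elim (simp add: add.assoc)
  qed (intro hardy_add(1) xyz)+
next
  fix x y assume xy: "x \<in> carrier HS" "y \<in> carrier HS"
  show "x \<oplus>\<^bsub>HS\<^esub> y = y \<oplus>\<^bsub>HS\<^esub> x"
  proof (rule hardy_eqI)
    show "AE w in circle_measure. rep (x \<oplus>\<^bsub>HS\<^esub> y) w = rep (y \<oplus>\<^bsub>HS\<^esub> x) w"
      using hardy_add(2)[OF xy] hardy_add(2)[OF xy(2,1)] by eventually_elim (simp add: add.commute)
  qed (intro hardy_add(1) xy)+
  fix a
  show "a \<odot>\<^bsub>HS\<^esub> (x \<oplus>\<^bsub>HS\<^esub> y) = a \<odot>\<^bsub>HS\<^esub> x \<oplus>\<^bsub>HS\<^esub> a \<odot>\<^bsub>HS\<^esub> y"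
  proof (rule hardy_eqI)
    show "AE w in circle_measure. rep (a \<odot>\<^bsub>HS\<^esub> (x \<oplus>\<^bsub>HS\<^esub> y)) w = rep (a \<odot>\<^bsub>HS\<^esub> x \<oplus>\<^bsub>HS\<^esub> a \<odot>\<^bsub>HS\<^esub> y) w"
      using hardy_smult(2)[OF hardy_add(1)[OF xy], of a] hardy_add(2)[OF hardy_smult(1)[OF xy(1), of a] hardy_smult(1)[OF xy(2), of a]]
        hardy_add(2)[OF xy] hardy_smult(2)[OF xy(1), of a] hardy_smult(2)[OF xy(2), of a]
      by eventually_elim (simp add: distrib_left)
  qed (intro hardy_add(1) hardy_smult(1) xy)+
next
  fix x assume x: "x \<in> carrier HS"
  show "\<zero>\<^bsub>HS\<^esub> \<oplus>\<^bsub>HS\<^esub> x = x"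
  proof (rule hardy_eqI)
    show "AE w in circle_measure. rep (\<zero>\<^bsub>HS\<^esub> \<oplus>\<^bsub>HS\<^esub> x) w = rep x w"
      using hardy_add(2)[OF hardy_zero(1) x] hardy_zero(2) by eventually_elim simp
  qed (intro hardy_add(1) hardy_zero(1) x)+
  show "1 \<odot>\<^bsub>HS\<^esub> x = x"
  proof (rule hardy_eqI)
    show "AE w in circle_measure. rep (1 \<odot>\<^bsub>HS\<^esub> x) w = rep x w"
      using hardy_smult(2)[OF x, of 1] by eventually_elim simp
  qed (intro hardy_smult(1) x)+
  show "0 \<odot>\<^bsub>HS\<^esub> x = \<zero>\<^bsub>HS\<^esub>"
  proof (rule hardy_eqI)
    show "AE w in circle_measure. rep (0 \<odot>\<^bsub>HS\<^esub> x) w = rep \<zero>\<^bsub>HS\<^esub> w"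
      using hardy_smult(2)[OF x, of 0] hardy_zero(2) by eventually_elim simp
  qed (intro hardy_smult(1) hardy_zero(1) x)+
  fix a b
  show "(a + b) \<odot>\<^bsub>HS\<^esub> x = a \<odot>\<^bsub>HS\<^esub> x \<oplus>\<^bsub>HS\<^esub> b \<odot>\<^bsub>HS\<^esub> x"
  proof (rule hardy_eqI)
    show "AE w in circle_measure. rep ((a + b) \<odot>\<^bsub>HS\<^esub> x) w = rep (a \<odot>\<^bsub>HS\<^esub> x \<oplus>\<^bsub>HS\<^esub> b \<odot>\<^bsub>HS\<^esub> x) w"
      using hardy_smult(2)[OF x, of "a + b"] hardy_add(2)[OF hardy_smult(1)[OF x, of a] hardy_smult(1)[OF x, of b]]
        hardy_smult(2)[OF x, of a] hardy_smult(2)[OF x, of b]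
      by eventually_elim (simp add: distrib_right)
  qed (intro hardy_add(1) hardy_smult(1) x)+
  show "(a * b) \<odot>\<^bsub>HS\<^esub> x = a \<odot>\<^bsub>HS\<^esub> (b \<odot>\<^bsub>HS\<^esub> x)"
  proof (rule hardy_eqI)
    show "AE w in circle_measure. rep ((a * b) \<odot>\<^bsub>HS\<^esub> x) w = rep (a \<odot>\<^bsub>HS\<^esub> (b \<odot>\<^bsub>HS\<^esub> x)) w"
      using hardy_smult(2)[OF x, of "a * b"] hardy_smult(2)[OF hardy_smult(1)[OF x, of b], of a] hardy_smult(2)[OF x, of b]
      by eventually_elim (simp add: mult.assoc)
  qed (intro hardy_smult(1) x)+
qed (intro hardy_add(1) hardy_smult(1) hardy_zero(1); assumption)+

interpretation HS: complex_module HS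
  by (rule complex_module.intro[OF module_hardy])

text \<open>
  The parallelogram law replaces the inner product, so that the dual needs no Riesz representation.
\<close>

definition para_normed :: "'a complex_normed \<Rightarrow> bool" where
  "para_normed V \<longleftrightarrow> Module.module complex_space V \<and>
    (\<forall>x\<in>carrier V. 0 \<le> \<parallel>x\<parallel>\<^bsub>V\<^esub>) \<and>
    (\<forall>a. \<forall>x\<in>carrier V. \<parallel>a \<odot>\<^bsub>V\<^esub> x\<parallel>\<^bsub>V\<^esub> = cmod a * \<parallel>x\<parallel>\<^bsub>V\<^esub>) \<and>
    (\<forall>x\<in>carrier V. \<forall>y\<in>carrier V. \<parallel>x \<oplus>\<^bsub>V\<^esub> y\<parallel>\<^bsub>V\<^esub> \<le> \<parallel>x\<parallel>\<^bsub>V\<^esub> + \<parallel>y\<parallel>\<^bsub>V\<^esub>) \<and>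
    (\<forall>x\<in>carrier V. \<forall>y\<in>carrier V.
      (\<parallel>x \<oplus>\<^bsub>V\<^esub> y\<parallel>\<^bsub>V\<^esub>)\<^sup>2 + (\<parallel>x \<oplus>\<^bsub>V\<^esub> (-1) \<odot>\<^bsub>V\<^esub> y\<parallel>\<^bsub>V\<^esub>)\<^sup>2 = 2 * (\<parallel>x\<parallel>\<^bsub>V\<^esub>)\<^sup>2 + 2 * (\<parallel>y\<parallel>\<^bsub>V\<^esub>)\<^sup>2)"

text \<open>The right side of the assumption, minimized over \<open>t\<close>, is the square of
  \<open>a + b\<close>; the minimum is at \<open>t = b / a\<close>.\<close>

lemma weighted_squares_imp_triangle:
  fixes a b c :: real
  assumes "\<And>t. t > 0 \<Longrightarrow> c\<^sup>2 \<le> (1 + t) * a\<^sup>2 + (1 + 1 / t) * b\<^sup>2" and ab: "0 \<le> a" "0 \<le> b"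
  shows "c \<le> a + b"
proof (rule field_le_epsilon)
  fix e :: real assume e: "e > 0"
  \<comment> \<open>The minimizer is perturbed by \<open>d\<close> so that it exists and is positive
    even if \<open>a\<close> or \<open>b\<close> is zero.\<close>
  define d where "d = e / 2"
  have d: "d > 0" using e by (simp add: d_def)
  define t where "t = (b + d) / (a + d)"
  have t: "t > 0" using ab d by (simp add: t_def)
  have 1: "(1 + t) * a\<^sup>2 \<le> (1 + t) * (a + d)\<^sup>2" "(1 + 1 / t) * b\<^sup>2 \<le> (1 + 1 / t) * (b + d)\<^sup>2"
    using ab d t by (intro mult_left_mono power_mono; simp)+
  have 2: "(1 + t) * (a + d)\<^sup>2 = (a + b + 2 * d) * (a + d)" "(1 + 1 / t) * (b + d)\<^sup>2 = (a + b + 2 * d) * (b + d)"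
    using ab d by (simp_all add: t_def field_simps power2_eq_square)
  have "c\<^sup>2 \<le> (a + b + 2 * d) * (a + d) + (a + b + 2 * d) * (b + d)"
    using assms(1)[OF t] 1 unfolding 2 by linarith
  also have "\<dots> = (a + b + 2 * d)\<^sup>2" by (simp add: power2_eq_square algebra_simps)
  finally have "c \<le> a + b + 2 * d" by (rule power2_le_imp_le) (use ab d in auto)
  then show "c \<le> a + b + e" by (simp add: d_def)
qed

lemma hardy_norm: "\<parallel>u\<parallel>\<^bsub>HS\<^esub> = sqrt (\<integral>z. (\<parallel>rep u z\<parallel>\<^bsub>ell2\<^esub>)\<^sup>2 \<partial>circle_measure)"
  by (simp add: hardy_space_def)

lemma hardy_norm_sq:
  assumes u: "u \<in> carrier HS"
  shows "(\<parallel>u\<parallel>\<^bsub>HS\<^esub>)\<^sup>2 = (\<integral>z. ell2_sq (rep u z) \<partial>circle_measure)"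
proof -
  have "(\<integral>z. (\<parallel>rep u z\<parallel>\<^bsub>ell2\<^esub>)\<^sup>2 \<partial>circle_measure) = (\<integral>z. ell2_sq (rep u z) \<partial>circle_measure)"
    using hardy_rep_carrier[OF u] by (intro Bochner_Integration.integral_cong refl ell2_norm_sq) auto
  moreover have "0 \<le> (\<integral>z. (\<parallel>rep u z\<parallel>\<^bsub>ell2\<^esub>)\<^sup>2 \<partial>circle_measure)" by (rule integral_nonneg_AE) auto
  ultimately show ?thesis by (simp add: hardy_norm)
qed

lemma hardy_norm_nonneg: "0 \<le> \<parallel>u\<parallel>\<^bsub>HS\<^esub>"
  unfolding hardy_norm by (intro real_sqrt_ge_zero integral_nonneg_AE) auto

lemma hardy_sq_integrable: "u \<in> carrier HS \<Longrightarrow> integrable circle_measure (\<lambda>z. ell2_sq (rep u z))"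
  by (rule L2_ell2D(3)[OF H2_L2[OF hardy_rep(1)]])

text \<open>Allows the norm to be computed from any convenient function in the class instead of the
  chosen representative.\<close>

lemma hardy_sq_cong:
  assumes "u \<in> carrier HS" "AE z in circle_measure. rep u z = f z" "integrable circle_measure (\<lambda>z. ell2_sq (f z))"
  shows "(\<parallel>u\<parallel>\<^bsub>HS\<^esub>)\<^sup>2 = (\<integral>z. ell2_sq (f z) \<partial>circle_measure)"
  unfolding hardy_norm_sq[OF assms(1)]
  using assms hardy_sq_integrable[OF assms(1)] by (intro integral_cong_AE) auto

lemma hardy_mult_op_norm:
  assumes u: "u \<in> carrier HS" and p: "p \<in> disc_algebra" and M: "\<And>z. cmod z = 1 \<Longrightarrow> cmod (p z) \<le> M"
  shows "\<parallel>mult_op ell2 p u\<parallel>\<^bsub>HS\<^esub> \<le> M * \<parallel>u\<parallel>\<^bsub>HS\<^esub>"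
proof -
  have M0: "0 \<le> M" using order_trans[OF norm_ge_zero M[of 1]] by simp
  have i: "integrable circle_measure (\<lambda>z. ell2_sq (\<lambda>n. p z * rep u z n))"
    by (rule L2_ell2D(3)[OF L2_mult[OF H2_L2[OF hardy_rep(1)[OF u]] disc_algebra_continuous[OF p]]])
  have "(\<parallel>mult_op ell2 p u\<parallel>\<^bsub>HS\<^esub>)\<^sup>2 = (\<integral>z. ell2_sq (\<lambda>n. p z * rep u z n) \<partial>circle_measure)"
    by (rule hardy_sq_cong[OF hardy_mult_op[OF u p] i])
  also have "\<dots> \<le> (\<integral>z. M\<^sup>2 * ell2_sq (rep u z) \<partial>circle_measure)"
  proof (rule integral_mono[OF i])
    show "integrable circle_measure (\<lambda>z. M\<^sup>2 * ell2_sq (rep u z))"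
      by (intro integrable_mult_right hardy_sq_integrable u)
    fix z assume "z \<in> space circle_measure"
    then have c: "rep u z \<in> carrier ell2" and z: "cmod z = 1" using hardy_rep_carrier[OF u] by auto
    show "ell2_sq (\<lambda>n. p z * rep u z n) \<le> M\<^sup>2 * ell2_sq (rep u z)"
      unfolding ell2_sq_scale[OF c] using M[OF z] by (intro mult_right_mono power_mono ell2_sq_nonneg c) auto
  qed
  also have "\<dots> = (M * \<parallel>u\<parallel>\<^bsub>HS\<^esub>)\<^sup>2"
    by (simp add: hardy_norm_sq[OF u] power_mult_distrib)
  finally show ?thesis
    by (rule power2_le_imp_le) (simp add: M0 hardy_norm_nonneg)
qed

lemma para_normed_hardy: "para_normed HS"
  unfolding para_normed_def
proof (intro conjI ballI allI module_hardy hardy_norm_nonneg)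
  fix a u assume u: "u \<in> carrier HS"
  have c: "rep u z \<in> carrier ell2" if "z \<in> space circle_measure" for z using hardy_rep_carrier[OF u] that by simp
  have i: "integrable circle_measure (\<lambda>z. ell2_sq (\<lambda>n. a * rep u z n))"
    by (rule L2_ell2D(3)[OF L2_mult[OF H2_L2[OF hardy_rep(1)[OF u]]]]) auto
  have "(\<parallel>a \<odot>\<^bsub>HS\<^esub> u\<parallel>\<^bsub>HS\<^esub>)\<^sup>2 = (\<integral>z. ell2_sq (\<lambda>n. a * rep u z n) \<partial>circle_measure)"
    by (rule hardy_sq_cong[OF hardy_smult[OF u] i])
  also have "\<dots> = (\<integral>z. (cmod a)\<^sup>2 * ell2_sq (rep u z) \<partial>circle_measure)"
    by (intro Bochner_Integration.integral_cong refl ell2_sq_scale c)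
  also have "\<dots> = (cmod a * \<parallel>u\<parallel>\<^bsub>HS\<^esub>)\<^sup>2"
    by (simp add: hardy_norm_sq[OF u] power_mult_distrib)
  finally show "\<parallel>a \<odot>\<^bsub>HS\<^esub> u\<parallel>\<^bsub>HS\<^esub> = cmod a * \<parallel>u\<parallel>\<^bsub>HS\<^esub>"
    by (simp add: power2_eq_iff_nonneg hardy_norm_nonneg)
next
  fix u v assume u: "u \<in> carrier HS" and v: "v \<in> carrier HS"
  have c: "rep u z \<in> carrier ell2" "rep v z \<in> carrier ell2" if "z \<in> space circle_measure" for z
    using hardy_rep_carrier[OF u] hardy_rep_carrier[OF v] that by simp_all
  have i: "integrable circle_measure (\<lambda>z. ell2_sq (\<lambda>n. rep u z n + rep v z n))"
    by (intro L2_ell2D(3) L2_add H2_L2 hardy_rep(1) u v)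
  have sq: "(\<parallel>u \<oplus>\<^bsub>HS\<^esub> v\<parallel>\<^bsub>HS\<^esub>)\<^sup>2 = (\<integral>z. ell2_sq (\<lambda>n. rep u z n + rep v z n) \<partial>circle_measure)"
    by (rule hardy_sq_cong[OF hardy_add[OF u v] i])
  show "\<parallel>u \<oplus>\<^bsub>HS\<^esub> v\<parallel>\<^bsub>HS\<^esub> \<le> \<parallel>u\<parallel>\<^bsub>HS\<^esub> + \<parallel>v\<parallel>\<^bsub>HS\<^esub>"
  proof (rule weighted_squares_imp_triangle[OF _ hardy_norm_nonneg hardy_norm_nonneg])
    fix t :: real assume t: "t > 0"
    have "(\<parallel>u \<oplus>\<^bsub>HS\<^esub> v\<parallel>\<^bsub>HS\<^esub>)\<^sup>2 \<le> (\<integral>z. (1 + t) * ell2_sq (rep u z) + (1 + 1 / t) * ell2_sq (rep v z) \<partial>circle_measure)"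
      unfolding sq
    proof (rule integral_mono[OF i])
      show "integrable circle_measure (\<lambda>z. (1 + t) * ell2_sq (rep u z) + (1 + 1 / t) * ell2_sq (rep v z))"
        by (intro Bochner_Integration.integrable_add integrable_mult_right hardy_sq_integrable u v)
    qed (intro ell2_sq_add_le c t)
    also have "\<dots> = (1 + t) * (\<parallel>u\<parallel>\<^bsub>HS\<^esub>)\<^sup>2 + (1 + 1 / t) * (\<parallel>v\<parallel>\<^bsub>HS\<^esub>)\<^sup>2"
      unfolding hardy_norm_sq[OF u] hardy_norm_sq[OF v]
      by (subst Bochner_Integration.integral_add) (auto intro!: integrable_mult_right hardy_sq_integrable u v)
    finally show "(\<parallel>u \<oplus>\<^bsub>HS\<^esub> v\<parallel>\<^bsub>HS\<^esub>)\<^sup>2 \<le> (1 + t) * (\<parallel>u\<parallel>\<^bsub>HS\<^esub>)\<^sup>2 + (1 + 1 / t) * (\<parallel>v\<parallel>\<^bsub>HS\<^esub>)\<^sup>2" .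
  qed
  have mv: "(-1) \<odot>\<^bsub>HS\<^esub> v \<in> carrier HS" by (rule hardy_smult(1)[OF v])
  have i': "integrable circle_measure (\<lambda>z. ell2_sq (\<lambda>n. rep u z n + (-1) * rep v z n))"
    by (intro L2_ell2D(3) L2_add L2_mult H2_L2 hardy_rep(1) u v continuous_intros)
  have ae: "AE z in circle_measure. rep (u \<oplus>\<^bsub>HS\<^esub> (-1) \<odot>\<^bsub>HS\<^esub> v) z = (\<lambda>n. rep u z n + (-1) * rep v z n)"
    using hardy_add(2)[OF u mv] hardy_smult(2)[OF v, of "-1"] by eventually_elim simp
  have sq': "(\<parallel>u \<oplus>\<^bsub>HS\<^esub> (-1) \<odot>\<^bsub>HS\<^esub> v\<parallel>\<^bsub>HS\<^esub>)\<^sup>2 = (\<integral>z. ell2_sq (\<lambda>n. rep u z n + (-1) * rep v z n) \<partial>circle_measure)"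
    by (rule hardy_sq_cong[OF hardy_add(1)[OF u mv] ae i'])
  have "(\<parallel>u \<oplus>\<^bsub>HS\<^esub> v\<parallel>\<^bsub>HS\<^esub>)\<^sup>2 + (\<parallel>u \<oplus>\<^bsub>HS\<^esub> (-1) \<odot>\<^bsub>HS\<^esub> v\<parallel>\<^bsub>HS\<^esub>)\<^sup>2
     = (\<integral>z. ell2_sq (\<lambda>n. rep u z n + rep v z n) + ell2_sq (\<lambda>n. rep u z n + (-1) * rep v z n) \<partial>circle_measure)"
    unfolding sq sq' by (rule Bochner_Integration.integral_add[OF i i', symmetric])
  also have "\<dots> = (\<integral>z. 2 * ell2_sq (rep u z) + 2 * ell2_sq (rep v z) \<partial>circle_measure)"
    by (intro Bochner_Integration.integral_cong refl ell2_sq_parallelogram c)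
  also have "\<dots> = 2 * (\<parallel>u\<parallel>\<^bsub>HS\<^esub>)\<^sup>2 + 2 * (\<parallel>v\<parallel>\<^bsub>HS\<^esub>)\<^sup>2"
    unfolding hardy_norm_sq[OF u] hardy_norm_sq[OF v]
    by (subst Bochner_Integration.integral_add) (auto intro!: integrable_mult_right hardy_sq_integrable u v)
  finally show "(\<parallel>u \<oplus>\<^bsub>HS\<^esub> v\<parallel>\<^bsub>HS\<^esub>)\<^sup>2 + (\<parallel>u \<oplus>\<^bsub>HS\<^esub> (-1) \<odot>\<^bsub>HS\<^esub> v\<parallel>\<^bsub>HS\<^esub>)\<^sup>2 = 2 * (\<parallel>u\<parallel>\<^bsub>HS\<^esub>)\<^sup>2 + 2 * (\<parallel>v\<parallel>\<^bsub>HS\<^esub>)\<^sup>2" .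
qed

section \<open>Fourier coefficients of the elements of the Hardy space\<close>

definition hardy_coeff :: "(complex \<Rightarrow> nat \<Rightarrow> complex) set \<Rightarrow> dseq" where
  "hardy_coeff u p = (\<integral>z. cnj z ^ fst p * rep u z (snd p) \<partial>circle_measure)"

lemma component_integrable:
  assumes f: "f \<in> L2_functions ell2"
  shows "integrable circle_measure (\<lambda>z. f z n)" "integrable circle_measure (\<lambda>z. (cmod (f z n))\<^sup>2)"
proof -
  have le: "(cmod (f z n))\<^sup>2 \<le> ell2_sq (f z)" if "z \<in> space circle_measure" for z
    using L2_ell2D(1)[OF f, of z] that sum_le_suminf[of "\<lambda>n. (cmod (f z n))\<^sup>2" "{n}"] by (simp add: ell2_sq_def)
  have m: "(\<lambda>z. f z n) \<in> borel_measurable circle_measure" by (rule L2_ell2D(2)[OF f])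
  show sq: "integrable circle_measure (\<lambda>z. (cmod (f z n))\<^sup>2)"
  proof (rule Bochner_Integration.integrable_bound[OF L2_ell2D(3)[OF f]])
    show "AE z in circle_measure. norm ((cmod (f z n))\<^sup>2) \<le> norm (ell2_sq (f z))"
      using le by (intro AE_I2) (simp add: order_trans[OF _ abs_ge_self])
  qed (use m in measurable)
  show "integrable circle_measure (\<lambda>z. f z n)"
  proof (rule Bochner_Integration.integrable_bound)
    show "integrable circle_measure (\<lambda>z. 1 + (cmod (f z n))\<^sup>2)"
      by (intro Bochner_Integration.integrable_add sq circle.integrable_const)
    have "r \<le> 1 + r\<^sup>2" if "0 \<le> r" for r :: real
      using that zero_le_power2[of "r - 1"] unfolding power2_diff by simp
    then show "AE z in circle_measure. norm (f z n) \<le> norm (1 + (cmod (f z n))\<^sup>2)"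
      by (intro AE_I2) simp
  qed (rule m)
qed

lemma hardy_component_integrable:
  assumes "u \<in> carrier HS" "continuous_on (sphere 0 1) p"
  shows "integrable circle_measure (\<lambda>z. p z * rep u z n)"
  by (rule circle_integrable_mult[OF assms(2) component_integrable(1)[OF H2_L2[OF hardy_rep(1)[OF assms(1)]]]])

lemma hardy_coeff_cong:
  assumes u: "u \<in> carrier HS" and ae: "AE z in circle_measure. rep u z = f z"
    and i: "\<And>n. integrable circle_measure (\<lambda>z. f z n)"
  shows "hardy_coeff u p = (\<integral>z. cnj z ^ fst p * f z (snd p) \<partial>circle_measure)"
  unfolding hardy_coeff_def
proof (rule integral_cong_AE)
  show "(\<lambda>z. cnj z ^ fst p * rep u z (snd p)) \<in> borel_measurable circle_measure"
    by (intro borel_measurable_integrable hardy_component_integrable u continuous_intros)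
  show "(\<lambda>z. cnj z ^ fst p * f z (snd p)) \<in> borel_measurable circle_measure"
    by (intro borel_measurable_integrable circle_integrable_mult i continuous_intros)
  show "AE z in circle_measure. cnj z ^ fst p * rep u z (snd p) = cnj z ^ fst p * f z (snd p)"
    using ae by eventually_elim simp
qed

lemma hardy_coeff_add:
  assumes u: "u \<in> carrier HS" and v: "v \<in> carrier HS"
  shows "hardy_coeff (u \<oplus>\<^bsub>HS\<^esub> v) = (\<lambda>p. hardy_coeff u p + hardy_coeff v p)"
proof
  fix p :: "nat \<times> nat"
  have i: "integrable circle_measure (\<lambda>z. cnj z ^ fst p * rep w z n)" if "w \<in> carrier HS" for w n
    by (intro hardy_component_integrable that continuous_intros)
  have i1: "integrable circle_measure (\<lambda>z. rep w z n)" if "w \<in> carrier HS" for w n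
    by (rule component_integrable(1)[OF H2_L2[OF hardy_rep(1)[OF that]]])
  have "hardy_coeff (u \<oplus>\<^bsub>HS\<^esub> v) p = (\<integral>z. cnj z ^ fst p * (rep u z (snd p) + rep v z (snd p)) \<partial>circle_measure)"
    by (rule hardy_coeff_cong[OF hardy_add[OF u v]]) (intro Bochner_Integration.integrable_add i1 u v)
  also have "\<dots> = hardy_coeff u p + hardy_coeff v p"
    unfolding hardy_coeff_def distrib_left by (rule Bochner_Integration.integral_add[OF i[OF u] i[OF v]])
  finally show "hardy_coeff (u \<oplus>\<^bsub>HS\<^esub> v) p = hardy_coeff u p + hardy_coeff v p" .
qed

lemma hardy_coeff_smult:
  assumes u: "u \<in> carrier HS"
  shows "hardy_coeff (a \<odot>\<^bsub>HS\<^esub> u) = (\<lambda>p. a * hardy_coeff u p)"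
proof
  fix p :: "nat \<times> nat"
  have "hardy_coeff (a \<odot>\<^bsub>HS\<^esub> u) p = (\<integral>z. cnj z ^ fst p * (a * rep u z (snd p)) \<partial>circle_measure)"
    by (rule hardy_coeff_cong[OF hardy_smult[OF u]]) (intro hardy_component_integrable u continuous_intros)
  also have "\<dots> = (\<integral>z. a * (cnj z ^ fst p * rep u z (snd p)) \<partial>circle_measure)"
    by (simp add: mult_ac)
  finally show "hardy_coeff (a \<odot>\<^bsub>HS\<^esub> u) p = a * hardy_coeff u p"
    by (simp add: hardy_coeff_def)
qed

lemma component_dual:
  "(\<lambda>x\<in>carrier ell2. x n) \<in> carrier (dual_space ell2)"
proof -
  have "bounded_op ell2 complex_space (\<lambda>x\<in>carrier ell2. x n)"
    unfolding bounded_op_def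
  proof (intro conjI ballI allI)
    fix x y a assume xy: "x \<in> carrier ell2" "y \<in> carrier ell2"
    show "(\<lambda>x\<in>carrier ell2. x n) (x \<oplus>\<^bsub>ell2\<^esub> y) = (\<lambda>x\<in>carrier ell2. x n) x \<oplus>\<^bsub>complex_space\<^esub> (\<lambda>x\<in>carrier ell2. x n) y"
      using ell2.M.a_closed[OF xy] xy by (simp add: complex_space_def)
  next
    fix x a assume x: "x \<in> carrier ell2"
    show "(\<lambda>x\<in>carrier ell2. x n) (a \<odot>\<^bsub>ell2\<^esub> x) = a \<odot>\<^bsub>complex_space\<^esub> (\<lambda>x\<in>carrier ell2. x n) x"
      using ell2.smult_closed[OF x, of a] x by (simp add: complex_space_def)
  next
    show "\<exists>K. \<forall>x\<in>carrier ell2. \<parallel>(\<lambda>x\<in>carrier ell2. x n) x\<parallel>\<^bsub>complex_space\<^esub> \<le> K * \<parallel>x\<parallel>\<^bsub>ell2\<^esub>"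
      by (rule exI[of _ 1]) (auto simp: complex_space_def ell2_component_le simp del: ell2_simps)
  qed (simp add: complex_space_def)
  then show ?thesis by (simp add: dual_space_def)
qed

lemma H2_component_vanish:
  assumes f: "f \<in> H2_functions ell2" and k: "k > 0"
  shows "(\<integral>z. z ^ k * f z n \<partial>circle_measure) = 0"
proof -
  have "(\<integral>z. z ^ k * f z n \<partial>circle_measure) = (\<integral>z. z ^ k * (\<lambda>x\<in>carrier ell2. x n) (f z) \<partial>circle_measure)"
    using L2_ell2D(1)[OF H2_L2[OF f]] by (intro Bochner_Integration.integral_cong) (auto simp del: ell2_simps)
  also have "\<dots> = 0" by (rule H2_vanish[OF f k component_dual])
  finally show ?thesis .
qed

lemma power_disc_algebra: "(\<lambda>z. z ^ m) \<in> disc_algebra"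
  by (auto simp: disc_algebra_def intro!: continuous_intros holomorphic_intros)

text \<open>Since \<open>cnj z * z = 1\<close> on the circle, the coefficient at \<open>n\<close> is
  that of \<open>u\<close> at \<open>n - m\<close>. For \<open>n < m\<close> this is a negative
  coefficient, which is zero in the Hardy space.\<close>

lemma hardy_coeff_shift:
  assumes u: "u \<in> carrier HS"
  shows "hardy_coeff (mult_op ell2 (\<lambda>z. z ^ m) u) = shift_seq m (hardy_coeff u)"
proof
  fix p :: "nat \<times> nat"
  obtain n b where p: "p = (n, b)" by (cases p)
  have "hardy_coeff (mult_op ell2 (\<lambda>z. z ^ m) u) p = (\<integral>z. cnj z ^ n * (z ^ m * rep u z b) \<partial>circle_measure)"
    unfolding p using hardy_coeff_cong[OF hardy_mult_op[OF u power_disc_algebra], of m "(n, b)"]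
    by (simp add: hardy_component_integrable[OF u] continuous_intros)
  also have "\<dots> = shift_seq m (hardy_coeff u) p"
  proof (cases "n < m")
    case True
    have "(\<integral>z. cnj z ^ n * (z ^ m * rep u z b) \<partial>circle_measure) = (\<integral>z. z ^ (m - n) * rep u z b \<partial>circle_measure)"
    proof (rule Bochner_Integration.integral_cong[OF refl])
      fix z assume "z \<in> space circle_measure"
      then have zz: "cnj z * z = 1" using complex_norm_square[of z] by (simp add: mult.commute)
      have "cnj z ^ n * z ^ m = (cnj z * z) ^ n * z ^ (m - n)"
        using True by (simp add: power_mult_distrib mult.assoc flip: power_add)
      then show "cnj z ^ n * (z ^ m * rep u z b) = z ^ (m - n) * rep u z b"
        unfolding zz by (simp add: mult.assoc[symmetric])
    qed
    also have "\<dots> = 0" using True by (intro H2_component_vanish hardy_rep(1) u) simp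
    finally show ?thesis using True by (simp add: p shift_seq_def)
  next
    case False
    have "(\<integral>z. cnj z ^ n * (z ^ m * rep u z b) \<partial>circle_measure) = (\<integral>z. cnj z ^ (n - m) * rep u z b \<partial>circle_measure)"
    proof (rule Bochner_Integration.integral_cong[OF refl])
      fix z assume "z \<in> space circle_measure"
      then have zz: "cnj z * z = 1" using complex_norm_square[of z] by (simp add: mult.commute)
      have "cnj z ^ n = cnj z ^ m * cnj z ^ (n - m)" using False by (simp flip: power_add)
      then have "cnj z ^ n * z ^ m = (cnj z * z) ^ m * cnj z ^ (n - m)"
        by (simp add: power_mult_distrib mult_ac)
      then show "cnj z ^ n * (z ^ m * rep u z b) = cnj z ^ (n - m) * rep u z b"
        unfolding zz by (simp add: mult.assoc[symmetric])
    qed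
    then show ?thesis using False by (simp add: p shift_seq_def hardy_coeff_def)
  qed
  finally show "hardy_coeff (mult_op ell2 (\<lambda>z. z ^ m) u) p = shift_seq m (hardy_coeff u) p" .
qed

text \<open>Bessel's inequality, from the nonnegative square distance between \<open>f\<close> and
  its Fourier partial sum \<open>P\<close>.\<close>

lemma circle_bessel:
  fixes f :: "complex \<Rightarrow> complex"
  assumes f: "integrable circle_measure f" and f2: "integrable circle_measure (\<lambda>z. (cmod (f z))\<^sup>2)"
  shows "(\<Sum>n<N. (cmod (\<integral>z. cnj z ^ n * f z \<partial>circle_measure))\<^sup>2) \<le> (\<integral>z. (cmod (f z))\<^sup>2 \<partial>circle_measure)"
proof -
  define c where "c n = (\<integral>z. cnj z ^ n * f z \<partial>circle_measure)" for n
  define P where "P = seq_poly N c"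
  have Pz: "poly P z = (\<Sum>n<N. c n * z ^ n)" for z
    by (simp add: P_def seq_poly_def poly_sum poly_monom)
  have iP: "integrable circle_measure (\<lambda>z. cnj (poly P z) * f z)"
    by (intro circle_integrable_mult f continuous_intros)
  have iP2: "integrable circle_measure (\<lambda>z. (cmod (poly P z))\<^sup>2)"
    by (intro circle_continuous_integrable continuous_intros)
  have in': "integrable circle_measure (\<lambda>z. cnj (c n) * (cnj z ^ n * f z))" for n
    by (intro integrable_mult_right circle_integrable_mult f continuous_intros)
  have "(\<integral>z. cnj (poly P z) * f z \<partial>circle_measure) = (\<integral>z. (\<Sum>n<N. cnj (c n) * (cnj z ^ n * f z)) \<partial>circle_measure)"
    by (simp add: Pz sum_distrib_right mult.assoc)
  also have "\<dots> = (\<Sum>n<N. cnj (c n) * c n)"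
    by (simp only: Bochner_Integration.integral_sum[OF in'] integral_mult_right_zero) (simp only: c_def)
  also have "\<dots> = of_real (\<Sum>n<N. (cmod (c n))\<^sup>2)"
    unfolding of_real_sum complex_norm_square by (simp add: mult.commute)
  finally have 1: "(\<integral>z. cnj (poly P z) * f z \<partial>circle_measure) = \<dots>" .
  have "degree P \<le> N" unfolding P_def by (rule degree_seq_poly)
  then have "(\<integral>z. (cmod (poly P z))\<^sup>2 \<partial>circle_measure) = sqnorm_coeffs P"
    unfolding sqnorm_coeffs_def by (intro circle_poly_norm) simp
  then have 2: "(\<integral>z. (cmod (poly P z))\<^sup>2 \<partial>circle_measure) = (\<Sum>n<N. (cmod (c n))\<^sup>2)"
    by (simp add: P_def sqnorm_coeffs_seq_poly)
  have "0 \<le> (\<integral>z. (cmod (f z - poly P z))\<^sup>2 \<partial>circle_measure)" by simp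
  also have "\<dots> = (\<integral>z. (cmod (f z))\<^sup>2 - 2 * Re (cnj (poly P z) * f z) + (cmod (poly P z))\<^sup>2 \<partial>circle_measure)"
    by (intro Bochner_Integration.integral_cong refl) (simp only: cmod_power2, simp add: power2_eq_square algebra_simps)
  also have "\<dots> = (\<integral>z. (cmod (f z))\<^sup>2 \<partial>circle_measure) - 2 * Re (\<integral>z. cnj (poly P z) * f z \<partial>circle_measure) + (\<integral>z. (cmod (poly P z))\<^sup>2 \<partial>circle_measure)"
  proof -
    define q where "q z = cnj (poly P z) * f z" for z
    have "integrable circle_measure q" using iP by (simp add: q_def[abs_def])
    then show ?thesis
      unfolding q_def[symmetric] using f2 iP2 by simp
  qed
  also have "\<dots> = (\<integral>z. (cmod (f z))\<^sup>2 \<partial>circle_measure) - (\<Sum>n<N. (cmod (c n))\<^sup>2)"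
    unfolding 1 2 Re_complex_of_real by simp
  finally show ?thesis by (simp add: c_def)
qed

lemma hardy_coeff_bound:
  assumes u: "u \<in> carrier HS"
  shows "l2_bound (hardy_coeff u) ((\<parallel>u\<parallel>\<^bsub>HS\<^esub>)\<^sup>2)"
  unfolding l2_bound_def
proof
  fix N
  have f: "rep u \<in> L2_functions ell2" by (rule H2_L2[OF hardy_rep(1)[OF u]])
  have "sqnorm_on (nat_box N) (hardy_coeff u) = (\<Sum>b<N. \<Sum>n<N. (cmod (\<integral>z. cnj z ^ n * rep u z b \<partial>circle_measure))\<^sup>2)"
    unfolding sqnorm_on_def nat_box_def sum.cartesian_product' by (subst sum.swap) (simp add: hardy_coeff_def)
  also have "\<dots> \<le> (\<Sum>b<N. \<integral>z. (cmod (rep u z b))\<^sup>2 \<partial>circle_measure)"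
    by (intro sum_mono circle_bessel component_integrable f)
  also have "\<dots> = (\<integral>z. (\<Sum>b<N. (cmod (rep u z b))\<^sup>2) \<partial>circle_measure)"
    by (rule Bochner_Integration.integral_sum[symmetric]) (rule component_integrable(2)[OF f])
  also have "\<dots> \<le> (\<integral>z. ell2_sq (rep u z) \<partial>circle_measure)"
  proof (rule integral_mono)
    fix z assume "z \<in> space circle_measure"
    then have "rep u z \<in> carrier ell2" using hardy_rep_carrier[OF u] by simp
    then show "(\<Sum>b<N. (cmod (rep u z b))\<^sup>2) \<le> ell2_sq (rep u z)"
      unfolding ell2_sq_def by (intro sum_le_suminf) auto
  qed (intro Bochner_Integration.integrable_sum component_integrable(2)[OF f] hardy_sq_integrable u)+
  finally show "sqnorm_on (nat_box N) (hardy_coeff u) \<le> (\<parallel>u\<parallel>\<^bsub>HS\<^esub>)\<^sup>2"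
    by (simp add: hardy_norm_sq[OF u])
qed

definition hardy_unit :: "nat \<Rightarrow> nat \<Rightarrow> (complex \<Rightarrow> nat \<Rightarrow> complex) set" where
  "hardy_unit m b = ae_class ell2 (\<lambda>z n. if n = b then z ^ m else 0)"

lemma ell2_unit: "(\<lambda>n. if n = b then c else 0) \<in> carrier ell2" "ell2_sq (\<lambda>n. if n = b then c else 0) = (cmod c)\<^sup>2"
proof -
  have e: "(\<lambda>n. (cmod (if n = b then c else 0))\<^sup>2) = (\<lambda>n. if n = b then (cmod c)\<^sup>2 else 0)" by auto
  show "(\<lambda>n. if n = b then c else 0) \<in> carrier ell2" unfolding ell2_simps e by simp
  show "ell2_sq (\<lambda>n. if n = b then c else 0) = (cmod c)\<^sup>2"
    unfolding ell2_sq_def e using sums_unique[OF sums_single[of b "\<lambda>_. (cmod c)\<^sup>2"]] by simp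
qed

lemma hardy_unit_H2: "(\<lambda>z n. if n = b then z ^ m else 0) \<in> H2_functions ell2"
  unfolding H2_ell2_iff
proof (intro conjI allI impI ballI)
  show "(\<lambda>z n. if n = b then z ^ m else 0) \<in> L2_functions ell2"
    unfolding L2_ell2_iff ell2_unit(2)
  proof (intro conjI ballI allI ell2_unit(1))
    show "(\<lambda>z. if n = b then z ^ m else 0) \<in> borel_measurable circle_measure" for n
      by (cases "n = b") (auto intro!: circle_continuous_measurable continuous_intros)
    show "integrable circle_measure (\<lambda>z. (cmod (z ^ m))\<^sup>2)"
      by (intro circle_continuous_integrable continuous_intros)
  qed
  fix k :: nat and \<phi> assume k: "k > 0" and \<phi>: "\<phi> \<in> carrier (dual_space ell2)"
  have "\<phi> (\<lambda>n. if n = b then z ^ m else 0) = z ^ m * \<phi> (\<lambda>n. if n = b then 1 else 0)" for z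
    using dual_linear(2)[OF \<phi> ell2_unit(1)[of b 1], of "z ^ m"] by (simp add: if_distrib cong: if_cong)
  then have "(\<integral>z. z ^ k * \<phi> (\<lambda>n. if n = b then z ^ m else 0) \<partial>circle_measure)
     = (\<integral>z. (z ^ (k + m) * cnj z ^ 0) * \<phi> (\<lambda>n. if n = b then 1 else 0) \<partial>circle_measure)"
    by (simp add: power_add mult_ac)
  also have "\<dots> = 0"
    unfolding integral_mult_left_zero circle_moment using k by simp
  finally show "(\<integral>z. z ^ k * \<phi> (\<lambda>n. if n = b then z ^ m else 0) \<partial>circle_measure) = 0" .
qed

lemma hardy_unit_carrier: "hardy_unit m b \<in> carrier HS"
  unfolding hardy_unit_def by (rule hardy_ae_class_closed[OF hardy_unit_H2])

lemma hardy_unit_rep: "AE z in circle_measure. rep (hardy_unit m b) z = (\<lambda>n. if n = b then z ^ m else 0)"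
  unfolding hardy_unit_def by (rule rep_ae_class(2)[OF H2_L2[OF hardy_unit_H2]])

lemma hardy_unit_norm: "\<parallel>hardy_unit m b\<parallel>\<^bsub>HS\<^esub> = 1"
proof -
  have "(\<parallel>hardy_unit m b\<parallel>\<^bsub>HS\<^esub>)\<^sup>2 = (\<integral>z. ell2_sq (\<lambda>n. if n = b then z ^ m else 0) \<partial>circle_measure)"
    by (rule hardy_sq_cong[OF hardy_unit_carrier hardy_unit_rep L2_ell2D(3)[OF H2_L2[OF hardy_unit_H2]]])
  also have "\<dots> = (\<integral>z. (cmod (poly (monom 1 m) z))\<^sup>2 \<partial>circle_measure)"
    unfolding ell2_unit(2) by (simp add: poly_monom)
  also have "\<dots> = (\<Sum>i\<le>m. (cmod (coeff (monom 1 m) i))\<^sup>2)"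
    by (rule circle_poly_norm) (simp add: degree_monom_eq)
  also have "\<dots> = (\<Sum>i\<le>m. if i = m then 1 else 0)"
    by (intro sum.cong refl) (simp add: coeff_monom)
  also have "\<dots> = 1" by simp
  finally show ?thesis using hardy_norm_nonneg[of "hardy_unit m b"] by (simp add: power2_eq_1_iff)
qed

lemma hardy_coeff_unit: "hardy_coeff (hardy_unit m b) = (\<lambda>p. if p = (m, b) then 1 else 0)"
proof
  fix p :: "nat \<times> nat"
  obtain n a where p: "p = (n, a)" by (cases p)
  have "hardy_coeff (hardy_unit m b) p = (\<integral>z. cnj z ^ n * (if a = b then z ^ m else 0) \<partial>circle_measure)"
    using hardy_coeff_cong[OF hardy_unit_carrier[of m b] hardy_unit_rep[of m b], of p] component_integrable(1)[OF H2_L2[OF hardy_unit_H2]]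
    by (simp add: p)
  also have "\<dots> = (if p = (m, b) then 1 else 0)"
    using circle_moment[of m n] by (cases "a = b") (auto simp: p mult.commute)
  finally show "hardy_coeff (hardy_unit m b) p = (if p = (m, b) then 1 else 0)" .
qed

subsection \<open>Norms with the parallelogram law\<close>

lemma para_normedD:
  assumes "para_normed V"
  shows "Module.module complex_space V"
    and "x \<in> carrier V \<Longrightarrow> 0 \<le> \<parallel>x\<parallel>\<^bsub>V\<^esub>"
    and "x \<in> carrier V \<Longrightarrow> \<parallel>a \<odot>\<^bsub>V\<^esub> x\<parallel>\<^bsub>V\<^esub> = cmod a * \<parallel>x\<parallel>\<^bsub>V\<^esub>"
    and "x \<in> carrier V \<Longrightarrow> y \<in> carrier V \<Longrightarrow> \<parallel>x \<oplus>\<^bsub>V\<^esub> y\<parallel>\<^bsub>V\<^esub> \<le> \<parallel>x\<parallel>\<^bsub>V\<^esub> + \<parallel>y\<parallel>\<^bsub>V\<^esub>"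
    and "x \<in> carrier V \<Longrightarrow> y \<in> carrier V \<Longrightarrow>
      (\<parallel>x \<oplus>\<^bsub>V\<^esub> y\<parallel>\<^bsub>V\<^esub>)\<^sup>2 + (\<parallel>x \<oplus>\<^bsub>V\<^esub> (-1) \<odot>\<^bsub>V\<^esub> y\<parallel>\<^bsub>V\<^esub>)\<^sup>2 = 2 * (\<parallel>x\<parallel>\<^bsub>V\<^esub>)\<^sup>2 + 2 * (\<parallel>y\<parallel>\<^bsub>V\<^esub>)\<^sup>2"
  using assms unfolding para_normed_def by blast+

lemma para_normed_complex_module: "para_normed V \<Longrightarrow> complex_module V"
  by (rule complex_module.intro[OF para_normedD(1)])

lemma para_normed_zero:
  assumes "para_normed V" shows "\<zero>\<^bsub>V\<^esub> \<in> carrier V" "\<parallel>\<zero>\<^bsub>V\<^esub>\<parallel>\<^bsub>V\<^esub> = 0"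
proof -
  interpret complex_module V by (rule para_normed_complex_module[OF assms])
  show z: "\<zero>\<^bsub>V\<^esub> \<in> carrier V" by simp
  show "\<parallel>\<zero>\<^bsub>V\<^esub>\<parallel>\<^bsub>V\<^esub> = 0" using para_normedD(3)[OF assms z, of 0] z by simp
qed

lemma complex_space_simps [simp]:
  "carrier complex_space = UNIV" "\<zero>\<^bsub>complex_space\<^esub> = 0" "x \<oplus>\<^bsub>complex_space\<^esub> y = x + y"
  "a \<odot>\<^bsub>complex_space\<^esub> x = a * x" "\<parallel>x\<parallel>\<^bsub>complex_space\<^esub> = cmod x"
  by (simp_all add: complex_space_def)

lemma para_normed_complex_space: "para_normed complex_space"
proof -
  have "(cmod (x + y))\<^sup>2 + (cmod (x - y))\<^sup>2 = 2 * (cmod x)\<^sup>2 + 2 * (cmod y)\<^sup>2" for x y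
    unfolding cmod_power2 by (simp add: power2_eq_square algebra_simps)
  moreover have "Module.module complex_space complex_space"
    by (rule complex_moduleI) (auto simp: algebra_simps)
  ultimately show ?thesis
    unfolding para_normed_def by (auto simp: norm_mult norm_triangle_ineq)
qed

lemma bounded_opD:
  assumes "bounded_op V W T"
  shows "x \<in> carrier V \<Longrightarrow> T x \<in> carrier W"
    and "x \<in> carrier V \<Longrightarrow> y \<in> carrier V \<Longrightarrow> T (x \<oplus>\<^bsub>V\<^esub> y) = T x \<oplus>\<^bsub>W\<^esub> T y"
    and "x \<in> carrier V \<Longrightarrow> T (a \<odot>\<^bsub>V\<^esub> x) = a \<odot>\<^bsub>W\<^esub> T x"
    and "\<exists>K. \<forall>x\<in>carrier V. \<parallel>T x\<parallel>\<^bsub>W\<^esub> \<le> K * \<parallel>x\<parallel>\<^bsub>V\<^esub>"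
  using assms unfolding bounded_op_def by auto

lemma op_norm_bdd:
  assumes V: "para_normed V" and T: "bounded_op V W T"
  shows "bdd_above ((\<lambda>x. \<parallel>T x\<parallel>\<^bsub>W\<^esub>) ` {x \<in> carrier V. \<parallel>x\<parallel>\<^bsub>V\<^esub> \<le> 1})"
proof -
  obtain K where K: "\<forall>x\<in>carrier V. \<parallel>T x\<parallel>\<^bsub>W\<^esub> \<le> K * \<parallel>x\<parallel>\<^bsub>V\<^esub>" using bounded_opD(4)[OF T] by blast
  have "\<parallel>T x\<parallel>\<^bsub>W\<^esub> \<le> \<bar>K\<bar>" if "x \<in> carrier V" "\<parallel>x\<parallel>\<^bsub>V\<^esub> \<le> 1" for x
  proof -
    have "K * \<parallel>x\<parallel>\<^bsub>V\<^esub> \<le> \<bar>K\<bar> * 1" using that para_normedD(2)[OF V] by (intro mult_mono) auto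
    then show ?thesis using K that(1) by fastforce
  qed
  then show ?thesis by (intro bdd_aboveI[of _ "\<bar>K\<bar>"]) auto
qed

lemma op_norm_bound:
  assumes V: "para_normed V" and W: "para_normed W" and T: "bounded_op V W T" and x: "x \<in> carrier V"
  shows "\<parallel>T x\<parallel>\<^bsub>W\<^esub> \<le> op_norm V W T * \<parallel>x\<parallel>\<^bsub>V\<^esub>"
proof (cases "\<parallel>x\<parallel>\<^bsub>V\<^esub> = 0")
  case True
  then show ?thesis using bounded_opD(4)[OF T] x by force
next
  case False
  then have n: "\<parallel>x\<parallel>\<^bsub>V\<^esub> > 0" using para_normedD(2)[OF V x] by simp
  interpret complex_module V by (rule para_normed_complex_module[OF V])
  define y where "y = of_real (1 / \<parallel>x\<parallel>\<^bsub>V\<^esub>) \<odot>\<^bsub>V\<^esub> x"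
  have y: "y \<in> carrier V" using x by (simp add: y_def)
  have y1: "\<parallel>y\<parallel>\<^bsub>V\<^esub> \<le> 1" unfolding y_def para_normedD(3)[OF V x] using n by (simp add: norm_divide)
  have "\<parallel>T y\<parallel>\<^bsub>W\<^esub> = (1 / \<parallel>x\<parallel>\<^bsub>V\<^esub>) * \<parallel>T x\<parallel>\<^bsub>W\<^esub>"
    unfolding y_def bounded_opD(3)[OF T x] para_normedD(3)[OF W bounded_opD(1)[OF T x]] using n by (simp add: norm_divide)
  moreover have "\<parallel>T y\<parallel>\<^bsub>W\<^esub> \<le> op_norm V W T"
    unfolding op_norm_def by (rule cSUP_upper[OF _ op_norm_bdd[OF V T]]) (use y y1 in auto)
  ultimately have "\<parallel>x\<parallel>\<^bsub>V\<^esub> * ((1 / \<parallel>x\<parallel>\<^bsub>V\<^esub>) * \<parallel>T x\<parallel>\<^bsub>W\<^esub>) \<le> \<parallel>x\<parallel>\<^bsub>V\<^esub> * op_norm V W T"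
    using n by (intro mult_left_mono) auto
  then show ?thesis using n by (simp add: mult.commute)
qed

lemma op_norm_le:
  assumes V: "para_normed V" and C: "0 \<le> C" and T: "\<And>x. x \<in> carrier V \<Longrightarrow> \<parallel>T x\<parallel>\<^bsub>W\<^esub> \<le> C * \<parallel>x\<parallel>\<^bsub>V\<^esub>"
  shows "op_norm V W T \<le> C"
  unfolding op_norm_def
proof (rule cSUP_least)
  show "{x \<in> carrier V. \<parallel>x\<parallel>\<^bsub>V\<^esub> \<le> 1} \<noteq> {}" using para_normed_zero[OF V] by auto
  fix x assume "x \<in> {x \<in> carrier V. \<parallel>x\<parallel>\<^bsub>V\<^esub> \<le> 1}"
  then have x: "x \<in> carrier V" "\<parallel>x\<parallel>\<^bsub>V\<^esub> \<le> 1" by auto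
  show "\<parallel>T x\<parallel>\<^bsub>W\<^esub> \<le> C" using T[OF x(1)] mult_left_mono[OF x(2) C] by simp
qed

text \<open>Allows a supremum to be taken in an inequality that is known for each vector of the unit
  ball; the factor \<open>t\<close> may vanish.\<close>

lemma op_norm_scaled_le:
  assumes V: "para_normed V" and t: "0 \<le> t" and c: "\<And>x. x \<in> carrier V \<Longrightarrow> \<parallel>x\<parallel>\<^bsub>V\<^esub> \<le> 1 \<Longrightarrow> t * \<parallel>T x\<parallel>\<^bsub>W\<^esub> \<le> c"
  shows "t * op_norm V W T \<le> c"
proof (cases "t = 0")
  case True
  then show ?thesis using c[OF para_normed_zero(1)[OF V]] para_normed_zero(2)[OF V] by simp
next
  case False
  then have t: "t > 0" using t by simp
  have "op_norm V W T \<le> c / t"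
    unfolding op_norm_def
  proof (rule cSUP_least)
    show "{x \<in> carrier V. \<parallel>x\<parallel>\<^bsub>V\<^esub> \<le> 1} \<noteq> {}" using para_normed_zero[OF V] by auto
    show "\<parallel>T x\<parallel>\<^bsub>W\<^esub> \<le> c / t" if "x \<in> {x \<in> carrier V. \<parallel>x\<parallel>\<^bsub>V\<^esub> \<le> 1}" for x
      using c[of x] that t by (simp add: pos_le_divide_eq mult.commute)
  qed
  then show ?thesis using t by (simp add: pos_le_divide_eq mult.commute)
qed

lemma op_norm_nonneg:
  assumes V: "para_normed V" and W: "para_normed W" and T: "bounded_op V W T"
  shows "0 \<le> op_norm V W T"
proof -
  have "\<parallel>T \<zero>\<^bsub>V\<^esub>\<parallel>\<^bsub>W\<^esub> \<le> op_norm V W T"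
    unfolding op_norm_def by (rule cSUP_upper[OF _ op_norm_bdd[OF V T]]) (use para_normed_zero[OF V] in auto)
  then show ?thesis
    using para_normedD(2)[OF W bounded_opD(1)[OF T para_normed_zero(1)[OF V]]] by simp
qed

section \<open>The dual norm and its parallelogram law\<close>

lemma dual_simps:
  "\<phi> \<in> carrier (dual_space V) \<longleftrightarrow> \<phi> \<in> extensional (carrier V) \<and> bounded_op V complex_space \<phi>"
  "\<zero>\<^bsub>dual_space V\<^esub> = (\<lambda>x\<in>carrier V. 0)" "\<phi> \<oplus>\<^bsub>dual_space V\<^esub> \<psi> = (\<lambda>x\<in>carrier V. \<phi> x + \<psi> x)"
  "a \<odot>\<^bsub>dual_space V\<^esub> \<phi> = (\<lambda>x\<in>carrier V. a * \<phi> x)" "\<parallel>\<phi>\<parallel>\<^bsub>dual_space V\<^esub> = op_norm V complex_space \<phi>"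
  by (simp_all add: dual_space_def)

lemma dual_intro:
  assumes V: "para_normed V"
    and "\<And>x y. x \<in> carrier V \<Longrightarrow> y \<in> carrier V \<Longrightarrow> F (x \<oplus>\<^bsub>V\<^esub> y) = F x + F y"
    and "\<And>a x. x \<in> carrier V \<Longrightarrow> F (a \<odot>\<^bsub>V\<^esub> x) = a * F x"
    and "\<And>x. x \<in> carrier V \<Longrightarrow> cmod (F x) \<le> K * \<parallel>x\<parallel>\<^bsub>V\<^esub>"
  shows "(\<lambda>x\<in>carrier V. F x) \<in> carrier (dual_space V)"
proof -
  interpret complex_module V by (rule para_normed_complex_module[OF V])
  show ?thesis
    unfolding dual_simps(1) bounded_op_def using assms by (auto intro!: exI[of _ K])
qed

lemma dual_bound:
  assumes "para_normed V" "\<phi> \<in> carrier (dual_space V)" "x \<in> carrier V"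
  shows "cmod (\<phi> x) \<le> \<parallel>\<phi>\<parallel>\<^bsub>dual_space V\<^esub> * \<parallel>x\<parallel>\<^bsub>V\<^esub>"
  using op_norm_bound[OF assms(1) para_normed_complex_space _ assms(3), of \<phi>] assms(2) by (simp add: dual_simps)

lemma dual_norm_nonneg:
  assumes "para_normed V" "\<phi> \<in> carrier (dual_space V)" shows "0 \<le> \<parallel>\<phi>\<parallel>\<^bsub>dual_space V\<^esub>"
  using op_norm_nonneg[OF assms(1) para_normed_complex_space] assms(2) by (simp add: dual_simps)

lemma dual_add_closed:
  assumes V: "para_normed V" and p: "\<phi> \<in> carrier (dual_space V)" and q: "\<psi> \<in> carrier (dual_space V)"
  shows "\<phi> \<oplus>\<^bsub>dual_space V\<^esub> \<psi> \<in> carrier (dual_space V)"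
  unfolding dual_simps(3)
proof (rule dual_intro[OF V])
  fix x assume x: "x \<in> carrier V"
  show "cmod (\<phi> x + \<psi> x) \<le> (\<parallel>\<phi>\<parallel>\<^bsub>dual_space V\<^esub> + \<parallel>\<psi>\<parallel>\<^bsub>dual_space V\<^esub>) * \<parallel>x\<parallel>\<^bsub>V\<^esub>"
    using norm_triangle_ineq[of "\<phi> x" "\<psi> x"] dual_bound[OF V p x] dual_bound[OF V q x] by (simp add: distrib_right)
qed (simp_all add: dual_linear[OF p] dual_linear[OF q] algebra_simps)

lemma dual_smult_closed:
  assumes V: "para_normed V" and p: "\<phi> \<in> carrier (dual_space V)"
  shows "a \<odot>\<^bsub>dual_space V\<^esub> \<phi> \<in> carrier (dual_space V)"
  unfolding dual_simps(4)
proof (rule dual_intro[OF V])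
  fix x assume x: "x \<in> carrier V"
  show "cmod (a * \<phi> x) \<le> (cmod a * \<parallel>\<phi>\<parallel>\<^bsub>dual_space V\<^esub>) * \<parallel>x\<parallel>\<^bsub>V\<^esub>"
    using mult_left_mono[OF dual_bound[OF V p x], of "cmod a"] by (simp add: norm_mult)
qed (simp_all add: dual_linear[OF p] algebra_simps)

lemma dual_eqI:
  assumes "\<phi> \<in> carrier (dual_space V)" "\<psi> \<in> carrier (dual_space V)" "\<And>x. x \<in> carrier V \<Longrightarrow> \<phi> x = \<psi> x"
  shows "\<phi> = \<psi>"
  using assms by (auto simp: dual_simps intro: extensionalityI)

lemma module_dual:
  assumes V: "para_normed V" shows "Module.module complex_space (dual_space V)"
proof (rule complex_moduleI)
  show z: "\<zero>\<^bsub>dual_space V\<^esub> \<in> carrier (dual_space V)"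
    unfolding dual_simps(2) by (rule dual_intro[OF V, of _ 0]) simp_all
qed ((rule dual_add_closed[OF V]; assumption) | (rule dual_smult_closed[OF V]; assumption) |
    (simp add: dual_simps restrict_def extensional_def fun_eq_iff algebra_simps))+

text \<open>The inequality for \<open>a\<close> together with the same inequality for
  \<open>inverse a\<close>.\<close>

lemma dual_norm_smult:
  assumes V: "para_normed V" and p: "\<phi> \<in> carrier (dual_space V)"
  shows "\<parallel>a \<odot>\<^bsub>dual_space V\<^esub> \<phi>\<parallel>\<^bsub>dual_space V\<^esub> = cmod a * \<parallel>\<phi>\<parallel>\<^bsub>dual_space V\<^esub>"
proof -
  have le: "\<parallel>a \<odot>\<^bsub>dual_space V\<^esub> \<phi>\<parallel>\<^bsub>dual_space V\<^esub> \<le> cmod a * \<parallel>\<phi>\<parallel>\<^bsub>dual_space V\<^esub>" if p: "\<phi> \<in> carrier (dual_space V)" for a \<phi>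
    unfolding dual_simps(5)[of V "a \<odot>\<^bsub>dual_space V\<^esub> \<phi>"]
  proof (rule op_norm_le[OF V])
    fix x assume x: "x \<in> carrier V"
    show "\<parallel>(a \<odot>\<^bsub>dual_space V\<^esub> \<phi>) x\<parallel>\<^bsub>complex_space\<^esub> \<le> cmod a * \<parallel>\<phi>\<parallel>\<^bsub>dual_space V\<^esub> * \<parallel>x\<parallel>\<^bsub>V\<^esub>"
      using mult_left_mono[OF dual_bound[OF V p x], of "cmod a"] x by (simp add: dual_simps(4) norm_mult)
  qed (simp add: dual_norm_nonneg[OF V p])
  show ?thesis
  proof (cases "a = 0")
    case True
    then show ?thesis using le[OF p, of 0] dual_norm_nonneg[OF V dual_smult_closed[OF V p, of 0]] by simp
  next
    case False
    interpret D: complex_module "dual_space V" by (rule complex_module.intro[OF module_dual[OF V]])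
    have "inverse a \<odot>\<^bsub>dual_space V\<^esub> (a \<odot>\<^bsub>dual_space V\<^esub> \<phi>) = \<phi>"
      using p False by (simp add: D.smult_mult)
    then have "\<parallel>\<phi>\<parallel>\<^bsub>dual_space V\<^esub> \<le> cmod (inverse a) * \<parallel>a \<odot>\<^bsub>dual_space V\<^esub> \<phi>\<parallel>\<^bsub>dual_space V\<^esub>"
      using le[OF dual_smult_closed[OF V p, of a], of "inverse a"] by simp
    then have "cmod a * \<parallel>\<phi>\<parallel>\<^bsub>dual_space V\<^esub> \<le> \<parallel>a \<odot>\<^bsub>dual_space V\<^esub> \<phi>\<parallel>\<^bsub>dual_space V\<^esub>"
      using False by (simp add: norm_divide inverse_eq_divide field_simps)
    then show ?thesis using le[OF p, of a] by simp
  qed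
qed

lemma unimodular_rotation:
  obtains u where "cmod u = 1" "u * c = of_real (cmod c)"
proof (cases "c = 0")
  case True
  then show ?thesis by (intro that[of 1]) auto
next
  case False
  have "cnj c / of_real (cmod c) * c = of_real (cmod c)"
    using False complex_norm_square[of c] by (simp add: mult.commute power2_eq_square field_simps)
  then show ?thesis using False by (intro that[of "cnj c / of_real (cmod c)"]) (auto simp: norm_divide)
qed

text \<open>For vectors \<open>X\<close> and \<open>Y\<close> the value of
  \<open>\<phi> + \<psi>\<close> at \<open>X\<close> plus that of \<open>\<phi> - \<psi>\<close> at
  \<open>Y\<close> equals \<open>\<phi>(X + Y) + \<psi>(X - Y)\<close>. Cauchy-Schwarz in the plane
  and the parallelogram law of \<open>V\<close> bound this by \<open>sqrt N\<close> times the root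
  of \<open>2 |X|^2 + 2 |Y|^2\<close>.\<close>

lemma dual_parallelogram_le:
  assumes V: "para_normed V" and p: "\<phi> \<in> carrier (dual_space V)" and q: "\<psi> \<in> carrier (dual_space V)"
  shows "(\<parallel>\<phi> \<oplus>\<^bsub>dual_space V\<^esub> \<psi>\<parallel>\<^bsub>dual_space V\<^esub>)\<^sup>2 + (\<parallel>\<phi> \<oplus>\<^bsub>dual_space V\<^esub> (-1) \<odot>\<^bsub>dual_space V\<^esub> \<psi>\<parallel>\<^bsub>dual_space V\<^esub>)\<^sup>2
     \<le> 2 * (\<parallel>\<phi>\<parallel>\<^bsub>dual_space V\<^esub>)\<^sup>2 + 2 * (\<parallel>\<psi>\<parallel>\<^bsub>dual_space V\<^esub>)\<^sup>2"
proof -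
  interpret complex_module V by (rule para_normed_complex_module[OF V])
  define F G where "F = \<phi> \<oplus>\<^bsub>dual_space V\<^esub> \<psi>" and "G = \<phi> \<oplus>\<^bsub>dual_space V\<^esub> (-1) \<odot>\<^bsub>dual_space V\<^esub> \<psi>"
  have F: "F \<in> carrier (dual_space V)" unfolding F_def by (rule dual_add_closed[OF V p q])
  have G: "G \<in> carrier (dual_space V)" unfolding G_def by (intro dual_add_closed[OF V p] dual_smult_closed[OF V q])
  have Fx: "F x = \<phi> x + \<psi> x" and Gx: "G x = \<phi> x - \<psi> x" if "x \<in> carrier V" for x
    using that by (simp_all add: F_def G_def dual_simps)
  define a b N where "a = op_norm V complex_space F" and "b = op_norm V complex_space G"
    and "N = (\<parallel>\<phi>\<parallel>\<^bsub>dual_space V\<^esub>)\<^sup>2 + (\<parallel>\<psi>\<parallel>\<^bsub>dual_space V\<^esub>)\<^sup>2"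
  have ab: "0 \<le> a" "0 \<le> b"
    using dual_norm_nonneg[OF V F] dual_norm_nonneg[OF V G] by (simp_all add: a_def b_def dual_simps(5))
  have N0: "0 \<le> N" by (simp add: N_def)
  have key: "a * cmod (F x) + b * cmod (G y) \<le> sqrt N * sqrt (2 * a\<^sup>2 + 2 * b\<^sup>2)"
    if x: "x \<in> carrier V" "\<parallel>x\<parallel>\<^bsub>V\<^esub> \<le> 1" and y: "y \<in> carrier V" "\<parallel>y\<parallel>\<^bsub>V\<^esub> \<le> 1" for x y
  proof -
    obtain u where u: "cmod u = 1" "u * F x = of_real (cmod (F x))" by (rule unimodular_rotation)
    obtain v where v: "cmod v = 1" "v * G y = of_real (cmod (G y))" by (rule unimodular_rotation)
    \<comment> \<open>The phases make both values real and nonnegative. Scaling by the norms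
      \<open>a\<close> and \<open>b\<close> of the two functionals makes the left side tend to
      \<open>a^2 + b^2\<close> for nearly extremal \<open>x\<close> and \<open>y\<close>.\<close>
    define X Y where "X = (of_real a * u) \<odot>\<^bsub>V\<^esub> x" and "Y = (of_real b * v) \<odot>\<^bsub>V\<^esub> y"
    have XY: "X \<in> carrier V" "Y \<in> carrier V" using x y by (simp_all add: X_def Y_def)
    have mY: "(-1) \<odot>\<^bsub>V\<^esub> Y \<in> carrier V" using XY by simp
    have nX: "\<parallel>X\<parallel>\<^bsub>V\<^esub> \<le> a" unfolding X_def para_normedD(3)[OF V x(1)] using u ab x by (simp add: norm_mult mult_left_le)
    have nY: "\<parallel>Y\<parallel>\<^bsub>V\<^esub> \<le> b" unfolding Y_def para_normedD(3)[OF V y(1)] using v ab y by (simp add: norm_mult mult_left_le)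
    have "F X = of_real a * (u * F x)" unfolding X_def dual_linear(2)[OF F x(1)] by simp
    then have FX: "F X = of_real (a * cmod (F x))" by (simp add: u)
    have "G Y = of_real b * (v * G y)" unfolding Y_def dual_linear(2)[OF G y(1)] by simp
    then have GY: "G Y = of_real (b * cmod (G y))" by (simp add: v)
    have "F X + G Y = \<phi> (X \<oplus>\<^bsub>V\<^esub> Y) + \<psi> (X \<oplus>\<^bsub>V\<^esub> (-1) \<odot>\<^bsub>V\<^esub> Y)"
      unfolding dual_linear(1)[OF p XY] dual_linear(1)[OF q XY(1) mY] dual_linear(2)[OF q XY(2)] Fx[OF XY(1)] Gx[OF XY(2)] by simp
    moreover have "F X + G Y = of_real (a * cmod (F x) + b * cmod (G y))" by (simp add: FX GY)
    ultimately have "a * cmod (F x) + b * cmod (G y) = cmod (\<phi> (X \<oplus>\<^bsub>V\<^esub> Y) + \<psi> (X \<oplus>\<^bsub>V\<^esub> (-1) \<odot>\<^bsub>V\<^esub> Y))"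
      using ab by (metis norm_of_real abs_of_nonneg add_nonneg_nonneg mult_nonneg_nonneg norm_ge_zero)
    also have "\<dots> \<le> \<parallel>\<phi>\<parallel>\<^bsub>dual_space V\<^esub> * \<parallel>X \<oplus>\<^bsub>V\<^esub> Y\<parallel>\<^bsub>V\<^esub> + \<parallel>\<psi>\<parallel>\<^bsub>dual_space V\<^esub> * \<parallel>X \<oplus>\<^bsub>V\<^esub> (-1) \<odot>\<^bsub>V\<^esub> Y\<parallel>\<^bsub>V\<^esub>"
      using XY mY by (intro order_trans[OF norm_triangle_ineq] add_mono dual_bound[OF V] p q) auto
    also have "\<dots> \<le> sqrt N * sqrt ((\<parallel>X \<oplus>\<^bsub>V\<^esub> Y\<parallel>\<^bsub>V\<^esub>)\<^sup>2 + (\<parallel>X \<oplus>\<^bsub>V\<^esub> (-1) \<odot>\<^bsub>V\<^esub> Y\<parallel>\<^bsub>V\<^esub>)\<^sup>2)"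
    proof -
      have cs: "p * x + q * y \<le> sqrt (p\<^sup>2 + q\<^sup>2) * sqrt (x\<^sup>2 + y\<^sup>2)" for p q x y :: real
      proof -
        have "(p * x + q * y)\<^sup>2 \<le> (p\<^sup>2 + q\<^sup>2) * (x\<^sup>2 + y\<^sup>2)"
          using zero_le_power2[of "p * y - q * x"] by (simp add: power2_eq_square algebra_simps)
        then have "p * x + q * y \<le> sqrt ((p\<^sup>2 + q\<^sup>2) * (x\<^sup>2 + y\<^sup>2))" by (rule real_le_rsqrt)
        then show ?thesis by (simp add: real_sqrt_mult)
      qed
      show ?thesis unfolding N_def by (rule cs)
    qed
    also have "\<dots> = sqrt N * sqrt (2 * (\<parallel>X\<parallel>\<^bsub>V\<^esub>)\<^sup>2 + 2 * (\<parallel>Y\<parallel>\<^bsub>V\<^esub>)\<^sup>2)"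
      by (simp only: para_normedD(5)[OF V XY])
    also have "\<dots> \<le> sqrt N * sqrt (2 * a\<^sup>2 + 2 * b\<^sup>2)"
      using nX nY para_normedD(2)[OF V XY(1)] para_normedD(2)[OF V XY(2)] N0
      by (intro mult_left_mono real_sqrt_le_mono add_mono power_mono) auto
    finally show ?thesis .
  qed
  \<comment> \<open>The supremum is taken over \<open>x\<close> with \<open>y\<close> fixed, and
    then over \<open>y\<close>.\<close>
  have "a * a \<le> sqrt N * sqrt (2 * a\<^sup>2 + 2 * b\<^sup>2) - b * b"
  proof -
    have 1: "b * cmod (G y) \<le> sqrt N * sqrt (2 * a\<^sup>2 + 2 * b\<^sup>2) - a * a" if y: "y \<in> carrier V" "\<parallel>y\<parallel>\<^bsub>V\<^esub> \<le> 1" for y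
    proof -
      have "a * op_norm V complex_space F \<le> sqrt N * sqrt (2 * a\<^sup>2 + 2 * b\<^sup>2) - b * cmod (G y)"
        by (rule op_norm_scaled_le[OF V ab(1)]) (use key[OF _ _ y] in force)
      then show ?thesis by (simp add: a_def)
    qed
    have "b * op_norm V complex_space G \<le> sqrt N * sqrt (2 * a\<^sup>2 + 2 * b\<^sup>2) - a * a"
      by (rule op_norm_scaled_le[OF V ab(2)]) (use 1 in simp)
    then show ?thesis by (simp add: b_def)
  qed
  then have le: "a\<^sup>2 + b\<^sup>2 \<le> sqrt N * sqrt (2 * (a\<^sup>2 + b\<^sup>2))" by (simp add: power2_eq_square)
  have "a\<^sup>2 + b\<^sup>2 \<le> 2 * N"
  proof (cases "a\<^sup>2 + b\<^sup>2 = 0")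
    case False
    then have pos: "0 < a\<^sup>2 + b\<^sup>2" by (simp add: order_less_le)
    have "(a\<^sup>2 + b\<^sup>2)\<^sup>2 \<le> (sqrt N * sqrt (2 * (a\<^sup>2 + b\<^sup>2)))\<^sup>2" using le pos by (intro power_mono) auto
    also have "\<dots> = 2 * N * (a\<^sup>2 + b\<^sup>2)" using N0 pos by (simp add: power_mult_distrib)
    finally show ?thesis using pos by (simp add: power2_eq_square[of "a\<^sup>2 + b\<^sup>2"])
  qed (use N0 in simp)
  then show ?thesis by (simp add: a_def b_def N_def F_def G_def dual_simps(5))
qed

text \<open>Equality in the parallelogram law comes from applying the inequality a second time, to
  \<open>p + q\<close> and \<open>p - q\<close>, whose sum and difference are \<open>2 p\<close> and
  \<open>2 q\<close>.\<close>

lemma para_normed_dual: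
  assumes V: "para_normed V" shows "para_normed (dual_space V)"
  unfolding para_normed_def
proof (intro conjI ballI allI module_dual[OF V] dual_norm_nonneg[OF V] dual_norm_smult[OF V])
  interpret D: complex_module "dual_space V" by (rule complex_module.intro[OF module_dual[OF V]])
  fix p q assume p: "p \<in> carrier (dual_space V)" and q: "q \<in> carrier (dual_space V)"
  show "\<parallel>p \<oplus>\<^bsub>dual_space V\<^esub> q\<parallel>\<^bsub>dual_space V\<^esub> \<le> \<parallel>p\<parallel>\<^bsub>dual_space V\<^esub> + \<parallel>q\<parallel>\<^bsub>dual_space V\<^esub>"
    unfolding dual_simps(5)[of V "p \<oplus>\<^bsub>dual_space V\<^esub> q"]
  proof (rule op_norm_le[OF V])
    fix x assume x: "x \<in> carrier V"
    show "\<parallel>(p \<oplus>\<^bsub>dual_space V\<^esub> q) x\<parallel>\<^bsub>complex_space\<^esub> \<le> (\<parallel>p\<parallel>\<^bsub>dual_space V\<^esub> + \<parallel>q\<parallel>\<^bsub>dual_space V\<^esub>) * \<parallel>x\<parallel>\<^bsub>V\<^esub>"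
      using norm_triangle_ineq[of "p x" "q x"] dual_bound[OF V p x] dual_bound[OF V q x] x by (simp add: dual_simps(3) distrib_right)
  qed (simp add: dual_norm_nonneg[OF V] p q)
  define s d where "s = p \<oplus>\<^bsub>dual_space V\<^esub> q" and "d = p \<oplus>\<^bsub>dual_space V\<^esub> (-1) \<odot>\<^bsub>dual_space V\<^esub> q"
  have s: "s \<in> carrier (dual_space V)" and d: "d \<in> carrier (dual_space V)" using p q by (simp_all add: s_def d_def)
  have "s \<oplus>\<^bsub>dual_space V\<^esub> d = 2 \<odot>\<^bsub>dual_space V\<^esub> p"
    by (rule dual_eqI[OF D.M.a_closed[OF s d] D.smult_closed[OF p]]) (simp add: s_def d_def dual_simps(3,4))
  moreover have "s \<oplus>\<^bsub>dual_space V\<^esub> (-1) \<odot>\<^bsub>dual_space V\<^esub> d = 2 \<odot>\<^bsub>dual_space V\<^esub> q"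
    by (rule dual_eqI[OF D.M.a_closed[OF s D.smult_closed[OF d]] D.smult_closed[OF q]]) (simp add: s_def d_def dual_simps(3,4))
  ultimately have "(2 * \<parallel>p\<parallel>\<^bsub>dual_space V\<^esub>)\<^sup>2 + (2 * \<parallel>q\<parallel>\<^bsub>dual_space V\<^esub>)\<^sup>2 \<le> 2 * (\<parallel>s\<parallel>\<^bsub>dual_space V\<^esub>)\<^sup>2 + 2 * (\<parallel>d\<parallel>\<^bsub>dual_space V\<^esub>)\<^sup>2"
    using dual_parallelogram_le[OF V s d] by (simp add: dual_norm_smult[OF V p] dual_norm_smult[OF V q])
  then show "(\<parallel>p \<oplus>\<^bsub>dual_space V\<^esub> q\<parallel>\<^bsub>dual_space V\<^esub>)\<^sup>2 + (\<parallel>p \<oplus>\<^bsub>dual_space V\<^esub> (-1) \<odot>\<^bsub>dual_space V\<^esub> q\<parallel>\<^bsub>dual_space V\<^esub>)\<^sup>2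
      = 2 * (\<parallel>p\<parallel>\<^bsub>dual_space V\<^esub>)\<^sup>2 + 2 * (\<parallel>q\<parallel>\<^bsub>dual_space V\<^esub>)\<^sup>2"
    using dual_parallelogram_le[OF V p q] by (simp add: s_def d_def power_mult_distrib)
qed

lemma direct_sum_simps [simp]:
  "p \<in> carrier (direct_sum V W) \<longleftrightarrow> fst p \<in> carrier V \<and> snd p \<in> carrier W"
  "\<zero>\<^bsub>direct_sum V W\<^esub> = (\<zero>\<^bsub>V\<^esub>, \<zero>\<^bsub>W\<^esub>)"
  "p \<oplus>\<^bsub>direct_sum V W\<^esub> q = (fst p \<oplus>\<^bsub>V\<^esub> fst q, snd p \<oplus>\<^bsub>W\<^esub> snd q)"
  "a \<odot>\<^bsub>direct_sum V W\<^esub> p = (a \<odot>\<^bsub>V\<^esub> fst p, a \<odot>\<^bsub>W\<^esub> snd p)"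
  by (simp_all add: direct_sum_def mem_Times_iff)

lemma direct_sum_norm: "\<parallel>p\<parallel>\<^bsub>direct_sum V W\<^esub> = sqrt ((\<parallel>fst p\<parallel>\<^bsub>V\<^esub>)\<^sup>2 + (\<parallel>snd p\<parallel>\<^bsub>W\<^esub>)\<^sup>2)"
  by (simp add: direct_sum_def)

lemma direct_sum_norm_sq: "(\<parallel>p\<parallel>\<^bsub>direct_sum V W\<^esub>)\<^sup>2 = (\<parallel>fst p\<parallel>\<^bsub>V\<^esub>)\<^sup>2 + (\<parallel>snd p\<parallel>\<^bsub>W\<^esub>)\<^sup>2"
  by (simp add: direct_sum_norm)

lemma para_normed_direct_sum:
  assumes V: "para_normed V" and W: "para_normed W" shows "para_normed (direct_sum V W)"
  unfolding para_normed_def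
proof (intro conjI ballI allI)
  interpret V: complex_module V by (rule para_normed_complex_module[OF V])
  interpret W: complex_module W by (rule para_normed_complex_module[OF W])
  show "Module.module complex_space (direct_sum V W)"
    by (rule complex_moduleI)
       (auto simp: V.M.a_ac W.M.a_ac V.dist1 W.dist1 V.dist2 W.dist2 V.smult_mult W.smult_mult)
  fix p assume p: "p \<in> carrier (direct_sum V W)"
  show "0 \<le> \<parallel>p\<parallel>\<^bsub>direct_sum V W\<^esub>" by (simp add: direct_sum_norm)
  fix a
  show "\<parallel>a \<odot>\<^bsub>direct_sum V W\<^esub> p\<parallel>\<^bsub>direct_sum V W\<^esub> = cmod a * \<parallel>p\<parallel>\<^bsub>direct_sum V W\<^esub>"
    using p by (simp add: direct_sum_norm para_normedD(3)[OF V] para_normedD(3)[OF W] power_mult_distrib real_sqrt_mult flip: distrib_left)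
next
  interpret V: complex_module V by (rule para_normed_complex_module[OF V])
  interpret W: complex_module W by (rule para_normed_complex_module[OF W])
  fix p q assume pq: "p \<in> carrier (direct_sum V W)" "q \<in> carrier (direct_sum V W)"
  have "\<parallel>p \<oplus>\<^bsub>direct_sum V W\<^esub> q\<parallel>\<^bsub>direct_sum V W\<^esub>
     \<le> sqrt ((\<parallel>fst p\<parallel>\<^bsub>V\<^esub> + \<parallel>fst q\<parallel>\<^bsub>V\<^esub>)\<^sup>2 + (\<parallel>snd p\<parallel>\<^bsub>W\<^esub> + \<parallel>snd q\<parallel>\<^bsub>W\<^esub>)\<^sup>2)"
    using pq unfolding direct_sum_norm
    by (intro real_sqrt_le_mono add_mono power_mono) (auto intro: para_normedD(2,4)[OF V] para_normedD(2,4)[OF W])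
  also have "\<dots> \<le> \<parallel>p\<parallel>\<^bsub>direct_sum V W\<^esub> + \<parallel>q\<parallel>\<^bsub>direct_sum V W\<^esub>"
    unfolding direct_sum_norm by (rule real_sqrt_sum_squares_triangle_ineq)
  finally show "\<parallel>p \<oplus>\<^bsub>direct_sum V W\<^esub> q\<parallel>\<^bsub>direct_sum V W\<^esub> \<le> \<parallel>p\<parallel>\<^bsub>direct_sum V W\<^esub> + \<parallel>q\<parallel>\<^bsub>direct_sum V W\<^esub>" .
  show "(\<parallel>p \<oplus>\<^bsub>direct_sum V W\<^esub> q\<parallel>\<^bsub>direct_sum V W\<^esub>)\<^sup>2 + (\<parallel>p \<oplus>\<^bsub>direct_sum V W\<^esub> (-1) \<odot>\<^bsub>direct_sum V W\<^esub> q\<parallel>\<^bsub>direct_sum V W\<^esub>)\<^sup>2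
      = 2 * (\<parallel>p\<parallel>\<^bsub>direct_sum V W\<^esub>)\<^sup>2 + 2 * (\<parallel>q\<parallel>\<^bsub>direct_sum V W\<^esub>)\<^sup>2"
    using pq para_normedD(5)[OF V, of "fst p" "fst q"] para_normedD(5)[OF W, of "snd p" "snd q"]
    by (simp add: direct_sum_norm_sq)
qed

text \<open>The deviation \<open>E\<close> from linearity is additive and zero at the integers,
  hence determined by the fractional part and bounded. Since \<open>E (n t) = n E t\<close>, it is
  zero.\<close>

lemma real_additive_bounded_linear:
  fixes F :: "real \<Rightarrow> real"
  assumes add: "\<And>s t. F (s + t) = F s + F t" and bd: "\<And>t. \<bar>t\<bar> \<le> 1 \<Longrightarrow> \<bar>F t\<bar> \<le> C"
  shows "F t = t * F 1"
proof -
  define E where "E t = F t - t * F 1" for t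
  have E_add: "E (s + t) = E s + E t" for s t by (simp add: E_def add algebra_simps)
  have E0: "E 0 = 0" using E_add[of 0 0] by simp
  have E_nat: "E (of_nat n * t) = of_nat n * E t" for n t
    by (induction n) (simp_all add: E0 E_add distrib_right)
  have E_neg: "E (- t) = - E t" for t using E_add[of t "- t"] E0 by simp
  have E1: "E 1 = 0" by (simp add: E_def)
  have E_int: "E (of_int k) = 0" for k
  proof (cases "k \<ge> 0")
    case True
    then show ?thesis using E_nat[of "nat k" 1] E1 by simp
  next
    case False
    then show ?thesis using E_nat[of "nat (- k)" 1] E1 E_neg[of "of_int k"] by simp
  qed
  have Ebd: "\<bar>E t\<bar> \<le> \<bar>C\<bar> + \<bar>F 1\<bar>" for t
  proof -
    have "E t = E (frac t)" using E_add[of "of_int \<lfloor>t\<rfloor>" "frac t"] E_int[of "\<lfloor>t\<rfloor>"] by (simp add: frac_def)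
    moreover have f: "\<bar>frac t\<bar> \<le> 1" using frac_ge_0[of t] frac_lt_1[of t] by simp
    have "\<bar>frac t * F 1\<bar> \<le> 1 * \<bar>F 1\<bar>" unfolding abs_mult using f by (intro mult_right_mono) auto
    then have "\<bar>E (frac t)\<bar> \<le> \<bar>C\<bar> + \<bar>F 1\<bar>" using bd[OF f] unfolding E_def by linarith
    ultimately show ?thesis by simp
  qed
  have "E t = 0"
  proof (rule ccontr)
    assume "E t \<noteq> 0"
    then obtain n where n: "\<bar>C\<bar> + \<bar>F 1\<bar> < of_nat n * \<bar>E t\<bar>" using reals_Archimedean3[of "\<bar>E t\<bar>"] by auto
    show False using Ebd[of "of_nat n * t"] n unfolding E_nat by (simp add: abs_mult)
  qed
  then show ?thesis by (simp add: E_def)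
qed

section \<open>The real inner product of a norm with the parallelogram law (Jordan and von
  Neumann)\<close>

locale para_space = complex_module +
  assumes para: "para_normed V"
begin

definition nsq :: "'a \<Rightarrow> real" where "nsq x = (\<parallel>x\<parallel>)\<^sup>2"

text \<open>The real part of the inner product, recovered from the norm by polarization.\<close>

definition rip :: "'a \<Rightarrow> 'a \<Rightarrow> real" where
  "rip x y = (nsq (x \<oplus> y) - nsq (x \<oplus> (-1) \<odot> y)) / 4"

lemma nsq_scale: "x \<in> carrier V \<Longrightarrow> nsq (a \<odot> x) = (cmod a)\<^sup>2 * nsq x"
  by (simp add: nsq_def para_normedD(3)[OF para] power_mult_distrib)

lemma nsq_nonneg: "0 \<le> nsq x" by (simp add: nsq_def)

lemma nsq_parallelogram:
  "x \<in> carrier V \<Longrightarrow> y \<in> carrier V \<Longrightarrow> nsq (x \<oplus> y) + nsq (x \<oplus> (-1) \<odot> y) = 2 * nsq x + 2 * nsq y"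
  unfolding nsq_def by (rule para_normedD(5)[OF para])

lemma nsq_zero [simp]: "nsq \<zero> = 0" by (simp add: nsq_def para_normed_zero[OF para])

text \<open>A normal form for combinations of three vectors, which turns identities between vectors
  into identities between coefficients.\<close>

definition lc3 :: "'a \<Rightarrow> 'a \<Rightarrow> 'a \<Rightarrow> complex \<Rightarrow> complex \<Rightarrow> complex \<Rightarrow> 'a" where
  "lc3 x y z a b c = a \<odot> x \<oplus> (b \<odot> y \<oplus> c \<odot> z)"

lemma lc3_closed: "x \<in> carrier V \<Longrightarrow> y \<in> carrier V \<Longrightarrow> z \<in> carrier V \<Longrightarrow> lc3 x y z a b c \<in> carrier V"
  by (simp add: lc3_def)

lemma lc3_add:
  assumes "x \<in> carrier V" "y \<in> carrier V" "z \<in> carrier V"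
  shows "lc3 x y z a b c \<oplus> lc3 x y z a' b' c' = lc3 x y z (a + a') (b + b') (c + c')"
  unfolding lc3_def using assms by (simp add: dist1 M.a_ac)

lemma lc3_smult:
  assumes "x \<in> carrier V" "y \<in> carrier V" "z \<in> carrier V"
  shows "d \<odot> lc3 x y z a b c = lc3 x y z (d * a) (d * b) (d * c)"
  unfolding lc3_def using assms by (simp add: dist2 smult_mult)

lemma double_minus:
  assumes w: "w \<in> carrier V" and y: "y \<in> carrier V"
  shows "w \<oplus> s \<odot> y = 2 \<odot> w \<oplus> (-1) \<odot> (w \<oplus> (- s) \<odot> y)"
proof -
  have e: "w \<oplus> t \<odot> y = lc3 w y \<zero> 1 t 0" "2 \<odot> w = lc3 w y \<zero> 2 0 0" for t
    using w y by (simp_all add: lc3_def)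
  show ?thesis
    unfolding e lc3_smult[OF w y M.zero_closed] lc3_add[OF w y M.zero_closed] by simp
qed

lemma rip_sym: "x \<in> carrier V \<Longrightarrow> y \<in> carrier V \<Longrightarrow> rip x y = rip y x"
proof -
  assume x: "x \<in> carrier V" and y: "y \<in> carrier V"
  have "(-1) \<odot> (x \<oplus> (-1) \<odot> y) = y \<oplus> (-1) \<odot> x" using x y by (simp add: dist2 smult_mult M.a_comm)
  then have "nsq (y \<oplus> (-1) \<odot> x) = nsq (x \<oplus> (-1) \<odot> y)"
    using nsq_scale[of "x \<oplus> (-1) \<odot> y" "-1"] x y by simp
  then show ?thesis using x y by (simp add: rip_def M.a_comm)
qed

lemma rip_self: "x \<in> carrier V \<Longrightarrow> rip x x = nsq x"
proof -
  assume x: "x \<in> carrier V"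
  have "x \<oplus> x = 2 \<odot> x" using x dist1[of x 1 1] by simp
  moreover have "x \<oplus> (-1) \<odot> x = \<zero>" using x dist1[of x 1 "-1"] by simp
  ultimately show ?thesis using x by (simp add: rip_def nsq_scale)
qed

lemma rip_zero_left: "y \<in> carrier V \<Longrightarrow> rip \<zero> y = 0"
  using nsq_scale[of y "-1"] by (simp add: rip_def)

text \<open>The parallelogram law for the midpoint plus or minus \<open>z\<close> and half the
  difference of \<open>x\<close> and \<open>y\<close>. Subtracting the two instances cancels the
  term with the half difference.\<close>

lemma rip_midpoint:
  assumes x: "x \<in> carrier V" and y: "y \<in> carrier V" and z: "z \<in> carrier V"
  shows "rip x z + rip y z = 2 * rip ((1 / 2) \<odot> (x \<oplus> y)) z"
proof -
  let ?L = "lc3 x y z"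
  note c = lc3_closed[OF x y z]
  have e: "x = ?L 1 0 0" "y = ?L 0 1 0" "z = ?L 0 0 1" using x y z by (simp_all add: lc3_def)
  have u: "(1 / 2) \<odot> (x \<oplus> y) = ?L (1/2) (1/2) 0"
    using x y z by (simp add: lc3_def dist2)
  have xz: "x \<oplus> z = ?L 1 0 1" "y \<oplus> z = ?L 0 1 1" "x \<oplus> (-1) \<odot> z = ?L 1 0 (-1)" "y \<oplus> (-1) \<odot> z = ?L 0 1 (-1)"
    using x y z by (simp_all add: lc3_def)
  have uz: "(1 / 2) \<odot> (x \<oplus> y) \<oplus> z = ?L (1/2) (1/2) 1" "(1 / 2) \<odot> (x \<oplus> y) \<oplus> (-1) \<odot> z = ?L (1/2) (1/2) (-1)"
    using x y z by (simp_all add: lc3_def dist2 M.a_assoc)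
  have "nsq (?L (1/2) (1/2) s \<oplus> ?L (1/2) (-1/2) 0) + nsq (?L (1/2) (1/2) s \<oplus> (-1) \<odot> ?L (1/2) (-1/2) 0)
     = 2 * nsq (?L (1/2) (1/2) s) + 2 * nsq (?L (1/2) (-1/2) 0)" for s
    by (rule nsq_parallelogram[OF c c])
  then have P: "nsq (?L 1 0 s) + nsq (?L 0 1 s) = 2 * nsq (?L (1/2) (1/2) s) + 2 * nsq (?L (1/2) (-1/2) 0)" for s
    by (simp add: lc3_add[OF x y z] lc3_smult[OF x y z])
  have gen: "p + p' = 2 * e + 2 * v \<Longrightarrow> q + q' = 2 * f + 2 * v \<Longrightarrow> (p - q) / 4 + (p' - q') / 4 = 2 * ((e - f) / 4)"
    for p p' q q' e f v :: real
    by (simp add: field_simps)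
  show ?thesis
    unfolding rip_def xz uz by (rule gen[OF P P])
qed

text \<open>With the zero vector as second argument, the midpoint identity says that halving
  \<open>x \<oplus> y\<close> halves the product.\<close>

lemma rip_add_left:
  assumes x: "x \<in> carrier V" and y: "y \<in> carrier V" and z: "z \<in> carrier V"
  shows "rip (x \<oplus> y) z = rip x z + rip y z"
  using rip_midpoint[OF x y z] rip_midpoint[of "x \<oplus> y" \<zero> z] x y z by (simp add: rip_zero_left)

text \<open>The map of \<open>t\<close> is additive and bounded for
  \<open>\<bar>t\<bar> \<le> 1\<close>, hence linear. Real scalars match the real coefficients
  \<open>b k\<close> and \<open>car k A B\<close> to come.\<close>

lemma rip_scale_left:
  assumes x: "x \<in> carrier V" and y: "y \<in> carrier V"
  shows "rip (of_real t \<odot> x) y = t * rip x y"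
proof -
  define F where "F t = rip (of_real t \<odot> x) y" for t
  define C where "C = \<parallel>x\<parallel> * (\<parallel>x\<parallel> + \<parallel>y\<parallel>)"
  have nx: "0 \<le> \<parallel>x\<parallel>" "0 \<le> \<parallel>y\<parallel>" using para_normedD(2)[OF para] x y by auto
  have "F t = t * F 1"
  proof (rule real_additive_bounded_linear)
    show "F (s + t) = F s + F t" for s t
      unfolding F_def using x y by (simp add: dist1 rip_add_left)
    fix t :: real assume t: "\<bar>t\<bar> \<le> 1"
    let ?w = "of_real t \<odot> x"
    have w: "?w \<in> carrier V" using x by simp
    have my: "(-1) \<odot> y \<in> carrier V" using y by simp
    have nw: "\<parallel>?w\<parallel> = \<bar>t\<bar> * \<parallel>x\<parallel>" using para_normedD(3)[OF para x] by simp
    then have nw1: "0 \<le> \<parallel>?w\<parallel>" "\<parallel>?w\<parallel> \<le> \<parallel>x\<parallel>" using t nx by (auto simp: mult_left_le_one_le)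
    have nmy: "\<parallel>(-1) \<odot> y\<parallel> = \<parallel>y\<parallel>" using para_normedD(3)[OF para y, of "-1"] by simp
    define p q where "p = \<parallel>?w \<oplus> y\<parallel>" and "q = \<parallel>?w \<oplus> (-1) \<odot> y\<parallel>"
    have pq0: "0 \<le> p" "0 \<le> q" using para_normedD(2)[OF para] w y my by (simp_all add: p_def q_def)
    have pq: "p \<le> \<parallel>x\<parallel> + \<parallel>y\<parallel>" "q \<le> \<parallel>x\<parallel> + \<parallel>y\<parallel>"
      using para_normedD(4)[OF para w y] para_normedD(4)[OF para w my] nw1 nmy by (simp_all add: p_def q_def)
    \<comment> \<open>Each of the two vectors is \<open>2 w\<close> minus the other, so their norms
      differ by at most twice the norm of \<open>w\<close>; this bounds the difference of the
      squares.\<close>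
    have "?w \<oplus> y = 2 \<odot> ?w \<oplus> (-1) \<odot> (?w \<oplus> (-1) \<odot> y)"
      using double_minus[OF w y, of 1] y by simp
    then have "p \<le> 2 * \<parallel>?w\<parallel> + q"
      using para_normedD(4)[OF para, of "2 \<odot> ?w" "(-1) \<odot> (?w \<oplus> (-1) \<odot> y)"] w y
        para_normedD(3)[OF para w, of 2] para_normedD(3)[OF para, of "?w \<oplus> (-1) \<odot> y" "-1"] by (simp add: p_def q_def)
    moreover have "?w \<oplus> (-1) \<odot> y = 2 \<odot> ?w \<oplus> (-1) \<odot> (?w \<oplus> y)"
      using double_minus[OF w y, of "-1"] y by simp
    then have "q \<le> 2 * \<parallel>?w\<parallel> + p"
      using para_normedD(4)[OF para, of "2 \<odot> ?w" "(-1) \<odot> (?w \<oplus> y)"] w y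
        para_normedD(3)[OF para w, of 2] para_normedD(3)[OF para, of "?w \<oplus> y" "-1"] by (simp add: p_def q_def)
    ultimately have d: "\<bar>p - q\<bar> \<le> 2 * \<parallel>x\<parallel>" using nw1 by linarith
    have "\<bar>p\<^sup>2 - q\<^sup>2\<bar> = \<bar>p - q\<bar> * (p + q)"
      using pq0 by (simp add: power2_eq_square square_diff_square_factored abs_mult mult.commute)
    also have "\<dots> \<le> (2 * \<parallel>x\<parallel>) * (2 * (\<parallel>x\<parallel> + \<parallel>y\<parallel>))"
      using d pq pq0 nx by (intro mult_mono) auto
    finally show "\<bar>F t\<bar> \<le> C"
      unfolding F_def rip_def nsq_def C_def p_def[symmetric] q_def[symmetric] by (simp add: algebra_simps)
  qed
  then show ?thesis using x by (simp add: F_def)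
qed

lemma rip_finsum_left:
  assumes "finite I" "\<And>i. i \<in> I \<Longrightarrow> v i \<in> carrier V" and y: "y \<in> carrier V"
  shows "rip (finsum V (\<lambda>i. of_real (c i) \<odot> v i) I) y = (\<Sum>i\<in>I. c i * rip (v i) y)"
  using assms(1,2)
proof (induction I rule: finite_induct)
  case empty
  then show ?case by (simp add: rip_zero_left y)
next
  case (insert i I)
  have cl: "(\<lambda>i. of_real (c i) \<odot> v i) \<in> I \<rightarrow> carrier V" using insert by auto
  have "rip (finsum V (\<lambda>i. of_real (c i) \<odot> v i) (insert i I)) y
     = rip (of_real (c i) \<odot> v i \<oplus> finsum V (\<lambda>i. of_real (c i) \<odot> v i) I) y"
    using insert cl by (subst M.finsum_insert) auto
  also have "\<dots> = c i * rip (v i) y + (\<Sum>i\<in>I. c i * rip (v i) y)"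
    using insert cl y by (subst rip_add_left) (auto simp: rip_scale_left M.finsum_closed)
  finally show ?case using insert by simp
qed

lemma nsq_finsum:
  assumes I: "finite I" and v: "\<And>i. i \<in> I \<Longrightarrow> v i \<in> carrier V"
  shows "nsq (finsum V (\<lambda>i. of_real (c i) \<odot> v i) I) = (\<Sum>i\<in>I. \<Sum>j\<in>I. c i * c j * rip (v i) (v j))"
proof -
  let ?s = "finsum V (\<lambda>i. of_real (c i) \<odot> v i) I"
  have s: "?s \<in> carrier V" by (rule M.finsum_closed) (use v in auto)
  have "nsq ?s = rip ?s ?s" by (simp add: rip_self s)
  also have "\<dots> = (\<Sum>i\<in>I. c i * rip (v i) ?s)" by (rule rip_finsum_left[OF I v s])
  also have "\<dots> = (\<Sum>i\<in>I. c i * (\<Sum>j\<in>I. c j * rip (v j) (v i)))"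
    using v s by (intro sum.cong refl) (simp add: rip_sym[of _ ?s] rip_finsum_left[OF I v])
  also have "\<dots> = (\<Sum>i\<in>I. \<Sum>j\<in>I. c i * c j * rip (v i) (v j))"
    unfolding sum_distrib_left using v by (intro sum.cong refl) (simp add: rip_sym mult_ac)
  finally show ?thesis .
qed

lemma rip_kernel_nonneg:
  assumes "finite I" "\<And>i. i \<in> I \<Longrightarrow> v i \<in> carrier V"
  shows "0 \<le> (\<Sum>i\<in>I. \<Sum>j\<in>I. c i * c j * rip (v i) (v j))"
  using nsq_nonneg[of "finsum V (\<lambda>i. of_real (c i) \<odot> v i) I"] nsq_finsum[OF assms, where c=c] by simp

end

subsection \<open>Contractions and the anticommutation relations\<close>

text \<open>The points \<open>y p\<close> may coincide, so the kernel can also be evaluated at times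
  that have been reduced modulo \<open>N\<close>.\<close>

definition psd_kernel :: "('p \<Rightarrow> 'p \<Rightarrow> real) \<Rightarrow> bool" where
  "psd_kernel K \<longleftrightarrow> (\<forall>(I :: (nat \<times> nat set) set) z y. finite I \<longrightarrow> 0 \<le> (\<Sum>p\<in>I. \<Sum>q\<in>I. z p * z q * K (y p) (y q)))"

text \<open>Rotation by \<open>s\<close> is a bijection of the cyclic group; the inverse is rotation
  by \<open>N - s mod N\<close>.\<close>

lemma sum_mod_shift:
  fixes f :: "nat \<Rightarrow> 'a::comm_monoid_add"
  assumes N: "N > 0"
  shows "(\<Sum>j<N. f ((j + s) mod N)) = (\<Sum>j<N. f j)"
proof (rule sum.reindex_bij_witness[where i="\<lambda>j. (j + (N - s mod N)) mod N" and j="\<lambda>j. (j + s) mod N"])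
  fix a assume "a \<in> {..<N}"
  then have a: "a < N" by simp
  have "N * (s div N) + s mod N = s" by (rule mult_div_mod_eq)
  moreover have "s mod N < N" using N by simp
  ultimately have "s + (N - s mod N) = N * (s div N) + N" by linarith
  then have k: "s + (N - s mod N) = N * Suc (s div N)" by (simp only: mult_Suc_right add.commute)
  have "((a + s) mod N + (N - s mod N)) mod N = (a + (s + (N - s mod N))) mod N"
    by (simp only: mod_add_left_eq add.assoc)
  then show "((a + s) mod N + (N - s mod N)) mod N = a" using a unfolding k mod_mult_self2 by simp
  have "((a + (N - s mod N)) mod N + s) mod N = (a + (s + (N - s mod N))) mod N"
    by (simp only: mod_add_left_eq add.assoc add.commute[of "N - s mod N" s])
  then show "((a + (N - s mod N)) mod N + s) mod N = a" using a unfolding k mod_mult_self2 by simp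
qed (use N in auto)

text \<open>If \<open>K\<close> is the Gram kernel of vectors \<open>u\<close>, this is the sum over
  \<open>A\<close> of the squared norms of the combinations of \<open>u (y (k, B))\<close> with
  coefficients \<open>b k * car k A B\<close>.\<close>

definition car_quad :: "nat \<Rightarrow> (nat \<Rightarrow> real) \<Rightarrow> ((nat \<times> nat set) \<Rightarrow> 'p) \<Rightarrow> ('p \<Rightarrow> 'p \<Rightarrow> real) \<Rightarrow> real" where
  "car_quad L b y K = (\<Sum>A\<in>Pow {..<L}. \<Sum>p\<in>{..<L} \<times> Pow {..<L}. \<Sum>q\<in>{..<L} \<times> Pow {..<L}.
     (b (fst p) * car (fst p) A (snd p)) * (b (fst q) * car (fst q) A (snd q)) * K (y p) (y q))"

lemma psd_kernelD:
  fixes I :: "(nat \<times> nat set) set"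
  shows "psd_kernel K \<Longrightarrow> finite I \<Longrightarrow> 0 \<le> (\<Sum>p\<in>I. \<Sum>q\<in>I. z p * z q * K (y p) (y q))"
  by (simp add: psd_kernel_def)

lemma car_quad_nonneg:
  assumes "psd_kernel K" shows "0 \<le> car_quad L b y K"
  unfolding car_quad_def
proof (rule sum_nonneg)
  fix A
  have f: "finite ({..<L} \<times> Pow {..<L})" by simp
  show "0 \<le> (\<Sum>p\<in>{..<L} \<times> Pow {..<L}. \<Sum>q\<in>{..<L} \<times> Pow {..<L}.
     (b (fst p) * car (fst p) A (snd p)) * (b (fst q) * car (fst q) A (snd q)) * K (y p) (y q))"
    by (rule psd_kernelD[OF assms f, of "\<lambda>p. b (fst p) * car (fst p) A (snd p)" y])
qed

lemma sum_swap4: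
  "(\<Sum>A\<in>U. \<Sum>k\<in>X. \<Sum>B\<in>U. \<Sum>l\<in>X. \<Sum>B'\<in>U. F A k B l B') = (\<Sum>k\<in>X. \<Sum>l\<in>X. \<Sum>B\<in>U. \<Sum>B'\<in>U. \<Sum>A\<in>U. F A k B l B')"
proof -
  have "(\<Sum>A\<in>U. \<Sum>k\<in>X. \<Sum>B\<in>U. \<Sum>l\<in>X. \<Sum>B'\<in>U. F A k B l B') = (\<Sum>k\<in>X. \<Sum>A\<in>U. \<Sum>B\<in>U. \<Sum>l\<in>X. \<Sum>B'\<in>U. F A k B l B')"
    by (rule sum.swap)
  also have "\<dots> = (\<Sum>k\<in>X. \<Sum>B\<in>U. \<Sum>A\<in>U. \<Sum>l\<in>X. \<Sum>B'\<in>U. F A k B l B')"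
    by (rule sum.cong[OF refl], rule sum.swap)
  also have "\<dots> = (\<Sum>k\<in>X. \<Sum>B\<in>U. \<Sum>l\<in>X. \<Sum>A\<in>U. \<Sum>B'\<in>U. F A k B l B')"
    by (rule sum.cong[OF refl], rule sum.cong[OF refl], rule sum.swap)
  also have "\<dots> = (\<Sum>k\<in>X. \<Sum>B\<in>U. \<Sum>l\<in>X. \<Sum>B'\<in>U. \<Sum>A\<in>U. F A k B l B')"
    by (rule sum.cong[OF refl], rule sum.cong[OF refl], rule sum.cong[OF refl], rule sum.swap)
  also have "\<dots> = (\<Sum>k\<in>X. \<Sum>l\<in>X. \<Sum>B\<in>U. \<Sum>B'\<in>U. \<Sum>A\<in>U. F A k B l B')"
    by (rule sum.cong[OF refl], rule sum.swap)
  finally show ?thesis .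
qed

lemma car_quad_expand:
  "car_quad L b y K = (\<Sum>k<L. \<Sum>l<L. \<Sum>B\<in>Pow {..<L}. \<Sum>B'\<in>Pow {..<L}.
     (\<Sum>A\<in>Pow {..<L}. car k A B * car l A B') * (b k * b l * K (y (k, B)) (y (l, B'))))"
  unfolding car_quad_def sum.cartesian_product' fst_conv snd_conv sum_swap4
  by (intro sum.cong refl) (simp add: sum_distrib_left mult_ac)

text \<open>The same quadratic form for the adjoint matrices, that is, the other half of the
  anticommutation relation.\<close>

lemma car_quad_adjoint_expand:
  "(\<Sum>B\<in>Pow {..<L}. \<Sum>p\<in>{..<L} \<times> Pow {..<L}. \<Sum>q\<in>{..<L} \<times> Pow {..<L}.
     (b (fst p) * car (fst p) (snd p) B) * (b (fst q) * car (fst q) (snd q) B) * K (y p) (y q))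
  = (\<Sum>k<L. \<Sum>l<L. \<Sum>A\<in>Pow {..<L}. \<Sum>A'\<in>Pow {..<L}.
     (\<Sum>B\<in>Pow {..<L}. car k A B * car l A' B) * (b k * b l * K (y (k, A)) (y (l, A')) :: real))"
  unfolding sum.cartesian_product' fst_conv snd_conv sum_swap4
  by (intro sum.cong refl) (simp add: sum_distrib_left mult_ac)

text \<open>
  A Toeplitz kernel is the Gram kernel of the orbits of an isometry. Replacing time by the cyclic group of
  order \<open>N\<close>, the anticommutation relations bound the average over all time shifts, and only boundedly
  many shifts wrap around.
\<close>

lemma car_toeplitz_bound:
  fixes K :: "nat \<times> nat set \<Rightarrow> nat \<times> nat set \<Rightarrow> real"
  assumes psd: "psd_kernel K" and toep: "\<And>j A j' A'. K (Suc j, A) (Suc j', A') = K (j, A) (j', A')"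
  shows "car_quad L b (\<lambda>(k, B). (m k, B)) K \<le> (\<Sum>k<L. (b k)\<^sup>2) * (\<Sum>A\<in>Pow {..<L}. K (0, A) (0, A))"
proof -
  let ?U = "Pow {..<L}"
  define S where "S = car_quad L b (\<lambda>(k, B). (m k, B)) K"
  define R where "R = (\<Sum>k<L. (b k)\<^sup>2) * (\<Sum>A\<in>?U. K (0, A) (0, A))"
  define mm where "mm = (\<Sum>k<L. m k)"
  have mle: "m k \<le> mm" if "k < L" for k
    unfolding mm_def using that by (intro member_le_sum) auto
  have toep': "K (j + i, A) (j + i', A') = K (i, A) (i', A')" for j i i' A A'
    by (induction j) (simp_all add: toep)
  have main: "real N * S \<le> real mm * S + real N * R" if N: "N > mm" for N
  proof -
    have N0: "N > 0" using N by simp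
    \<comment> \<open>\<open>Y\<close> runs forward and \<open>Z\<close> backward in cyclic time, as
      \<open>(N - 1) m\<close> is \<open>- m\<close> modulo \<open>N\<close>. In the sum over
      \<open>j\<close>, a rotation by \<open>m k + m l\<close> sends the backward kernel of the pair
      \<open>k, l\<close> to the forward kernel of \<open>l, k\<close>. This is the transposition
      under which the two halves of the relation meet the same kernel.\<close>
    define Y where "Y j = (\<lambda>(k, B). ((j + m k) mod N, B :: nat set))" for j
    define Z where "Z j = (\<lambda>(k, B). ((j + (N - 1) * m k) mod N, B :: nat set))" for j
    define W where "W k l B B' = b k * b l * (\<Sum>j<N. K ((j + m k) mod N, B) ((j + m l) mod N, B'))" for k l B B'
    have pull: "(\<Sum>j<N. \<Sum>k<L. \<Sum>l<L. \<Sum>B\<in>?U. \<Sum>B'\<in>?U. c k l B B' * (b k * b l * G j k l B B'))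
       = (\<Sum>k<L. \<Sum>l<L. \<Sum>B\<in>?U. \<Sum>B'\<in>?U. c k l B B' * (b k * b l * (\<Sum>j<N. G j k l B B')))" for c G
    proof -
      have "(\<Sum>j<N. \<Sum>k<L. \<Sum>l<L. \<Sum>B\<in>?U. \<Sum>B'\<in>?U. H j k l B B') = (\<Sum>k<L. \<Sum>l<L. \<Sum>B\<in>?U. \<Sum>B'\<in>?U. \<Sum>j<N. H j k l B B')" for H :: "_ \<Rightarrow> _ \<Rightarrow> _ \<Rightarrow> _ \<Rightarrow> _ \<Rightarrow> real"
      proof -
        have "(\<Sum>j<N. \<Sum>k<L. \<Sum>l<L. \<Sum>B\<in>?U. \<Sum>B'\<in>?U. H j k l B B') = (\<Sum>k<L. \<Sum>j<N. \<Sum>l<L. \<Sum>B\<in>?U. \<Sum>B'\<in>?U. H j k l B B')"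
          by (rule sum.swap)
        also have "\<dots> = (\<Sum>k<L. \<Sum>l<L. \<Sum>j<N. \<Sum>B\<in>?U. \<Sum>B'\<in>?U. H j k l B B')"
          by (rule sum.cong[OF refl], rule sum.swap)
        also have "\<dots> = (\<Sum>k<L. \<Sum>l<L. \<Sum>B\<in>?U. \<Sum>j<N. \<Sum>B'\<in>?U. H j k l B B')"
          by (rule sum.cong[OF refl], rule sum.cong[OF refl], rule sum.swap)
        also have "\<dots> = (\<Sum>k<L. \<Sum>l<L. \<Sum>B\<in>?U. \<Sum>B'\<in>?U. \<Sum>j<N. H j k l B B')"
          by (rule sum.cong[OF refl], rule sum.cong[OF refl], rule sum.cong[OF refl], rule sum.swap)
        finally show ?thesis .
      qed
      then show ?thesis by (simp only: sum_distrib_left)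
    qed
    have S1: "(\<Sum>j<N. car_quad L b (Y j) K) = (\<Sum>k<L. \<Sum>l<L. \<Sum>B\<in>?U. \<Sum>B'\<in>?U. (\<Sum>A\<in>?U. car l A B * car k A B') * W l k B B')"
    proof -
      have "(\<Sum>j<N. car_quad L b (Y j) K) = (\<Sum>k<L. \<Sum>l<L. \<Sum>B\<in>?U. \<Sum>B'\<in>?U. (\<Sum>A\<in>?U. car k A B * car l A B') * W k l B B')"
        unfolding car_quad_expand Y_def prod.case pull W_def ..
      also have "\<dots> = (\<Sum>k<L. \<Sum>l<L. \<Sum>B\<in>?U. \<Sum>B'\<in>?U. (\<Sum>A\<in>?U. car l A B * car k A B') * W l k B B')"
        by (rule sum.swap)
      finally show ?thesis .
    qed
    define S2 where "S2 = (\<Sum>j<N. \<Sum>B\<in>?U. \<Sum>p\<in>{..<L} \<times> ?U. \<Sum>q\<in>{..<L} \<times> ?U.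
       (b (fst p) * car (fst p) (snd p) B) * (b (fst q) * car (fst q) (snd q) B) * K (Z j p) (Z j q))"
    have S2: "S2 = (\<Sum>k<L. \<Sum>l<L. \<Sum>A\<in>?U. \<Sum>A'\<in>?U. (\<Sum>B\<in>?U. car k A B * car l A' B) * W l k A A')"
    proof -
      have sh: "(\<Sum>j<N. K ((j + (N - 1) * m k) mod N, A) ((j + (N - 1) * m l) mod N, A'))
          = (\<Sum>j<N. K ((j + m l) mod N, A) ((j + m k) mod N, A'))" for k l A A'
      proof -
        define f where "f j = K ((j + (N - 1) * m k) mod N, A) ((j + (N - 1) * m l) mod N, A')" for j
        have per: "f (j mod N) = f j" for j by (simp add: f_def mod_add_left_eq)
        have a: "(j + (m k + m l) + (N - 1) * m k) mod N = (j + m l) mod N" "(j + (m k + m l) + (N - 1) * m l) mod N = (j + m k) mod N" for j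
        proof -
          obtain N' where N': "N = Suc N'" using N0 by (cases N) auto
          have "j + (m k + m l) + (N - 1) * m k = (j + m l) + m k * N" "j + (m k + m l) + (N - 1) * m l = (j + m k) + m l * N"
            by (simp_all add: N' algebra_simps)
          then show "(j + (m k + m l) + (N - 1) * m k) mod N = (j + m l) mod N" "(j + (m k + m l) + (N - 1) * m l) mod N = (j + m k) mod N"
            by (simp_all only: mod_mult_self1)
        qed
        have "(\<Sum>j<N. f j) = (\<Sum>j<N. f ((j + (m k + m l)) mod N))" by (rule sum_mod_shift[OF N0, symmetric])
        also have "\<dots> = (\<Sum>j<N. f (j + (m k + m l)))" by (simp only: per)
        finally show ?thesis unfolding f_def a .
      qed
      have "S2 = (\<Sum>j<N. \<Sum>k<L. \<Sum>l<L. \<Sum>A\<in>?U. \<Sum>A'\<in>?U.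
         (\<Sum>B\<in>?U. car k A B * car l A' B) * (b k * b l * K (Z j (k, A)) (Z j (l, A'))))"
        unfolding S2_def by (rule sum.cong[OF refl], rule car_quad_adjoint_expand)
      also have "\<dots> = (\<Sum>k<L. \<Sum>l<L. \<Sum>A\<in>?U. \<Sum>A'\<in>?U.
         (\<Sum>B\<in>?U. car k A B * car l A' B) * (b k * b l * (\<Sum>j<N. K (Z j (k, A)) (Z j (l, A')))))"
        by (rule pull)
      also have "\<dots> = (\<Sum>k<L. \<Sum>l<L. \<Sum>A\<in>?U. \<Sum>A'\<in>?U. (\<Sum>B\<in>?U. car k A B * car l A' B) * W l k A A')"
      proof -
        have "b k * b l * (\<Sum>j<N. K (Z j (k, A)) (Z j (l, A'))) = W l k A A'" for k l A A'
          using sh[of k A l A'] by (simp only: Z_def W_def prod.case mult.commute[of "b k" "b l"])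
        then show ?thesis by (simp only:)
      qed
      finally show ?thesis .
    qed
    have S20: "0 \<le> S2"
      unfolding S2_def
    proof (intro sum_nonneg[where A="{..<N}"] sum_nonneg[where A="Pow {..<L}"])
      fix j B
      have f: "finite ({..<L} \<times> Pow {..<L})" by simp
      show "0 \<le> (\<Sum>p\<in>{..<L} \<times> ?U. \<Sum>q\<in>{..<L} \<times> ?U.
         (b (fst p) * car (fst p) (snd p) B) * (b (fst q) * car (fst q) (snd q) B) * K (Z j p) (Z j q))"
        by (rule psd_kernelD[OF psd f, of "\<lambda>p. b (fst p) * car (fst p) (snd p) B" "Z j"])
    qed
    have "(\<Sum>j<N. car_quad L b (Y j) K) + S2 = (\<Sum>k<L. \<Sum>A\<in>?U. W k k A A)"
      unfolding S1 S2 by (subst add.commute) (rule car_kernel_sum[of L "\<lambda>k l. W l k"])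
    also have "\<dots> = real N * R"
    proof -
      have K0: "K (i, A) (i, A) = K (0, A) (0, A)" for i A using toep'[of i 0 A 0 A] by simp
      have "W k k A A = real N * ((b k)\<^sup>2 * K (0, A) (0, A))" for k A
      proof -
        have "(\<Sum>j<N. K ((j + m k) mod N, A) ((j + m k) mod N, A)) = (\<Sum>j<N. K (0, A) (0, A))"
          by (rule sum.cong[OF refl], rule K0)
        then show ?thesis by (simp add: W_def power2_eq_square)
      qed
      then show ?thesis unfolding R_def sum_product by (simp only: sum_distrib_left)
    qed
    finally have le: "(\<Sum>j<N. car_quad L b (Y j) K) \<le> real N * R" using S20 by simp
    \<comment> \<open>For \<open>j < N - mm\<close> no time wraps around, and Toeplitz invariance
      gives the value \<open>S\<close>. The remaining \<open>mm\<close> terms are nonnegative and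
      are dropped.\<close>
    have "real (N - mm) * S = (\<Sum>j<N - mm. car_quad L b (Y j) K)"
    proof -
      have "car_quad L b (Y j) K = S" if j: "j < N - mm" for j
      proof -
        have "(j + m k) mod N = j + m k" if "k < L" for k using j mle[OF that] by simp
        then show ?thesis
          unfolding S_def car_quad_def Y_def by (intro sum.cong refl) (auto simp: toep')
      qed
      then show ?thesis by simp
    qed
    also have "\<dots> \<le> (\<Sum>j<N. car_quad L b (Y j) K)"
      by (rule sum_mono2) (auto intro: car_quad_nonneg psd)
    finally have "real (N - mm) * S \<le> real N * R" using le by simp
    then show ?thesis using N by (simp add: of_nat_diff algebra_simps)
  qed
  show ?thesis
  \<comment> \<open>\<open>N\<close> is arbitrary while \<open>mm\<close> is fixed, so the wrapped
    shifts disappear after division by \<open>N\<close>.\<close>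
  proof (rule ccontr)
    assume "\<not> ?thesis"
    then have d: "S - R > 0" by (simp add: S_def R_def)
    obtain n where n: "real mm * S < real n * (S - R)" using reals_Archimedean3[OF d] by blast
    define N where "N = Suc (max n mm)"
    have "real n * (S - R) \<le> real N * (S - R)" using d by (intro mult_right_mono) (auto simp: N_def)
    moreover have "real N * (S - R) = real N * S - real N * R" by (rule right_diff_distrib)
    moreover have "real N * S \<le> real mm * S + real N * R" by (rule main) (simp add: N_def)
    ultimately show False using n by linarith
  qed
qed

section \<open>Orbits of a contraction and their Toeplitz majorant\<close>

locale para_contraction = para_space +
  fixes T :: "'a \<Rightarrow> 'a"
  assumes T_closed: "x \<in> carrier V \<Longrightarrow> T x \<in> carrier V"
    and T_add: "x \<in> carrier V \<Longrightarrow> y \<in> carrier V \<Longrightarrow> T (x \<oplus> y) = T x \<oplus> T y"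
    and T_smult: "x \<in> carrier V \<Longrightarrow> T (a \<odot> x) = a \<odot> T x"
    and T_contr: "x \<in> carrier V \<Longrightarrow> \<parallel>T x\<parallel> \<le> \<parallel>x\<parallel>"
begin

lemma pow_closed: "x \<in> carrier V \<Longrightarrow> (T ^^ n) x \<in> carrier V"
  by (induction n) (auto intro: T_closed)

text \<open>The form of the identity minus the adjoint of \<open>T\<close> times \<open>T\<close>;
  it is nonnegative because \<open>T\<close> is a contraction.\<close>

definition defect :: "'a \<Rightarrow> 'a \<Rightarrow> real" where
  "defect x y = rip x y - rip (T x) (T y)"

lemma T_finsum:
  assumes "finite I" "\<And>i. i \<in> I \<Longrightarrow> v i \<in> carrier V"
  shows "T (finsum V (\<lambda>i. of_real (c i) \<odot> v i) I) = finsum V (\<lambda>i. of_real (c i) \<odot> T (v i)) I"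
  using assms
proof (induction I rule: finite_induct)
  case empty
  have "T \<zero> = T (0 \<odot> \<zero>)" by simp
  also have "\<dots> = \<zero>" using T_smult[of \<zero> 0] T_closed[of \<zero>] by simp
  finally show ?case by simp
next
  case (insert i I)
  have c1: "(\<lambda>i. of_real (c i) \<odot> v i) \<in> I \<rightarrow> carrier V" "(\<lambda>i. of_real (c i) \<odot> T (v i)) \<in> I \<rightarrow> carrier V"
    using insert by (auto intro: T_closed)
  have "T (finsum V (\<lambda>i. of_real (c i) \<odot> v i) (insert i I)) = T (of_real (c i) \<odot> v i \<oplus> finsum V (\<lambda>i. of_real (c i) \<odot> v i) I)"
    using insert c1 by (subst M.finsum_insert) auto
  also have "\<dots> = of_real (c i) \<odot> T (v i) \<oplus> finsum V (\<lambda>i. of_real (c i) \<odot> T (v i)) I"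
    using insert c1 by (subst T_add) (auto simp: T_smult M.finsum_closed)
  also have "\<dots> = finsum V (\<lambda>i. of_real (c i) \<odot> T (v i)) (insert i I)"
    using insert c1 by (subst M.finsum_insert) (auto intro: T_closed)
  finally show ?case .
qed

lemma defect_kernel_nonneg:
  assumes I: "finite I" and v: "\<And>i. i \<in> I \<Longrightarrow> v i \<in> carrier V"
  shows "0 \<le> (\<Sum>i\<in>I. \<Sum>j\<in>I. c i * c j * defect (v i) (v j))"
proof -
  let ?s = "finsum V (\<lambda>i. of_real (c i) \<odot> v i) I"
  have s: "?s \<in> carrier V" by (rule M.finsum_closed) (use v in auto)
  have Tv: "\<And>i. i \<in> I \<Longrightarrow> T (v i) \<in> carrier V" using v T_closed by blast
  have "(\<Sum>i\<in>I. \<Sum>j\<in>I. c i * c j * defect (v i) (v j)) = nsq ?s - nsq (T ?s)"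
  proof -
    have "nsq ?s = (\<Sum>i\<in>I. \<Sum>j\<in>I. c i * c j * rip (v i) (v j))" by (rule nsq_finsum[OF I v])
    moreover have "T ?s = finsum V (\<lambda>i. of_real (c i) \<odot> T (v i)) I" by (rule T_finsum[OF I v])
    moreover have "nsq (finsum V (\<lambda>i. of_real (c i) \<odot> T (v i)) I) = (\<Sum>i\<in>I. \<Sum>j\<in>I. c i * c j * rip (T (v i)) (T (v j)))"
      by (rule nsq_finsum[OF I Tv])
    ultimately show ?thesis by (simp add: defect_def right_diff_distrib sum_subtractf)
  qed
  moreover have "nsq (T ?s) \<le> nsq ?s"
    unfolding nsq_def using T_contr[OF s] para_normedD(2)[OF para T_closed[OF s]] by (intro power_mono)
  ultimately show ?thesis by simp
qed

definition orbit_kernel :: "(nat set \<Rightarrow> 'a) \<Rightarrow> nat \<times> nat set \<Rightarrow> nat \<times> nat set \<Rightarrow> real" where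
  "orbit_kernel x p q = rip ((T ^^ fst p) (x (snd p))) ((T ^^ fst q) (x (snd q)))"

text \<open>
  Added to the orbit kernel, it gives the Toeplitz Gram kernel of the isometric dilation of \<open>T\<close>, without
  constructing the dilation.
\<close>

definition defect_kernel :: "(nat set \<Rightarrow> 'a) \<Rightarrow> nat \<times> nat set \<Rightarrow> nat \<times> nat set \<Rightarrow> real" where
  "defect_kernel x p q = (\<Sum>l<min (fst p) (fst q). defect ((T ^^ (fst p - Suc l)) (x (snd p))) ((T ^^ (fst q - Suc l)) (x (snd q))))"

lemma psd_orbit_kernel:
  assumes "\<And>A. x A \<in> carrier V" shows "psd_kernel (orbit_kernel x)"
  unfolding psd_kernel_def orbit_kernel_def using assms by (auto intro!: rip_kernel_nonneg pow_closed)

text \<open>For fixed \<open>l\<close> the summand is the defect form of vectors taken from the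
  points with time greater than \<open>l\<close>. Setting the other weights to zero extends all sums
  to the common range \<open>J\<close>, and they can be exchanged.\<close>

lemma psd_defect_kernel:
  assumes x: "\<And>A. x A \<in> carrier V" shows "psd_kernel (defect_kernel x)"
  unfolding psd_kernel_def
proof (intro allI impI)
  fix I :: "(nat \<times> nat set) set" and z :: "nat \<times> nat set \<Rightarrow> real" and y :: "nat \<times> nat set \<Rightarrow> nat \<times> nat set"
  assume I: "finite I"
  define J where "J = (\<Sum>p\<in>I. fst (y p))"
  have J: "fst (y p) \<le> J" if "p \<in> I" for p unfolding J_def using I that by (intro member_le_sum) auto
  define w where "w l p = (if l < fst (y p) then z p else 0)" for l p
  define v where "v l p = (T ^^ (fst (y p) - Suc l)) (x (snd (y p)))" for l p
  have "(\<Sum>p\<in>I. \<Sum>q\<in>I. z p * z q * defect_kernel x (y p) (y q)) = (\<Sum>p\<in>I. \<Sum>q\<in>I. \<Sum>l<J. w l p * w l q * defect (v l p) (v l q))"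
  proof (intro sum.cong refl)
    fix p q assume "p \<in> I" "q \<in> I"
    have "defect_kernel x (y p) (y q) = (\<Sum>l<J. if l < min (fst (y p)) (fst (y q)) then defect (v l p) (v l q) else 0)"
      unfolding defect_kernel_def v_def using J[OF \<open>p \<in> I\<close>] by (intro sum.mono_neutral_cong_left) auto
    then show "z p * z q * defect_kernel x (y p) (y q) = (\<Sum>l<J. w l p * w l q * defect (v l p) (v l q))"
      by (simp only: sum_distrib_left) (intro sum.cong refl, simp add: w_def)
  qed
  also have "\<dots> = (\<Sum>l<J. \<Sum>p\<in>I. \<Sum>q\<in>I. w l p * w l q * defect (v l p) (v l q))"
    by (rule trans[OF sum.cong[OF refl sum.swap] sum.swap])
  also have "\<dots> \<ge> 0"
    by (intro sum_nonneg[where A="{..<J}"] defect_kernel_nonneg I) (simp add: v_def pow_closed x)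
  finally show "0 \<le> (\<Sum>p\<in>I. \<Sum>q\<in>I. z p * z q * defect_kernel x (y p) (y q))" .
qed

text \<open>Each defect term replaces the product of two images under \<open>T\<close> by the
  product of the vectors one step earlier. After \<open>min j j'\<close> steps only the difference
  of the times matters, which is the Toeplitz property.\<close>

lemma orbit_defect_telescope:
  assumes "i \<le> min j j'" "a \<in> carrier V" "a' \<in> carrier V"
  shows "rip ((T ^^ j) a) ((T ^^ j') a') + (\<Sum>l<i. defect ((T ^^ (j - Suc l)) a) ((T ^^ (j' - Suc l)) a'))
     = rip ((T ^^ (j - i)) a) ((T ^^ (j' - i)) a')"
  using assms(1)
proof (induction i)
  case (Suc i)
  then have e: "j - i = Suc (j - Suc i)" "j' - i = Suc (j' - Suc i)" by auto
  show ?case using Suc by (simp add: defect_def e)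
qed simp

text \<open>The left side is \<open>car_quad\<close> of the orbit kernel. Adding the defect kernel
  can only increase it and makes the kernel Toeplitz, while at time zero nothing is added. The
  delays \<open>m\<close> are left free.\<close>

lemma contraction_car_bound:
  assumes x: "\<And>A. x A \<in> carrier V"
  shows "(\<Sum>A\<in>Pow {..<L}. nsq (finsum V (\<lambda>p. of_real (b (fst p) * car (fst p) A (snd p)) \<odot> (T ^^ m (fst p)) (x (snd p))) ({..<L} \<times> Pow {..<L})))
     \<le> (\<Sum>k<L. (b k)\<^sup>2) * (\<Sum>A\<in>Pow {..<L}. nsq (x A))"
proof -
  define K where "K p q = orbit_kernel x p q + defect_kernel x p q" for p q
  have K: "K (j, A) (j', A') = rip ((T ^^ (j - min j j')) (x A)) ((T ^^ (j' - min j j')) (x A'))" for j j' A A'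
    unfolding K_def orbit_kernel_def defect_kernel_def fst_conv snd_conv
    by (rule orbit_defect_telescope) (simp_all add: x)
  have psd: "psd_kernel K"
    unfolding psd_kernel_def
  proof (intro allI impI)
    fix I :: "(nat \<times> nat set) set" and z :: "nat \<times> nat set \<Rightarrow> real" and y assume I: "finite I"
    show "0 \<le> (\<Sum>p\<in>I. \<Sum>q\<in>I. z p * z q * K (y p) (y q))"
      unfolding K_def distrib_left sum.distrib
      by (intro add_nonneg_nonneg psd_kernelD[OF psd_orbit_kernel I] psd_kernelD[OF psd_defect_kernel I] x)
  qed
  define y where "y = (\<lambda>(k, B :: nat set). (m k, B))"
  have fin: "finite ({..<L} \<times> Pow {..<L})" by simp
  have "(\<Sum>A\<in>Pow {..<L}. nsq (finsum V (\<lambda>p. of_real (b (fst p) * car (fst p) A (snd p)) \<odot> (T ^^ m (fst p)) (x (snd p))) ({..<L} \<times> Pow {..<L})))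
     = car_quad L b y (orbit_kernel x)"
    unfolding car_quad_def
  proof (intro sum.cong refl)
    fix A
    show "nsq (finsum V (\<lambda>p. of_real (b (fst p) * car (fst p) A (snd p)) \<odot> (T ^^ m (fst p)) (x (snd p))) ({..<L} \<times> Pow {..<L}))
       = (\<Sum>p\<in>{..<L} \<times> Pow {..<L}. \<Sum>q\<in>{..<L} \<times> Pow {..<L}.
         (b (fst p) * car (fst p) A (snd p)) * (b (fst q) * car (fst q) A (snd q)) * orbit_kernel x (y p) (y q))"
      by (subst nsq_finsum[OF fin]) (simp_all add: pow_closed x orbit_kernel_def y_def case_prod_unfold)
  qed
  also have "\<dots> \<le> car_quad L b y K"
  proof -
    have "car_quad L b y K = car_quad L b y (orbit_kernel x) + car_quad L b y (defect_kernel x)"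
      unfolding car_quad_def K_def distrib_left sum.distrib ..
    then show ?thesis using car_quad_nonneg[OF psd_defect_kernel[of x, OF x], of L b y] by simp
  qed
  also have "\<dots> \<le> (\<Sum>k<L. (b k)\<^sup>2) * (\<Sum>A\<in>Pow {..<L}. K (0, A) (0, A))"
    unfolding y_def by (rule car_toeplitz_bound[OF psd]) (simp add: K)
  also have "(\<Sum>A\<in>Pow {..<L}. K (0, A) (0, A)) = (\<Sum>A\<in>Pow {..<L}. nsq (x A))"
    by (simp add: K rip_self x)
  finally show ?thesis .
qed

end

subsection \<open>The Hankel operator\<close>

text \<open>Restricted to the carrier because the elements of the dual are extensional
  functions.\<close>

definition pisier_form :: "(complex \<Rightarrow> nat \<Rightarrow> complex) set \<Rightarrow> (complex \<Rightarrow> nat \<Rightarrow> complex) set \<Rightarrow> complex" where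
  "pisier_form u = (\<lambda>v\<in>carrier HS. form_lim (hankel_matrix 0) (hardy_coeff u) (hardy_coeff v))"

lemma pisier_form_apply: "v \<in> carrier HS \<Longrightarrow> pisier_form u v = form_lim (hankel_matrix 0) (hardy_coeff u) (hardy_coeff v)"
  by (simp add: pisier_form_def)

lemma pisier_form_bound:
  assumes "u \<in> carrier HS" "v \<in> carrier HS"
  shows "cmod (pisier_form u v) \<le> 12 * \<parallel>u\<parallel>\<^bsub>HS\<^esub> * \<parallel>v\<parallel>\<^bsub>HS\<^esub>"
  using form_lim_bound[OF bounded_form_hankel_matrix[of 0] hardy_coeff_bound[OF assms(1)] hardy_coeff_bound[OF assms(2)]]
  by (simp add: pisier_form_apply assms hardy_norm_nonneg)

lemma pisier_form_add_right:
  assumes "u \<in> carrier HS" "v \<in> carrier HS" "w \<in> carrier HS"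
  shows "pisier_form u (v \<oplus>\<^bsub>HS\<^esub> w) = pisier_form u v + pisier_form u w"
  unfolding pisier_form_apply[OF hardy_add(1)[OF assms(2,3)]] pisier_form_apply[OF assms(2)] pisier_form_apply[OF assms(3)] hardy_coeff_add[OF assms(2,3)]
  by (rule form_lim_add_right[OF bounded_form_hankel_matrix]) (rule hardy_coeff_bound, rule assms)+

lemma pisier_form_add_left:
  assumes "u \<in> carrier HS" "v \<in> carrier HS" "w \<in> carrier HS"
  shows "pisier_form (u \<oplus>\<^bsub>HS\<^esub> v) w = pisier_form u w + pisier_form v w"
  unfolding pisier_form_apply[OF assms(3)] hardy_coeff_add[OF assms(1,2)]
  by (rule form_lim_add_left[OF bounded_form_hankel_matrix]) (rule hardy_coeff_bound, rule assms)+

lemma pisier_form_smult_right: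
  assumes "u \<in> carrier HS" "v \<in> carrier HS"
  shows "pisier_form u (a \<odot>\<^bsub>HS\<^esub> v) = a * pisier_form u v"
  unfolding pisier_form_apply[OF hardy_smult(1)[OF assms(2)]] pisier_form_apply[OF assms(2)] hardy_coeff_smult[OF assms(2)]
  by (rule form_lim_scale_right[OF bounded_form_hankel_matrix]) (rule hardy_coeff_bound, rule assms)+

lemma pisier_form_smult_left:
  assumes "u \<in> carrier HS" "v \<in> carrier HS"
  shows "pisier_form (a \<odot>\<^bsub>HS\<^esub> u) v = a * pisier_form u v"
  unfolding pisier_form_apply[OF assms(2)] hardy_coeff_smult[OF assms(1)]
  by (rule form_lim_scale_left[OF bounded_form_hankel_matrix]) (rule hardy_coeff_bound, rule assms)+

lemma pisier_form_dual: "u \<in> carrier HS \<Longrightarrow> pisier_form u \<in> carrier (dual_space HS)"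
proof -
  assume u: "u \<in> carrier HS"
  have "(\<lambda>v\<in>carrier HS. pisier_form u v) \<in> carrier (dual_space HS)"
    by (rule dual_intro[OF para_normed_hardy]) (auto intro: pisier_form_add_right pisier_form_smult_right pisier_form_bound u)
  moreover have "(\<lambda>v\<in>carrier HS. pisier_form u v) = pisier_form u" by (simp add: pisier_form_def restrict_def fun_eq_iff)
  ultimately show ?thesis by (simp only:)
qed

lemma pisier_form_bounded_op: "bounded_op HS (dual_space HS) pisier_form"
  unfolding bounded_op_def
proof (intro conjI ballI allI)
  show "pisier_form \<in> carrier HS \<rightarrow> carrier (dual_space HS)" by (auto intro: pisier_form_dual)
  fix u v assume uv: "u \<in> carrier HS" "v \<in> carrier HS"
  show "pisier_form (u \<oplus>\<^bsub>HS\<^esub> v) = pisier_form u \<oplus>\<^bsub>dual_space HS\<^esub> pisier_form v"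
    by (rule dual_eqI[OF pisier_form_dual[OF hardy_add(1)[OF uv]] dual_add_closed[OF para_normed_hardy pisier_form_dual[OF uv(1)] pisier_form_dual[OF uv(2)]]])
       (simp add: dual_simps pisier_form_add_left uv)
next
  fix a u assume u: "u \<in> carrier HS"
  show "pisier_form (a \<odot>\<^bsub>HS\<^esub> u) = a \<odot>\<^bsub>dual_space HS\<^esub> pisier_form u"
    by (rule dual_eqI[OF pisier_form_dual[OF hardy_smult(1)[OF u]] dual_smult_closed[OF para_normed_hardy pisier_form_dual[OF u]]])
       (simp add: dual_simps pisier_form_smult_left u)
next
  have "\<parallel>pisier_form u\<parallel>\<^bsub>dual_space HS\<^esub> \<le> 12 * \<parallel>u\<parallel>\<^bsub>HS\<^esub>" if u: "u \<in> carrier HS" for u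
    unfolding dual_simps(5)
    by (rule op_norm_le[OF para_normed_hardy]) (auto simp: hardy_norm_nonneg intro: pisier_form_bound u)
  then show "\<exists>K. \<forall>u\<in>carrier HS. \<parallel>pisier_form u\<parallel>\<^bsub>dual_space HS\<^esub> \<le> K * \<parallel>u\<parallel>\<^bsub>HS\<^esub>" by blast
qed

lemma disc_algebra_mult: "p \<in> disc_algebra \<Longrightarrow> q \<in> disc_algebra \<Longrightarrow> (\<lambda>z. p z * q z) \<in> disc_algebra"
  by (auto simp: disc_algebra_def intro!: continuous_intros holomorphic_intros)

lemma disc_algebra_add: "p \<in> disc_algebra \<Longrightarrow> q \<in> disc_algebra \<Longrightarrow> (\<lambda>z. p z + q z) \<in> disc_algebra"
  by (auto simp: disc_algebra_def intro!: continuous_intros holomorphic_intros)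

lemma disc_algebra_diff: "p \<in> disc_algebra \<Longrightarrow> q \<in> disc_algebra \<Longrightarrow> (\<lambda>z. p z - q z) \<in> disc_algebra"
  by (auto simp: disc_algebra_def intro!: continuous_intros holomorphic_intros)

lemma id_disc_algebra: "(\<lambda>z. z) \<in> disc_algebra"
  by (auto simp: disc_algebra_def)

lemma mult_op_mult:
  assumes u: "u \<in> carrier HS" and p: "p \<in> disc_algebra" and q: "q \<in> disc_algebra"
  shows "mult_op ell2 p (mult_op ell2 q u) = mult_op ell2 (\<lambda>z. p z * q z) u"
proof (rule hardy_eqI)
  note qu = hardy_mult_op[OF u q]
  show "mult_op ell2 p (mult_op ell2 q u) \<in> carrier HS" by (rule hardy_mult_op(1)[OF qu(1) p])
  show "mult_op ell2 (\<lambda>z. p z * q z) u \<in> carrier HS" by (rule hardy_mult_op(1)[OF u disc_algebra_mult[OF p q]])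
  show "AE z in circle_measure. rep (mult_op ell2 p (mult_op ell2 q u)) z = rep (mult_op ell2 (\<lambda>z. p z * q z) u) z"
    using hardy_mult_op(2)[OF qu(1) p] qu(2) hardy_mult_op(2)[OF u disc_algebra_mult[OF p q]]
    by eventually_elim (simp add: mult.assoc)
qed

lemma mult_op_add:
  assumes u: "u \<in> carrier HS" and p: "p \<in> disc_algebra" and q: "q \<in> disc_algebra"
  shows "mult_op ell2 p u \<oplus>\<^bsub>HS\<^esub> mult_op ell2 q u = mult_op ell2 (\<lambda>z. p z + q z) u"
proof (rule hardy_eqI)
  note pu = hardy_mult_op[OF u p] and qu = hardy_mult_op[OF u q]
  show "mult_op ell2 p u \<oplus>\<^bsub>HS\<^esub> mult_op ell2 q u \<in> carrier HS" by (rule hardy_add(1)[OF pu(1) qu(1)])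
  show "mult_op ell2 (\<lambda>z. p z + q z) u \<in> carrier HS" by (rule hardy_mult_op(1)[OF u disc_algebra_add[OF p q]])
  show "AE z in circle_measure. rep (mult_op ell2 p u \<oplus>\<^bsub>HS\<^esub> mult_op ell2 q u) z = rep (mult_op ell2 (\<lambda>z. p z + q z) u) z"
    using hardy_add(2)[OF pu(1) qu(1)] pu(2) qu(2) hardy_mult_op(2)[OF u disc_algebra_add[OF p q]]
    by eventually_elim (simp add: distrib_right)
qed

text \<open>A power of \<open>z\<close> on either argument ends up in the parameter of
  \<open>hankel_matrix\<close>; the two equations together are the Hankel identity for
  powers.\<close>

lemma pisier_form_power:
  assumes u: "u \<in> carrier HS" and v: "v \<in> carrier HS"
  shows "pisier_form (mult_op ell2 (\<lambda>z. z ^ m) u) v = form_lim (hankel_matrix m) (hardy_coeff u) (hardy_coeff v)"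
    and "pisier_form u (mult_op ell2 (\<lambda>z. z ^ m) v) = form_lim (hankel_matrix m) (hardy_coeff u) (hardy_coeff v)"
proof -
  have bd: "l2_bound (shift_seq m (hardy_coeff w)) ((\<parallel>mult_op ell2 (\<lambda>z. z ^ m) w\<parallel>\<^bsub>HS\<^esub>)\<^sup>2)" if "w \<in> carrier HS" for w
    using hardy_coeff_bound[OF hardy_mult_op(1)[OF that power_disc_algebra, of m]] unfolding hardy_coeff_shift[OF that] .
  show "pisier_form (mult_op ell2 (\<lambda>z. z ^ m) u) v = form_lim (hankel_matrix m) (hardy_coeff u) (hardy_coeff v)"
    unfolding pisier_form_apply[OF v] hardy_coeff_shift[OF u]
    by (rule form_lim_shift_left[OF hardy_coeff_bound[OF u] hardy_coeff_bound[OF v] bd[OF u]])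
  show "pisier_form u (mult_op ell2 (\<lambda>z. z ^ m) v) = form_lim (hankel_matrix m) (hardy_coeff u) (hardy_coeff v)"
    unfolding pisier_form_apply[OF hardy_mult_op(1)[OF v power_disc_algebra]] hardy_coeff_shift[OF v]
    by (rule form_lim_shift_right[OF hardy_coeff_bound[OF u] hardy_coeff_bound[OF v] bd[OF v]])
qed

lemma pisier_form_hankel_id:
  assumes "u \<in> carrier HS" "v \<in> carrier HS"
  shows "pisier_form (mult_op ell2 (\<lambda>z. z) u) v = pisier_form u (mult_op ell2 (\<lambda>z. z) v)"
  using pisier_form_power[OF assms, of 1] by simp

text \<open>Along the Horner form \<open>a + z P\<close>: first \<open>z\<close> is moved to the
  other side, then \<open>P\<close> by the induction hypothesis at the shifted vector. This is why
  \<open>v\<close> is generalized.\<close>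

lemma pisier_form_hankel_poly:
  assumes "u \<in> carrier HS" "v \<in> carrier HS"
  shows "pisier_form (mult_op ell2 (poly P) u) v = pisier_form u (mult_op ell2 (poly P) v)"
  using assms
proof (induction P arbitrary: v)
  case 0
  have "poly (0::complex poly) = (\<lambda>z. 0)" by (simp add: fun_eq_iff)
  then have e: "mult_op ell2 (poly 0) w = 0 \<odot>\<^bsub>HS\<^esub> w" for w by (simp only: hardy_smult_mult_op)
  show ?case unfolding e using 0 by (simp add: pisier_form_smult_left pisier_form_smult_right del: HS.smult_0)
next
  case (pCons a P)
  note u = pCons.prems(1) and v = pCons.prems(2)
  note Pd = poly_disc_algebra[of P]
  have zP: "(\<lambda>z. z * poly P z) \<in> disc_algebra" by (rule disc_algebra_mult[OF id_disc_algebra Pd])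
  have split: "mult_op ell2 (poly (pCons a P)) w = a \<odot>\<^bsub>HS\<^esub> w \<oplus>\<^bsub>HS\<^esub> mult_op ell2 (\<lambda>z. z) (mult_op ell2 (poly P) w)"
    if w: "w \<in> carrier HS" for w
  proof -
    have "poly (pCons a P) = (\<lambda>z. a + z * poly P z)" by (simp add: fun_eq_iff)
    then show ?thesis
      unfolding hardy_smult_mult_op mult_op_mult[OF w id_disc_algebra Pd] mult_op_add[OF w const_disc_algebra zP] by (simp only:)
  qed
  have comm: "mult_op ell2 (poly P) (mult_op ell2 (\<lambda>z. z) v) = mult_op ell2 (\<lambda>z. z) (mult_op ell2 (poly P) v)"
    unfolding mult_op_mult[OF v id_disc_algebra Pd] mult_op_mult[OF v Pd id_disc_algebra] by (simp only: mult.commute)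
  note Pu = hardy_mult_op(1)[OF u Pd] and Pv = hardy_mult_op(1)[OF v Pd] and zv = hardy_mult_op(1)[OF v id_disc_algebra]
  note zPu = hardy_mult_op(1)[OF Pu id_disc_algebra] and zPv = hardy_mult_op(1)[OF Pv id_disc_algebra]
  have "pisier_form (mult_op ell2 (poly (pCons a P)) u) v = a * pisier_form u v + pisier_form (mult_op ell2 (poly P) u) (mult_op ell2 (\<lambda>z. z) v)"
    unfolding split[OF u] pisier_form_add_left[OF hardy_smult(1)[OF u] zPu v] pisier_form_smult_left[OF u v] pisier_form_hankel_id[OF Pu v] ..
  also have "\<dots> = a * pisier_form u v + pisier_form u (mult_op ell2 (\<lambda>z. z) (mult_op ell2 (poly P) v))"
    unfolding pCons.IH[OF u zv] comm ..
  also have "\<dots> = pisier_form u (mult_op ell2 (poly (pCons a P)) v)"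
    unfolding split[OF v] pisier_form_add_right[OF u hardy_smult(1)[OF v] zPv] pisier_form_smult_right[OF u v] ..
  finally show ?case .
qed

lemma pisier_form_hankel:
  assumes f: "f \<in> disc_algebra" and u: "u \<in> carrier HS" and v: "v \<in> carrier HS"
  shows "pisier_form (mult_op ell2 f u) v = pisier_form u (mult_op ell2 f v)"
proof -
  \<comment> \<open>Both error terms are at most \<open>12 (e / c)\<close> times the norms of
    \<open>u\<close> and \<open>v\<close>; the summand \<open>1\<close> keeps \<open>c\<close>
    positive.\<close>
  define c where "c = 24 * \<parallel>u\<parallel>\<^bsub>HS\<^esub> * \<parallel>v\<parallel>\<^bsub>HS\<^esub> + 1"
  have c: "c > 0" unfolding c_def by (intro add_nonneg_pos mult_nonneg_nonneg hardy_norm_nonneg) auto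
  have "cmod (pisier_form (mult_op ell2 f u) v - pisier_form u (mult_op ell2 f v)) \<le> 0"
  proof (rule field_le_epsilon)
    fix e :: real assume e: "e > 0"
    obtain P where P: "\<And>z. cmod z \<le> 1 \<Longrightarrow> cmod (f z - poly P z) \<le> e / c"
      using disc_algebra_poly_approx[OF f, of "e / c"] e c by auto
    define r where "r = (\<lambda>z. f z - poly P z)"
    have r: "r \<in> disc_algebra" unfolding r_def by (rule disc_algebra_diff[OF f poly_disc_algebra])
    have f_eq: "mult_op ell2 f w = mult_op ell2 (poly P) w \<oplus>\<^bsub>HS\<^esub> mult_op ell2 r w" if "w \<in> carrier HS" for w
      unfolding mult_op_add[OF that poly_disc_algebra r] by (simp add: r_def)
    have nr: "\<parallel>mult_op ell2 r w\<parallel>\<^bsub>HS\<^esub> \<le> (e / c) * \<parallel>w\<parallel>\<^bsub>HS\<^esub>" if "w \<in> carrier HS" for w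
      by (rule hardy_mult_op_norm[OF that r]) (simp add: r_def P)
    note cl = hardy_mult_op(1)[OF u poly_disc_algebra] hardy_mult_op(1)[OF u r] hardy_mult_op(1)[OF v poly_disc_algebra] hardy_mult_op(1)[OF v r]
    have "pisier_form (mult_op ell2 f u) v - pisier_form u (mult_op ell2 f v) = pisier_form (mult_op ell2 r u) v - pisier_form u (mult_op ell2 r v)"
      unfolding f_eq[OF u] f_eq[OF v] pisier_form_add_left[OF cl(1,2) v] pisier_form_add_right[OF u cl(3,4)] pisier_form_hankel_poly[OF u v] by simp
    also have "cmod \<dots> \<le> 12 * \<parallel>mult_op ell2 r u\<parallel>\<^bsub>HS\<^esub> * \<parallel>v\<parallel>\<^bsub>HS\<^esub> + 12 * \<parallel>u\<parallel>\<^bsub>HS\<^esub> * \<parallel>mult_op ell2 r v\<parallel>\<^bsub>HS\<^esub>"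
      by (intro order_trans[OF norm_triangle_ineq4] add_mono pisier_form_bound cl u v)
    also have "\<dots> \<le> 12 * ((e / c) * \<parallel>u\<parallel>\<^bsub>HS\<^esub>) * \<parallel>v\<parallel>\<^bsub>HS\<^esub> + 12 * \<parallel>u\<parallel>\<^bsub>HS\<^esub> * ((e / c) * \<parallel>v\<parallel>\<^bsub>HS\<^esub>)"
      by (intro add_mono mult_right_mono mult_left_mono nr u v hardy_norm_nonneg) (auto simp: hardy_norm_nonneg)
    also have "\<dots> = e * ((c - 1) / c)" by (simp add: c_def algebra_simps)
    also have "\<dots> \<le> e * 1" using e c by (intro mult_left_mono) auto
    finally show "cmod (pisier_form (mult_op ell2 f u) v - pisier_form u (mult_op ell2 f v)) \<le> 0 + e" by simp
  qed
  then show ?thesis by simp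
qed

lemma hankel_operator_pisier_form: "hankel_operator ell2 pisier_form"
  unfolding hankel_operator_def using pisier_form_bounded_op pisier_form_hankel by blast

section \<open>The block operator and its powers\<close>

abbreviation TS where "TS \<equiv> T_space ell2"
abbreviation TG where "TG \<equiv> T_op ell2 pisier_form"

lemma para_normed_TS: "para_normed TS"
  unfolding T_space_def by (intro para_normed_direct_sum para_normed_dual para_normed_hardy)

interpretation TS: complex_module TS by (rule para_normed_complex_module[OF para_normed_TS])

lemma TS_carrier: "p \<in> carrier TS \<longleftrightarrow> fst p \<in> carrier (dual_space HS) \<and> snd p \<in> carrier HS"
  by (simp add: T_space_def)

lemma TS_add: "p \<oplus>\<^bsub>TS\<^esub> q = (fst p \<oplus>\<^bsub>dual_space HS\<^esub> fst q, snd p \<oplus>\<^bsub>HS\<^esub> snd q)"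
  by (simp add: T_space_def)

lemma TS_smult: "a \<odot>\<^bsub>TS\<^esub> p = (a \<odot>\<^bsub>dual_space HS\<^esub> fst p, a \<odot>\<^bsub>HS\<^esub> snd p)"
  by (simp add: T_space_def)

lemma TS_norm: "\<parallel>p\<parallel>\<^bsub>TS\<^esub> = sqrt ((\<parallel>fst p\<parallel>\<^bsub>dual_space HS\<^esub>)\<^sup>2 + (\<parallel>snd p\<parallel>\<^bsub>HS\<^esub>)\<^sup>2)"
  by (simp add: T_space_def direct_sum_norm)

lemma TS_norm_ge: "\<parallel>fst p\<parallel>\<^bsub>dual_space HS\<^esub> \<le> \<parallel>p\<parallel>\<^bsub>TS\<^esub>" "\<parallel>snd p\<parallel>\<^bsub>HS\<^esub> \<le> \<parallel>p\<parallel>\<^bsub>TS\<^esub>"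
  unfolding TS_norm by (rule real_le_rsqrt, simp)+

lemma TS_norm_le:
  assumes "p \<in> carrier TS" shows "\<parallel>p\<parallel>\<^bsub>TS\<^esub> \<le> \<parallel>fst p\<parallel>\<^bsub>dual_space HS\<^esub> + \<parallel>snd p\<parallel>\<^bsub>HS\<^esub>"
  unfolding TS_norm by (rule sqrt_sum_squares_le_sum) (use assms in \<open>auto simp: TS_carrier hardy_norm_nonneg dual_norm_nonneg[OF para_normed_hardy]\<close>)

abbreviation mz :: "nat \<Rightarrow> (complex \<Rightarrow> nat \<Rightarrow> complex) set \<Rightarrow> (complex \<Rightarrow> nat \<Rightarrow> complex) set" where
  "mz m \<equiv> mult_op ell2 (\<lambda>z. z ^ m)"

lemma mz_closed: "u \<in> carrier HS \<Longrightarrow> mz m u \<in> carrier HS"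
  by (rule hardy_mult_op(1)[OF _ power_disc_algebra])

lemma mz_norm: "u \<in> carrier HS \<Longrightarrow> \<parallel>mz m u\<parallel>\<^bsub>HS\<^esub> \<le> \<parallel>u\<parallel>\<^bsub>HS\<^esub>"
  using hardy_mult_op_norm[OF _ power_disc_algebra[of m], of u 1] by (simp add: norm_power)

lemma mz_mz: "u \<in> carrier HS \<Longrightarrow> mz m (mz n u) = mz (m + n) u"
  by (simp add: mult_op_mult[OF _ power_disc_algebra power_disc_algebra] power_add)

lemma shift_mz: "shift ell2 = mz 1"
  by (simp add: shift_def)

lemma mz_0: "u \<in> carrier HS \<Longrightarrow> mz 0 u = u"
  using hardy_smult_mult_op[of 1 u] by simp

lemma mult_op_linear:
  assumes p: "p \<in> disc_algebra" and u: "u \<in> carrier HS" and v: "v \<in> carrier HS"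
  shows "mult_op ell2 p (u \<oplus>\<^bsub>HS\<^esub> v) = mult_op ell2 p u \<oplus>\<^bsub>HS\<^esub> mult_op ell2 p v"
    and "mult_op ell2 p (a \<odot>\<^bsub>HS\<^esub> u) = a \<odot>\<^bsub>HS\<^esub> mult_op ell2 p u"
proof -
  note pu = hardy_mult_op[OF u p] and pv = hardy_mult_op[OF v p]
  show "mult_op ell2 p (u \<oplus>\<^bsub>HS\<^esub> v) = mult_op ell2 p u \<oplus>\<^bsub>HS\<^esub> mult_op ell2 p v"
  proof (rule hardy_eqI[OF hardy_mult_op(1)[OF hardy_add(1)[OF u v] p] hardy_add(1)[OF pu(1) pv(1)]])
    show "AE z in circle_measure. rep (mult_op ell2 p (u \<oplus>\<^bsub>HS\<^esub> v)) z = rep (mult_op ell2 p u \<oplus>\<^bsub>HS\<^esub> mult_op ell2 p v) z"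
      using hardy_mult_op(2)[OF hardy_add(1)[OF u v] p] hardy_add(2)[OF u v] hardy_add(2)[OF pu(1) pv(1)] pu(2) pv(2)
      by eventually_elim (simp add: distrib_left)
  qed
  show "mult_op ell2 p (a \<odot>\<^bsub>HS\<^esub> u) = a \<odot>\<^bsub>HS\<^esub> mult_op ell2 p u"
    unfolding hardy_smult_mult_op mult_op_mult[OF u p const_disc_algebra] mult_op_mult[OF u const_disc_algebra p]
    by (simp only: mult.commute)
qed

lemma TG_apply: "TG (\<phi>, g) = ((\<lambda>h\<in>carrier HS. \<phi> (mz 1 h) + pisier_form g h), mz 1 g)"
proof -
  have "banach_adjoint HS (shift ell2) \<phi> \<oplus>\<^bsub>dual_space HS\<^esub> pisier_form g = (\<lambda>h\<in>carrier HS. \<phi> (mz 1 h) + pisier_form g h)"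
    by (auto simp: dual_simps banach_adjoint_def shift_mz restrict_def fun_eq_iff)
  then show ?thesis by (simp add: T_op_def shift_mz)
qed

lemma TG_fst_dual:
  assumes "\<phi> \<in> carrier (dual_space HS)" "g \<in> carrier HS"
  shows "(\<lambda>h\<in>carrier HS. \<phi> (mz 1 h) + pisier_form g h) \<in> carrier (dual_space HS)"
proof (rule dual_intro[OF para_normed_hardy])
  fix x assume x: "x \<in> carrier HS"
  have "cmod (\<phi> (mz 1 x)) \<le> \<parallel>\<phi>\<parallel>\<^bsub>dual_space HS\<^esub> * \<parallel>x\<parallel>\<^bsub>HS\<^esub>"
    using dual_bound[OF para_normed_hardy assms(1) mz_closed[OF x, of 1]]
      mult_left_mono[OF mz_norm[OF x, of 1] dual_norm_nonneg[OF para_normed_hardy assms(1)]] by linarith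
  then show "cmod (\<phi> (mz 1 x) + pisier_form g x) \<le> (\<parallel>\<phi>\<parallel>\<^bsub>dual_space HS\<^esub> + 12 * \<parallel>g\<parallel>\<^bsub>HS\<^esub>) * \<parallel>x\<parallel>\<^bsub>HS\<^esub>"
    using pisier_form_bound[OF assms(2) x] norm_triangle_ineq[of "\<phi> (mz 1 x)" "pisier_form g x"] unfolding distrib_right by linarith
next
  fix x y assume xy: "x \<in> carrier HS" "y \<in> carrier HS"
  show "\<phi> (mz 1 (x \<oplus>\<^bsub>HS\<^esub> y)) + pisier_form g (x \<oplus>\<^bsub>HS\<^esub> y) = (\<phi> (mz 1 x) + pisier_form g x) + (\<phi> (mz 1 y) + pisier_form g y)"
    unfolding mult_op_linear(1)[OF power_disc_algebra xy] dual_linear(1)[OF assms(1) mz_closed[OF xy(1)] mz_closed[OF xy(2)]]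
      pisier_form_add_right[OF assms(2) xy] by simp
next
  fix a x assume x: "x \<in> carrier HS"
  show "\<phi> (mz 1 (a \<odot>\<^bsub>HS\<^esub> x)) + pisier_form g (a \<odot>\<^bsub>HS\<^esub> x) = a * (\<phi> (mz 1 x) + pisier_form g x)"
    unfolding mult_op_linear(2)[OF power_disc_algebra x x] dual_linear(2)[OF assms(1) mz_closed[OF x]]
      pisier_form_smult_right[OF assms(2) x] by (simp add: distrib_left)
qed

lemma TG_bounded: "bounded_op TS TS TG"
  unfolding bounded_op_def
proof (intro conjI ballI allI)
  show "TG \<in> carrier TS \<rightarrow> carrier TS"
  proof
    fix p assume p: "p \<in> carrier TS"
    show "TG p \<in> carrier TS"
      using TG_fst_dual[of "fst p" "snd p"] mz_closed[of "snd p" 1] p TG_apply[of "fst p" "snd p"] by (simp add: TS_carrier)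
  qed
  fix p q assume p: "p \<in> carrier TS" and q: "q \<in> carrier TS"
  then have c: "fst p \<in> carrier (dual_space HS)" "snd p \<in> carrier HS" "fst q \<in> carrier (dual_space HS)" "snd q \<in> carrier HS"
    by (auto simp: TS_carrier)
  show "TG (p \<oplus>\<^bsub>TS\<^esub> q) = TG p \<oplus>\<^bsub>TS\<^esub> TG q"
    unfolding TS_add TG_apply TG_apply[of "fst p" "snd p", simplified] TG_apply[of "fst q" "snd q", simplified] fst_conv snd_conv
      mult_op_linear(1)[OF power_disc_algebra c(2,4)]
    by (auto simp: dual_simps restrict_def fun_eq_iff mz_closed mz_closed[of _ 1, simplified] pisier_form_add_left c)
next
  fix a p assume p: "p \<in> carrier TS"
  then have c: "fst p \<in> carrier (dual_space HS)" "snd p \<in> carrier HS" by (auto simp: TS_carrier)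
  show "TG (a \<odot>\<^bsub>TS\<^esub> p) = a \<odot>\<^bsub>TS\<^esub> TG p"
    unfolding TS_smult TG_apply TG_apply[of "fst p" "snd p", simplified] fst_conv snd_conv
      mult_op_linear(2)[OF power_disc_algebra c(2,2)]
    by (auto simp: dual_simps restrict_def fun_eq_iff mz_closed mz_closed[of _ 1, simplified] pisier_form_smult_left c distrib_left)
next
  \<comment> \<open>\<open>14 = 1 + 12 + 1\<close> for the adjoint shift, the form and the
    shift.\<close>
  have "\<parallel>TG p\<parallel>\<^bsub>TS\<^esub> \<le> 14 * \<parallel>p\<parallel>\<^bsub>TS\<^esub>" if p: "p \<in> carrier TS" for p
  proof -
    have c: "fst p \<in> carrier (dual_space HS)" "snd p \<in> carrier HS" using p by (auto simp: TS_carrier)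
    have e: "TG p = ((\<lambda>h\<in>carrier HS. fst p (mz 1 h) + pisier_form (snd p) h), mz 1 (snd p))"
      using TG_apply[of "fst p" "snd p"] by simp
    have "\<parallel>(\<lambda>h\<in>carrier HS. fst p (mz 1 h) + pisier_form (snd p) h)\<parallel>\<^bsub>dual_space HS\<^esub> \<le> \<parallel>fst p\<parallel>\<^bsub>dual_space HS\<^esub> + 12 * \<parallel>snd p\<parallel>\<^bsub>HS\<^esub>"
      unfolding dual_simps(5)[of HS "\<lambda>h\<in>carrier HS. fst p (mz 1 h) + pisier_form (snd p) h"]
    proof (rule op_norm_le[OF para_normed_hardy])
      fix x assume x: "x \<in> carrier HS"
      have "cmod (fst p (mz 1 x)) \<le> \<parallel>fst p\<parallel>\<^bsub>dual_space HS\<^esub> * \<parallel>x\<parallel>\<^bsub>HS\<^esub>"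
        using dual_bound[OF para_normed_hardy c(1) mz_closed[OF x, of 1]]
          mult_left_mono[OF mz_norm[OF x, of 1] dual_norm_nonneg[OF para_normed_hardy c(1)]] by linarith
      then have "cmod (fst p (mz 1 x) + pisier_form (snd p) x) \<le> (\<parallel>fst p\<parallel>\<^bsub>dual_space HS\<^esub> + 12 * \<parallel>snd p\<parallel>\<^bsub>HS\<^esub>) * \<parallel>x\<parallel>\<^bsub>HS\<^esub>"
        using pisier_form_bound[OF c(2) x] norm_triangle_ineq[of "fst p (mz 1 x)" "pisier_form (snd p) x"] unfolding distrib_right by linarith
      then show "\<parallel>(\<lambda>h\<in>carrier HS. fst p (mz 1 h) + pisier_form (snd p) h) x\<parallel>\<^bsub>complex_space\<^esub> \<le> (\<parallel>fst p\<parallel>\<^bsub>dual_space HS\<^esub> + 12 * \<parallel>snd p\<parallel>\<^bsub>HS\<^esub>) * \<parallel>x\<parallel>\<^bsub>HS\<^esub>"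
        using x by simp
    qed (simp add: hardy_norm_nonneg dual_norm_nonneg[OF para_normed_hardy c(1)])
    moreover have "TG p \<in> carrier TS"
      unfolding e TS_carrier fst_conv snd_conv using TG_fst_dual[OF c] mz_closed[OF c(2)] by blast
    ultimately have "\<parallel>TG p\<parallel>\<^bsub>TS\<^esub> \<le> \<parallel>fst p\<parallel>\<^bsub>dual_space HS\<^esub> + 12 * \<parallel>snd p\<parallel>\<^bsub>HS\<^esub> + \<parallel>snd p\<parallel>\<^bsub>HS\<^esub>"
      using TS_norm_le[of "TG p"] mz_norm[OF c(2), of 1] unfolding e fst_conv snd_conv by linarith
    then show ?thesis using TS_norm_ge[of p] by linarith
  qed
  then show "\<exists>K. \<forall>p\<in>carrier TS. \<parallel>TG p\<parallel>\<^bsub>TS\<^esub> \<le> K * \<parallel>p\<parallel>\<^bsub>TS\<^esub>" by blast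
qed

text \<open>The off-diagonal block of the power collects \<open>k\<close> terms in which
  \<open>k - 1\<close> shifts are distributed over the two arguments of the form. By the Hankel
  identity they all agree, hence the factor \<open>k\<close>. For \<open>k = 0\<close> the truncated
  \<open>k - 1\<close> is multiplied by zero.\<close>

lemma TG_power:
  assumes "\<phi> \<in> carrier (dual_space HS)" "g \<in> carrier HS"
  shows "(TG ^^ k) (\<phi>, g) \<in> carrier TS" "snd ((TG ^^ k) (\<phi>, g)) = mz k g"
    "\<And>h. h \<in> carrier HS \<Longrightarrow> fst ((TG ^^ k) (\<phi>, g)) h = \<phi> (mz k h) + of_nat k * pisier_form (mz (k - 1) g) h"
proof -
  have "(TG ^^ k) (\<phi>, g) \<in> carrier TS \<and> snd ((TG ^^ k) (\<phi>, g)) = mz k g \<and>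
    (\<forall>h\<in>carrier HS. fst ((TG ^^ k) (\<phi>, g)) h = \<phi> (mz k h) + of_nat k * pisier_form (mz (k - 1) g) h)"
  proof (induction k)
    case 0
    then show ?case using assms by (simp add: TS_carrier mz_0[unfolded power_0])
  next
    case (Suc k)
    define A where "A = fst ((TG ^^ k) (\<phi>, g))"
    have pk: "(TG ^^ k) (\<phi>, g) = (A, mz k g)" using Suc by (simp add: A_def prod_eq_iff)
    have A: "A h = \<phi> (mz k h) + of_nat k * pisier_form (mz (k - 1) g) h" if "h \<in> carrier HS" for h
      using Suc that by (simp add: A_def)
    have e: "(TG ^^ Suc k) (\<phi>, g) = ((\<lambda>h\<in>carrier HS. A (mz 1 h) + pisier_form (mz k g) h), mz 1 (mz k g))"
      using TG_apply[of A "mz k g"] by (simp add: pk)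
    have "A (mz 1 h) + pisier_form (mz k g) h = \<phi> (mz (Suc k) h) + of_nat (Suc k) * pisier_form (mz k g) h" if h: "h \<in> carrier HS" for h
    proof (cases k)
      case 0
      then show ?thesis unfolding A[OF mz_closed[OF h]] mz_mz[OF h] by simp
    next
      case (Suc j)
      have "pisier_form (mz j g) (mz 1 h) = pisier_form (mz k g) h"
        using pisier_form_hankel[OF power_disc_algebra[of 1] mz_closed[OF assms(2), of j] h] unfolding mz_mz[OF assms(2)] by (simp add: Suc)
      then show ?thesis unfolding A[OF mz_closed[OF h]] mz_mz[OF h] by (simp add: Suc algebra_simps)
    qed
    moreover have "mz 1 (mz k g) = mz (Suc k) g" by (subst mz_mz[OF assms(2)]) simp
    moreover have "(TG ^^ Suc k) (\<phi>, g) \<in> carrier TS"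
      using bounded_opD(1)[OF TG_bounded] Suc by simp
    ultimately show ?case unfolding e by simp
  qed
  then show "(TG ^^ k) (\<phi>, g) \<in> carrier TS" "snd ((TG ^^ k) (\<phi>, g)) = mz k g"
    "\<And>h. h \<in> carrier HS \<Longrightarrow> fst ((TG ^^ k) (\<phi>, g)) h = \<phi> (mz k h) + of_nat k * pisier_form (mz (k - 1) g) h" by auto
qed

subsection \<open>The counterexample\<close>

lemma (in complex_module) additive_finsum:
  fixes F :: "'a \<Rightarrow> 'b::comm_monoid_add"
  assumes "\<And>x y. x \<in> carrier V \<Longrightarrow> y \<in> carrier V \<Longrightarrow> F (x \<oplus> y) = F x + F y" and "F \<zero> = 0"
    and "finite I" and "\<And>i. i \<in> I \<Longrightarrow> v i \<in> carrier V"
  shows "F (finsum V v I) = (\<Sum>i\<in>I. F (v i))"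
  using assms(3,4)
proof (induction I rule: finite_induct)
  case empty
  then show ?case by (simp add: assms(2))
next
  case (insert i I)
  have v: "v \<in> I \<rightarrow> carrier V" using insert.prems by auto
  then have "finsum V v (insert i I) = v i \<oplus> finsum V v I"
    using insert.hyps insert.prems by (intro M.finsum_insert) auto
  then show ?case using insert M.finsum_closed[OF v] by (simp add: assms(1))
qed

lemma linear_finsum:
  assumes V: "complex_module V" and W: "complex_module W"
    and cl: "\<And>x. x \<in> carrier V \<Longrightarrow> F x \<in> carrier W"
    and add: "\<And>x y. x \<in> carrier V \<Longrightarrow> y \<in> carrier V \<Longrightarrow> F (x \<oplus>\<^bsub>V\<^esub> y) = F x \<oplus>\<^bsub>W\<^esub> F y"
    and smult: "\<And>a x. x \<in> carrier V \<Longrightarrow> F (a \<odot>\<^bsub>V\<^esub> x) = a \<odot>\<^bsub>W\<^esub> F x"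
    and "finite I" and "\<And>i. i \<in> I \<Longrightarrow> v i \<in> carrier V"
  shows "F (finsum V v I) = finsum W (\<lambda>i. F (v i)) I"
proof -
  interpret V: complex_module V by fact
  interpret W: complex_module W by fact
  have z: "F \<zero>\<^bsub>V\<^esub> = \<zero>\<^bsub>W\<^esub>" using smult[of "\<zero>\<^bsub>V\<^esub>" 0] cl[of "\<zero>\<^bsub>V\<^esub>"] by simp
  show ?thesis using assms(6,7)
  proof (induction I rule: finite_induct)
    case empty
    then show ?case by (simp add: z)
  next
    case (insert i I)
    have v: "v \<in> I \<rightarrow> carrier V" using insert.prems by auto
    then have w: "(\<lambda>i. F (v i)) \<in> I \<rightarrow> carrier W" using cl by auto
    have "finsum V v (insert i I) = v i \<oplus>\<^bsub>V\<^esub> finsum V v I"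
      using insert.hyps insert.prems v by (intro V.M.finsum_insert) auto
    moreover have "finsum W (\<lambda>i. F (v i)) (insert i I) = F (v i) \<oplus>\<^bsub>W\<^esub> finsum W (\<lambda>i. F (v i)) I"
      using insert.hyps insert.prems w cl by (intro W.M.finsum_insert) auto
    ultimately show ?case using insert V.M.finsum_closed[OF v] by (simp add: add)
  qed
qed

lemma bounded_op_finsum:
  assumes "complex_module V" "complex_module W" "bounded_op V W R" "finite I" "\<And>i. i \<in> I \<Longrightarrow> v i \<in> carrier V"
  shows "R (finsum V v I) = finsum W (\<lambda>i. R (v i)) I"
  using assms by (intro linear_finsum bounded_opD[OF assms(3)]) auto

lemma bounded_op_comp:
  assumes V: "para_normed V" and W: "para_normed W" and X: "para_normed X"
    and S: "bounded_op V W S" and T: "bounded_op W X T"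
  shows "bounded_op V X (\<lambda>x. T (S x))"
proof -
  have "\<parallel>T (S x)\<parallel>\<^bsub>X\<^esub> \<le> (op_norm W X T * op_norm V W S) * \<parallel>x\<parallel>\<^bsub>V\<^esub>" if x: "x \<in> carrier V" for x
    using op_norm_bound[OF W X T bounded_opD(1)[OF S x]]
      mult_left_mono[OF op_norm_bound[OF V W S x] op_norm_nonneg[OF W X T]] by (simp add: mult.assoc)
  then show ?thesis
    unfolding bounded_op_def by (auto simp: bounded_opD(1-3)[OF S] bounded_opD(1-3)[OF T])
qed

lemma mult_op_finsum:
  assumes u: "u \<in> carrier HS" and "finite I"
  shows "finsum HS (\<lambda>k. a k \<odot>\<^bsub>HS\<^esub> mz k u) I = mult_op ell2 (\<lambda>z. \<Sum>k\<in>I. a k * z ^ k) u"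
  using assms(2)
proof (induction I rule: finite_induct)
  case empty
  then show ?case using hardy_smult_mult_op[of 0 u] u by simp
next
  case (insert i I)
  have d: "(\<lambda>z. \<Sum>k\<in>J. a k * z ^ k) \<in> disc_algebra" for J
    by (auto simp: disc_algebra_def intro!: continuous_intros holomorphic_intros)
  have di: "(\<lambda>z. a i * z ^ i) \<in> disc_algebra"
    by (auto simp: disc_algebra_def intro!: continuous_intros holomorphic_intros)
  have "finsum HS (\<lambda>k. a k \<odot>\<^bsub>HS\<^esub> mz k u) (insert i I)
    = a i \<odot>\<^bsub>HS\<^esub> mz i u \<oplus>\<^bsub>HS\<^esub> finsum HS (\<lambda>k. a k \<odot>\<^bsub>HS\<^esub> mz k u) I"
    using insert.hyps u by (intro HS.M.finsum_insert) (auto intro: mz_closed)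
  also have "\<dots> = mult_op ell2 (\<lambda>z. a i * z ^ i + (\<Sum>k\<in>I. a k * z ^ k)) u"
    unfolding insert.IH unfolding hardy_smult_mult_op mult_op_mult[OF u const_disc_algebra power_disc_algebra] mult_op_add[OF u di d] ..
  finally show ?case using insert.hyps by simp
qed

lemma mult_op_poly:
  assumes u: "u \<in> carrier HS"
  shows "finsum HS (\<lambda>k. coeff P k \<odot>\<^bsub>HS\<^esub> mz k u) {..degree P} = mult_op ell2 (poly P) u"
proof -
  have "poly P = (\<lambda>z. \<Sum>k\<le>degree P. coeff P k * z ^ k)" by (simp add: fun_eq_iff poly_altdef)
  then show ?thesis using mult_op_finsum[OF u, of "{..degree P}" "coeff P"] by simp
qed

lemma TS_finsum:
  assumes "finite I" "\<And>i. i \<in> I \<Longrightarrow> v i \<in> carrier TS"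
  shows "finsum TS v I \<in> carrier TS" "snd (finsum TS v I) = finsum HS (\<lambda>i. snd (v i)) I"
    "h \<in> carrier HS \<Longrightarrow> fst (finsum TS v I) h = (\<Sum>i\<in>I. fst (v i) h)"
proof -
  show "finsum TS v I \<in> carrier TS" using assms by (intro TS.M.finsum_closed) auto
  show "snd (finsum TS v I) = finsum HS (\<lambda>i. snd (v i)) I"
    using assms by (intro linear_finsum[OF TS.complex_module_axioms HS.complex_module_axioms]) (auto simp: TS_carrier TS_add TS_smult)
  assume h: "h \<in> carrier HS"
  have "fst \<zero>\<^bsub>TS\<^esub> h = 0" using h by (simp add: T_space_def dual_simps(2))
  then show "fst (finsum TS v I) h = (\<Sum>i\<in>I. fst (v i) h)"
    using assms h by (intro TS.additive_finsum) (auto simp: TS_add dual_simps(3))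
qed

lemma dual_finsum:
  assumes V: "complex_module V" and \<phi>: "\<phi> \<in> carrier (dual_space V)" and "finite I" "\<And>i. i \<in> I \<Longrightarrow> v i \<in> carrier V"
  shows "\<phi> (finsum V v I) = (\<Sum>i\<in>I. \<phi> (v i))"
proof -
  interpret complex_module V by fact
  have "\<phi> \<zero>\<^bsub>V\<^esub> = 0" using dual_linear(2)[OF \<phi>, of "\<zero>\<^bsub>V\<^esub>" 0] by simp
  then show ?thesis using assms(3,4) by (intro additive_finsum dual_linear(1)[OF \<phi>]) auto
qed

text \<open>The factor \<open>k\<close> from the power formula is the one from differentiation, so
  the off-diagonal block of a polynomial contains the derivative.\<close>

lemma sum_coeff_pderiv:
  fixes P :: "complex poly"
  shows "(\<Sum>k\<le>degree P. coeff P k * (of_nat k * G (k - 1))) = (\<Sum>m\<le>degree (pderiv P). coeff (pderiv P) m * G m)"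
proof (cases "degree P")
  case 0
  then have "pderiv P = 0" by (simp add: pderiv_eq_0_iff)
  then show ?thesis using 0 by simp
next
  case (Suc d)
  then have "degree (pderiv P) = d" by (simp add: degree_pderiv)
  then show ?thesis unfolding Suc sum.atMost_Suc_shift by (simp add: coeff_pderiv mult_ac)
qed

lemma poly_TG:
  assumes p: "p \<in> carrier TS"
  shows "poly_op TS P TG p \<in> carrier TS" "snd (poly_op TS P TG p) = mult_op ell2 (poly P) (snd p)"
    "h \<in> carrier HS \<Longrightarrow> fst (poly_op TS P TG p) h = fst p (mult_op ell2 (poly P) h)
       + (\<Sum>m\<le>degree (pderiv P). coeff (pderiv P) m * form_lim (hankel_matrix m) (hardy_coeff (snd p)) (hardy_coeff h))"
proof -
  have c: "fst p \<in> carrier (dual_space HS)" "snd p \<in> carrier HS" using p by (auto simp: TS_carrier)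
  note pw = TG_power[OF c, unfolded prod.collapse]
  have cl: "coeff P k \<odot>\<^bsub>TS\<^esub> (TG ^^ k) p \<in> carrier TS" for k using pw(1) by simp
  show "poly_op TS P TG p \<in> carrier TS" unfolding poly_op_def by (rule TS_finsum(1)[OF finite_atMost cl])
  show "snd (poly_op TS P TG p) = mult_op ell2 (poly P) (snd p)"
    unfolding poly_op_def TS_finsum(2)[OF finite_atMost cl] unfolding TS_smult snd_conv pw(2) by (rule mult_op_poly[OF c(2)])
  assume h: "h \<in> carrier HS"
  have t: "fst (coeff P k \<odot>\<^bsub>TS\<^esub> (TG ^^ k) p) h = fst p (coeff P k \<odot>\<^bsub>HS\<^esub> mz k h)
      + coeff P k * (of_nat k * form_lim (hankel_matrix (k - 1)) (hardy_coeff (snd p)) (hardy_coeff h))" for k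
    unfolding TS_smult fst_conv dual_simps(4) restrict_apply' [OF h] pw(3)[OF h] pisier_form_power(1)[OF c(2) h]
      dual_linear(2)[OF c(1) mz_closed[OF h]] by (simp add: distrib_left)
  have "fst p (mult_op ell2 (poly P) h) = (\<Sum>k\<le>degree P. fst p (coeff P k \<odot>\<^bsub>HS\<^esub> mz k h))"
    unfolding mult_op_poly[OF h, symmetric]
    by (rule dual_finsum[OF HS.complex_module_axioms c(1)]) (auto intro: mz_closed h)
  then show "fst (poly_op TS P TG p) h = fst p (mult_op ell2 (poly P) h)
       + (\<Sum>m\<le>degree (pderiv P). coeff (pderiv P) m * form_lim (hankel_matrix m) (hardy_coeff (snd p)) (hardy_coeff h))"
    unfolding poly_op_def TS_finsum(3)[OF finite_atMost cl h] t sum.distrib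
      sum_coeff_pderiv[where G = "\<lambda>m. form_lim (hankel_matrix m) (hardy_coeff (snd p)) (hardy_coeff h)"] by simp
qed

text \<open>With \<open>M\<close> the supremum of the polynomial, the diagonal blocks contribute
  \<open>M\<close> each and the off-diagonal block \<open>12 M\<close>, the bound of
  \<open>hankel_polynomial_bound\<close>; this adds up to \<open>14\<close>.\<close>

lemma polynomially_bounded_TG: "polynomially_bounded TS TG"
  unfolding polynomially_bounded_def
proof (intro conjI TG_bounded exI[of _ 14] allI)
  fix P :: "complex poly"
  define M where "M = (SUP z\<in>sphere 0 1. cmod (poly P z))"
  have "compact ((\<lambda>z. cmod (poly P z)) ` sphere 0 1)"
    by (intro compact_continuous_image continuous_intros) auto
  then have bdd: "bdd_above ((\<lambda>z. cmod (poly P z)) ` sphere 0 1)"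
    by (intro bounded_imp_bdd_above compact_imp_bounded)
  have M: "cmod (poly P z) \<le> M" if "cmod z = 1" for z
    unfolding M_def by (rule cSUP_upper[OF _ bdd]) (use that in simp)
  have M0: "0 \<le> M" using order_trans[OF norm_ge_zero M[of 1]] by simp
  show "op_norm TS TS (poly_op TS P TG) \<le> 14 * (SUP z\<in>sphere 0 1. cmod (poly P z))"
    unfolding M_def[symmetric]
  proof (rule op_norm_le[OF para_normed_TS])
    show "0 \<le> 14 * M" using M0 by simp
    fix p assume p: "p \<in> carrier TS"
    then have c: "fst p \<in> carrier (dual_space HS)" "snd p \<in> carrier HS" by (auto simp: TS_carrier)
    note q = poly_TG[OF p, where P = P]
    define A B where "A = \<parallel>fst p\<parallel>\<^bsub>dual_space HS\<^esub>" and "B = \<parallel>snd p\<parallel>\<^bsub>HS\<^esub>"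
    have nn: "A \<ge> 0" "B \<ge> 0" unfolding A_def B_def by (rule dual_norm_nonneg[OF para_normed_hardy c(1)], rule hardy_norm_nonneg)
    have "\<parallel>fst (poly_op TS P TG p)\<parallel>\<^bsub>dual_space HS\<^esub> \<le> M * A + 12 * M * B"
      unfolding dual_simps(5)[of HS "fst (poly_op TS P TG p)"]
    proof (rule op_norm_le[OF para_normed_hardy])
      show "0 \<le> M * A + 12 * M * B" using nn M0 by simp
      fix h assume h: "h \<in> carrier HS"
      have "cmod (fst p (mult_op ell2 (poly P) h)) \<le> A * \<parallel>mult_op ell2 (poly P) h\<parallel>\<^bsub>HS\<^esub>"
        unfolding A_def by (rule dual_bound[OF para_normed_hardy c(1) hardy_mult_op(1)[OF h poly_disc_algebra]])
      also have "\<dots> \<le> A * (M * \<parallel>h\<parallel>\<^bsub>HS\<^esub>)"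
        by (rule mult_left_mono[OF hardy_mult_op_norm[OF h poly_disc_algebra M] nn(1)])
      finally have 1: "cmod (fst p (mult_op ell2 (poly P) h)) \<le> M * A * \<parallel>h\<parallel>\<^bsub>HS\<^esub>" by (simp add: mult_ac)
      have 2: "cmod (\<Sum>m\<le>degree (pderiv P). coeff (pderiv P) m * form_lim (hankel_matrix m) (hardy_coeff (snd p)) (hardy_coeff h))
        \<le> 12 * M * B * \<parallel>h\<parallel>\<^bsub>HS\<^esub>"
        using hankel_polynomial_bound[OF M hardy_coeff_bound[OF c(2)] hardy_coeff_bound[OF h]]
        by (simp add: B_def hardy_norm_nonneg)
      show "\<parallel>fst (poly_op TS P TG p) h\<parallel>\<^bsub>complex_space\<^esub> \<le> (M * A + 12 * M * B) * \<parallel>h\<parallel>\<^bsub>HS\<^esub>"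
        unfolding complex_space_simps(5) q(3)[OF h] distrib_right
        by (rule norm_triangle_le[OF add_mono[OF 1 2]])
    qed
    moreover have "\<parallel>snd (poly_op TS P TG p)\<parallel>\<^bsub>HS\<^esub> \<le> M * B"
      unfolding q(2) B_def by (rule hardy_mult_op_norm[OF c(2) poly_disc_algebra M])
    ultimately have "\<parallel>poly_op TS P TG p\<parallel>\<^bsub>TS\<^esub> \<le> M * A + 13 * (M * B)"
      using TS_norm_le[OF q(1)] by linarith
    also have "\<dots> \<le> M * \<parallel>p\<parallel>\<^bsub>TS\<^esub> + 13 * (M * \<parallel>p\<parallel>\<^bsub>TS\<^esub>)"
      unfolding A_def B_def by (intro add_mono mult_left_mono TS_norm_ge M0) auto
    finally show "\<parallel>poly_op TS P TG p\<parallel>\<^bsub>TS\<^esub> \<le> 14 * M * \<parallel>p\<parallel>\<^bsub>TS\<^esub>" by simp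
  qed
qed

text \<open>Evaluating the form at constant basis vectors recovers the entries of the matrices
  \<open>c_k\<close>.\<close>

lemma pisier_form_mz_units:
  assumes "finite A" "finite B"
  shows "pisier_form (mz k (hardy_unit 0 (set_encode B))) (hardy_unit 0 (set_encode A)) = of_real (hankel_weight k) * car k A B"
  unfolding pisier_form_power(1)[OF hardy_unit_carrier hardy_unit_carrier] hardy_coeff_unit form_lim_unit
  using assms by (simp add: hankel_matrix_def set_encode_inverse)

lemma of_real_car [simp]: "of_real (car l A B) = (car l A B :: complex)"
  by (simp add: car_def)

text \<open>The summands are \<open>2 (k + 1) / ((k + 2) (k + 3))\<close>, compared with the
  harmonic series; the factor \<open>1 / 3\<close> is forced by \<open>k = 0\<close>, where equality
  holds.\<close>

lemma weight_sum_unbounded: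
  assumes "\<And>L. (\<Sum>k<L. ((real k + 1) * hankel_weight k)\<^sup>2) \<le> K"
  shows False
proof -
  have "1 / (3 * (real k + 1)) \<le> ((real k + 1) * hankel_weight k)\<^sup>2" for k
  proof -
    have "((real k + 1) * hankel_weight k)\<^sup>2 = 2 * (real k + 1) / ((real k + 2) * (real k + 3))"
      unfolding power_mult_distrib hankel_weight_sq by (simp add: power2_eq_square)
    moreover have "1 / (3 * (real k + 1)) \<le> 2 * (real k + 1) / ((real k + 2) * (real k + 3))"
      by (simp add: divide_simps) (simp add: algebra_simps)
    ultimately show ?thesis by simp
  qed
  then have "(\<Sum>k<L. 1 / (3 * (real k + 1))) \<le> K" for L
    by (intro order_trans[OF sum_mono assms])
  then have "summable (\<lambda>k. 1 / (3 * (real k + 1)))"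
    by (intro summableI_nonneg_bounded) auto
  from summable_mult[OF this, of 3] have "summable (\<lambda>k. 3 * (1 / (3 * (real k + 1))))" .
  moreover have "3 * (1 / (3 * (real k + 1))) = inverse (real (Suc k))" for k
    unfolding of_nat_Suc by (simp add: divide_simps)
  ultimately have "summable (\<lambda>k. inverse (real (Suc k)))" by (simp only:)
  then have "summable (\<lambda>k. inverse (real k))" by (simp only: summable_Suc_iff[of "\<lambda>k. inverse (real k)"])
  then show False using not_summable_harmonic[where 'a = real] by simp
qed

text \<open>The contraction inequality for the conjugated operator is applied to the images under
  \<open>R'\<close> of the vectors \<open>(0, e_B)\<close>. Pulled back through \<open>R\<close> and
  tested against \<open>e_A\<close>, its left side is at least of order \<open>\<beta>^2\<close>,
  while its right side is linear in \<open>\<beta>\<close>.\<close>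

lemma similar_contraction_bound:
  assumes R: "bounded_op TS TS R" and R': "bounded_op TS TS R'"
    and inv: "\<And>x. x \<in> carrier TS \<Longrightarrow> R (R' x) = x \<and> R' (R x) = x"
    and contr: "op_norm TS TS (\<lambda>x. R' (TG (R x))) \<le> 1"
  shows "(\<Sum>k<L. ((real k + 1) * hankel_weight k)\<^sup>2) \<le> 4 * (op_norm TS TS R * op_norm TS TS R')\<^sup>2"
proof -
  define T where "T = (\<lambda>x. R' (TG (R x)))"
  have T: "bounded_op TS TS T"
    unfolding T_def using bounded_op_comp[OF para_normed_TS para_normed_TS para_normed_TS
        bounded_op_comp[OF para_normed_TS para_normed_TS para_normed_TS R TG_bounded] R'] .
  have Tc: "\<parallel>T x\<parallel>\<^bsub>TS\<^esub> \<le> \<parallel>x\<parallel>\<^bsub>TS\<^esub>" if x: "x \<in> carrier TS" for x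
    using op_norm_bound[OF para_normed_TS para_normed_TS T x]
      mult_right_mono[OF contr[folded T_def] para_normedD(2)[OF para_normed_TS x]] by simp
  interpret PC: para_contraction TS T
    by (intro para_contraction.intro para_space.intro TS.complex_module_axioms para_space_axioms.intro para_normed_TS
        para_contraction_axioms.intro bounded_opD(1-3)[OF T] Tc)
  have TG_pow: "(TG ^^ k) z \<in> carrier TS" if "z \<in> carrier TS" for k z
    using TG_power(1)[of "fst z" "snd z"] that by (simp add: TS_carrier)
  have pow: "R ((T ^^ k) x) = (TG ^^ k) (R x) \<and> (T ^^ k) x \<in> carrier TS" if x: "x \<in> carrier TS" for k x
  proof (induction k)
    case (Suc k)
    have "TG (R ((T ^^ k) x)) \<in> carrier TS"
      using Suc by (intro bounded_opD(1)[OF TG_bounded] bounded_opD(1)[OF R]) blast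
    then have "R (R' (TG (R ((T ^^ k) x)))) = TG (R ((T ^^ k) x))" using inv by blast
    moreover have "T ((T ^^ k) x) \<in> carrier TS" using Suc by (intro bounded_opD(1)[OF T]) blast
    ultimately show ?case using Suc by (simp add: T_def)
  qed (use x in simp)
  define r r' where "r = op_norm TS TS R" and "r' = op_norm TS TS R'"
  have r: "0 \<le> r" "0 \<le> r'" unfolding r_def r'_def by (intro op_norm_nonneg para_normed_TS R R')+
  define b where "b k = (real k + 1) * hankel_weight k" for k
  define \<beta> where "\<beta> = (\<Sum>k<L. (b k)\<^sup>2)"
  define U where "U = Pow {..<L}"
  define e where "e A = hardy_unit 0 (set_encode A)" for A
  define y where "y A = (\<zero>\<^bsub>dual_space HS\<^esub>, e A)" for A
  define x where "x A = R' (y A)" for A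
  have zd: "\<zero>\<^bsub>dual_space HS\<^esub> \<in> carrier (dual_space HS)" by (rule para_normed_zero(1)[OF para_normed_dual[OF para_normed_hardy]])
  have e: "e A \<in> carrier HS" for A unfolding e_def by (rule hardy_unit_carrier)
  have y: "y A \<in> carrier TS" for A by (simp add: TS_carrier y_def zd e)
  have y1: "\<parallel>y A\<parallel>\<^bsub>TS\<^esub> = 1" for A
    unfolding TS_norm y_def e_def by (simp add: hardy_unit_norm para_normed_zero(2)[OF para_normed_dual[OF para_normed_hardy]])
  have x: "x A \<in> carrier TS" for A unfolding x_def by (rule bounded_opD(1)[OF R' y])
  have Rx: "R (x A) = y A" for A unfolding x_def using inv[OF y] by simp
  have nx: "PC.nsq (x A) \<le> r'\<^sup>2" for A
    unfolding PC.nsq_def using op_norm_bound[OF para_normed_TS para_normed_TS R' y, of A]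
    by (intro power_mono para_normedD(2)[OF para_normed_TS x]) (simp add: y1 x_def r'_def)
  define I where "I = {..<L} \<times> U"
  have fin: "finite I" "finite U" by (auto simp: I_def U_def)
  define c :: "nat set \<Rightarrow> nat \<times> nat set \<Rightarrow> real" where "c A p = b (fst p) * car (fst p) A (snd p)" for A p
  \<comment> \<open>The delay is \<open>Suc k\<close>, since the power \<open>k + 1\<close> of
    \<open>TG\<close> has the off-diagonal block \<open>(k + 1) \<Gamma>(z^k g, h)\<close>. Its
    entry is \<open>b k * car k A B\<close>.\<close>
  define v where "v A = finsum TS (\<lambda>p. of_real (c A p) \<odot>\<^bsub>TS\<^esub> (T ^^ Suc (fst p)) (x (snd p))) I" for A
  have cl: "of_real (c A p) \<odot>\<^bsub>TS\<^esub> (T ^^ Suc (fst p)) (x (snd p)) \<in> carrier TS" for A p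
    using pow[OF x] by (intro TS.smult_closed) blast
  have v: "v A \<in> carrier TS" for A unfolding v_def by (rule TS_finsum(1)[OF fin(1) cl])
  have clR: "of_real (c A p) \<odot>\<^bsub>TS\<^esub> (TG ^^ Suc (fst p)) (y (snd p)) \<in> carrier TS" for A p
    unfolding y_def by (intro TS.smult_closed TG_power(1) zd e)
  have "R (v A) = finsum TS (\<lambda>p. of_real (c A p) \<odot>\<^bsub>TS\<^esub> (TG ^^ Suc (fst p)) (y (snd p))) I" for A
    unfolding v_def bounded_op_finsum[OF TS.complex_module_axioms TS.complex_module_axioms R fin(1) cl]
    unfolding bounded_opD(3)[OF R conjunct2[OF pow[OF x]]] conjunct1[OF pow[OF x]] Rx ..
  then have fv: "fst (R (v A)) (e A) = (\<Sum>p\<in>I. fst (of_real (c A p) \<odot>\<^bsub>TS\<^esub> (TG ^^ Suc (fst p)) (y (snd p))) (e A))" for A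
    using TS_finsum(3)[OF fin(1) clR[of A] e[of A]] by simp
  \<comment> \<open>The number \<open>b k * car k A B\<close> occurs both as coefficient of the
    combination and as matrix entry, so signs disappear.\<close>
  have entry: "fst (of_real (c A p) \<odot>\<^bsub>TS\<^esub> (TG ^^ Suc (fst p)) (y (snd p))) (e A) = of_real ((b (fst p))\<^sup>2 * (car (fst p) A (snd p))\<^sup>2)"
    if "A \<in> U" "p \<in> I" for A p
  proof -
    have f: "finite A" "finite (snd p)" using that finite_subset[OF _ finite_lessThan[of L]] by (auto simp: I_def U_def)
    have "pisier_form (mz (fst p) (e (snd p))) (e A) = of_real (hankel_weight (fst p)) * car (fst p) A (snd p)"
      unfolding e_def by (rule pisier_form_mz_units[OF f])
    then have "fst ((TG ^^ Suc (fst p)) (y (snd p))) (e A) = of_real (b (fst p)) * car (fst p) A (snd p)"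
      unfolding y_def TG_power(3)[OF zd e e] unfolding dual_simps(2) restrict_apply'[OF mz_closed[OF e]] by (simp add: b_def add.commute)
    then show ?thesis unfolding TS_smult fst_conv dual_simps(4) restrict_apply'[OF e]
      by (simp add: c_def power2_eq_square mult_ac)
  qed
  define q where "q A = (\<Sum>p\<in>I. (b (fst p))\<^sup>2 * (car (fst p) A (snd p))\<^sup>2)" for A
  have q0: "0 \<le> q A" for A unfolding q_def by (intro sum_nonneg) auto
  have qv: "q A \<le> r * \<parallel>v A\<parallel>\<^bsub>TS\<^esub>" if A: "A \<in> U" for A
  proof -
    have Rv: "R (v A) \<in> carrier TS" by (rule bounded_opD(1)[OF R v])
    have "fst (R (v A)) (e A) = of_real (q A)" unfolding fv q_def using entry[OF A] by simp
    then have "q A = cmod (fst (R (v A)) (e A))" using q0[of A] by simp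
    also have "\<dots> \<le> \<parallel>fst (R (v A))\<parallel>\<^bsub>dual_space HS\<^esub> * \<parallel>e A\<parallel>\<^bsub>HS\<^esub>"
      by (rule dual_bound[OF para_normed_hardy _ e]) (use Rv in \<open>simp add: TS_carrier\<close>)
    also have "\<dots> \<le> \<parallel>R (v A)\<parallel>\<^bsub>TS\<^esub>" unfolding e_def hardy_unit_norm using TS_norm_ge(1) by simp
    also have "\<dots> \<le> r * \<parallel>v A\<parallel>\<^bsub>TS\<^esub>" unfolding r_def by (rule op_norm_bound[OF para_normed_TS para_normed_TS R v])
    finally show ?thesis .
  qed
  have frob: "(\<Sum>A\<in>U. \<Sum>B\<in>U. (car k A B)\<^sup>2) = (2 ^ L / 2 :: real)" if "k < L" for k
    using car_frobenius_norm[OF that, where 'a = real] unfolding U_def by linarith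
  have "(\<Sum>A\<in>U. q A) = (\<Sum>k<L. (b k)\<^sup>2 * (\<Sum>A\<in>U. \<Sum>B\<in>U. (car k A B)\<^sup>2))"
    unfolding q_def I_def sum.cartesian_product' sum_distrib_left fst_conv snd_conv by (rule sum.swap)
  also have "\<dots> = (\<Sum>k<L. (b k)\<^sup>2 * (2 ^ L / 2))"
    by (rule sum.cong[OF refl]) (simp only: frob lessThan_iff)
  finally have Sq: "(\<Sum>A\<in>U. q A) = \<beta> * (2 ^ L / 2)" by (simp only: sum_distrib_right \<beta>_def)
  have card: "real (card U) = 2 ^ L" by (simp add: U_def card_Pow)
  have b0: "0 \<le> \<beta>" unfolding \<beta>_def by (intro sum_nonneg) auto
  \<comment> \<open>The average of \<open>q\<close> over the \<open>2 ^ L\<close> subsets is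
    \<open>\<beta> / 2\<close> by the Frobenius norms; Cauchy-Schwarz passes to the squares, which
    the contraction inequality controls.\<close>
  have cs: "(\<beta> * (2 ^ L / 2))\<^sup>2 \<le> (\<Sum>A\<in>U. (q A)\<^sup>2) * 2 ^ L"
    using sum_squared_le_sum_of_squares[of q U] unfolding Sq card .
  have "(\<Sum>A\<in>U. (q A)\<^sup>2) \<le> (\<Sum>A\<in>U. r\<^sup>2 * PC.nsq (v A))"
    unfolding PC.nsq_def power_mult_distrib[symmetric] by (intro sum_mono power_mono qv q0)
  also have "\<dots> = r\<^sup>2 * (\<Sum>A\<in>U. PC.nsq (v A))" by (simp only: sum_distrib_left)
  also have "\<dots> \<le> r\<^sup>2 * (\<beta> * (\<Sum>A\<in>U. PC.nsq (x A)))"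
    using PC.contraction_car_bound[OF x, where L = L and b = b and m = Suc] unfolding \<beta>_def v_def c_def U_def I_def by (intro mult_left_mono) auto
  also have "\<dots> \<le> r\<^sup>2 * (\<beta> * (\<Sum>A\<in>U. r'\<^sup>2))"
    by (intro mult_left_mono sum_mono nx b0) auto
  also have "\<dots> = r\<^sup>2 * (\<beta> * (2 ^ L * r'\<^sup>2))" by (simp add: card)
  finally have "(\<Sum>A\<in>U. (q A)\<^sup>2) \<le> r\<^sup>2 * (\<beta> * (2 ^ L * r'\<^sup>2))" .
  from order_trans[OF cs mult_right_mono[OF this, of "2 ^ L"]]
  have "(\<beta> * (2 ^ L / 2))\<^sup>2 \<le> r\<^sup>2 * (\<beta> * (2 ^ L * r'\<^sup>2)) * 2 ^ L" by simp
  \<comment> \<open>The powers of \<open>2 ^ L\<close> cancel, so the bound does not depend on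
    \<open>L\<close>; the factor \<open>4\<close> is the inverse square of the one half from the
    Frobenius norm.\<close>
  then have "(2 ^ L)\<^sup>2 * (\<beta> * \<beta>) \<le> (2 ^ L)\<^sup>2 * (\<beta> * (4 * (r * r')\<^sup>2))"
    by (simp add: power2_eq_square mult_ac)
  then have main: "\<beta> * \<beta> \<le> \<beta> * (4 * (r * r')\<^sup>2)" by simp
  have "\<beta> \<le> 4 * (r * r')\<^sup>2"
  proof (cases "\<beta> = 0")
    case False
    then show ?thesis using main b0 by simp
  qed simp
  then show ?thesis unfolding \<beta>_def b_def r_def r'_def .
qed

lemma not_similar_TG: "\<not> similar_to_contraction TS TG"
proof
  assume "similar_to_contraction TS TG"
  then obtain R R' where R: "bounded_op TS TS R" "bounded_op TS TS R'" "\<forall>x\<in>carrier TS. R (R' x) = x \<and> R' (R x) = x"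
    "op_norm TS TS (\<lambda>x. R' (TG (R x))) \<le> 1"
    unfolding similar_to_contraction_def by blast
  show False
    by (rule weight_sum_unbounded[OF similar_contraction_bound[OF R(1,2) _ R(4)]]) (use R(3) in blast)
qed

theorem corollary1p2:
  shows "\<exists>(H :: (nat \<Rightarrow> complex) complex_normed) \<Gamma>.
    hilbert_space H \<and> hankel_operator H \<Gamma> \<and>
    polynomially_bounded (T_space H) (T_op H \<Gamma>) \<and>
    \<not> similar_to_contraction (T_space H) (T_op H \<Gamma>)"
  using hilbert_space_ell2 hankel_operator_pisier_form polynomially_bounded_TG not_similar_TG by blast

end
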